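(* Let $\alpha\in(0,1)$ and let $\mu$ be a probability measure with $\operatorname{supp}(\mu)\subset[\underline\theta,\bar\theta]$, $-\alpha<\underline\theta\le 0\le\bar\theta<+\infty$. Let $(\Pi_n)_{n\ge1}$ be the exchangeable Gibbs partition with parameter $\alpha$ and weights $v_{n,k}=\int v_{n,k}(\alpha,\theta)\,d\mu(\theta)$, with predictive simplex $\mathsf p_n$ and its estimator $\hat{\mathsf p}_n$. Let $f:[0,\infty)\to\mathbb R$ be a convex function with $f(1)=0$ that is locally twice differentiable with Hölder continuous second derivative at $1$: there exist $\delta>0$, $C>0$, $\beta>0$ such that $f$ is twice differentiable on $(1-\delta,1+\delta)$ and $|f''(1+x)-f''(1)|\le C|x|^\beta$ for all $|x|<\delta$. Then, as $n\to\infty$, $$n\cdot\mathsf D_f(\hat{\mathsf p}_n\|\mathsf p_n)\to\frac{\alpha f''(1)}{2}|N|^2\qquad\mathcal F_\infty\text{-stably},$$ where $N\sim\mathcal N(0,1)$ is independent of $\mathcal F_\infty$.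
   Context: Weights: for $1\le k\le n$, $v_{n,k}(\alpha,\theta)=\frac{\prod_{i=1}^{k-1}(\theta+i\alpha)}{\prod_{i=1}^{n-1}(\theta+i)}$ (empty products equal 1) and $v_{n,k}=\int v_{n,k}(\alpha,\theta)\,d\mu(\theta)$; $\mu$ does not depend on $\alpha$. Gibbs partition: $\Pi_n$ is a random partition of $\{1,\dots,n\}$ defined sequentially on a probability space $(\Omega,\mathcal F,P)$. $\Pi_1=\{\{1\}\}$. Given $\Pi_n=\{U_1,\dots,U_{\mathsf k_n}\}$ ($\mathsf k_n$ = number of blocks), $\Pi_{n+1}$ is obtained by putting $n+1$ into a new block with probability $\mathsf p_{n,0}=v_{n+1,\mathsf k_n+1}/v_{n,\mathsf k_n}$ and into $U_i$ with probability $\mathsf p_{n,i}=\frac{v_{n+1,\mathsf k_n}}{v_{n,\mathsf k_n}}(|U_i|-\alpha)$, $i=1,\dots,\mathsf k_n$. The predictive simplex is $\mathsf p_n=(\mathsf p_{n,0},\dots,\mathsf p_{n,\mathsf k_n})$. Let $\mathsf k_{n,j}$ be the number of blocks of $\Pi_n$ of size $j$, $\mathcal F_n=\sigma(\Pi_n)$ and $\mathcal F_\infty=\sigma(\cup_n\mathcal F_n)$. QMLE: for $n\ge2$, $\hat\alpha_n$ is the maximizer over $x\in(0,1)$ of $(\mathsf k_n-1)\log x+\sum_{j=2}^n\mathsf k_{n,j}\sum_{i=1}^{j-1}\log(i-x)$, understood as: $\hat\alpha_n=0$ if $\mathsf k_n=1$; $\hat\alpha_n=1$ if $\mathsf k_n=n$;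 and if $1<\mathsf k_n<n$, $\hat\alpha_n$ is the unique solution $x\in(0,1)$ of $\frac{\mathsf k_n-1}{x}-\sum_{j=2}^n\mathsf k_{n,j}\sum_{i=1}^{j-1}\frac1{i-x}=0$. Estimator: $\hat{\mathsf p}_n=(\hat{\mathsf p}_{n,0},\dots,\hat{\mathsf p}_{n,\mathsf k_n})$ with $\hat{\mathsf p}_{n,0}=\frac{\mathsf k_n}{n}\hat\alpha_n$ and $\hat{\mathsf p}_{n,i}=\frac{|U_i|-\hat\alpha_n}{n}$ for $i=1,\dots,\mathsf k_n$. $f$-divergence: $\mathsf D_f(\hat{\mathsf p}_n\|\mathsf p_n)=\sum_{i=0}^{\mathsf k_n}\mathsf p_{n,i}\,f(\hat{\mathsf p}_{n,i}/\mathsf p_{n,i})$. Stable convergence: for a sub-$\sigma$-field $\mathcal G\subset\mathcal F$, real random variables $X_n\to X$ $\mathcal G$-stably if $\lim_n\mathbb E[g\,\mathbb E[h(X_n)\mid\mathcal G]]=\mathbb E[g\,\mathbb E[h(X)\mid\mathcal G]]$ for every $\mathcal F$-measurable integrable $g$ and every bounded continuous $h:\mathbb R\to\mathbb R$. The probability space is assumed rich enough (enlarged if necessary) to carry $N$ independent of $\mathcal F_\infty$. *)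

theory Defs
  imports "HOL-Probability.Probability"
begin

text \<open>Topological support of a Borel measure.\<close>

definition msupport :: "'a::topological_space measure \<Rightarrow> 'a set" where
  "msupport \<mu> = {x. \<forall>U. open U \<and> x \<in> U \<longrightarrow> emeasure \<mu> U > 0}"

text \<open>Pitman--Yor weights and their mixtures; only the arguments \<open>1 \<le> k \<le> n\<close> are meaningful.\<close>

definition py_weight :: "real \<Rightarrow> real \<Rightarrow> nat \<Rightarrow> nat \<Rightarrow> real" where
  "py_weight \<alpha> \<theta> n k =
     (\<Prod>i\<in>{1..<k}. \<theta> + real i * \<alpha>) / (\<Prod>i\<in>{1..<n}. \<theta> + real i)"

definition gibbs_weight :: "real \<Rightarrow> real measure \<Rightarrow> nat \<Rightarrow> nat \<Rightarrow> real" where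
  "gibbs_weight \<alpha> \<mu> n k = (LINT \<theta>|\<mu>. py_weight \<alpha> \<theta> n k)"

text \<open>The predictive simplex has one coordinate for a new block and one per existing block.
  The blocks themselves are used as indices: \<open>None\<close> is the coordinate \<open>0\<close> and \<open>Some U\<close>
  the coordinate of the block \<open>U\<close>, so that no enumeration of the blocks is needed.\<close>

definition slots :: "nat set set \<Rightarrow> nat set option set" where
  "slots \<pi> = insert None (Some ` \<pi>)"

definition predictive ::
    "real \<Rightarrow> real measure \<Rightarrow> nat \<Rightarrow> nat set set \<Rightarrow> nat set option \<Rightarrow> real" where
  "predictive \<alpha> \<mu> n \<pi> s =
     (case s of
        None \<Rightarrow> gibbs_weight \<alpha> \<mu> (n + 1) (card \<pi> + 1) / gibbs_weight \<alpha> \<mu> n (card \<pi>)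
      | Some U \<Rightarrow> gibbs_weight \<alpha> \<mu> (n + 1) (card \<pi>) / gibbs_weight \<alpha> \<mu> n (card \<pi>)
                    * (real (card U) - \<alpha>))"

text \<open>The partition of \<open>{1..n+1}\<close> obtained from a partition of \<open>{1..n}\<close> by placing \<open>n + 1\<close>
  in the given slot.\<close>

definition extend_partition :: "nat \<Rightarrow> nat set set \<Rightarrow> nat set option \<Rightarrow> nat set set" where
  "extend_partition n \<pi> s =
     (case s of
        None \<Rightarrow> insert {n + 1} \<pi>
      | Some U \<Rightarrow> insert (insert (n + 1) U) (\<pi> - {U}))"

text \<open>Conditioning on the event that \<open>\<rho> n = \<pi>\<close> is conditioning on the whole past, since
  \<open>\<rho> n\<close> determines \<open>\<rho> m\<close> for \<open>1 \<le> m \<le> n\<close>. The value \<open>\<rho> 0\<close> is irrelevant.\<close>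

definition gibbs_partition ::
    "'a measure \<Rightarrow> real \<Rightarrow> real measure \<Rightarrow> (nat \<Rightarrow> 'a \<Rightarrow> nat set set) \<Rightarrow> bool" where
  "gibbs_partition M \<alpha> \<mu> \<rho> \<longleftrightarrow>
     (\<forall>n\<ge>1. \<rho> n \<in> measurable M (count_space UNIV)) \<and>
     (\<forall>\<omega>\<in>space M. \<rho> 1 \<omega> = {{1}}) \<and>
     (\<forall>n\<ge>1. \<forall>\<omega>\<in>space M.
        \<exists>s\<in>slots (\<rho> n \<omega>). \<rho> (n + 1) \<omega> = extend_partition n (\<rho> n \<omega>) s) \<and>
     (\<forall>n\<ge>1. \<forall>\<pi>. \<P>(\<omega> in M. \<rho> n \<omega> = \<pi>) > 0 \<longrightarrow>
        (\<forall>s\<in>slots \<pi>.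
           \<P>(\<omega> in M. \<rho> (n + 1) \<omega> = extend_partition n \<pi> s \<bar> \<rho> n \<omega> = \<pi>)
             = predictive \<alpha> \<mu> n \<pi> s))"

definition F_infinity :: "'a measure \<Rightarrow> (nat \<Rightarrow> 'a \<Rightarrow> nat set set) \<Rightarrow> 'a measure" where
  "F_infinity M \<rho> =
     sigma (space M) (\<Union>n\<in>{1..}. sets (vimage_algebra (space M) (\<rho> n) (count_space UNIV)))"

definition blocks_of_size :: "nat set set \<Rightarrow> nat \<Rightarrow> nat" where
  "blocks_of_size \<pi> j = card {U\<in>\<pi>. card U = j}"

definition qmle :: "nat \<Rightarrow> nat set set \<Rightarrow> real" where
  "qmle n \<pi> =
     (if card \<pi> = 1 then 0
      else if card \<pi> = n then 1
      else (THE x. 0 < x \<and> x < 1 \<and>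
              (real (card \<pi>) - 1) / x
                - (\<Sum>j=2..n. real (blocks_of_size \<pi> j) * (\<Sum>i=1..j-1. 1 / (real i - x))) = 0))"

definition predictive_estimate :: "nat \<Rightarrow> nat set set \<Rightarrow> nat set option \<Rightarrow> real" where
  "predictive_estimate n \<pi> s =
     (case s of
        None \<Rightarrow> real (card \<pi>) / real n * qmle n \<pi>
      | Some U \<Rightarrow> (real (card U) - qmle n \<pi>) / real n)"

text \<open>The divergence of \<open>q\<close> from \<open>p\<close>, two vectors indexed by \<open>I\<close>.\<close>

definition f_divergence :: "(real \<Rightarrow> real) \<Rightarrow> 'i set \<Rightarrow> ('i \<Rightarrow> real) \<Rightarrow> ('i \<Rightarrow> real) \<Rightarrow> real" where
  "f_divergence f I q p = (\<Sum>i\<in>I. p i * f (q i / p i))"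

definition stably_converges ::
    "'a measure \<Rightarrow> 'a measure \<Rightarrow> (nat \<Rightarrow> 'a \<Rightarrow> real) \<Rightarrow> ('a \<Rightarrow> real) \<Rightarrow> bool" where
  "stably_converges M G X Y \<longleftrightarrow>
     subalgebra M G \<and>
     (\<forall>n. X n \<in> borel_measurable M) \<and> Y \<in> borel_measurable M \<and>
     (\<forall>g h. integrable M g \<and> continuous_on UNIV h \<and> bounded (range h) \<longrightarrow>
        (\<lambda>n. LINT \<omega>|M. g \<omega> * real_cond_exp M G (\<lambda>\<omega>. h (X n \<omega>)) \<omega>)
          \<longlonglongrightarrow> (LINT \<omega>|M. g \<omega> * real_cond_exp M G (\<lambda>\<omega>. h (Y \<omega>)) \<omega>))"

end

theory Submission
  imports Defs "HOL-Real_Asymp.Real_Asymp"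
begin

text \<open>
  Write \<open>k\<close> for the number of blocks of the partition at time \<open>n\<close>, \<open>Y\<close> for the derivative of the
  quasi log-likelihood at the true \<open>\<alpha>\<close> (the score) and \<open>I\<close> for the Fisher information per block.
  The divergence is governed by the score alone, \<open>n D \<approx> (\<alpha> f''(1) / 2) Y\<^sup>2 / (I k)\<close>, and
  \<open>Y / sqrt (I k)\<close> is asymptotically standard normal and independent of the past.

  The current partition determines all earlier ones, so conditioning on the past is elementary: every
  estimate comes from one-step expectations, which are finite sums over the slots
  (\<open>expectation_step\<close>). The weights enter only through \<open>w = v\<^bsub>n+1,k\<^esub> / v\<^bsub>n,k\<^esub> = 1/n + O(n\<^sup>-\<^sup>2)\<close> and a lower
  bound for the probability of a new block; this is the locale \<open>partition_chain\<close>.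

  The ratio \<open>R = k / n\<^sup>\<alpha>\<close> is a martingale up to summable errors and Cauchy in \<open>L\<^sup>2\<close>
  (\<open>expectation_R_diff_square\<close>). Its limit is random, but mass cannot collect at zero because the
  expectation of \<open>ln R\<close> stays bounded below (\<open>R_not_small\<close>).

  The proportion of blocks with more than \<open>i\<close> elements tends to the tail of
  the Sibuya distribution, by induction on \<open>i\<close> (\<open>expectation_tail_deviation_square\<close>). Hence sums
  over the blocks, divided by \<open>k\<close>, converge (\<open>block_sum_lln\<close>); this applies to the observed
  information and to the conditional variance of the score.

  Placing an element changes \<open>Y\<close> by \<open>1/\<alpha>\<close> or by \<open>-1/(|U| - \<alpha>)\<close>; the
  mean of this increment is \<open>O(1/n)\<close> and its conditional variance is about \<open>\<alpha> I k / n\<close>. Lindeberg's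
  telescoping of characteristic functions applies once the random scale is frozen: normalise by
  \<open>I n\<^sup>\<alpha> R\<close> with \<open>R\<close> taken at a fixed time \<open>m\<close>, let \<open>n\<close> and then \<open>m\<close> tend to infinity
  (\<open>char_given_past\<close>, \<open>std_score_char\<close>).

  The estimator is a zero of the score as a function of the parameter, and an exact secant
  identity \<open>Y = (\<alpha>' - \<alpha>) B\<close> with \<open>B \<ge> k - 1\<close> holds for the estimate \<open>\<alpha>'\<close>
  (\<open>score_at_diff\<close>, \<open>secant_information_ge\<close>). So the estimator is consistent, and then \<open>B / k\<close> tends
  to \<open>I\<close>.

  The predictive simplex and its estimate sum to one, so the linear term of \<open>f\<close> at \<open>1\<close> cancels and the
  divergence is \<open>f''(1) / 2\<close> times the chi-square distance, up to a smaller error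
  (\<open>f_divergence_chi_square\<close>). With \<open>a = \<alpha>' - \<alpha>\<close> the new block contributes \<open>k a\<^sup>2 / \<alpha>\<close> to \<open>n\<close> times that
  distance, and the old blocks contribute \<open>a\<^sup>2\<close> times the sum of \<open>1 / (|U| - \<alpha>)\<close>, about
  \<open>k a\<^sup>2 (\<alpha> I - 1/\<alpha>)\<close>. The total is \<open>\<alpha> I k a\<^sup>2 \<approx> \<alpha> Y\<^sup>2 / (I k)\<close> (\<open>divergence_on_typical\<close>).

  The limit of the characteristic functions holds on every event of the past.
  Levy's continuity theorem, an approximation argument for integrable weights and the independence of
  \<open>N\<close> turn it into the claim (\<open>mixing_limit\<close>, \<open>mixing_limit_integrable\<close>, \<open>stable_limit\<close>).
\<close>

section \<open>Set partitions and their extension by one element\<close>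

abbreviation partition_of :: "nat \<Rightarrow> nat set set \<Rightarrow> bool" where
  "partition_of n \<pi> \<equiv> partition_on {1..n} \<pi>"

definition block_sum :: "(nat \<Rightarrow> real) \<Rightarrow> nat set set \<Rightarrow> real" where
  "block_sum g \<pi> = (\<Sum>U\<in>\<pi>. g (card U))"

definition restrict_partition :: "nat \<Rightarrow> nat set set \<Rightarrow> nat set set" where
  "restrict_partition m \<pi> = (\<lambda>U. U \<inter> {1..m}) ` \<pi> - {{}}"

lemma finite_partition_of: "partition_of n \<pi> \<Longrightarrow> finite \<pi>"
  by (rule finite_elements[of "{1..n}"]) auto

lemma block_subset: "partition_of n \<pi> \<Longrightarrow> U \<in> \<pi> \<Longrightarrow> U \<subseteq> {1..n}"
  by (auto simp: partition_on_def)

lemma finite_block: "partition_of n \<pi> \<Longrightarrow> U \<in> \<pi> \<Longrightarrow> finite U"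
  by (rule finite_subset[OF block_subset]) auto

lemma block_nonempty: "partition_of n \<pi> \<Longrightarrow> U \<in> \<pi> \<Longrightarrow> U \<noteq> {}"
  by (auto simp: partition_on_def)

lemma card_block_pos: "partition_of n \<pi> \<Longrightarrow> U \<in> \<pi> \<Longrightarrow> 1 \<le> card U"
  using finite_block[of n \<pi> U] block_nonempty[of n \<pi> U] card_gt_0_iff[of U] by linarith

lemma new_notin_block: "partition_of n \<pi> \<Longrightarrow> U \<in> \<pi> \<Longrightarrow> Suc n \<notin> U"
  using block_subset[of n \<pi> U] by auto

lemma block_sum_size: "partition_of n \<pi> \<Longrightarrow> block_sum real \<pi> = real n"
proof -
  assume p: "partition_of n \<pi>"
  then have "card (\<Union>\<pi>) = (\<Sum>U\<in>\<pi>. card U)"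
    by (intro card_Union_disjoint) (auto simp: partition_on_def finite_block[OF p])
  moreover have "\<Union>\<pi> = {1..n}" using p by (simp add: partition_on_def)
  ultimately have "n = (\<Sum>U\<in>\<pi>. card U)" by simp
  then have "real n = real (\<Sum>U\<in>\<pi>. card U)" by (rule arg_cong)
  then show ?thesis unfolding block_sum_def by (simp only: of_nat_sum)
qed

lemma block_sum_card: "block_sum (\<lambda>_. 1) \<pi> = real (card \<pi>)"
  by (simp add: block_sum_def)

lemma block_sum_mono:
  assumes "partition_of n \<pi>" "\<And>j. 1 \<le> j \<Longrightarrow> g j \<le> h j"
  shows "block_sum g \<pi> \<le> block_sum h \<pi>"
  unfolding block_sum_def by (intro sum_mono assms(2) card_block_pos[OF assms(1)])

lemma card_partition_le: "partition_of n \<pi> \<Longrightarrow> card \<pi> \<le> n"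
  using block_sum_mono[of n \<pi> "\<lambda>_. 1" real] block_sum_size[of n \<pi>] block_sum_card[of \<pi>] by simp

lemma card_partition_pos:
  assumes "partition_of n \<pi>" "1 \<le> n"
  shows "1 \<le> card \<pi>"
proof -
  have "\<Union>\<pi> = {1..n}" using assms by (simp add: partition_on_def)
  then have "\<pi> \<noteq> {}" using assms(2) by auto
  then show ?thesis using finite_partition_of[OF assms(1)] card_gt_0_iff[of \<pi>] by linarith
qed

lemma partition_of_1: "partition_of 1 {{1}}"
  by (auto simp: partition_on_def)

lemma extend_None: "extend_partition n \<pi> None = insert {Suc n} \<pi>"
  and extend_Some: "extend_partition n \<pi> (Some U) = insert (insert (Suc n) U) (\<pi> - {U})"
  by (auto simp: extend_partition_def)

lemma slots_cases:
  assumes "s \<in> slots \<pi>"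
  obtains "s = None" | U where "s = Some U" "U \<in> \<pi>"
  using assms by (auto simp: slots_def)

lemma finite_slots: "partition_of n \<pi> \<Longrightarrow> finite (slots \<pi>)"
  by (simp add: slots_def finite_partition_of)

lemma sum_slots:
  fixes g :: "nat set option \<Rightarrow> 'b::comm_monoid_add"
  assumes "partition_of n \<pi>"
  shows "(\<Sum>s\<in>slots \<pi>. g s) = g None + (\<Sum>U\<in>\<pi>. g (Some U))"
  unfolding slots_def using finite_partition_of[OF assms]
  by (subst sum.insert) (auto simp: sum.reindex)

lemma partition_of_extend:
  assumes p: "partition_of n \<pi>" and s: "s \<in> slots \<pi>"
  shows "partition_of (Suc n) (extend_partition n \<pi> s)"
  using s
proof (cases rule: slots_cases)
  case 1
  have "{1..Suc n} - {Suc n} = {1..n}" by auto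
  moreover have "disjnt {Suc n} (\<Union> \<pi>)"
    using p by (auto simp: partition_on_def)
  ultimately show ?thesis using p 1 by (simp add: extend_None partition_on_insert)
next
  case (2 U)
  have dis: "disjnt U V" if "V \<in> \<pi> - {U}" for V
    using p 2 that pairwiseD[of disjnt \<pi> U V] by (auto simp: partition_on_def)
  then have dU: "disjnt U (\<Union> (\<pi> - {U}))" by (auto simp: disjnt_def)
  have "insert U (\<pi> - {U}) = \<pi>" using 2 by auto
  then have q: "partition_on ({1..n} - U) (\<pi> - {U})"
    using p partition_on_insert[OF dU, of "{1..n}"] by simp
  have "{1..Suc n} - insert (Suc n) U = {1..n} - U" by auto
  moreover have "disjnt (insert (Suc n) U) (\<Union> (\<pi> - {U}))"
    using partition_onD1[OF q, symmetric] by (auto simp: disjnt_def)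
  moreover have "insert (Suc n) U \<subseteq> {1..Suc n}" using block_subset[OF p 2(2)] by auto
  ultimately show ?thesis
    using q 2 partition_on_insert[of "insert (Suc n) U" "\<pi> - {U}" "{1..Suc n}"]
    by (simp add: extend_Some)
qed

text \<open>The block that contains the new element reveals the slot it was placed in.\<close>

lemma inj_extend_partition:
  assumes p: "partition_of n \<pi>"
  shows "inj_on (extend_partition n \<pi>) (slots \<pi>)"
proof -
  have N: "{V \<in> extend_partition n \<pi> None. Suc n \<in> V} = {{Suc n}}"
    using new_notin_block[OF p] by (auto simp: extend_None)
  have S: "{V \<in> extend_partition n \<pi> (Some U). Suc n \<in> V} = {insert (Suc n) U}" if "U \<in> \<pi>" for U
    using new_notin_block[OF p] that by (auto simp: extend_Some)
  show ?thesis
  proof (rule inj_onI)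
    fix s t assume s: "s \<in> slots \<pi>" and t: "t \<in> slots \<pi>"
      and eq: "extend_partition n \<pi> s = extend_partition n \<pi> t"
    from s show "s = t"
    proof (cases rule: slots_cases)
      case 1
      from t show ?thesis
      proof (cases rule: slots_cases)
        case (2 U)
        then have "{{Suc n}} = {insert (Suc n) U}" using eq 1 N S[of U] by simp
        then show ?thesis
          using new_notin_block[OF p, of U] block_nonempty[OF p, of U] 2 by auto
      qed (use 1 in auto)
    next
      case (2 U)
      from t show ?thesis
      proof (cases rule: slots_cases)
        case 1
        then have "{{Suc n}} = {insert (Suc n) U}" using eq 2 N S[of U] by simp
        then show ?thesis
          using new_notin_block[OF p, of U] block_nonempty[OF p, of U] 2 by auto
      next
        case (2 V)
        then have "insert (Suc n) U = insert (Suc n) V"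
          using eq \<open>s = Some U\<close> \<open>U \<in> \<pi>\<close> S[of U] S[of V] by simp
        then show ?thesis
          using new_notin_block[OF p, of U] new_notin_block[OF p, of V] 2 \<open>s = Some U\<close> \<open>U \<in> \<pi>\<close>
          by (auto simp: insert_ident)
      qed
    qed
  qed
qed

lemma restrict_partition_id: "partition_of n \<pi> \<Longrightarrow> restrict_partition n \<pi> = \<pi>"
proof -
  assume p: "partition_of n \<pi>"
  have "(\<lambda>U. U \<inter> {1..n}) ` \<pi> = id ` \<pi>"
    using block_subset[OF p] by (intro image_cong) auto
  then show ?thesis using p by (auto simp: restrict_partition_def partition_on_def)
qed

lemma restrict_extend_partition:
  assumes s: "s \<in> slots \<pi>" and "m \<le> n"
  shows "restrict_partition m (extend_partition n \<pi> s) = restrict_partition m \<pi>"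
  using s
proof (cases rule: slots_cases)
  case 1
  then show ?thesis using \<open>m \<le> n\<close> by (auto simp: restrict_partition_def extend_None)
next
  case (2 U)
  have "insert (Suc n) U \<inter> {1..m} = U \<inter> {1..m}" using \<open>m \<le> n\<close> by auto
  then have "(\<lambda>U. U \<inter> {1..m}) ` insert (insert (Suc n) U) (\<pi> - {U})
      = (\<lambda>U. U \<inter> {1..m}) ` insert U (\<pi> - {U})" by (simp only: image_insert)
  moreover have "insert U (\<pi> - {U}) = \<pi>" using 2 by auto
  ultimately show ?thesis by (simp only: restrict_partition_def extend_Some 2(1))
qed

text \<open>Additive statistics change by a term that depends on the receiving block only. All one-step
  moments are computed from this.\<close>

lemma block_sum_extend:
  assumes p: "partition_of n \<pi>" and s: "s \<in> slots \<pi>"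
  shows "block_sum g (extend_partition n \<pi> s) = block_sum g \<pi> +
     (case s of None \<Rightarrow> g 1 | Some U \<Rightarrow> g (Suc (card U)) - g (card U))"
  using s
proof (cases rule: slots_cases)
  case 1
  have "{Suc n} \<notin> \<pi>" using new_notin_block[OF p] by auto
  then show ?thesis using 1 finite_partition_of[OF p] by (simp add: block_sum_def extend_None)
next
  case (2 U)
  have "insert (Suc n) U \<notin> \<pi> - {U}" using new_notin_block[OF p] by auto
  moreover have "card (insert (Suc n) U) = Suc (card U)"
    using 2 new_notin_block[OF p] finite_block[OF p] by auto
  moreover have "(\<Sum>U\<in>\<pi>. g (card U)) = g (card U) + (\<Sum>U\<in>\<pi> - {U}. g (card U))"
    using 2 finite_partition_of[OF p] by (simp add: sum.remove)
  ultimately show ?thesis using 2 finite_partition_of[OF p] by (simp add: block_sum_def extend_Some)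
qed

section \<open>Chains of partitions grown one element at a time\<close>

text \<open>What is used of a Gibbs partition. The factor \<open>w\<close> stands for the ratio \<open>v\<^bsub>n+1,k\<^esub> / v\<^bsub>n,k\<^esub>\<close>; in the one
  parameter model \<open>\<theta> = 0\<close> it equals \<open>1 / n\<close>, and \<open>c\<close> measures the distance to that model. The
  constant \<open>\<kappa>\<close> keeps the number of blocks growing at a polynomial rate even where the error term of
  \<open>w\<close> exceeds \<open>\<alpha> k / n\<close>. Transitions are stated for joint probabilities, so that partitions of
  probability zero need no separate treatment.\<close>

locale partition_chain = prob_space M
  for M :: "'a measure" +
  fixes \<rho> :: "nat \<Rightarrow> 'a \<Rightarrow> nat set set"
    and \<alpha> :: real
    and p :: "nat \<Rightarrow> nat set set \<Rightarrow> nat set option \<Rightarrow> real"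
    and w :: "nat \<Rightarrow> nat set set \<Rightarrow> real"
    and c \<kappa> :: real
  assumes alpha_pos: "0 < \<alpha>" and alpha_less_1: "\<alpha> < 1"
    and measurable_rho: "\<And>n. 1 \<le> n \<Longrightarrow> \<rho> n \<in> measurable M (count_space UNIV)"
    and rho_1: "\<And>\<omega>. \<omega> \<in> space M \<Longrightarrow> \<rho> 1 \<omega> = {{1}}"
    and rho_Suc: "\<And>n \<omega>. 1 \<le> n \<Longrightarrow> \<omega> \<in> space M \<Longrightarrow>
          \<exists>s\<in>slots (\<rho> n \<omega>). \<rho> (Suc n) \<omega> = extend_partition n (\<rho> n \<omega>) s"
    and transition: "\<And>n \<pi> s. 1 \<le> n \<Longrightarrow> partition_of n \<pi> \<Longrightarrow> s \<in> slots \<pi> \<Longrightarrow>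
          \<P>(\<omega> in M. \<rho> n \<omega> = \<pi> \<and> \<rho> (Suc n) \<omega> = extend_partition n \<pi> s)
            = \<P>(\<omega> in M. \<rho> n \<omega> = \<pi>) * p n \<pi> s"
    and p_None: "\<And>n \<pi>. 1 \<le> n \<Longrightarrow> partition_of n \<pi> \<Longrightarrow>
          p n \<pi> None = 1 - w n \<pi> * (real n - \<alpha> * real (card \<pi>))"
    and p_Some: "\<And>n \<pi> U. 1 \<le> n \<Longrightarrow> partition_of n \<pi> \<Longrightarrow> U \<in> \<pi> \<Longrightarrow>
          p n \<pi> (Some U) = w n \<pi> * (real (card U) - \<alpha>)"
    and w_approx: "\<And>n \<pi>. 1 \<le> n \<Longrightarrow> partition_of n \<pi> \<Longrightarrow> \<bar>w n \<pi> - 1 / real n\<bar> \<le> c / (real n)\<^sup>2"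
    and w_pos: "\<And>n \<pi>. 1 \<le> n \<Longrightarrow> partition_of n \<pi> \<Longrightarrow> 0 < w n \<pi>"
    and kappa_pos: "0 < \<kappa>"
    and p_None_ge: "\<And>n \<pi>. 1 \<le> n \<Longrightarrow> partition_of n \<pi> \<Longrightarrow> \<kappa> * real (card \<pi>) / real n \<le> p n \<pi> None"
begin

lemma rho_partition:
  assumes "1 \<le> n" "\<omega> \<in> space M"
  shows "partition_of n (\<rho> n \<omega>)"
  using assms(1)
proof (induction n rule: dec_induct)
  case base
  then show ?case using rho_1 partition_of_1 assms by simp
next
  case (step n)
  then obtain s where "s \<in> slots (\<rho> n \<omega>)" "\<rho> (Suc n) \<omega> = extend_partition n (\<rho> n \<omega>) s"
    using rho_Suc[of n \<omega>] assms by auto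
  then show ?case using partition_of_extend[OF step.IH] by simp
qed

text \<open>Every earlier partition is a function of the current one. This takes the place of a filtration.\<close>

lemma rho_restrict:
  assumes "1 \<le> m" "m \<le> n" "\<omega> \<in> space M"
  shows "\<rho> m \<omega> = restrict_partition m (\<rho> n \<omega>)"
  using assms(2)
proof (induction n rule: dec_induct)
  case base
  then show ?case using restrict_partition_id rho_partition assms by simp
next
  case (step n)
  obtain s where "s \<in> slots (\<rho> n \<omega>)" "\<rho> (Suc n) \<omega> = extend_partition n (\<rho> n \<omega>) s"
    using rho_Suc[of n \<omega>] assms step by auto
  then show ?case
    using restrict_extend_partition[of s "\<rho> n \<omega>" m n] step assms by auto
qed

lemma borel_measurable_rho:
  "1 \<le> n \<Longrightarrow> (\<lambda>\<omega>. \<phi> (\<rho> n \<omega>)) \<in> borel_measurable M"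
  for \<phi> :: "nat set set \<Rightarrow> 'c::topological_space"
  by (intro measurable_compose[OF measurable_rho]) auto

lemma finite_partitions: "finite {\<pi>. partition_of n \<pi>}"
  by (rule finitely_many_partition_on) simp

lemma integrable_rho [simp, intro]:
  fixes \<phi> :: "nat set set \<Rightarrow> 'c::{banach, second_countable_topology}"
  assumes "1 \<le> n"
  shows "integrable M (\<lambda>\<omega>. \<phi> (\<rho> n \<omega>))"
proof -
  define B where "B = Max ((\<lambda>\<pi>. norm (\<phi> \<pi>)) ` {\<pi>. partition_of n \<pi>})"
  have "norm (\<phi> (\<rho> n \<omega>)) \<le> B" if "\<omega> \<in> space M" for \<omega>
    unfolding B_def using rho_partition[OF assms that] finite_partitions by (intro Max_ge) auto
  then show ?thesis
    by (intro integrable_const_bound[where B=B]) (use assms in \<open>auto intro!: AE_I2 borel_measurable_rho\<close>)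
qed

lemma integrable_rho2 [simp, intro]:
  fixes \<phi> :: "nat set set \<Rightarrow> nat set set \<Rightarrow> 'c::{banach, second_countable_topology}"
  assumes "1 \<le> m" "m \<le> n"
  shows "integrable M (\<lambda>\<omega>. \<phi> (\<rho> m \<omega>) (\<rho> n \<omega>))"
proof -
  have "integrable M (\<lambda>\<omega>. \<phi> (restrict_partition m (\<rho> n \<omega>)) (\<rho> n \<omega>))"
    using assms by (intro integrable_rho) auto
  then show ?thesis
    by (subst Bochner_Integration.integrable_cong[OF refl]) (simp_all add: rho_restrict[OF assms])
qed

lemma sets_rho: "1 \<le> n \<Longrightarrow> {\<omega> \<in> space M. Q (\<rho> n \<omega>)} \<in> sets M"
  using measurable_sets[OF measurable_rho, of n "Collect Q"]
  by (simp add: vimage_def Int_def conj_commute)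

lemma sum_p:
  assumes "1 \<le> n" "partition_of n \<pi>"
  shows "(\<Sum>s\<in>slots \<pi>. p n \<pi> s) = 1"
proof -
  have "(\<Sum>U\<in>\<pi>. p n \<pi> (Some U)) = w n \<pi> * (\<Sum>U\<in>\<pi>. real (card U) - \<alpha>)"
    using assms by (simp add: p_Some sum_distrib_left)
  also have "(\<Sum>U\<in>\<pi>. real (card U) - \<alpha>) = real n - \<alpha> * real (card \<pi>)"
    using block_sum_size[OF assms(2)] by (simp add: sum_subtractf block_sum_def)
  finally show ?thesis using assms by (simp add: sum_slots p_None)
qed

lemma p_nonneg:
  assumes "1 \<le> n" "partition_of n \<pi>" "s \<in> slots \<pi>"
  shows "0 \<le> p n \<pi> s"
  using assms(3)
proof (cases rule: slots_cases)
  case 1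
  have "0 \<le> \<kappa> * real (card \<pi>) / real n" using kappa_pos by simp
  then show ?thesis using p_None_ge[OF assms(1,2)] 1 by simp
next
  case (2 U)
  then have "1 \<le> real (card U)" using card_block_pos[OF assms(2)] by simp
  then show ?thesis using 2 p_Some[OF assms(1,2)] w_pos[OF assms(1,2)] alpha_less_1
    by simp
qed

text \<open>Since \<open>\<rho> n\<close> determines \<open>\<rho> m\<close>, the one-step transition probabilities remain valid when an earlier
  partition of the chain occurs in the integrand. The transition
  probabilities are used in this form from here on.\<close>

lemma expectation_step:
  fixes \<phi> :: "nat set set \<Rightarrow> nat set set \<Rightarrow> nat set set \<Rightarrow> 'c::{banach, second_countable_topology}"
  assumes "1 \<le> m" "m \<le> n"
  shows "expectation (\<lambda>\<omega>. \<phi> (\<rho> m \<omega>) (\<rho> n \<omega>) (\<rho> (Suc n) \<omega>)) =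
         expectation (\<lambda>\<omega>. \<Sum>s\<in>slots (\<rho> n \<omega>). p n (\<rho> n \<omega>) s *\<^sub>R
            \<phi> (\<rho> m \<omega>) (\<rho> n \<omega>) (extend_partition n (\<rho> n \<omega>) s))"
proof -
  have n: "1 \<le> n" using assms by simp
  define P where "P = {\<pi>. partition_of n \<pi>}"
  have finP: "finite P" unfolding P_def by (rule finite_partitions)
  define X where "X \<pi> s = \<phi> (restrict_partition m \<pi>) \<pi> (extend_partition n \<pi> s)" for \<pi> s
  define A where "A \<pi> = {\<omega>\<in>space M. \<rho> n \<omega> = \<pi>}" for \<pi>
  define D where "D \<pi> s = {\<omega>\<in>space M. \<rho> n \<omega> = \<pi> \<and> \<rho> (Suc n) \<omega> = extend_partition n \<pi> s}" for \<pi> s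
  have [measurable]: "A \<pi> \<in> sets M" for \<pi> unfolding A_def by (rule sets_rho[OF n])
  have D_eq: "D \<pi> s = A \<pi> \<inter> {\<omega>\<in>space M. \<rho> (Suc n) \<omega> = extend_partition n \<pi> s}" for \<pi> s
    by (auto simp: D_def A_def)
  have [measurable]: "D \<pi> s \<in> sets M" for \<pi> s unfolding D_eq
    by (intro sets.Int sets_rho) auto
  have ind: "has_bochner_integral M (\<lambda>\<omega>. indicat_real E \<omega> *\<^sub>R x) (prob E *\<^sub>R x)"
    if "E \<in> sets M" for E and x :: 'c
    using that by (intro has_bochner_integral_indicator) (auto simp: emeasure_eq_measure)
  have L: "\<phi> (\<rho> m \<omega>) (\<rho> n \<omega>) (\<rho> (Suc n) \<omega>)
      = (\<Sum>\<pi>\<in>P. \<Sum>s\<in>slots \<pi>. indicat_real (D \<pi> s) \<omega> *\<^sub>R X \<pi> s)" if w: "\<omega> \<in> space M" for \<omega>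
  proof -
    have part: "partition_of n (\<rho> n \<omega>)" using rho_partition n w by simp
    obtain t where t: "t \<in> slots (\<rho> n \<omega>)" "\<rho> (Suc n) \<omega> = extend_partition n (\<rho> n \<omega>) t"
      using rho_Suc[OF n w] by auto
    have "(\<Sum>\<pi>\<in>P. \<Sum>s\<in>slots \<pi>. indicat_real (D \<pi> s) \<omega> *\<^sub>R X \<pi> s)
        = (\<Sum>\<pi>\<in>P. if \<pi> = \<rho> n \<omega> then \<Sum>s\<in>slots \<pi>. indicat_real (D \<pi> s) \<omega> *\<^sub>R X \<pi> s else 0)"
      by (intro sum.cong) (auto simp: D_def indicator_def)
    also have "\<dots> = (\<Sum>s\<in>slots (\<rho> n \<omega>). indicat_real (D (\<rho> n \<omega>) s) \<omega> *\<^sub>R X (\<rho> n \<omega>) s)"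
      using finP part by (simp add: P_def)
    also have "\<dots> = (\<Sum>s\<in>slots (\<rho> n \<omega>). if s = t then X (\<rho> n \<omega>) s else 0)"
      using inj_onD[OF inj_extend_partition[OF part]] t w
      by (intro sum.cong) (auto simp: D_def indicator_def)
    also have "\<dots> = X (\<rho> n \<omega>) t" using finite_slots[OF part] t by simp
    finally show ?thesis using t rho_restrict[OF assms w] by (simp add: X_def)
  qed
  have R: "(\<Sum>s\<in>slots (\<rho> n \<omega>). p n (\<rho> n \<omega>) s *\<^sub>R \<phi> (\<rho> m \<omega>) (\<rho> n \<omega>) (extend_partition n (\<rho> n \<omega>) s))
      = (\<Sum>\<pi>\<in>P. indicat_real (A \<pi>) \<omega> *\<^sub>R (\<Sum>s\<in>slots \<pi>. p n \<pi> s *\<^sub>R X \<pi> s))" if w: "\<omega> \<in> space M" for \<omega>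
  proof -
    have part: "partition_of n (\<rho> n \<omega>)" using rho_partition n w by simp
    have "(\<Sum>\<pi>\<in>P. indicat_real (A \<pi>) \<omega> *\<^sub>R (\<Sum>s\<in>slots \<pi>. p n \<pi> s *\<^sub>R X \<pi> s))
       = (\<Sum>\<pi>\<in>P. if \<pi> = \<rho> n \<omega> then \<Sum>s\<in>slots \<pi>. p n \<pi> s *\<^sub>R X \<pi> s else 0)"
      using w by (intro sum.cong) (auto simp: A_def indicator_def)
    also have "\<dots> = (\<Sum>s\<in>slots (\<rho> n \<omega>). p n (\<rho> n \<omega>) s *\<^sub>R X (\<rho> n \<omega>) s)"
      using finP part by (simp add: P_def)
    finally show ?thesis using rho_restrict[OF assms w] by (simp add: X_def)
  qed
  have "expectation (\<lambda>\<omega>. \<phi> (\<rho> m \<omega>) (\<rho> n \<omega>) (\<rho> (Suc n) \<omega>))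
      = expectation (\<lambda>\<omega>. \<Sum>\<pi>\<in>P. \<Sum>s\<in>slots \<pi>. indicat_real (D \<pi> s) \<omega> *\<^sub>R X \<pi> s)"
    by (intro Bochner_Integration.integral_cong refl L)
  also have "\<dots> = (\<Sum>\<pi>\<in>P. \<Sum>s\<in>slots \<pi>. prob (D \<pi> s) *\<^sub>R X \<pi> s)"
    by (intro has_bochner_integral_integral_eq has_bochner_integral_sum ind) simp
  also have "\<dots> = (\<Sum>\<pi>\<in>P. prob (A \<pi>) *\<^sub>R (\<Sum>s\<in>slots \<pi>. p n \<pi> s *\<^sub>R X \<pi> s))"
    using transition[OF n] by (auto simp: P_def D_def A_def scaleR_sum_right intro!: sum.cong)
  also have "\<dots> = expectation (\<lambda>\<omega>. \<Sum>\<pi>\<in>P. indicat_real (A \<pi>) \<omega> *\<^sub>R (\<Sum>s\<in>slots \<pi>. p n \<pi> s *\<^sub>R X \<pi> s))"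
    by (intro has_bochner_integral_integral_eq[symmetric] has_bochner_integral_sum ind) simp
  also have "\<dots> = expectation (\<lambda>\<omega>. \<Sum>s\<in>slots (\<rho> n \<omega>). p n (\<rho> n \<omega>) s *\<^sub>R
            \<phi> (\<rho> m \<omega>) (\<rho> n \<omega>) (extend_partition n (\<rho> n \<omega>) s))"
    by (intro Bochner_Integration.integral_cong refl R[symmetric])
  finally show ?thesis .
qed

end

section \<open>Powers and discrete growth estimates\<close>

lemma powr_succ_mvt:
  fixes x s :: real
  assumes "0 < x"
  obtains \<xi> where "x < \<xi>" "\<xi> < x + 1" "(x + 1) powr s - x powr s = s * \<xi> powr (s - 1)"
proof -
  have "\<exists>z. x < z \<and> z < x + 1 \<and> (x + 1) powr s - x powr s = (x + 1 - x) * (s * z powr (s - 1))"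
    using assms by (intro MVT2) (auto intro!: derivative_eq_intros)
  then show ?thesis using that by auto
qed

lemma powr_diff_bounds:
  fixes s x :: real
  assumes "0 < s" "1 \<le> x"
  shows "s * (x + 1) powr (-s - 1) \<le> x powr (-s) - (x + 1) powr (-s)"
    and "x powr (-s) - (x + 1) powr (-s) \<le> s * x powr (-s - 1)"
proof -
  obtain z where z: "x < z" "z < x + 1" "(x + 1) powr (-s) - x powr (-s) = (-s) * z powr (-s - 1)"
    using powr_succ_mvt[of x "-s"] assms by auto
  have "(x + 1) powr (-s - 1) \<le> z powr (-s - 1)" "z powr (-s - 1) \<le> x powr (-s - 1)"
    using z assms by (auto intro!: powr_mono2')
  then have "s * (x + 1) powr (-s - 1) \<le> s * z powr (-s - 1)" "s * z powr (-s - 1) \<le> s * x powr (-s - 1)"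
    using assms by auto
  then show "s * (x + 1) powr (-s - 1) \<le> x powr (-s) - (x + 1) powr (-s)"
    and "x powr (-s) - (x + 1) powr (-s) \<le> s * x powr (-s - 1)"
    using z(3) by linarith+
qed

lemma powr_diff_bounds':
  fixes s x :: real
  assumes "0 < s" "s \<le> 1" "1 \<le> x"
  shows "s * (x + 1) powr (s - 1) \<le> (x + 1) powr s - x powr s"
    and "(x + 1) powr s - x powr s \<le> s * x powr (s - 1)"
proof -
  obtain z where z: "x < z" "z < x + 1" "(x + 1) powr s - x powr s = s * z powr (s - 1)"
    using powr_succ_mvt[of x "s"] assms by auto
  have "(x + 1) powr (s - 1) \<le> z powr (s - 1)" "z powr (s - 1) \<le> x powr (s - 1)"
    using z assms by (auto intro!: powr_mono2')
  then have "s * (x + 1) powr (s - 1) \<le> s * z powr (s - 1)" "s * z powr (s - 1) \<le> s * x powr (s - 1)"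
    using assms by auto
  then show "s * (x + 1) powr (s - 1) \<le> (x + 1) powr s - x powr s"
    and "(x + 1) powr s - x powr s \<le> s * x powr (s - 1)"
    using z(3) by linarith+
qed

lemma powr_succ_ge_half:
  fixes x s :: real
  assumes "0 \<le> s" "s \<le> 1" "1 \<le> x"
  shows "x powr (s - 1) / 2 \<le> (x + 1) powr (s - 1)"
proof -
  have "(2 * x) powr (s - 1) \<le> (x + 1) powr (s - 1)"
    using assms by (intro powr_mono2') auto
  moreover have "(2 * x) powr (s - 1) = 2 powr (s - 1) * x powr (s - 1)"
    using assms by (simp add: powr_mult)
  moreover have "2 powr (-1) \<le> (2::real) powr (s - 1)"
    using assms by (intro powr_mono) auto
  moreover have "(2::real) powr (-1) = 1 / 2" by (simp add: powr_minus_divide)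
  ultimately have "1 / 2 * x powr (s - 1) \<le> 2 powr (s - 1) * x powr (s - 1)"
    by (intro mult_right_mono) auto
  then show ?thesis using \<open>(2 * x) powr (s - 1) \<le> _\<close> \<open>(2 * x) powr (s - 1) = _\<close> by linarith
qed

text \<open>The relative drift alone would give growth of order \<open>n\<close> to the power \<open>s / 4\<close>. This is slower than
  what the forcing term produces, so the forcing term decides.\<close>

lemma growth_from_recursion:
  fixes x :: "nat \<Rightarrow> real"
  assumes s: "0 < s" "s \<le> 1" and "0 \<le> C"
    and rec: "\<And>n. 1 \<le> n \<Longrightarrow> x (Suc n) \<le> (1 + s / (4 * real n)) * x n + C * real n powr (s - 1)"
  shows "\<exists>K\<ge>0. \<forall>n\<ge>1. x n \<le> K * real n powr s"
proof -
  (* as 4 C / s <= K, drift and forcing together are at most (K s / 2) n^(s - 1), and the increment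
     of K n^s is at least that much *)
  define K where "K = max \<bar>x 1\<bar> (4 * C / s)"
  have K: "0 \<le> K" "x 1 \<le> K" "4 * C / s \<le> K" by (auto simp: K_def)
  have "x n \<le> K * real n powr s" if "1 \<le> n" for n
    using that
  proof (induction n rule: dec_induct)
    case base
    then show ?case using K by simp
  next
    case (step n)
    have n: "1 \<le> real n" using step by simp
    have "x (Suc n) \<le> (1 + s / (4 * real n)) * (K * real n powr s) + C * real n powr (s - 1)"
      using rec[OF step(1)] step.IH s n
      by (smt (verit) mult_left_mono divide_nonneg_pos)
    also have "\<dots> = K * real n powr s + (K * s / 4 + C) * real n powr (s - 1)"
      using n by (simp add: field_simps powr_diff)
    also have "\<dots> \<le> K * real n powr s + (K * s / 2) * real n powr (s - 1)"
      using K s by (intro add_left_mono mult_right_mono) (auto simp: field_simps)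
    also have "\<dots> \<le> K * real n powr s + K * s * (real n + 1) powr (s - 1)"
    proof -
      have "K * s * (real n powr (s - 1) / 2) \<le> K * s * (real n + 1) powr (s - 1)"
        using powr_succ_ge_half[of s "real n"] s n K by (intro mult_left_mono) auto
      then show ?thesis by simp
    qed
    also have "\<dots> \<le> K * (real n + 1) powr s"
      using mult_left_mono[OF powr_diff_bounds'(1)[of s "real n"], of K] s n K
      by (simp add: algebra_simps)
    finally show ?case by (simp add: add.commute)
  qed
  then show ?thesis using K by auto
qed

text \<open>The increments are summable, and the tail of their sum is of order \<open>m\<close> to the power \<open>-s\<close>.\<close>

lemma decay_from_recursion:
  fixes z :: "nat \<Rightarrow> real"
  assumes s: "0 < s" and "0 \<le> C" and "1 \<le> m" "m \<le> n"
    and rec: "\<And>j. m \<le> j \<Longrightarrow> z (Suc j) \<le> z j + C * real j powr (-1 - s)"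
  shows "z n \<le> z m + C * 2 powr (1 + s) / s * real m powr (-s)"
proof -
  define K where "K = C * 2 powr (1 + s) / s"
  have K: "0 \<le> K" using assms by (simp add: K_def)
  have "z n \<le> z m + K * (real m powr (-s) - real n powr (-s))"
    using \<open>m \<le> n\<close>
  proof (induction n rule: dec_induct)
    case (step n)
    have n: "1 \<le> real n" using step assms by simp
    have "real n powr (-1 - s) = 2 powr (1 + s) * (2 * real n) powr (-1 - s)"
    proof -
      have "(2::real) powr (1 + s) * 2 powr (-1 - s) = 1"
        by (simp flip: powr_add)
      then show ?thesis using n by (simp add: powr_mult)
    qed
    also have "\<dots> \<le> 2 powr (1 + s) * (real n + 1) powr (-s - 1)"
    proof -
      have "(2 * real n) powr (-s - 1) \<le> (real n + 1) powr (-s - 1)"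
        using n s by (intro powr_mono2') auto
      moreover have "-1 - s = -s - 1" by simp
      ultimately show ?thesis by (simp only:) (intro mult_left_mono, auto)
    qed
    finally have "C * real n powr (-1 - s) \<le> K * (s * (real n + 1) powr (-s - 1))"
      using assms(2) s by (simp add: K_def mult.assoc mult_left_mono)
    also have "\<dots> \<le> K * (real n powr (-s) - (real n + 1) powr (-s))"
      using powr_diff_bounds(1)[of s "real n"] s n K by (intro mult_left_mono) auto
    finally show ?case using step.IH rec[of n] step(1) by (simp add: algebra_simps add.commute)
  qed simp
  also have "\<dots> \<le> z m + K * real m powr (-s)"
    using K by (intro add_left_mono mult_left_mono) auto
  finally show ?thesis by (simp add: K_def)
qed

section \<open>One-step moments\<close>

context partition_chain
begin

lemma c_nonneg: "0 \<le> c"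
  using w_approx[OF _ partition_of_1] abs_ge_zero[of "w 1 {{1}} - 1 / real 1"]
  by (metis (no_types, lifting) div_by_1 le_refl of_nat_1 one_power2 order_trans)

lemma w_le: "1 \<le> n \<Longrightarrow> partition_of n \<pi> \<Longrightarrow> w n \<pi> \<le> (1 + c) / real n"
proof -
  assume n: "1 \<le> n" "partition_of n \<pi>"
  have "c / (real n)\<^sup>2 \<le> c / real n"
    using n c_nonneg by (intro divide_left_mono) (auto simp: power2_eq_square)
  then show ?thesis using w_approx[OF n] by (simp add: add_divide_distrib)
qed

lemma p_None_approx:
  assumes "1 \<le> n" "partition_of n \<pi>"
  shows "\<bar>p n \<pi> None - \<alpha> * real (card \<pi>) / real n\<bar> \<le> c / real n"
proof -
  have k: "real (card \<pi>) \<le> real n" using card_partition_le assms by simp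
  have ak: "0 \<le> \<alpha> * real (card \<pi>)" "\<alpha> * real (card \<pi>) \<le> real n"
    using k alpha_pos alpha_less_1 mult_mono[of \<alpha> 1 "real (card \<pi>)" "real n"] by auto
  have "p n \<pi> None - \<alpha> * real (card \<pi>) / real n = (1 / real n - w n \<pi>) * (real n - \<alpha> * real (card \<pi>))"
    using assms by (simp add: p_None field_simps)
  also have "\<bar>\<dots>\<bar> \<le> c / (real n)\<^sup>2 * real n"
    unfolding abs_mult using w_approx[OF assms] ak by (intro mult_mono) auto
  finally show ?thesis using assms(1) by (simp add: power2_eq_square)
qed

lemma p_None_le:
  assumes "1 \<le> n" "partition_of n \<pi>"
  shows "p n \<pi> None \<le> (1 + c) * real (card \<pi>) / real n"
proof -
  have k: "1 \<le> real (card \<pi>)" using card_partition_pos assms by simp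
  have "p n \<pi> None \<le> \<alpha> * real (card \<pi>) / real n + c / real n"
    using p_None_approx[OF assms] by linarith
  also have "\<dots> = (\<alpha> * real (card \<pi>) + c) / real n" by (simp add: add_divide_distrib)
  also have "\<dots> \<le> (1 + c) * real (card \<pi>) / real n"
  proof (rule divide_right_mono)
    have "c \<le> c * real (card \<pi>)" using c_nonneg k mult_left_mono[of 1 "real (card \<pi>)" c] by simp
    moreover have "\<alpha> * real (card \<pi>) \<le> real (card \<pi>)" using alpha_less_1 k mult_right_mono[of \<alpha> 1] by simp
    ultimately show "\<alpha> * real (card \<pi>) + c \<le> (1 + c) * real (card \<pi>)" by (simp add: algebra_simps)
  qed simp
  finally show ?thesis .
qed

lemma sum_p_times:
  assumes "1 \<le> n" "partition_of n \<pi>"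
  shows "(\<Sum>s\<in>slots \<pi>. p n \<pi> s * (case s of None \<Rightarrow> a | Some U \<Rightarrow> b (card U)))
     = p n \<pi> None * a + w n \<pi> * block_sum (\<lambda>j. (real j - \<alpha>) * b j) \<pi>"
  using assms by (simp add: sum_slots p_Some block_sum_def sum_distrib_left mult.assoc)

lemma expectation_step_le:
  fixes \<phi> :: "nat set set \<Rightarrow> nat set set \<Rightarrow> nat set set \<Rightarrow> real"
  assumes "1 \<le> m" "m \<le> n"
    and "\<And>\<pi>\<^sub>0 \<pi>. partition_of m \<pi>\<^sub>0 \<Longrightarrow> partition_of n \<pi> \<Longrightarrow>
       (\<Sum>s\<in>slots \<pi>. p n \<pi> s * \<phi> \<pi>\<^sub>0 \<pi> (extend_partition n \<pi> s)) \<le> \<psi> \<pi>\<^sub>0 \<pi>"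
  shows "expectation (\<lambda>\<omega>. \<phi> (\<rho> m \<omega>) (\<rho> n \<omega>) (\<rho> (Suc n) \<omega>)) \<le> expectation (\<lambda>\<omega>. \<psi> (\<rho> m \<omega>) (\<rho> n \<omega>))"
  unfolding expectation_step[OF assms(1,2)] real_scaleR_def
proof (rule integral_mono)
  show "integrable M (\<lambda>\<omega>. \<Sum>s\<in>slots (\<rho> n \<omega>). p n (\<rho> n \<omega>) s * \<phi> (\<rho> m \<omega>) (\<rho> n \<omega>) (extend_partition n (\<rho> n \<omega>) s))"
    using assms(1,2) by (intro integrable_rho2) auto
  show "integrable M (\<lambda>\<omega>. \<psi> (\<rho> m \<omega>) (\<rho> n \<omega>))"
    using assms(1,2) by (intro integrable_rho2) auto
  show "(\<Sum>s\<in>slots (\<rho> n \<omega>). p n (\<rho> n \<omega>) s * \<phi> (\<rho> m \<omega>) (\<rho> n \<omega>) (extend_partition n (\<rho> n \<omega>) s))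
      \<le> \<psi> (\<rho> m \<omega>) (\<rho> n \<omega>)" if "\<omega> \<in> space M" for \<omega>
    using assms rho_partition[of m \<omega>] rho_partition[of n \<omega>] that by simp
qed

lemma expectation_rho_mono:
  fixes \<phi> \<psi> :: "nat set set \<Rightarrow> real"
  assumes "1 \<le> n" "\<And>\<pi>. partition_of n \<pi> \<Longrightarrow> \<phi> \<pi> \<le> \<psi> \<pi>"
  shows "expectation (\<lambda>\<omega>. \<phi> (\<rho> n \<omega>)) \<le> expectation (\<lambda>\<omega>. \<psi> (\<rho> n \<omega>))"
  using assms rho_partition by (intro integral_mono integrable_rho) auto

lemma expectation_rho2_mono:
  fixes \<phi> \<psi> :: "nat set set \<Rightarrow> nat set set \<Rightarrow> real"
  assumes "1 \<le> m" "m \<le> n"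
    and "\<And>\<pi>\<^sub>0 \<pi>. partition_of m \<pi>\<^sub>0 \<Longrightarrow> partition_of n \<pi> \<Longrightarrow> \<phi> \<pi>\<^sub>0 \<pi> \<le> \<psi> \<pi>\<^sub>0 \<pi>"
  shows "expectation (\<lambda>\<omega>. \<phi> (\<rho> m \<omega>) (\<rho> n \<omega>)) \<le> expectation (\<lambda>\<omega>. \<psi> (\<rho> m \<omega>) (\<rho> n \<omega>))"
  using assms rho_partition by (intro integral_mono integrable_rho2) auto

lemma sum_p_square:
  assumes "1 \<le> n" "partition_of n \<pi>" "\<And>s. s \<in> slots \<pi> \<Longrightarrow> f s = x + d s"
  shows "(\<Sum>s\<in>slots \<pi>. p n \<pi> s * (f s)\<^sup>2)
     = x\<^sup>2 + 2 * x * (\<Sum>s\<in>slots \<pi>. p n \<pi> s * d s) + (\<Sum>s\<in>slots \<pi>. p n \<pi> s * (d s)\<^sup>2)"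
proof -
  have "(\<Sum>s\<in>slots \<pi>. p n \<pi> s * (f s)\<^sup>2)
      = (\<Sum>s\<in>slots \<pi>. x\<^sup>2 * p n \<pi> s + 2 * x * (p n \<pi> s * d s) + p n \<pi> s * (d s)\<^sup>2)"
    using assms(3) by (intro sum.cong) (auto simp: power2_eq_square algebra_simps)
  also have "\<dots> = x\<^sup>2 * (\<Sum>s\<in>slots \<pi>. p n \<pi> s) + 2 * x * (\<Sum>s\<in>slots \<pi>. p n \<pi> s * d s)
      + (\<Sum>s\<in>slots \<pi>. p n \<pi> s * (d s)\<^sup>2)"
    by (simp add: sum.distrib sum_distrib_left)
  finally show ?thesis using sum_p[OF assms(1,2)] by simp
qed

lemma card_extend:
  assumes "partition_of n \<pi>" "s \<in> slots \<pi>"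
  shows "real (card (extend_partition n \<pi> s)) = real (card \<pi>) + (case s of None \<Rightarrow> 1 | Some U \<Rightarrow> 0)"
  using block_sum_extend[OF assms, of "\<lambda>_. 1"] by (simp add: block_sum_card split: option.splits)

section \<open>The number of blocks\<close>

definition R :: "nat \<Rightarrow> nat set set \<Rightarrow> real" where
  "R n \<pi> = real (card \<pi>) * real n powr (-\<alpha>)"

lemma R_nonneg: "0 \<le> R n \<pi>" by (simp add: R_def)

definition R_increment :: "nat \<Rightarrow> nat set set \<Rightarrow> nat set option \<Rightarrow> real" where
  "R_increment n \<pi> s = (case s of None \<Rightarrow> (real n + 1) powr (-\<alpha>) | Some U \<Rightarrow> 0)
     - real (card \<pi>) * (real n powr (-\<alpha>) - (real n + 1) powr (-\<alpha>))"

text \<open>New blocks make \<open>k\<close> grow at the relative rate \<open>\<alpha> / n\<close>, and \<open>n\<close> to the power \<open>-\<alpha>\<close> decreases at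
  that rate, so the drift of \<open>R\<close> cancels to first order.\<close>

lemma R_step:
  assumes "1 \<le> n" "partition_of n \<pi>"
  shows "s \<in> slots \<pi> \<Longrightarrow> R (Suc n) (extend_partition n \<pi> s) = R n \<pi> + R_increment n \<pi> s"
    and "\<bar>\<Sum>s\<in>slots \<pi>. p n \<pi> s * R_increment n \<pi> s\<bar> \<le> (\<alpha> * (\<alpha> + 1) + c) * real n powr (-1 - \<alpha>)"
    and "(\<Sum>s\<in>slots \<pi>. p n \<pi> s * (R_increment n \<pi> s)\<^sup>2) \<le> (2 * (1 + c) + 2 * \<alpha>\<^sup>2) * R n \<pi> * real n powr (-1 - \<alpha>)"
proof -
  define k where "k = real (card \<pi>)"
  define x where "x = real n"
  have x: "1 \<le> x" using assms by (simp add: x_def)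
  have k: "1 \<le> k" "k \<le> x" using card_partition_le card_partition_pos assms by (auto simp: k_def x_def)
  define D where "D = x powr (-\<alpha>) - (x + 1) powr (-\<alpha>)"
  have D: "\<alpha> * (x + 1) powr (-\<alpha> - 1) \<le> D" "D \<le> \<alpha> * x powr (-\<alpha> - 1)"
    using powr_diff_bounds[of \<alpha> x] alpha_pos x by (auto simp: D_def)
  have D0: "0 \<le> D" using D(1) alpha_pos by (smt (verit) mult_nonneg_nonneg powr_ge_zero)
  define d where "d = R_increment n \<pi>"
  have d: "d s = (case s of None \<Rightarrow> (x + 1) powr (-\<alpha>) | Some U \<Rightarrow> 0) - k * D" for s
    by (simp add: d_def R_increment_def x_def k_def D_def split: option.split)
  show "R (Suc n) (extend_partition n \<pi> s) = R n \<pi> + R_increment n \<pi> s" if "s \<in> slots \<pi>"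
    using card_extend[OF assms(2) that] unfolding d_def[symmetric]
    by (simp add: R_def d D_def split: option.splits) (simp_all add: x_def k_def algebra_simps)
  have P: "(\<Sum>s\<in>slots \<pi>. p n \<pi> s * (case s of None \<Rightarrow> a | Some U \<Rightarrow> 0)) = p n \<pi> None * a" for a
    using sum_p_times[OF assms(1,2), of a "\<lambda>_. 0"] by (simp add: block_sum_def)
  have "(\<Sum>s\<in>slots \<pi>. p n \<pi> s * d s) = p n \<pi> None * (x + 1) powr (-\<alpha>) - k * D"
    using P[of "(x + 1) powr (-\<alpha>)"] sum_p[OF assms(1,2)]
    by (simp add: d right_diff_distrib sum_subtractf flip: sum_distrib_right)
  also have "\<dots> = (p n \<pi> None - \<alpha> * k / x) * (x + 1) powr (-\<alpha>) + k * (\<alpha> / x * (x + 1) powr (-\<alpha>) - D)"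
    by (simp add: algebra_simps)
  also have "\<bar>\<dots>\<bar> \<le> c / x * x powr (-\<alpha>) + x * (\<alpha> * (\<alpha> + 1) * x powr (-\<alpha> - 2))"
  proof -
    have 1: "\<bar>(p n \<pi> None - \<alpha> * k / x) * (x + 1) powr (-\<alpha>)\<bar> \<le> c / x * x powr (-\<alpha>)"
      unfolding abs_mult using p_None_approx[OF assms(1,2)] x alpha_pos
      by (intro mult_mono) (auto simp: k_def x_def intro!: powr_mono2')
    have 3: "\<alpha> * (x + 1) powr (-\<alpha> - 1) \<le> \<alpha> / x * (x + 1) powr (-\<alpha>)"
      using x alpha_pos by (simp add: powr_diff field_simps)
    have 4: "\<alpha> / x * (x + 1) powr (-\<alpha>) \<le> \<alpha> / x * x powr (-\<alpha>)"
      using x alpha_pos by (intro mult_left_mono powr_mono2') auto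
    have 5: "\<alpha> / x * x powr (-\<alpha>) = \<alpha> * x powr (-\<alpha> - 1)"
      using x by (simp add: powr_diff)
    have "x powr (-(\<alpha> + 1)) - (x + 1) powr (-(\<alpha> + 1)) \<le> (\<alpha> + 1) * x powr (-(\<alpha> + 1) - 1)"
      using powr_diff_bounds(2)[of "\<alpha> + 1" x] alpha_pos x by simp
    moreover have "-(\<alpha> + 1) = -\<alpha> - 1" "-(\<alpha> + 1) - 1 = -\<alpha> - 2" by auto
    ultimately have "x powr (-\<alpha> - 1) - (x + 1) powr (-\<alpha> - 1) \<le> (\<alpha> + 1) * x powr (-\<alpha> - 2)"
      by (simp only:)
    then have "\<alpha> * (x powr (-\<alpha> - 1) - (x + 1) powr (-\<alpha> - 1)) \<le> \<alpha> * ((\<alpha> + 1) * x powr (-\<alpha> - 2))"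
      using alpha_pos by (intro mult_left_mono) auto
    with 3 4 5 have "\<bar>\<alpha> / x * (x + 1) powr (-\<alpha>) - D\<bar> \<le> \<alpha> * (\<alpha> + 1) * x powr (-\<alpha> - 2)"
      using D by (simp add: right_diff_distrib mult.assoc abs_le_iff)
    then have 2: "\<bar>k * (\<alpha> / x * (x + 1) powr (-\<alpha>) - D)\<bar> \<le> x * (\<alpha> * (\<alpha> + 1) * x powr (-\<alpha> - 2))"
      unfolding abs_mult using k by (intro mult_mono) auto
    show ?thesis by (rule order_trans[OF abs_triangle_ineq add_mono[OF 1 2]])
  qed
  also have "\<dots> = (\<alpha> * (\<alpha> + 1) + c) * x powr (-1 - \<alpha>)"
    using x by (simp add: powr_diff powr_minus field_simps power2_eq_square powr_add)
  finally show "\<bar>\<Sum>s\<in>slots \<pi>. p n \<pi> s * R_increment n \<pi> s\<bar> \<le> (\<alpha> * (\<alpha> + 1) + c) * real n powr (-1 - \<alpha>)"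
    by (simp add: x_def d_def)
  have "(\<Sum>s\<in>slots \<pi>. p n \<pi> s * (d s)\<^sup>2) \<le>
     (\<Sum>s\<in>slots \<pi>. p n \<pi> s * (2 * (case s of None \<Rightarrow> ((x + 1) powr (-\<alpha>))\<^sup>2 | Some U \<Rightarrow> 0) + 2 * (k * D)\<^sup>2))"
  proof (intro sum_mono mult_left_mono p_nonneg assms(1,2))
    fix s :: "nat set option"
    have "(a - b)\<^sup>2 \<le> 2 * a\<^sup>2 + 2 * b\<^sup>2" for a b :: real
      using zero_le_power2[of "a + b"] by (simp add: power2_eq_square algebra_simps)
    from this[of "case s of None \<Rightarrow> (x + 1) powr (-\<alpha>) | Some U \<Rightarrow> 0" "k * D"]
    show "(d s)\<^sup>2 \<le> 2 * (case s of None \<Rightarrow> ((x + 1) powr (-\<alpha>))\<^sup>2 | Some U \<Rightarrow> 0) + 2 * (k * D)\<^sup>2"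
      by (cases s) (simp_all add: d)
  qed
  also have "\<dots> = 2 * (p n \<pi> None * ((x + 1) powr (-\<alpha>))\<^sup>2) + 2 * (k * D)\<^sup>2"
  proof -
    have "(\<Sum>s\<in>slots \<pi>. p n \<pi> s * (2 * (case s of None \<Rightarrow> ((x + 1) powr (-\<alpha>))\<^sup>2 | Some U \<Rightarrow> 0) + 2 * (k * D)\<^sup>2))
      = (\<Sum>s\<in>slots \<pi>. 2 * (p n \<pi> s * (case s of None \<Rightarrow> ((x + 1) powr (-\<alpha>))\<^sup>2 | Some U \<Rightarrow> 0)) + 2 * (k * D)\<^sup>2 * p n \<pi> s)"
      by (intro sum.cong) (auto simp: algebra_simps)
    also have "\<dots> = 2 * (\<Sum>s\<in>slots \<pi>. p n \<pi> s * (case s of None \<Rightarrow> ((x + 1) powr (-\<alpha>))\<^sup>2 | Some U \<Rightarrow> 0)) + 2 * (k * D)\<^sup>2 * (\<Sum>s\<in>slots \<pi>. p n \<pi> s)"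
      by (simp only: sum.distrib sum_distrib_left)
    finally show ?thesis unfolding P sum_p[OF assms(1,2)] by simp
  qed
  also have "\<dots> \<le> 2 * ((1 + c) * k / x * (x powr (-\<alpha>))\<^sup>2) + 2 * (k * (\<alpha> * x powr (-\<alpha> - 1)))\<^sup>2"
  proof (intro add_mono mult_left_mono mult_mono power_mono)
    show "p n \<pi> None \<le> (1 + c) * k / x" using p_None_le[OF assms(1,2)] by (simp add: k_def x_def)
    show "(x + 1) powr (-\<alpha>) \<le> x powr (-\<alpha>)" using x alpha_pos by (intro powr_mono2') auto
    show "0 \<le> k * D" "0 \<le> k" "0 \<le> (1 + c) * k / x" using k D0 c_nonneg x by auto
    show "D \<le> \<alpha> * x powr (-\<alpha> - 1)" by (rule D)
  qed auto
  also have "\<dots> = (2 * (1 + c) * (k / x) + 2 * \<alpha>\<^sup>2 * (k / x)\<^sup>2) * (x powr (-\<alpha>))\<^sup>2"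
    using x by (simp add: powr_diff power_mult_distrib power_divide field_simps)
  also have "\<dots> \<le> (2 * (1 + c) * (k / x) + 2 * \<alpha>\<^sup>2 * (k / x)) * (x powr (-\<alpha>))\<^sup>2"
  proof -
    have "(k / x)\<^sup>2 \<le> k / x" using k x by (intro power_le_one_iff[THEN iffD2] | simp add: power2_eq_square field_simps)+
    then show ?thesis by (intro mult_right_mono add_left_mono mult_left_mono) auto
  qed
  also have "\<dots> = (2 * (1 + c) + 2 * \<alpha>\<^sup>2) * R n \<pi> * x powr (-1 - \<alpha>)"
    using x by (simp add: R_def powr_diff powr_minus power2_eq_square field_simps flip: x_def k_def)
  finally show "(\<Sum>s\<in>slots \<pi>. p n \<pi> s * (R_increment n \<pi> s)\<^sup>2) \<le> (2 * (1 + c) + 2 * \<alpha>\<^sup>2) * R n \<pi> * real n powr (-1 - \<alpha>)"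
    by (simp add: x_def d_def)
qed

lemma expectation_R_bounded: "\<exists>C\<ge>0. \<forall>n\<ge>1. expectation (\<lambda>\<omega>. R n (\<rho> n \<omega>)) \<le> C"
proof -
  define A where "A = \<alpha> * (\<alpha> + 1) + c"
  have A: "0 \<le> A" using alpha_pos c_nonneg by (simp add: A_def)
  have step: "expectation (\<lambda>\<omega>. R (Suc n) (\<rho> (Suc n) \<omega>)) \<le> expectation (\<lambda>\<omega>. R n (\<rho> n \<omega>)) + A * real n powr (-1 - \<alpha>)"
    if n: "1 \<le> n" for n
  proof -
    have "expectation (\<lambda>\<omega>. R (Suc n) (\<rho> (Suc n) \<omega>)) \<le> expectation (\<lambda>\<omega>. R n (\<rho> n \<omega>) + A * real n powr (-1 - \<alpha>))"
    proof (rule expectation_step_le[where m = 1 and \<phi> = "\<lambda>_ _ \<pi>. R (Suc n) \<pi>" and \<psi> = "\<lambda>_ \<pi>. R n \<pi> + A * real n powr (-1 - \<alpha>)"])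
      fix \<pi> assume pa: "partition_of n \<pi>"
      note R = R_step[OF n pa]
      have "(\<Sum>s\<in>slots \<pi>. p n \<pi> s * R (Suc n) (extend_partition n \<pi> s))
         = R n \<pi> + (\<Sum>s\<in>slots \<pi>. p n \<pi> s * R_increment n \<pi> s)"
        using sum_p[OF n pa]
        by (simp add: R(1) distrib_left sum.distrib flip: sum_distrib_right)
      then show "(\<Sum>s\<in>slots \<pi>. p n \<pi> s * R (Suc n) (extend_partition n \<pi> s)) \<le> R n \<pi> + A * real n powr (-1 - \<alpha>)"
        using R(2) by (simp add: A_def abs_le_iff)
    qed (use n in auto)
    also have "\<dots> = expectation (\<lambda>\<omega>. R n (\<rho> n \<omega>)) + A * real n powr (-1 - \<alpha>)"
      using n by (subst Bochner_Integration.integral_add) (auto simp: prob_space)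
    finally show ?thesis .
  qed
  define C where "C = max 0 (expectation (\<lambda>\<omega>. R 1 (\<rho> 1 \<omega>)) + A * 2 powr (1 + \<alpha>) / \<alpha> * real 1 powr (-\<alpha>))"
  have "expectation (\<lambda>\<omega>. R n (\<rho> n \<omega>)) \<le> C" if "1 \<le> n" for n
    using decay_from_recursion[of \<alpha> A 1 n "\<lambda>n. expectation (\<lambda>\<omega>. R n (\<rho> n \<omega>))"] alpha_pos A step that
    unfolding C_def by (simp add: max.coboundedI2)
  moreover have "0 \<le> C" by (simp add: C_def)
  ultimately show ?thesis by blast
qed

text \<open>The squared increments and the drift are summable, and the cross term is at most the drift times
  \<open>R n + R m\<close>, whose mean is bounded.\<close>

lemma expectation_R_diff_square:
  "\<exists>C\<ge>0. \<forall>m n. 1 \<le> m \<longrightarrow> m \<le> n \<longrightarrow>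
     expectation (\<lambda>\<omega>. (R n (\<rho> n \<omega>) - R m (\<rho> m \<omega>))\<^sup>2) \<le> C * real m powr (-\<alpha>)"
proof -
  obtain K where K: "0 \<le> K" "\<And>n. 1 \<le> n \<Longrightarrow> expectation (\<lambda>\<omega>. R n (\<rho> n \<omega>)) \<le> K"
    using expectation_R_bounded by blast
  define A where "A = \<alpha> * (\<alpha> + 1) + c"
  define B where "B = 2 * (1 + c) + 2 * \<alpha>\<^sup>2"
  have AB: "0 \<le> A" "0 \<le> B" using alpha_pos c_nonneg by (auto simp: A_def B_def)
  define C where "C = 4 * A * K + B * K"
  have C: "0 \<le> C" using AB K by (simp add: C_def)
  have step: "expectation (\<lambda>\<omega>. (R (Suc n) (\<rho> (Suc n) \<omega>) - R m (\<rho> m \<omega>))\<^sup>2)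
       \<le> expectation (\<lambda>\<omega>. (R n (\<rho> n \<omega>) - R m (\<rho> m \<omega>))\<^sup>2) + C * real n powr (-1 - \<alpha>)"
    if m: "1 \<le> m" "m \<le> n" for m n
  proof -
    have n: "1 \<le> n" using m by simp
    define q where "q = real n powr (-1 - \<alpha>)"
    have q: "0 \<le> q" by (simp add: q_def)
    have "expectation (\<lambda>\<omega>. (R (Suc n) (\<rho> (Suc n) \<omega>) - R m (\<rho> m \<omega>))\<^sup>2)
       \<le> expectation (\<lambda>\<omega>. (R n (\<rho> n \<omega>) - R m (\<rho> m \<omega>))\<^sup>2 +
             (2 * A * q * (R n (\<rho> n \<omega>) + R m (\<rho> m \<omega>)) + B * q * R n (\<rho> n \<omega>)))"
    proof (rule expectation_step_le[where \<phi> = "\<lambda>\<pi>\<^sub>0 _ \<pi>. (R (Suc n) \<pi> - R m \<pi>\<^sub>0)\<^sup>2" and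
          \<psi> = "\<lambda>\<pi>\<^sub>0 \<pi>. (R n \<pi> - R m \<pi>\<^sub>0)\<^sup>2 + (2 * A * q * (R n \<pi> + R m \<pi>\<^sub>0) + B * q * R n \<pi>)", OF m])
      fix \<pi>\<^sub>0 \<pi> assume pa: "partition_of n \<pi>"
      note R = R_step[OF n pa]
      define d where "d = R_increment n \<pi>"
      note R = R[folded d_def A_def B_def q_def]
      have "(\<Sum>s\<in>slots \<pi>. p n \<pi> s * (R (Suc n) (extend_partition n \<pi> s) - R m \<pi>\<^sub>0)\<^sup>2)
        = (R n \<pi> - R m \<pi>\<^sub>0)\<^sup>2 + 2 * (R n \<pi> - R m \<pi>\<^sub>0) * (\<Sum>s\<in>slots \<pi>. p n \<pi> s * d s) + (\<Sum>s\<in>slots \<pi>. p n \<pi> s * (d s)\<^sup>2)"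
        by (rule sum_p_square[OF n pa]) (simp add: R(1))
      moreover have "2 * (R n \<pi> - R m \<pi>\<^sub>0) * (\<Sum>s\<in>slots \<pi>. p n \<pi> s * d s) \<le> 2 * (R n \<pi> + R m \<pi>\<^sub>0) * (A * q)"
      proof -
        have "2 * (R n \<pi> - R m \<pi>\<^sub>0) * (\<Sum>s\<in>slots \<pi>. p n \<pi> s * d s)
           \<le> \<bar>2 * (R n \<pi> - R m \<pi>\<^sub>0)\<bar> * \<bar>\<Sum>s\<in>slots \<pi>. p n \<pi> s * d s\<bar>"
          by (metis abs_ge_self abs_mult)
        also have "\<dots> \<le> 2 * (R n \<pi> + R m \<pi>\<^sub>0) * (A * q)"
          using R(2) R_nonneg[of n \<pi>] R_nonneg[of m \<pi>\<^sub>0] by (intro mult_mono) auto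
        finally show ?thesis .
      qed
      ultimately show "(\<Sum>s\<in>slots \<pi>. p n \<pi> s * (R (Suc n) (extend_partition n \<pi> s) - R m \<pi>\<^sub>0)\<^sup>2)
         \<le> (R n \<pi> - R m \<pi>\<^sub>0)\<^sup>2 + (2 * A * q * (R n \<pi> + R m \<pi>\<^sub>0) + B * q * R n \<pi>)"
        using R(3) by (simp add: algebra_simps)
    qed
    also have "\<dots> = expectation (\<lambda>\<omega>. (R n (\<rho> n \<omega>) - R m (\<rho> m \<omega>))\<^sup>2) +
       (2 * A * q * (expectation (\<lambda>\<omega>. R n (\<rho> n \<omega>)) + expectation (\<lambda>\<omega>. R m (\<rho> m \<omega>))) + B * q * expectation (\<lambda>\<omega>. R n (\<rho> n \<omega>)))"
    proof -
      have "integrable M (\<lambda>\<omega>. (R n (\<rho> n \<omega>) - R m (\<rho> m \<omega>))\<^sup>2)"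
        using m by (intro integrable_rho2)
      moreover have "integrable M (\<lambda>\<omega>. R n (\<rho> n \<omega>))" "integrable M (\<lambda>\<omega>. R m (\<rho> m \<omega>))"
        using m n by (auto intro: integrable_rho)
      ultimately show ?thesis by simp
    qed
    also have "\<dots> \<le> expectation (\<lambda>\<omega>. (R n (\<rho> n \<omega>) - R m (\<rho> m \<omega>))\<^sup>2) + (2 * A * q * (K + K) + B * q * K)"
      using K m n AB q by (intro add_mono mult_left_mono) auto
    finally show ?thesis by (simp add: C_def q_def algebra_simps)
  qed
  have "expectation (\<lambda>\<omega>. (R n (\<rho> n \<omega>) - R m (\<rho> m \<omega>))\<^sup>2) \<le> C * 2 powr (1 + \<alpha>) / \<alpha> * real m powr (-\<alpha>)"
    if "1 \<le> m" "m \<le> n" for m n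
    using decay_from_recursion[of \<alpha> C m n "\<lambda>n. expectation (\<lambda>\<omega>. (R n (\<rho> n \<omega>) - R m (\<rho> m \<omega>))\<^sup>2)"]
      alpha_pos C step that by simp
  then show ?thesis using C alpha_pos by (intro exI[of _ "C * 2 powr (1 + \<alpha>) / \<alpha>"]) auto
qed

lemma kappa_less_1: "\<kappa> < 1"
proof -
  have "\<kappa> \<le> p 1 {{1}} None" using p_None_ge[OF _ partition_of_1] by simp
  also have "p 1 {{1}} None = 1 - w 1 {{1}} * (1 - \<alpha>)"
    using p_None[OF _ partition_of_1] by simp
  also have "\<dots> < 1" using w_pos[OF _ partition_of_1] alpha_less_1 by simp
  finally show ?thesis .
qed

text \<open>The probability \<open>\<kappa> k / n\<close> of a new block gives \<open>1 / k\<close> a relative drift of at most \<open>-\<kappa> / (2 n)\<close>.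
  The exponent is not sharp; the bound serves to make \<open>1 / (n k)\<close> summable in mean.\<close>

lemma expectation_inverse_card:
  "1 \<le> n \<Longrightarrow> expectation (\<lambda>\<omega>. 1 / real (card (\<rho> n \<omega>))) \<le> real n powr (- \<kappa> / 2)"
proof (induction n rule: dec_induct)
  case base
  have "expectation (\<lambda>\<omega>. 1 / real (card (\<rho> 1 \<omega>))) = expectation (\<lambda>\<omega>. 1)"
    using rho_1 by (intro Bochner_Integration.integral_cong) auto
  then show ?case by (simp add: prob_space)
next
  case (step n)
  have n: "1 \<le> n" using step by simp
  define q where "q = 1 - \<kappa> / (2 * real n)"
  have q: "0 \<le> q" using n kappa_less_1 by (simp add: q_def field_simps)
  have "expectation (\<lambda>\<omega>. 1 / real (card (\<rho> (Suc n) \<omega>)))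
     \<le> expectation (\<lambda>\<omega>. q * (1 / real (card (\<rho> n \<omega>))))"
  proof (rule expectation_step_le[where m = 1 and \<phi> = "\<lambda>_ _ \<pi>. 1 / real (card \<pi>)"
        and \<psi> = "\<lambda>_ \<pi>. q * (1 / real (card \<pi>))"])
    fix \<pi> assume pa: "partition_of n \<pi>"
    define k where "k = real (card \<pi>)"
    have k: "1 \<le> k" using card_partition_pos[OF pa n] by (simp add: k_def)
    have "(\<Sum>s\<in>slots \<pi>. p n \<pi> s * (1 / real (card (extend_partition n \<pi> s))))
       = (\<Sum>s\<in>slots \<pi>. p n \<pi> s * (1 / k) + p n \<pi> s * (case s of None \<Rightarrow> 1 / (k + 1) - 1 / k | Some U \<Rightarrow> 0))"
      using card_extend[OF pa] by (intro sum.cong) (auto simp: k_def algebra_simps split: option.splits)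
    also have "\<dots> = 1 / k + p n \<pi> None * (1 / (k + 1) - 1 / k)"
      using sum_p_times[OF n pa, of "1 / (k + 1) - 1 / k" "\<lambda>_. 0"] sum_p[OF n pa]
      by (simp add: sum.distrib block_sum_def flip: sum_divide_distrib)
    also have "\<dots> = 1 / k - p n \<pi> None * (1 / (k * (k + 1)))"
      using k by (simp add: field_simps)
    also have "\<dots> \<le> 1 / k - \<kappa> * k / real n * (1 / (k * (k + 1)))"
      using p_None_ge[OF n pa] k by (intro diff_left_mono mult_right_mono) (auto simp: k_def)
    also have "\<dots> = (1 - \<kappa> / real n * (k / (k + 1))) * (1 / k)"
      by (simp add: left_diff_distrib diff_divide_distrib)
    also have "\<dots> \<le> (1 - \<kappa> / real n * (1 / 2)) * (1 / k)"
      using k n kappa_pos by (intro mult_right_mono diff_left_mono mult_left_mono) (auto simp: field_simps)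
    finally show "(\<Sum>s\<in>slots \<pi>. p n \<pi> s * (1 / real (card (extend_partition n \<pi> s))))
       \<le> q * (1 / real (card \<pi>))" by (simp add: q_def k_def mult.commute)
  qed (use n in auto)
  also have "\<dots> = q * expectation (\<lambda>\<omega>. 1 / real (card (\<rho> n \<omega>)))" by (rule integral_mult_right_zero)
  also have "\<dots> \<le> q * real n powr (- \<kappa> / 2)" using step.IH q by (intro mult_left_mono)
  also have "\<dots> = real n powr (- (\<kappa> / 2)) - \<kappa> / 2 * real n powr (- (\<kappa> / 2) - 1)"
  proof -
    have 1: "real n powr (- (\<kappa> / 2) - 1) = real n powr (- (\<kappa> / 2)) / real n"
      using n by (simp add: powr_diff)
    show ?thesis unfolding 1 by (simp add: q_def algebra_simps)
  qed
  also have "\<dots> \<le> (real n + 1) powr (- (\<kappa> / 2))"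
    using powr_diff_bounds(2)[of "\<kappa> / 2" "real n"] kappa_pos n by simp
  finally show ?case by (simp add: add.commute)
qed

text \<open>The drift of \<open>ln k\<close> is at least \<open>\<alpha> / n\<close> minus a multiple of \<open>1 / (n k)\<close>. The first term is
  compensated by \<open>\<alpha> ln n\<close>, and the second is summable in mean by \<open>expectation_inverse_card\<close>.\<close>

lemma expectation_ln_R_bounded_below:
  "\<exists>C\<ge>0. \<forall>n\<ge>1. - C \<le> expectation (\<lambda>\<omega>. ln (R n (\<rho> n \<omega>)))"
proof -
  define A where "A = 1 + 2 * c"
  have A: "0 \<le> A" using c_nonneg by (simp add: A_def)
  define z where "z n = - expectation (\<lambda>\<omega>. ln (R n (\<rho> n \<omega>)))" for n
  have lnR: "ln (R n \<pi>) = ln (real (card \<pi>)) - \<alpha> * ln (real n)" if "1 \<le> n" "partition_of n \<pi>" for n \<pi>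
    using that card_partition_pos[OF that(2,1)] by (simp add: R_def ln_mult ln_powr)
  have step: "z (Suc n) \<le> z n + A * real n powr (-1 - \<kappa> / 2)" if n: "1 \<le> n" for n
  proof -
    have "expectation (\<lambda>\<omega>. - ln (R (Suc n) (\<rho> (Suc n) \<omega>)))
       \<le> expectation (\<lambda>\<omega>. - ln (R n (\<rho> n \<omega>)) + A / real n * (1 / real (card (\<rho> n \<omega>))))"
    proof (rule expectation_step_le[where m = 1 and \<phi> = "\<lambda>_ _ \<pi>. - ln (R (Suc n) \<pi>)"
        and \<psi> = "\<lambda>_ \<pi>. - ln (R n \<pi>) + A / real n * (1 / real (card \<pi>))"])
      fix \<pi> assume pa: "partition_of n \<pi>"
      define k where "k = real (card \<pi>)"
      have k: "1 \<le> k" using card_partition_pos[OF pa n] by (simp add: k_def)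
      define x where "x = real n"
      have x: "1 \<le> x" using n by (simp add: x_def)
      have "(\<Sum>s\<in>slots \<pi>. p n \<pi> s * - ln (R (Suc n) (extend_partition n \<pi> s)))
        = (\<Sum>s\<in>slots \<pi>. p n \<pi> s * (\<alpha> * ln (x + 1) - ln k) + p n \<pi> s * (case s of None \<Rightarrow> ln k - ln (k + 1) | Some U \<Rightarrow> 0))"
      proof (intro sum.cong refl)
        fix s assume s: "s \<in> slots \<pi>"
        show "p n \<pi> s * - ln (R (Suc n) (extend_partition n \<pi> s))
          = p n \<pi> s * (\<alpha> * ln (x + 1) - ln k) + p n \<pi> s * (case s of None \<Rightarrow> ln k - ln (k + 1) | Some U \<Rightarrow> 0)"
        proof -
          have "- ln (R (Suc n) (extend_partition n \<pi> s))
            = (\<alpha> * ln (x + 1) - ln k) + (case s of None \<Rightarrow> ln k - ln (k + 1) | Some U \<Rightarrow> 0)"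
            using card_extend[OF pa s] lnR[OF _ partition_of_extend[OF pa s]]
            by (cases s) (simp_all add: k_def x_def algebra_simps)
          then show ?thesis by (simp only: distrib_left)
        qed
      qed
      also have "\<dots> = (\<alpha> * ln (x + 1) - ln k) + p n \<pi> None * (ln k - ln (k + 1))"
        using sum_p_times[OF n pa, of "ln k - ln (k + 1)" "\<lambda>_. 0"] sum_p[OF n pa]
        by (simp add: sum.distrib block_sum_def flip: sum_distrib_right)
      also have "\<dots> \<le> (\<alpha> * (ln x + 1 / x) - ln k) + (- \<alpha> / x + A / x * (1 / k))"
      proof -
        have "ln (1 + 1 / x) \<le> 1 / x" using x by (intro ln_add_one_self_le_self) auto
        then have 1: "ln (x + 1) \<le> ln x + 1 / x"
        proof -
          have "1 + 1 / x = (x + 1) / x" using x by (simp add: field_simps)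
          then have "ln (1 + 1 / x) = ln (x + 1) - ln x" using x ln_div[of "x + 1" x] by simp
          then show ?thesis using \<open>ln (1 + 1 / x) \<le> 1 / x\<close> by linarith
        qed
        have "1 / k - (1 / k)\<^sup>2 \<le> ln (1 + 1 / k)"
          using k by (intro ln_one_plus_pos_lower_bound) auto
        then have 2: "1 / k - 1 / k\<^sup>2 \<le> ln (k + 1) - ln k"
        proof -
          have "1 + 1 / k = (k + 1) / k" using k by (simp add: field_simps)
          then have "ln (1 + 1 / k) = ln (k + 1) - ln k" using k ln_div[of "k + 1" k] by simp
          then show ?thesis using \<open>1 / k - (1 / k)\<^sup>2 \<le> ln (1 + 1 / k)\<close> by (simp add: power_divide)
        qed
        have d0: "0 \<le> 1 / k - 1 / k\<^sup>2" using k by (simp add: field_simps power2_eq_square)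
        have "(\<alpha> * k / x - c / x) * (1 / k - 1 / k\<^sup>2) \<le> p n \<pi> None * (1 / k - 1 / k\<^sup>2)"
          using p_None_approx[OF n pa] d0 by (intro mult_right_mono) (auto simp: k_def x_def abs_le_iff)
        also have "\<dots> \<le> p n \<pi> None * (ln (k + 1) - ln k)"
          using 2 p_nonneg[OF n pa, of None] by (intro mult_left_mono) (auto simp: slots_def)
        finally have 3: "(\<alpha> * k / x - c / x) * (1 / k - 1 / k\<^sup>2) \<le> p n \<pi> None * (ln (k + 1) - ln k)" .
        have "(\<alpha> * k / x - c / x) * (1 / k - 1 / k\<^sup>2) = \<alpha> / x - (\<alpha> + c - c / k) / (x * k)"
          using k x by (simp add: field_simps power2_eq_square)
        moreover have "(\<alpha> + c - c / k) / (x * k) \<le> A / (x * k)"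
        proof (rule divide_right_mono)
          have "0 \<le> c / k" using k c_nonneg by simp
          then show "\<alpha> + c - c / k \<le> A" using c_nonneg alpha_less_1 by (simp add: A_def)
        qed (use k x in auto)
        ultimately have "\<alpha> / x - A / (x * k) \<le> p n \<pi> None * (ln (k + 1) - ln k)" using 3 by linarith
        moreover have "\<alpha> * ln (x + 1) \<le> \<alpha> * (ln x + 1 / x)" using 1 alpha_pos by simp
        ultimately show ?thesis by (simp add: algebra_simps)
      qed
      also have "\<dots> = - ln (R n \<pi>) + A / real n * (1 / real (card \<pi>))"
        using lnR[OF n pa] by (simp add: k_def x_def algebra_simps)
      finally show "(\<Sum>s\<in>slots \<pi>. p n \<pi> s * - ln (R (Suc n) (extend_partition n \<pi> s)))
         \<le> - ln (R n \<pi>) + A / real n * (1 / real (card \<pi>))" .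
    qed (use n in auto)
    also have "\<dots> = z n + A / real n * expectation (\<lambda>\<omega>. 1 / real (card (\<rho> n \<omega>)))"
    proof -
      have "integrable M (\<lambda>\<omega>. - ln (R n (\<rho> n \<omega>)))"
        "integrable M (\<lambda>\<omega>. A / real n * (1 / real (card (\<rho> n \<omega>))))"
        using n by (auto intro: integrable_rho)
      then show ?thesis
        unfolding z_def by (subst Bochner_Integration.integral_add) (auto simp del: mult_1_right times_divide_eq_right simp: integral_mult_right_zero)
    qed
    also have "\<dots> \<le> z n + A / real n * real n powr (- \<kappa> / 2)"
      using expectation_inverse_card[OF n] A by (intro add_left_mono mult_left_mono) auto
    also have "\<dots> = z n + A * real n powr (-1 - \<kappa> / 2)"
    proof -
      have "-1 - \<kappa> / 2 = - \<kappa> / 2 - 1" by simp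
      then have "real n powr (-1 - \<kappa> / 2) = real n powr (- \<kappa> / 2) / real n"
        using n by (simp only: powr_diff) simp
      then show ?thesis by simp
    qed
    finally show ?thesis by (simp add: z_def)
  qed
  define C where "C = max 0 (z 1 + A * 2 powr (1 + \<kappa> / 2) / (\<kappa> / 2) * real 1 powr (-(\<kappa> / 2)))"
  have "z n \<le> C" if "1 \<le> n" for n
    using decay_from_recursion[of "\<kappa> / 2" A 1 n z] kappa_pos A step that
    unfolding C_def by (simp add: max.coboundedI2)
  moreover have "0 \<le> C" by (simp add: C_def)
  ultimately show ?thesis unfolding z_def by (intro exI[of _ C]) (auto simp: minus_le_iff)
qed

lemma R_pos: "1 \<le> n \<Longrightarrow> partition_of n \<pi> \<Longrightarrow> 0 < R n \<pi>"
  using card_partition_pos[of n \<pi>] by (simp add: R_def)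

text \<open>On the event in question \<open>ln R\<close> is at most \<open>- B\<close>, and elsewhere \<open>ln R \<le> R\<close> has bounded mean; an
  event that is too likely would contradict the lower bound for the mean of \<open>ln R\<close>.\<close>

lemma R_not_small:
  assumes "0 < \<epsilon>"
  shows "\<exists>\<delta>>0. \<forall>n\<ge>1. prob {\<omega>\<in>space M. R n (\<rho> n \<omega>) < \<delta>} \<le> \<epsilon>"
proof -
  obtain K where K: "0 \<le> K" "\<And>n. 1 \<le> n \<Longrightarrow> expectation (\<lambda>\<omega>. R n (\<rho> n \<omega>)) \<le> K"
    using expectation_R_bounded by blast
  obtain L where L: "0 \<le> L" "\<And>n. 1 \<le> n \<Longrightarrow> - L \<le> expectation (\<lambda>\<omega>. ln (R n (\<rho> n \<omega>)))"
    using expectation_ln_R_bounded_below by blast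
  define B where "B = (K + L + 1) / \<epsilon>"
  have B: "0 < B" using K L assms by (simp add: B_def add_nonneg_pos)
  have "prob {\<omega>\<in>space M. R n (\<rho> n \<omega>) < exp (- B)} \<le> \<epsilon>" if n: "1 \<le> n" for n
  proof -
    let ?A = "{\<omega>\<in>space M. R n (\<rho> n \<omega>) < exp (- B)}"
    have "expectation (\<lambda>\<omega>. ln (R n (\<rho> n \<omega>)))
       \<le> expectation (\<lambda>\<omega>. R n (\<rho> n \<omega>) - B * (if R n (\<rho> n \<omega>) < exp (- B) then 1 else 0))"
    proof (rule expectation_rho_mono[OF n])
      fix \<pi> assume pa: "partition_of n \<pi>"
      have pos: "0 < R n \<pi>" by (rule R_pos[OF n pa])
      have "ln (R n \<pi>) \<le> R n \<pi>" using ln_less_self[OF pos] by simp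
      moreover have "ln (R n \<pi>) \<le> - B" if "R n \<pi> < exp (- B)"
        using pos that by (metis ln_exp ln_le_cancel_iff exp_gt_zero less_imp_le)
      ultimately show "ln (R n \<pi>) \<le> R n \<pi> - B * (if R n \<pi> < exp (- B) then 1 else 0)"
        using pos by auto
    qed
    also have "\<dots> = expectation (\<lambda>\<omega>. R n (\<rho> n \<omega>)) - B * expectation (\<lambda>\<omega>. (if R n (\<rho> n \<omega>) < exp (- B) then 1 else 0))"
      using n by (subst Bochner_Integration.integral_diff) (auto intro!: integrable_rho)
    also have "expectation (\<lambda>\<omega>. (if R n (\<rho> n \<omega>) < exp (- B) then 1 else 0)) = expectation (indicat_real ?A)"
      by (intro Bochner_Integration.integral_cong) (auto simp: indicator_def)
    also have "\<dots> = prob ?A" using sets_rho[OF n] by (simp add: Int_absorb1 subset_eq)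
    finally have "B * prob ?A \<le> K + L" using K(2)[OF n] L(2)[OF n] by linarith
    then have "B * prob ?A \<le> B * \<epsilon>" using assms by (simp add: B_def)
    then show ?thesis using B by simp
  qed
  then show ?thesis by (intro exI[of _ "exp (- B)"]) auto
qed

lemma expectation_card_le: "\<exists>K\<ge>0. \<forall>n\<ge>1. expectation (\<lambda>\<omega>. real (card (\<rho> n \<omega>))) \<le> K * real n powr \<alpha>"
proof -
  obtain K where K: "0 \<le> K" "\<And>n. 1 \<le> n \<Longrightarrow> expectation (\<lambda>\<omega>. R n (\<rho> n \<omega>)) \<le> K"
    using expectation_R_bounded by blast
  have "expectation (\<lambda>\<omega>. real (card (\<rho> n \<omega>))) \<le> K * real n powr \<alpha>" if n: "1 \<le> n" for n
  proof -
    have "real n powr (-\<alpha>) * real n powr \<alpha> = 1" using n by (simp flip: powr_add)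
    then have "expectation (\<lambda>\<omega>. real (card (\<rho> n \<omega>))) = expectation (\<lambda>\<omega>. R n (\<rho> n \<omega>) * real n powr \<alpha>)"
      unfolding R_def mult.assoc by simp
    also have "\<dots> = expectation (\<lambda>\<omega>. R n (\<rho> n \<omega>)) * real n powr \<alpha>" by (rule integral_mult_left_zero)
    also have "\<dots> \<le> K * real n powr \<alpha>" using K(2)[OF n] by (intro mult_right_mono) auto
    finally show ?thesis .
  qed
  then show ?thesis using K(1) by blast
qed

text \<open>Jensen's inequality in the form \<open>2\<bar>x\<bar> \<le> r + x\<^sup>2 / r\<close>, where \<open>r\<close> is the scale of the second moment.\<close>

lemma expectation_abs_le:
  fixes F :: "nat set set \<Rightarrow> nat set set \<Rightarrow> real" and r :: real
  assumes "1 \<le> m" "m \<le> n" "0 < r" "expectation (\<lambda>\<omega>. (F (\<rho> m \<omega>) (\<rho> n \<omega>))\<^sup>2) \<le> C * r\<^sup>2"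
  shows "expectation (\<lambda>\<omega>. \<bar>F (\<rho> m \<omega>) (\<rho> n \<omega>)\<bar>) \<le> (1 + C) * r"
proof -
  have bound: "\<bar>x\<bar> \<le> r / 2 + x\<^sup>2 / (2 * r)" for x :: real
  proof -
    have "0 \<le> (\<bar>x\<bar> - r)\<^sup>2" by simp
    then show ?thesis using assms(3) by (simp add: power2_eq_square field_simps)
  qed
  have "0 \<le> expectation (\<lambda>\<omega>. (F (\<rho> m \<omega>) (\<rho> n \<omega>))\<^sup>2)" by simp
  then have "0 \<le> C * r\<^sup>2" using assms(4) by linarith
  then have C: "0 \<le> C" using assms(3) by (simp add: zero_le_mult_iff)
  have i: "integrable M (\<lambda>\<omega>. (F (\<rho> m \<omega>) (\<rho> n \<omega>))\<^sup>2)"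
    by (rule integrable_rho2[OF assms(1,2)])
  have "expectation (\<lambda>\<omega>. \<bar>F (\<rho> m \<omega>) (\<rho> n \<omega>)\<bar>)
     \<le> expectation (\<lambda>\<omega>. r / 2 + (F (\<rho> m \<omega>) (\<rho> n \<omega>))\<^sup>2 / (2 * r))"
    using assms(1,2) bound by (intro integral_mono integrable_rho2)
  also have "\<dots> = r / 2 + expectation (\<lambda>\<omega>. (F (\<rho> m \<omega>) (\<rho> n \<omega>))\<^sup>2) / (2 * r)"
    using i by (simp add: prob_space)
  also have "\<dots> \<le> r / 2 + C * r\<^sup>2 / (2 * r)"
    using assms(3,4) by (intro add_left_mono divide_right_mono) auto
  also have "\<dots> = (1 + C) * r / 2" using assms(3) by (simp add: power2_eq_square field_simps)
  also have "\<dots> \<le> (1 + C) * r" using assms(3) C by simp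
  finally show ?thesis .
qed

section \<open>The numbers of large blocks\<close>

text \<open>The tail of the Sibuya distribution with parameter \<open>\<alpha>\<close>, which is the limiting distribution of the
  size of a block chosen at random.\<close>

definition sibuya_tail :: "nat \<Rightarrow> real" where
  "sibuya_tail i = (\<Prod>l=1..i. 1 - \<alpha> / real l)"

text \<open>The number of blocks with more than \<open>i\<close> elements, minus its first-order prediction from the
  number of blocks.\<close>

definition tail_deviation :: "nat \<Rightarrow> nat set set \<Rightarrow> real" where
  "tail_deviation i = block_sum (\<lambda>j. (if i < j then 1 else 0) - sibuya_tail i)"

lemma sibuya_tail_0 [simp]: "sibuya_tail 0 = 1" by (simp add: sibuya_tail_def)

lemma sibuya_tail_Suc: "real (Suc i) * sibuya_tail (Suc i) = (real (Suc i) - \<alpha>) * sibuya_tail i"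
  by (simp add: sibuya_tail_def field_simps)

lemma sibuya_tail_bounds: "0 \<le> sibuya_tail i" "sibuya_tail i \<le> 1"
proof -
  have *: "0 \<le> 1 - \<alpha> / real l \<and> 1 - \<alpha> / real l \<le> 1" if "l \<in> {1..i}" for l
    using that alpha_pos alpha_less_1 by (auto simp: field_simps)
  show "0 \<le> sibuya_tail i" unfolding sibuya_tail_def using * by (intro prod_nonneg) auto
  show "sibuya_tail i \<le> 1" unfolding sibuya_tail_def using * by (intro prod_le_1) auto
qed

lemma tail_deviation_0: "partition_of n \<pi> \<Longrightarrow> tail_deviation 0 \<pi> = 0"
  unfolding tail_deviation_def block_sum_def
proof (intro sum.neutral ballI)
  fix U assume "partition_of n \<pi>" "U \<in> \<pi>"
  then show "(if 0 < card U then 1 else 0) - sibuya_tail 0 = 0"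
    using card_block_pos[of n \<pi> U] by simp
qed

text \<open>A block passes from \<open>Suc i\<close> to more than \<open>Suc i\<close> elements at the rate \<open>a / n\<close> with
  \<open>a = Suc i - \<alpha>\<close>. The recursion \<open>sibuya_tail_Suc\<close> cancels the terms proportional to \<open>k\<close>, and what
  remains is the drift \<open>a / n\<close> times the deviation at level \<open>i\<close> minus the deviation at level \<open>Suc i\<close>:
  the latter is pulled towards the former. So the second moment is of the order of the accumulated
  noise, that is of the number of blocks.\<close>

lemma expectation_tail_deviation_square:
  "\<exists>C\<ge>0. \<forall>n\<ge>1. expectation (\<lambda>\<omega>. (tail_deviation i (\<rho> n \<omega>))\<^sup>2) \<le> C * real n powr \<alpha>"
proof (induction i)
  case 0
  have "expectation (\<lambda>\<omega>. (tail_deviation 0 (\<rho> n \<omega>))\<^sup>2) = expectation (\<lambda>\<omega>. 0)" if "1 \<le> n" for n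
    using tail_deviation_0[OF rho_partition[OF that]] by (intro Bochner_Integration.integral_cong) auto
  then show ?case by (intro exI[of _ 0]) simp
next
  case (Suc i)
  then obtain C0 where C0: "0 \<le> C0"
    "\<And>n. 1 \<le> n \<Longrightarrow> expectation (\<lambda>\<omega>. (tail_deviation i (\<rho> n \<omega>))\<^sup>2) \<le> C0 * real n powr \<alpha>" by blast
  obtain K where K: "0 \<le> K"
    "\<And>n. 1 \<le> n \<Longrightarrow> expectation (\<lambda>\<omega>. real (card (\<rho> n \<omega>))) \<le> K * real n powr \<alpha>"
    using expectation_card_le by blast
  define a where "a = real (Suc i) - \<alpha>"
  have a: "0 < a" using alpha_less_1 by (simp add: a_def)
  define A where "A = c * (1 + a)"
  define B where "B = (1 + c) * (1 + a)"
  have AB: "0 \<le> A" "0 \<le> B" using a c_nonneg by (auto simp: A_def B_def)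
  define s where "s = sibuya_tail (Suc i)"
  define C where "C = a * C0 + A\<^sup>2 / a + B * K"
  have C: "0 \<le> C" using a C0(1) AB K(1) by (simp add: C_def)
  have step: "expectation (\<lambda>\<omega>. (tail_deviation (Suc i) (\<rho> (Suc n) \<omega>))\<^sup>2)
      \<le> expectation (\<lambda>\<omega>. (tail_deviation (Suc i) (\<rho> n \<omega>))\<^sup>2) + C * real n powr (\<alpha> - 1)"
    if n: "1 \<le> n" for n
  proof -
    define x where "x = real n"
    have x: "1 \<le> x" using n by (simp add: x_def)
    have "expectation (\<lambda>\<omega>. (tail_deviation (Suc i) (\<rho> (Suc n) \<omega>))\<^sup>2)
      \<le> expectation (\<lambda>\<omega>. (tail_deviation (Suc i) (\<rho> n \<omega>))\<^sup>2 +
          (a / x * (tail_deviation i (\<rho> n \<omega>))\<^sup>2 + A\<^sup>2 / a / x + B / x * real (card (\<rho> n \<omega>))))"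
    proof (rule expectation_step_le[where m = 1 and \<phi> = "\<lambda>_ _ \<pi>. (tail_deviation (Suc i) \<pi>)\<^sup>2"
         and \<psi> = "\<lambda>_ \<pi>. (tail_deviation (Suc i) \<pi>)\<^sup>2 +
          (a / x * (tail_deviation i \<pi>)\<^sup>2 + A\<^sup>2 / a / x + B / x * real (card \<pi>))"])
      fix \<pi> assume pa: "partition_of n \<pi>"
      define L where "L = tail_deviation (Suc i) \<pi>"
      define L' where "L' = tail_deviation i \<pi>"
      define k where "k = real (card \<pi>)"
      have k: "0 \<le> k" "k \<le> x" using card_partition_le[OF pa] by (auto simp: k_def x_def)
      define J where "J = block_sum (\<lambda>j. if j = Suc i then 1 else 0) \<pi>"
      have J: "0 \<le> J" "J \<le> k"
      proof -
        show "0 \<le> J" by (simp add: J_def block_sum_def sum_nonneg)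
        show "J \<le> k" unfolding J_def k_def block_sum_card[symmetric]
          by (intro block_sum_mono[OF pa]) auto
      qed
      have J_eq: "J = L' - L + (sibuya_tail i - s) * k"
      proof -
        have "L' - L + (sibuya_tail i - s) * k = (\<Sum>U\<in>\<pi>. ((if i < card U then 1 else 0) - sibuya_tail i) -
              ((if Suc i < card U then 1 else 0) - s) + (sibuya_tail i - s))"
          by (simp add: L_def L'_def tail_deviation_def block_sum_def s_def k_def sum.distrib sum_subtractf algebra_simps)
        also have "\<dots> = J" unfolding J_def block_sum_def by (intro sum.cong) auto
        finally show ?thesis by simp
      qed
      define d where "d = (\<lambda>s' :: nat set option. case s' of None \<Rightarrow> - s | Some U \<Rightarrow> (if card U = Suc i then 1 else 0))"
      define \<mu> where "\<mu> = (\<Sum>s'\<in>slots \<pi>. p n \<pi> s' * d s')"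
      have ws: "block_sum (\<lambda>j. (real j - \<alpha>) * (if j = Suc i then 1 else 0)) \<pi> = a * J"
        unfolding block_sum_def J_def a_def sum_distrib_left by (intro sum.cong) auto
      have mu: "\<mu> = p n \<pi> None * (- s) + w n \<pi> * (a * J)"
        using sum_p_times[OF n pa, of "- s" "\<lambda>j. if j = Suc i then 1 else 0"]
        unfolding \<mu>_def d_def ws .
      have d2: "(\<Sum>s'\<in>slots \<pi>. p n \<pi> s' * (d s')\<^sup>2) = p n \<pi> None * s\<^sup>2 + w n \<pi> * (a * J)"
      proof -
        have "(\<Sum>s'\<in>slots \<pi>. p n \<pi> s' * (d s')\<^sup>2)
          = (\<Sum>s'\<in>slots \<pi>. p n \<pi> s' * (case s' of None \<Rightarrow> s\<^sup>2 | Some U \<Rightarrow> (if card U = Suc i then 1 else 0)))"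
          by (intro sum.cong) (auto simp: d_def split: option.split)
        then show ?thesis
          using sum_p_times[OF n pa, of "s\<^sup>2" "\<lambda>j. if j = Suc i then 1 else 0"] unfolding ws by simp
      qed
      have sq: "(\<Sum>s'\<in>slots \<pi>. p n \<pi> s' * (tail_deviation (Suc i) (extend_partition n \<pi> s'))\<^sup>2)
        = L\<^sup>2 + 2 * L * \<mu> + (\<Sum>s'\<in>slots \<pi>. p n \<pi> s' * (d s')\<^sup>2)"
        unfolding \<mu>_def
      proof (rule sum_p_square[OF n pa])
        fix s' assume s': "s' \<in> slots \<pi>"
        show "tail_deviation (Suc i) (extend_partition n \<pi> s') = L + d s'"
          unfolding tail_deviation_def L_def block_sum_extend[OF pa s'] d_def s_def
          by (auto split: option.split)
      qed
      have "\<mu> - a / x * (L' - L) = - s * (p n \<pi> None - \<alpha> * k / x) + (w n \<pi> - 1 / x) * (a * J)"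
      proof -
        have "a * (sibuya_tail i - s) = \<alpha> * s"
          using sibuya_tail_Suc[of i] by (simp add: a_def s_def algebra_simps)
        moreover have "a * J = a * (L' - L) + a * (sibuya_tail i - s) * k"
          unfolding J_eq by (simp only: distrib_left mult.assoc)
        ultimately have "a * J = a * (L' - L) + \<alpha> * s * k" by simp
        then have "1 / x * (a * J) = a / x * (L' - L) + s * (\<alpha> * k / x)"
          by (simp add: add_divide_distrib mult_ac)
        then show ?thesis unfolding mu by (simp add: algebra_simps)
      qed
      also have "\<bar>\<dots>\<bar> \<le> 1 * (c / x) + c / x\<^sup>2 * (a * x)"
      proof -
        have "\<bar>- s * (p n \<pi> None - \<alpha> * k / x)\<bar> \<le> 1 * (c / x)"
          unfolding abs_mult using p_None_approx[OF n pa] sibuya_tail_bounds[of "Suc i"]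
          by (intro mult_mono) (auto simp: s_def k_def x_def)
        moreover have "\<bar>(w n \<pi> - 1 / x) * (a * J)\<bar> \<le> c / x\<^sup>2 * (a * x)"
          unfolding abs_mult using w_approx[OF n pa] J k a
          by (intro mult_mono) (auto simp: x_def)
        ultimately show ?thesis by (rule order_trans[OF abs_triangle_ineq add_mono])
      qed
      also have "\<dots> = A / x" using x by (simp add: A_def power2_eq_square field_simps)
      finally have mu_le: "\<bar>\<mu> - a / x * (L' - L)\<bar> \<le> A / x" .
      have "a / x * (2 * L * (L' - L)) = 2 * L * (a / x * (L' - L))" by (simp only: mult_ac)
      then have "2 * L * \<mu> = a / x * (2 * L * (L' - L)) + 2 * L * (\<mu> - a / x * (L' - L))"
        by (simp only: right_diff_distrib[of "2 * L" \<mu>])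
      also have "\<dots> \<le> a / x * (L'\<^sup>2 - L\<^sup>2) + \<bar>2 * L\<bar> * (A / x)"
      proof (rule add_mono)
        (* the negative square of L is kept: it absorbs the term 2 |L| A / x below *)
        have "2 * L * (L' - L) \<le> L'\<^sup>2 - L\<^sup>2"
          using zero_le_power2[of "L' - L"] by (simp add: power2_eq_square algebra_simps)
        then show "a / x * (2 * L * (L' - L)) \<le> a / x * (L'\<^sup>2 - L\<^sup>2)"
          using a x by (intro mult_left_mono) auto
        have "2 * L * (\<mu> - a / x * (L' - L)) \<le> \<bar>2 * L\<bar> * \<bar>\<mu> - a / x * (L' - L)\<bar>"
          by (metis abs_ge_self abs_mult)
        also have "\<dots> \<le> \<bar>2 * L\<bar> * (A / x)" by (intro mult_left_mono mu_le) auto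
        finally show "2 * L * (\<mu> - a / x * (L' - L)) \<le> \<bar>2 * L\<bar> * (A / x)" .
      qed
      also have "\<bar>2 * L\<bar> * (A / x) \<le> (a * L\<^sup>2 + A\<^sup>2 / a) / x"
      proof -
        have "0 \<le> (a * \<bar>L\<bar> - A)\<^sup>2 / a" using a by simp
        also have "\<dots> = a * L\<^sup>2 - 2 * \<bar>L\<bar> * A + A\<^sup>2 / a"
          using a by (simp add: power2_eq_square field_simps)
        finally have "\<bar>2 * L\<bar> * A \<le> a * L\<^sup>2 + A\<^sup>2 / a" by simp
        then show ?thesis using divide_right_mono[of _ _ x] x by simp
      qed
      also have "a / x * (L'\<^sup>2 - L\<^sup>2) + (a * L\<^sup>2 + A\<^sup>2 / a) / x = a / x * L'\<^sup>2 + A\<^sup>2 / a / x"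
        by (simp add: add_divide_distrib algebra_simps)
      finally have 1: "2 * L * \<mu> \<le> a / x * L'\<^sup>2 + A\<^sup>2 / a / x" by simp
      have 2: "(\<Sum>s'\<in>slots \<pi>. p n \<pi> s' * (d s')\<^sup>2) \<le> B / x * k"
      proof -
        have "p n \<pi> None * s\<^sup>2 \<le> (1 + c) * k / x * 1"
          using p_None_le[OF n pa] sibuya_tail_bounds[of "Suc i"] c_nonneg k x
          by (intro mult_mono) (auto simp: s_def k_def x_def power_le_one)
        moreover have "w n \<pi> * (a * J) \<le> (1 + c) / x * (a * k)"
          using w_le[OF n pa] w_pos[OF n pa] c_nonneg J a x by (intro mult_mono) (auto simp: x_def)
        moreover have "(1 + c) * k / x * 1 + (1 + c) / x * (a * k) = B / x * k"
          by (simp add: B_def algebra_simps add_divide_distrib)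
        ultimately show ?thesis unfolding d2 by linarith
      qed
      show "(\<Sum>s'\<in>slots \<pi>. p n \<pi> s' * (tail_deviation (Suc i) (extend_partition n \<pi> s'))\<^sup>2)
        \<le> (tail_deviation (Suc i) \<pi>)\<^sup>2 + (a / x * (tail_deviation i \<pi>)\<^sup>2 + A\<^sup>2 / a / x + B / x * real (card \<pi>))"
        using 1 2 unfolding sq L_def[symmetric] L'_def[symmetric] k_def[symmetric] by linarith
    qed (use n in auto)
    also have "\<dots> = expectation (\<lambda>\<omega>. (tail_deviation (Suc i) (\<rho> n \<omega>))\<^sup>2) +
          (a / x * expectation (\<lambda>\<omega>. (tail_deviation i (\<rho> n \<omega>))\<^sup>2) + A\<^sup>2 / a / x +
            B / x * expectation (\<lambda>\<omega>. real (card (\<rho> n \<omega>))))"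
    proof -
      have "integrable M (\<lambda>\<omega>. (tail_deviation (Suc i) (\<rho> n \<omega>))\<^sup>2)"
        "integrable M (\<lambda>\<omega>. (tail_deviation i (\<rho> n \<omega>))\<^sup>2)"
        "integrable M (\<lambda>\<omega>. real (card (\<rho> n \<omega>)))"
        using n by (auto intro: integrable_rho)
      then show ?thesis by (simp add: prob_space)
    qed
    also have "\<dots> \<le> expectation (\<lambda>\<omega>. (tail_deviation (Suc i) (\<rho> n \<omega>))\<^sup>2) +
          (a / x * (C0 * x powr \<alpha>) + A\<^sup>2 / a / x * x powr \<alpha> + B / x * (K * x powr \<alpha>))"
    proof (intro add_left_mono add_mono mult_left_mono)
      show "A\<^sup>2 / a / x \<le> A\<^sup>2 / a / x * x powr \<alpha>"
        using x a alpha_pos mult_left_mono[of 1 "x powr \<alpha>" "A\<^sup>2 / a / x"] by (simp add: ge_one_powr_ge_zero)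
    qed (use C0 K n x a AB in \<open>auto simp: x_def\<close>)
    also have "a / x * (C0 * x powr \<alpha>) + A\<^sup>2 / a / x * x powr \<alpha> + B / x * (K * x powr \<alpha>) = C * x powr (\<alpha> - 1)"
      using x by (simp add: C_def powr_diff algebra_simps add_divide_distrib)
    finally show ?thesis by (simp add: x_def)
  qed
  have "\<exists>K\<ge>0. \<forall>n\<ge>1. expectation (\<lambda>\<omega>. (tail_deviation (Suc i) (\<rho> n \<omega>))\<^sup>2) \<le> K * real n powr \<alpha>"
  proof (rule growth_from_recursion[OF alpha_pos _ C])
    fix n :: nat assume n: "1 \<le> n"
    have "0 \<le> \<alpha> / (4 * real n) * expectation (\<lambda>\<omega>. (tail_deviation (Suc i) (\<rho> n \<omega>))\<^sup>2)"
      using alpha_pos by (intro mult_nonneg_nonneg) auto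
    then show "expectation (\<lambda>\<omega>. (tail_deviation (Suc i) (\<rho> (Suc n) \<omega>))\<^sup>2)
        \<le> (1 + \<alpha> / (4 * real n)) * expectation (\<lambda>\<omega>. (tail_deviation (Suc i) (\<rho> n \<omega>))\<^sup>2) + C * real n powr (\<alpha> - 1)"
      using step[OF n] by (simp only: distrib_right mult_1_left)
  qed (use alpha_less_1 in auto)
  then show ?case .
qed

section \<open>The score\<close>

text \<open>The derivative at \<open>\<alpha>\<close> of the quasi log-likelihood. The terms \<open>i = 0\<close> of the inner sums account for
  the part \<open>k / \<alpha>\<close> coming from \<open>(k - 1) ln x\<close>, which leaves \<open>-1 / \<alpha>\<close> outside.\<close>

definition score :: "nat set set \<Rightarrow> real" where
  "score \<pi> = - block_sum (\<lambda>j. \<Sum>i<j. 1 / (real i - \<alpha>)) \<pi> - 1 / \<alpha>"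

definition score_increment :: "nat set option \<Rightarrow> real" where
  "score_increment s = (case s of None \<Rightarrow> 1 / \<alpha> | Some U \<Rightarrow> - 1 / (real (card U) - \<alpha>))"

definition score_variance :: "nat \<Rightarrow> nat set set \<Rightarrow> real" where
  "score_variance n \<pi> = (\<Sum>s\<in>slots \<pi>. p n \<pi> s * (score_increment s)\<^sup>2)"

text \<open>Multiplied by \<open>w\<close>, the contribution of the existing blocks to the conditional variance of the score.\<close>

definition inverse_sizes :: "nat set set \<Rightarrow> real" where
  "inverse_sizes = block_sum (\<lambda>j. 1 / (real j - \<alpha>))"

lemma score_extend:
  assumes "partition_of n \<pi>" "s \<in> slots \<pi>"
  shows "score (extend_partition n \<pi> s) = score \<pi> + score_increment s"
  unfolding score_def block_sum_extend[OF assms] score_increment_def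
  by (auto split: option.split)

lemma inverse_sizes_bounds:
  assumes "partition_of n \<pi>"
  shows "0 \<le> inverse_sizes \<pi>" "inverse_sizes \<pi> \<le> real (card \<pi>) / (1 - \<alpha>)"
proof -
  have j: "1 \<le> real (card U)" if "U \<in> \<pi>" for U using card_block_pos[OF assms that] by simp
  show "0 \<le> inverse_sizes \<pi>" unfolding inverse_sizes_def block_sum_def
  proof (rule sum_nonneg)
    fix U assume "U \<in> \<pi>" then show "0 \<le> 1 / (real (card U) - \<alpha>)" using j alpha_less_1 by force
  qed
  have "inverse_sizes \<pi> \<le> (\<Sum>U\<in>\<pi>. 1 / (1 - \<alpha>))" unfolding inverse_sizes_def block_sum_def
  proof (rule sum_mono)
    fix U assume "U \<in> \<pi>" then show "1 / (real (card U) - \<alpha>) \<le> 1 / (1 - \<alpha>)"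
      using j[of U] alpha_less_1 by (intro divide_left_mono) auto
  qed
  then show "inverse_sizes \<pi> \<le> real (card \<pi>) / (1 - \<alpha>)" by simp
qed

lemma abs_score_increment_le:
  assumes "partition_of n \<pi>" "s \<in> slots \<pi>"
  shows "\<bar>score_increment s\<bar> \<le> 1 / \<alpha> + 1 / (1 - \<alpha>)"
  using assms(2)
proof (cases rule: slots_cases)
  case 1
  then show ?thesis using alpha_pos alpha_less_1 by (simp add: score_increment_def)
next
  case (2 U)
  have "1 \<le> real (card U)" using card_block_pos[OF assms(1) 2(2)] by simp
  then have "1 / (real (card U) - \<alpha>) \<le> 1 / (1 - \<alpha>)" "0 < real (card U) - \<alpha>"
    using alpha_less_1 by (auto intro!: divide_left_mono)
  then show ?thesis using 2 alpha_pos by (simp add: score_increment_def add_increasing)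
qed

text \<open>The factor \<open>|U| - \<alpha>\<close> of the transition probability cancels the denominator of the increment, so that
  every block contributes \<open>- w\<close>. The drift is zero for \<open>w = 1 / n\<close>.\<close>

lemma score_drift:
  assumes "1 \<le> n" "partition_of n \<pi>"
  shows "\<bar>\<Sum>s\<in>slots \<pi>. p n \<pi> s * score_increment s\<bar> \<le> c / \<alpha> / real n"
proof -
  have ne: "real (card U) - \<alpha> \<noteq> 0" if "U \<in> \<pi>" for U
    using card_block_pos[OF assms(2) that] alpha_less_1 by auto
  have "(\<Sum>s\<in>slots \<pi>. p n \<pi> s * score_increment s)
     = p n \<pi> None * (1 / \<alpha>) + w n \<pi> * block_sum (\<lambda>j. (real j - \<alpha>) * (- 1 / (real j - \<alpha>))) \<pi>"
    using sum_p_times[OF assms, of "1 / \<alpha>" "\<lambda>j. - 1 / (real j - \<alpha>)"] by (simp add: score_increment_def)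
  also have "block_sum (\<lambda>j. (real j - \<alpha>) * (- 1 / (real j - \<alpha>))) \<pi> = (\<Sum>U\<in>\<pi>. - 1)"
    unfolding block_sum_def using ne by (intro sum.cong) auto
  also have "p n \<pi> None * (1 / \<alpha>) + w n \<pi> * (\<Sum>U\<in>\<pi>. - 1) = (1 / real n - w n \<pi>) * (real n / \<alpha>)"
    using assms alpha_pos by (simp add: p_None field_simps)
  also have "\<bar>\<dots>\<bar> \<le> c / (real n)\<^sup>2 * (real n / \<alpha>)"
    unfolding abs_mult using w_approx[OF assms] alpha_pos by (intro mult_mono) auto
  also have "\<dots> = c / \<alpha> / real n" using assms by (simp add: power2_eq_square field_simps)
  finally show ?thesis .
qed

lemma score_variance_eq:
  assumes "1 \<le> n" "partition_of n \<pi>"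
  shows "score_variance n \<pi> = p n \<pi> None / \<alpha>\<^sup>2 + w n \<pi> * inverse_sizes \<pi>"
proof -
  have ne: "real (card U) - \<alpha> \<noteq> 0" if "U \<in> \<pi>" for U
    using card_block_pos[OF assms(2) that] alpha_less_1 by auto
  have "score_variance n \<pi> = (\<Sum>s\<in>slots \<pi>. p n \<pi> s * (case s of None \<Rightarrow> (1 / \<alpha>)\<^sup>2 | Some U \<Rightarrow> (1 / (real (card U) - \<alpha>))\<^sup>2))"
    unfolding score_variance_def score_increment_def
    by (intro sum.cong) (auto simp: power2_eq_square split: option.split)
  also have "\<dots> = p n \<pi> None * (1 / \<alpha>)\<^sup>2 + w n \<pi> * block_sum (\<lambda>j. (real j - \<alpha>) * (1 / (real j - \<alpha>))\<^sup>2) \<pi>"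
    using sum_p_times[OF assms, of "(1 / \<alpha>)\<^sup>2" "\<lambda>j. (1 / (real j - \<alpha>))\<^sup>2"] by simp
  also have "block_sum (\<lambda>j. (real j - \<alpha>) * (1 / (real j - \<alpha>))\<^sup>2) \<pi> = inverse_sizes \<pi>"
    unfolding block_sum_def inverse_sizes_def using ne
    by (intro sum.cong) (auto simp: power2_eq_square)
  finally show ?thesis by (simp add: power_divide)
qed

definition variance_const :: real where
  "variance_const = (1 + c) / \<alpha>\<^sup>2 + (1 + c) / (1 - \<alpha>)"

lemma variance_const_nonneg: "0 \<le> variance_const"
  using c_nonneg alpha_less_1 by (simp add: variance_const_def)

lemma score_variance_bounds:
  assumes "1 \<le> n" "partition_of n \<pi>"
  shows "0 \<le> score_variance n \<pi>" "score_variance n \<pi> \<le> variance_const * real (card \<pi>) / real n"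
proof -
  show "0 \<le> score_variance n \<pi>" unfolding score_variance_def
    using p_nonneg[OF assms] by (intro sum_nonneg mult_nonneg_nonneg) auto
  have "p n \<pi> None / \<alpha>\<^sup>2 \<le> (1 + c) * real (card \<pi>) / real n / \<alpha>\<^sup>2"
    using p_None_le[OF assms] by (intro divide_right_mono) auto
  moreover have "w n \<pi> * inverse_sizes \<pi> \<le> (1 + c) / real n * (real (card \<pi>) / (1 - \<alpha>))"
    using w_le[OF assms] inverse_sizes_bounds[OF assms(2)] c_nonneg w_pos[OF assms]
    by (intro mult_mono) auto
  moreover have "(1 + c) * real (card \<pi>) / real n / \<alpha>\<^sup>2 + (1 + c) / real n * (real (card \<pi>) / (1 - \<alpha>))
      = variance_const * real (card \<pi>) / real n"
    using alpha_less_1 alpha_pos assms by (simp add: variance_const_def divide_simps) (simp add: algebra_simps)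
  ultimately show "score_variance n \<pi> \<le> variance_const * real (card \<pi>) / real n"
    unfolding score_variance_eq[OF assms] by linarith
qed

lemma expectation_score_variance_le:
  "\<exists>C\<ge>0. \<forall>n\<ge>1. expectation (\<lambda>\<omega>. score_variance n (\<rho> n \<omega>)) \<le> C * real n powr (\<alpha> - 1)"
proof -
  obtain K where K: "0 \<le> K"
    "\<And>n. 1 \<le> n \<Longrightarrow> expectation (\<lambda>\<omega>. real (card (\<rho> n \<omega>))) \<le> K * real n powr \<alpha>"
    using expectation_card_le by blast
  have "expectation (\<lambda>\<omega>. score_variance n (\<rho> n \<omega>)) \<le> variance_const * K * real n powr (\<alpha> - 1)"
    if n: "1 \<le> n" for n
  proof -
    have "expectation (\<lambda>\<omega>. score_variance n (\<rho> n \<omega>)) \<le> expectation (\<lambda>\<omega>. variance_const / real n * real (card (\<rho> n \<omega>)))"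
      using score_variance_bounds[OF n] by (intro expectation_rho_mono[OF n]) auto
    also have "\<dots> = variance_const / real n * expectation (\<lambda>\<omega>. real (card (\<rho> n \<omega>)))"
      by (rule integral_mult_right_zero)
    also have "\<dots> \<le> variance_const / real n * (K * real n powr \<alpha>)"
      using K(2)[OF n] variance_const_nonneg by (intro mult_left_mono) auto
    also have "\<dots> = variance_const * K * real n powr (\<alpha> - 1)" using n by (simp add: powr_diff)
    finally show ?thesis .
  qed
  then show ?thesis using variance_const_nonneg K(1) by (intro exI[of _ "variance_const * K"]) auto
qed

text \<open>The drift of the score is only known to be \<open>O(1 / n)\<close>. Young's inequality splits the cross term into
  the relative growth \<open>\<alpha> / (4 n)\<close> that \<open>growth_from_recursion\<close> tolerates and a term of order \<open>1 / n\<close>.\<close>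

lemma expectation_score_square:
  "\<exists>C\<ge>0. \<forall>n\<ge>1. expectation (\<lambda>\<omega>. (score (\<rho> n \<omega>))\<^sup>2) \<le> C * real n powr \<alpha>"
proof -
  obtain V where V: "0 \<le> V"
    "\<And>n. 1 \<le> n \<Longrightarrow> expectation (\<lambda>\<omega>. score_variance n (\<rho> n \<omega>)) \<le> V * real n powr (\<alpha> - 1)"
    using expectation_score_variance_le by blast
  define b where "b = c / \<alpha>"
  have b: "0 \<le> b" using c_nonneg alpha_pos by (simp add: b_def)
  define C where "C = 4 * b\<^sup>2 / \<alpha> + V"
  have C: "0 \<le> C" using V alpha_pos by (simp add: C_def)
  show ?thesis
  proof (rule growth_from_recursion[OF alpha_pos _ C])
    fix n :: nat assume n: "1 \<le> n"
    define x where "x = real n"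
    have x: "1 \<le> x" using n by (simp add: x_def)
    have "expectation (\<lambda>\<omega>. (score (\<rho> (Suc n) \<omega>))\<^sup>2)
       \<le> expectation (\<lambda>\<omega>. (1 + \<alpha> / (4 * x)) * (score (\<rho> n \<omega>))\<^sup>2 + (4 * b\<^sup>2 / \<alpha> / x + score_variance n (\<rho> n \<omega>)))"
    proof (rule expectation_step_le[where m = 1 and \<phi> = "\<lambda>_ _ \<pi>. (score \<pi>)\<^sup>2" and
         \<psi> = "\<lambda>_ \<pi>. (1 + \<alpha> / (4 * x)) * (score \<pi>)\<^sup>2 + (4 * b\<^sup>2 / \<alpha> / x + score_variance n \<pi>)"])
      fix \<pi> assume pa: "partition_of n \<pi>"
      define Y where "Y = score \<pi>"
      define \<mu> where "\<mu> = (\<Sum>s\<in>slots \<pi>. p n \<pi> s * score_increment s)"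
      have mu: "\<bar>\<mu>\<bar> \<le> b / x" using score_drift[OF n pa] by (simp add: \<mu>_def b_def x_def)
      have sq: "(\<Sum>s\<in>slots \<pi>. p n \<pi> s * (score (extend_partition n \<pi> s))\<^sup>2) = Y\<^sup>2 + 2 * Y * \<mu> + score_variance n \<pi>"
        unfolding \<mu>_def score_variance_def Y_def using score_extend[OF pa] by (intro sum_p_square[OF n pa])
      have "2 * Y * \<mu> \<le> 2 * \<bar>Y\<bar> * (b / x)"
      proof -
        have "2 * Y * \<mu> \<le> \<bar>2 * Y\<bar> * \<bar>\<mu>\<bar>" by (metis abs_ge_self abs_mult)
        also have "\<dots> \<le> \<bar>2 * Y\<bar> * (b / x)" by (intro mult_left_mono mu) auto
        finally show ?thesis by simp
      qed
      also have "\<dots> \<le> (\<alpha> / 4 * Y\<^sup>2 + 4 * b\<^sup>2 / \<alpha>) / x"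
      proof -
        have "0 \<le> (\<alpha> * \<bar>Y\<bar> - 4 * b)\<^sup>2 / (4 * \<alpha>)" using alpha_pos by simp
        also have "\<dots> = \<alpha> / 4 * Y\<^sup>2 - 2 * \<bar>Y\<bar> * b + 4 * b\<^sup>2 / \<alpha>"
          using alpha_pos by (simp add: power2_eq_square field_simps)
        finally have "2 * \<bar>Y\<bar> * b \<le> \<alpha> / 4 * Y\<^sup>2 + 4 * b\<^sup>2 / \<alpha>" by simp
        then show ?thesis using divide_right_mono[of _ _ x] x by simp
      qed
      also have "\<dots> = \<alpha> / (4 * x) * Y\<^sup>2 + 4 * b\<^sup>2 / \<alpha> / x" by (simp add: add_divide_distrib)
      finally show "(\<Sum>s\<in>slots \<pi>. p n \<pi> s * (score (extend_partition n \<pi> s))\<^sup>2)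
         \<le> (1 + \<alpha> / (4 * x)) * (score \<pi>)\<^sup>2 + (4 * b\<^sup>2 / \<alpha> / x + score_variance n \<pi>)"
        unfolding sq Y_def[symmetric] by (simp add: algebra_simps)
    qed (use n in auto)
    also have "\<dots> = (1 + \<alpha> / (4 * x)) * expectation (\<lambda>\<omega>. (score (\<rho> n \<omega>))\<^sup>2) +
        (4 * b\<^sup>2 / \<alpha> / x + expectation (\<lambda>\<omega>. score_variance n (\<rho> n \<omega>)))"
    proof -
      have "integrable M (\<lambda>\<omega>. (score (\<rho> n \<omega>))\<^sup>2)" "integrable M (\<lambda>\<omega>. score_variance n (\<rho> n \<omega>))"
        using n by (auto intro: integrable_rho)
      then show ?thesis by (simp add: prob_space)
    qed
    also have "\<dots> \<le> (1 + \<alpha> / (4 * x)) * expectation (\<lambda>\<omega>. (score (\<rho> n \<omega>))\<^sup>2) +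
        (4 * b\<^sup>2 / \<alpha> * x powr (\<alpha> - 1) + V * x powr (\<alpha> - 1))"
    proof (intro add_left_mono add_mono)
      have "1 / x = x powr (-1)" using x by (simp add: powr_minus_divide)
      also have "\<dots> \<le> x powr (\<alpha> - 1)" using x alpha_pos by (intro powr_mono) auto
      finally show "4 * b\<^sup>2 / \<alpha> / x \<le> 4 * b\<^sup>2 / \<alpha> * x powr (\<alpha> - 1)"
        using mult_left_mono[of "1 / x" "x powr (\<alpha> - 1)" "4 * b\<^sup>2 / \<alpha>"] alpha_pos by simp
      show "expectation (\<lambda>\<omega>. score_variance n (\<rho> n \<omega>)) \<le> V * x powr (\<alpha> - 1)"
        using V(2)[OF n] by (simp add: x_def)
    qed
    finally show "expectation (\<lambda>\<omega>. (score (\<rho> (Suc n) \<omega>))\<^sup>2)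
       \<le> (1 + \<alpha> / (4 * real n)) * expectation (\<lambda>\<omega>. (score (\<rho> n \<omega>))\<^sup>2) + C * real n powr (\<alpha> - 1)"
      by (simp add: C_def x_def algebra_simps)
  qed (use alpha_less_1 in auto)
qed

section \<open>Laws of large numbers for the block sizes\<close>

text \<open>Summation by parts over the block size expresses the statistic by the numbers of blocks with more
  than \<open>i\<close> elements. Finitely many \<open>i\<close> are treated by \<open>expectation_tail_deviation_square\<close>; the others
  contribute at most the number of blocks times a tail of the series of \<open>\<bar>b i\<bar>\<close>.\<close>

lemma block_sum_lln:
  fixes b :: "nat \<Rightarrow> real"
  assumes b: "summable (\<lambda>i. \<bar>b i\<bar>)"
  shows "(\<lambda>n. expectation (\<lambda>\<omega>. \<bar>block_sum (\<lambda>j. \<Sum>i<j. b i) (\<rho> n \<omega>)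
       - (\<Sum>i. b i * sibuya_tail i) * real (card (\<rho> n \<omega>))\<bar>) / real n powr \<alpha>) \<longlonglongrightarrow> 0"
proof -
  define S where "S = (\<Sum>i. b i * sibuya_tail i)"
  define F where "F \<pi> = block_sum (\<lambda>j. \<Sum>i<j. b i) \<pi> - S * real (card \<pi>)" for \<pi>
  define T where "T J = (\<Sum>i. \<bar>b (i + J)\<bar>)" for J
  obtain K where K: "0 \<le> K"
    "\<And>n. 1 \<le> n \<Longrightarrow> expectation (\<lambda>\<omega>. real (card (\<rho> n \<omega>))) \<le> K * real n powr \<alpha>"
    using expectation_card_le by blast
  have "\<exists>D. \<forall>i. 0 \<le> D i \<and> (\<forall>n\<ge>1. expectation (\<lambda>\<omega>. (tail_deviation i (\<rho> n \<omega>))\<^sup>2) \<le> D i * real n powr \<alpha>)"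
    using expectation_tail_deviation_square by (intro choice) blast
  then obtain D where D: "\<And>i. 0 \<le> D i"
    "\<And>i n. 1 \<le> n \<Longrightarrow> expectation (\<lambda>\<omega>. (tail_deviation i (\<rho> n \<omega>))\<^sup>2) \<le> D i * real n powr \<alpha>" by blast
  have bsib: "summable (\<lambda>i. b i * sibuya_tail i)"
    using sibuya_tail_bounds by (intro summable_comparison_test'[OF b, of 0])
      (auto simp: abs_mult intro!: mult_left_le)
  have bint: "summable (\<lambda>i. b i * (if i < j then 1 else 0))" for j :: nat
    by (intro summable_comparison_test'[OF b, of 0]) auto
  have split: "\<bar>((\<Sum>i<j. b i) - S) - (\<Sum>i<J. b i * ((if i < j then 1 else 0) - sibuya_tail i))\<bar> \<le> T J" for j J
  proof -
    let ?g = "\<lambda>i. b i * ((if i < j then 1 else 0) - sibuya_tail i)"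
    have gs: "summable ?g" using summable_diff[OF bint bsib] by (simp add: right_diff_distrib)
    have gle: "\<bar>?g i\<bar> \<le> \<bar>b i\<bar>" for i
      unfolding abs_mult using sibuya_tail_bounds[of i] by (intro mult_left_le) auto
    have "(\<Sum>i. b i * (if i < j then 1 else 0)) = (\<Sum>i<j. b i)"
      by (subst suminf_finite[of "{..<j}"]) auto
    then have "(\<Sum>i<j. b i) - S = (\<Sum>i. ?g i)"
      unfolding S_def using suminf_diff[OF bint[of j] bsib] by (simp only: right_diff_distrib)
    also have "\<dots> - (\<Sum>i<J. ?g i) = (\<Sum>i. ?g (i + J))"
      using suminf_minus_initial_segment[OF gs, of J] by simp
    also have "\<bar>\<dots>\<bar> \<le> (\<Sum>i. \<bar>?g (i + J)\<bar>)"
    proof (rule summable_rabs)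
      show "summable (\<lambda>i. \<bar>?g (i + J)\<bar>)"
        using gle by (intro summable_comparison_test'[OF summable_ignore_initial_segment[OF b, of J], of 0]) auto
    qed
    also have "\<dots> \<le> T J" unfolding T_def
    proof (rule suminf_le)
      show "summable (\<lambda>i. \<bar>?g (i + J)\<bar>)"
        using gle by (intro summable_comparison_test'[OF summable_ignore_initial_segment[OF b, of J], of 0]) auto
    qed (use gle summable_ignore_initial_segment[OF b, of J] in auto)
    finally show ?thesis .
  qed
  have point: "\<bar>F \<pi>\<bar> \<le> (\<Sum>i<J. \<bar>b i\<bar> * \<bar>tail_deviation i \<pi>\<bar>) + T J * real (card \<pi>)" for \<pi> J
  proof -
    have "F \<pi> = (\<Sum>U\<in>\<pi>. (\<Sum>i<card U. b i) - S)"
      by (simp add: F_def block_sum_def sum_subtractf)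
    also have "\<dots> = (\<Sum>U\<in>\<pi>. \<Sum>i<J. b i * ((if i < card U then 1 else 0) - sibuya_tail i))
       + (\<Sum>U\<in>\<pi>. ((\<Sum>i<card U. b i) - S) - (\<Sum>i<J. b i * ((if i < card U then 1 else 0) - sibuya_tail i)))"
      by (simp flip: sum.distrib)
    also have "(\<Sum>U\<in>\<pi>. \<Sum>i<J. b i * ((if i < card U then 1 else 0) - sibuya_tail i)) = (\<Sum>i<J. b i * tail_deviation i \<pi>)"
      unfolding tail_deviation_def block_sum_def sum_distrib_left by (rule sum.swap)
    finally have "\<bar>F \<pi>\<bar> \<le> \<bar>\<Sum>i<J. b i * tail_deviation i \<pi>\<bar>
       + \<bar>\<Sum>U\<in>\<pi>. ((\<Sum>i<card U. b i) - S) - (\<Sum>i<J. b i * ((if i < card U then 1 else 0) - sibuya_tail i))\<bar>"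
      by simp
    also have "\<dots> \<le> (\<Sum>i<J. \<bar>b i * tail_deviation i \<pi>\<bar>) + (\<Sum>U\<in>\<pi>. T J)"
      by (intro add_mono sum_abs order_trans[OF sum_abs] sum_mono split)
    finally show ?thesis by (simp add: abs_mult mult.commute)
  qed
  have mean: "expectation (\<lambda>\<omega>. \<bar>F (\<rho> n \<omega>)\<bar>) / real n powr \<alpha>
      \<le> (\<Sum>i<J. \<bar>b i\<bar> * (1 + D i)) * real n powr (-\<alpha> / 2) + T J * K" if n: "1 \<le> n" for n J
  proof -
    define r where "r = real n powr (\<alpha> / 2)"
    have r: "0 < r" "r\<^sup>2 = real n powr \<alpha>" "r / real n powr \<alpha> = real n powr (-\<alpha> / 2)"
      using n by (auto simp: r_def power2_eq_square simp flip: powr_add powr_diff)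
    have dev: "expectation (\<lambda>\<omega>. \<bar>tail_deviation i (\<rho> n \<omega>)\<bar>) \<le> (1 + D i) * r" for i
      using expectation_abs_le[of n n r "\<lambda>_. tail_deviation i" "D i"] D(2)[OF n, of i] n r by simp
    have T0: "0 \<le> T J" unfolding T_def using summable_ignore_initial_segment[OF b, of J] by (intro suminf_nonneg) auto
    have "expectation (\<lambda>\<omega>. \<bar>F (\<rho> n \<omega>)\<bar>)
      \<le> expectation (\<lambda>\<omega>. (\<Sum>i<J. \<bar>b i\<bar> * \<bar>tail_deviation i (\<rho> n \<omega>)\<bar>) + T J * real (card (\<rho> n \<omega>)))"
      by (rule expectation_rho_mono[OF n point])
    also have "\<dots> = (\<Sum>i<J. \<bar>b i\<bar> * expectation (\<lambda>\<omega>. \<bar>tail_deviation i (\<rho> n \<omega>)\<bar>)) + T J * expectation (\<lambda>\<omega>. real (card (\<rho> n \<omega>)))"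
    proof -
      have "integrable M (\<lambda>\<omega>. \<bar>tail_deviation i (\<rho> n \<omega>)\<bar>)" for i by (rule integrable_rho[OF n])
      moreover have "integrable M (\<lambda>\<omega>. real (card (\<rho> n \<omega>)))" by (rule integrable_rho[OF n])
      ultimately show ?thesis by simp
    qed
    also have "\<dots> \<le> (\<Sum>i<J. \<bar>b i\<bar> * ((1 + D i) * r)) + T J * (K * real n powr \<alpha>)"
      using dev K(2)[OF n] T0 by (intro add_mono sum_mono mult_left_mono) auto
    also have "\<dots> = (\<Sum>i<J. \<bar>b i\<bar> * (1 + D i)) * r + T J * K * real n powr \<alpha>"
      by (simp add: sum_distrib_right mult.assoc)
    finally have "expectation (\<lambda>\<omega>. \<bar>F (\<rho> n \<omega>)\<bar>) / real n powr \<alpha>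
        \<le> ((\<Sum>i<J. \<bar>b i\<bar> * (1 + D i)) * r + T J * K * real n powr \<alpha>) / real n powr \<alpha>"
      by (intro divide_right_mono) auto
    also have "\<dots> = (\<Sum>i<J. \<bar>b i\<bar> * (1 + D i)) * (r / real n powr \<alpha>) + T J * K"
      using n by (simp add: add_divide_distrib)
    finally show ?thesis unfolding r(3) .
  qed
  have "(\<lambda>n. expectation (\<lambda>\<omega>. \<bar>F (\<rho> n \<omega>)\<bar>) / real n powr \<alpha>) \<longlonglongrightarrow> 0"
  proof (rule LIMSEQ_I)
    fix e :: real assume e: "0 < e"
    have "T \<longlonglongrightarrow> 0" unfolding T_def by (rule suminf_exist_split2[OF b])
    then have "(\<lambda>J. T J * K) \<longlonglongrightarrow> 0 * K" by (intro tendsto_intros)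
    then have "\<forall>\<^sub>F J in sequentially. T J * K < e / 2" using e by (intro order_tendstoD) auto
    then obtain J where J: "T J * K < e / 2" by (auto simp: eventually_sequentially)
    have "(\<lambda>n. real n powr (-\<alpha> / 2)) \<longlonglongrightarrow> 0"
      using alpha_pos by (intro tendsto_neg_powr filterlim_real_sequentially) auto
    then have "(\<lambda>n. (\<Sum>i<J. \<bar>b i\<bar> * (1 + D i)) * real n powr (-\<alpha> / 2)) \<longlonglongrightarrow> 0"
      by (rule tendsto_mult_right_zero)
    then have "\<forall>\<^sub>F n in sequentially. (\<Sum>i<J. \<bar>b i\<bar> * (1 + D i)) * real n powr (-\<alpha> / 2) < e / 2"
      using e by (intro order_tendstoD) auto
    then obtain N where N: "\<And>n. N \<le> n \<Longrightarrow> (\<Sum>i<J. \<bar>b i\<bar> * (1 + D i)) * real n powr (-\<alpha> / 2) < e / 2"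
      by (auto simp: eventually_sequentially)
    show "\<exists>no. \<forall>n\<ge>no. norm (expectation (\<lambda>\<omega>. \<bar>F (\<rho> n \<omega>)\<bar>) / real n powr \<alpha> - 0) < e"
    proof (intro exI[of _ "max N 1"] allI impI)
      fix n assume "max N 1 \<le> n"
      then show "norm (expectation (\<lambda>\<omega>. \<bar>F (\<rho> n \<omega>)\<bar>) / real n powr \<alpha> - 0) < e"
        using mean[of n J] N[of n] J by simp
    qed
  qed
  then show ?thesis by (simp add: F_def S_def)
qed

text \<open>The limit of the information per block.\<close>

definition fisher :: real where
  "fisher = (\<Sum>i. 1 / (real i - \<alpha>)\<^sup>2 * sibuya_tail i)"

text \<open>Minus the derivative of the score with respect to the parameter.\<close>

definition information :: "nat set set \<Rightarrow> real" where
  "information \<pi> = block_sum (\<lambda>j. \<Sum>i<j. 1 / (real i - \<alpha>)\<^sup>2) \<pi> - 1 / \<alpha>\<^sup>2"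

lemma inverse_square_shift_le:
  assumes "1 \<le> i"
  shows "1 / (real i - \<alpha>)\<^sup>2 \<le> 1 / (1 - \<alpha>)\<^sup>2 * (1 / (real i)\<^sup>2)"
proof -
  have "(1 - \<alpha>) * real i \<le> real i - \<alpha>"
    using assms alpha_pos mult_left_mono[of 1 "real i" \<alpha>] by (simp add: algebra_simps)
  then have "((1 - \<alpha>) * real i)\<^sup>2 \<le> (real i - \<alpha>)\<^sup>2" using alpha_less_1 by (intro power_mono) auto
  then have "1 / (real i - \<alpha>)\<^sup>2 \<le> 1 / ((1 - \<alpha>) * real i)\<^sup>2"
    using assms alpha_less_1 by (intro divide_left_mono) auto
  then show ?thesis by (simp add: power_mult_distrib)
qed

lemma summable_inverse_square_shift: "summable (\<lambda>i. 1 / (real i - \<alpha>)\<^sup>2)"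
proof -
  have "summable (\<lambda>i. 1 / (1 - \<alpha>)\<^sup>2 * (1 / (real i)\<^sup>2))"
    using inverse_power_summable[of 2, where 'a = real] by (intro summable_mult) (simp add: field_simps)
  then show ?thesis
    by (rule summable_comparison_test'[where N = 1]) (use inverse_square_shift_le in auto)
qed

lemma fisher_pos: "0 < fisher"
proof -
  have s: "summable (\<lambda>i. 1 / (real i - \<alpha>)\<^sup>2 * sibuya_tail i)"
    using sibuya_tail_bounds by (intro summable_comparison_test'[OF summable_inverse_square_shift, of 0])
      (auto intro!: divide_right_mono)
  have "0 < 1 / (real 0 - \<alpha>)\<^sup>2 * sibuya_tail 0" using alpha_pos by simp
  then show ?thesis unfolding fisher_def
    using sibuya_tail_bounds by (intro suminf_pos2[OF s, of 0]) auto
qed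

lemma inverse_sizes_eq:
  assumes "partition_of n \<pi>"
  shows "inverse_sizes \<pi> = block_sum (\<lambda>j. \<Sum>i<j. 1 / (real (Suc i) - \<alpha>) - 1 / (real i - \<alpha>)) \<pi> - real (card \<pi>) / \<alpha>"
proof -
  have "block_sum (\<lambda>j. \<Sum>i<j. 1 / (real (Suc i) - \<alpha>) - 1 / (real i - \<alpha>)) \<pi> = (\<Sum>U\<in>\<pi>. 1 / (real (card U) - \<alpha>) + 1 / \<alpha>)"
    unfolding block_sum_def by (subst sum_lessThan_telescope) simp
  then show ?thesis by (simp add: inverse_sizes_def block_sum_def sum.distrib)
qed

text \<open>The information identity for this model: the rate of the conditional variance of the score and the
  rate of the information agree. By partial summation, which rests on \<open>sibuya_tail_Suc\<close>, the partial
  sums of the two series differ by a boundary term that tends to zero.\<close>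

lemma fisher_telescoped:
  defines "b \<equiv> \<lambda>i. 1 / (real (Suc i) - \<alpha>) - 1 / (real i - \<alpha>)"
  shows "summable (\<lambda>i. \<bar>b i\<bar>)" and "(\<Sum>i. b i * sibuya_tail i) = \<alpha> * fisher"
proof -
  have b_eq: "b i = - 1 / ((real i - \<alpha>) * (real (Suc i) - \<alpha>))" if "1 \<le> i" for i
  proof -
    have "real i - \<alpha> \<noteq> 0" "real (Suc i) - \<alpha> \<noteq> 0" using that alpha_less_1 by auto
    then show ?thesis by (simp add: b_def field_simps)
  qed
  have "\<bar>b i\<bar> \<le> 1 / (real i - \<alpha>)\<^sup>2" if i: "1 \<le> i" for i
  proof -
    have "0 < real i - \<alpha>" using i alpha_less_1 by auto
    then show ?thesis unfolding b_eq[OF i] power2_eq_square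
      by (simp add: abs_mult) (intro divide_left_mono mult_left_mono mult_pos_pos, auto)
  qed
  then show sb: "summable (\<lambda>i. \<bar>b i\<bar>)"
    by (intro summable_comparison_test'[OF summable_inverse_square_shift, of 1]) auto
  have bsib: "summable (\<lambda>i. b i * sibuya_tail i)"
    using sibuya_tail_bounds by (intro summable_comparison_test'[OF sb, of 0])
      (auto simp: abs_mult intro!: mult_left_le)
  have fs: "summable (\<lambda>i. 1 / (real i - \<alpha>)\<^sup>2 * sibuya_tail i)"
    using sibuya_tail_bounds by (intro summable_comparison_test'[OF summable_inverse_square_shift, of 0])
      (auto intro!: divide_right_mono)
  have partial: "(\<Sum>i<Suc J. b i * sibuya_tail i)
     = \<alpha> * (\<Sum>i<Suc J. 1 / (real i - \<alpha>)\<^sup>2 * sibuya_tail i) + sibuya_tail J / (real (Suc J) - \<alpha>)" for J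
  proof (induction J)
    case 0
    show ?case using alpha_pos by (simp add: b_def power2_eq_square)
  next
    case (Suc J)
    define s where "s = sibuya_tail (Suc J)"
    define y where "y = real (Suc J) - \<alpha>"
    have y: "0 < y" using alpha_less_1 by (simp add: y_def)
    have s0: "sibuya_tail J = real (Suc J) * s / y"
      using sibuya_tail_Suc[of J] y by (simp add: s_def y_def field_simps)
    have "b (Suc J) * s + sibuya_tail J / y = \<alpha> * (1 / y\<^sup>2 * s) + s / (y + 1)"
    proof -
      have "b (Suc J) = 1 / (y + 1) - 1 / y" by (simp add: b_def y_def algebra_simps)
      moreover have "real (Suc J) = y + \<alpha>" by (simp add: y_def)
      ultimately show ?thesis unfolding s0 using y by (simp add: power2_eq_square divide_simps) (simp add: algebra_simps)
    qed
    moreover have "real (Suc (Suc J)) - \<alpha> = y + 1" by (simp add: y_def)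
    ultimately show ?case using Suc.IH
      unfolding sum.lessThan_Suc[of _ "Suc J"] s_def[symmetric] y_def[symmetric]
      by (simp only: distrib_left)
  qed
  have "(\<lambda>J. \<Sum>i<Suc J. b i * sibuya_tail i) \<longlonglongrightarrow> (\<Sum>i. b i * sibuya_tail i)"
    using summable_LIMSEQ[OF bsib] by (rule LIMSEQ_Suc)
  moreover have "(\<lambda>J. \<alpha> * (\<Sum>i<Suc J. 1 / (real i - \<alpha>)\<^sup>2 * sibuya_tail i) + sibuya_tail J / (real (Suc J) - \<alpha>))
      \<longlonglongrightarrow> \<alpha> * fisher + 0"
  proof (intro tendsto_add tendsto_mult tendsto_const)
    show "(\<lambda>J. \<Sum>i<Suc J. 1 / (real i - \<alpha>)\<^sup>2 * sibuya_tail i) \<longlonglongrightarrow> fisher"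
      unfolding fisher_def using summable_LIMSEQ[OF fs] by (rule LIMSEQ_Suc)
    have lim: "(\<lambda>J. 1 / (real (Suc J) - \<alpha>)) \<longlonglongrightarrow> 0" by real_asymp
    show "(\<lambda>J. sibuya_tail J / (real (Suc J) - \<alpha>)) \<longlonglongrightarrow> 0"
    proof (rule tendsto_sandwich[OF _ _ tendsto_const lim])
      show "\<forall>\<^sub>F J in sequentially. 0 \<le> sibuya_tail J / (real (Suc J) - \<alpha>)"
        using sibuya_tail_bounds alpha_less_1 by (intro always_eventually allI divide_nonneg_pos) auto
      show "\<forall>\<^sub>F J in sequentially. sibuya_tail J / (real (Suc J) - \<alpha>) \<le> 1 / (real (Suc J) - \<alpha>)"
        using sibuya_tail_bounds alpha_less_1 by (intro always_eventually allI divide_right_mono) auto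
    qed
  qed
  ultimately show "(\<Sum>i. b i * sibuya_tail i) = \<alpha> * fisher"
    unfolding partial using LIMSEQ_unique by fastforce
qed

lemma inverse_sizes_lln:
  "(\<lambda>n. expectation (\<lambda>\<omega>. \<bar>inverse_sizes (\<rho> n \<omega>) - (\<alpha> * fisher - 1 / \<alpha>) * real (card (\<rho> n \<omega>))\<bar>) / real n powr \<alpha>) \<longlonglongrightarrow> 0"
proof -
  have "\<forall>\<^sub>F n in sequentially. expectation (\<lambda>\<omega>. \<bar>block_sum (\<lambda>j. \<Sum>i<j. 1 / (real (Suc i) - \<alpha>) - 1 / (real i - \<alpha>)) (\<rho> n \<omega>)
       - \<alpha> * fisher * real (card (\<rho> n \<omega>))\<bar>) / real n powr \<alpha>
    = expectation (\<lambda>\<omega>. \<bar>inverse_sizes (\<rho> n \<omega>) - (\<alpha> * fisher - 1 / \<alpha>) * real (card (\<rho> n \<omega>))\<bar>) / real n powr \<alpha>"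
    using eventually_ge_at_top[of 1]
  proof eventually_elim
    case (elim n)
    have "expectation (\<lambda>\<omega>. \<bar>block_sum (\<lambda>j. \<Sum>i<j. 1 / (real (Suc i) - \<alpha>) - 1 / (real i - \<alpha>)) (\<rho> n \<omega>)
       - \<alpha> * fisher * real (card (\<rho> n \<omega>))\<bar>)
      = expectation (\<lambda>\<omega>. \<bar>inverse_sizes (\<rho> n \<omega>) - (\<alpha> * fisher - 1 / \<alpha>) * real (card (\<rho> n \<omega>))\<bar>)"
      using inverse_sizes_eq[OF rho_partition[OF elim]]
      by (intro Bochner_Integration.integral_cong) (auto simp: algebra_simps)
    then show ?case by simp
  qed
  then show ?thesis
    using block_sum_lln[OF fisher_telescoped(1)] unfolding fisher_telescoped(2)
    by (rule Lim_transform_eventually[rotated])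
qed

lemma information_lln:
  "(\<lambda>n. expectation (\<lambda>\<omega>. \<bar>information (\<rho> n \<omega>) - fisher * real (card (\<rho> n \<omega>))\<bar>) / real n powr \<alpha>) \<longlonglongrightarrow> 0"
proof -
  define F where "F \<pi> = block_sum (\<lambda>j. \<Sum>i<j. 1 / (real i - \<alpha>)\<^sup>2) \<pi> - fisher * real (card \<pi>)" for \<pi>
  have "(\<lambda>n. expectation (\<lambda>\<omega>. \<bar>F (\<rho> n \<omega>)\<bar>) / real n powr \<alpha>) \<longlonglongrightarrow> 0"
    using block_sum_lln[of "\<lambda>i. 1 / (real i - \<alpha>)\<^sup>2"] summable_inverse_square_shift
    by (simp add: fisher_def F_def)
  moreover have "(\<lambda>n. 1 / \<alpha>\<^sup>2 * real n powr (-\<alpha>)) \<longlonglongrightarrow> 0"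
    using alpha_pos by (intro tendsto_mult_right_zero tendsto_neg_powr filterlim_real_sequentially) auto
  ultimately have lim: "(\<lambda>n. expectation (\<lambda>\<omega>. \<bar>F (\<rho> n \<omega>)\<bar>) / real n powr \<alpha> + 1 / \<alpha>\<^sup>2 * real n powr (-\<alpha>)) \<longlonglongrightarrow> 0"
    using tendsto_add by fastforce
  show ?thesis
  proof (rule tendsto_sandwich[OF _ _ tendsto_const lim])
    show "\<forall>\<^sub>F n in sequentially. 0 \<le> expectation (\<lambda>\<omega>. \<bar>information (\<rho> n \<omega>) - fisher * real (card (\<rho> n \<omega>))\<bar>) / real n powr \<alpha>"
      by (intro always_eventually allI divide_nonneg_nonneg integral_nonneg) auto
    show "\<forall>\<^sub>F n in sequentially. expectation (\<lambda>\<omega>. \<bar>information (\<rho> n \<omega>) - fisher * real (card (\<rho> n \<omega>))\<bar>) / real n powr \<alpha>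
       \<le> expectation (\<lambda>\<omega>. \<bar>F (\<rho> n \<omega>)\<bar>) / real n powr \<alpha> + 1 / \<alpha>\<^sup>2 * real n powr (-\<alpha>)"
      using eventually_ge_at_top[of 1]
    proof eventually_elim
      case (elim n)
      have "expectation (\<lambda>\<omega>. \<bar>information (\<rho> n \<omega>) - fisher * real (card (\<rho> n \<omega>))\<bar>)
        \<le> expectation (\<lambda>\<omega>. \<bar>F (\<rho> n \<omega>)\<bar> + 1 / \<alpha>\<^sup>2)"
        using abs_triangle_ineq4[of "F _" "1 / \<alpha>\<^sup>2"]
        by (intro expectation_rho_mono[OF elim]) (simp add: F_def information_def algebra_simps)
      also have "\<dots> = expectation (\<lambda>\<omega>. \<bar>F (\<rho> n \<omega>)\<bar>) + 1 / \<alpha>\<^sup>2"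
        using integrable_rho[OF elim, of "\<lambda>\<pi>. \<bar>F \<pi>\<bar>"] by (simp add: prob_space)
      finally have "expectation (\<lambda>\<omega>. \<bar>information (\<rho> n \<omega>) - fisher * real (card (\<rho> n \<omega>))\<bar>) / real n powr \<alpha>
         \<le> (expectation (\<lambda>\<omega>. \<bar>F (\<rho> n \<omega>)\<bar>) + 1 / \<alpha>\<^sup>2) / real n powr \<alpha>"
        by (intro divide_right_mono) auto
      then show ?case by (simp add: add_divide_distrib powr_minus_divide)
    qed
  qed
qed

text \<open>By \<open>score_variance_eq\<close> the new block contributes \<open>k / (\<alpha> n)\<close> to the conditional variance, and by
  \<open>inverse_sizes_lln\<close> the old blocks contribute \<open>(\<alpha> I - 1 / \<alpha>) k / n\<close>.\<close>

lemma score_variance_lln: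
  "(\<lambda>n. expectation (\<lambda>\<omega>. \<bar>score_variance n (\<rho> n \<omega>) - \<alpha> * fisher * real (card (\<rho> n \<omega>)) / real n\<bar>) / real n powr (\<alpha> - 1)) \<longlonglongrightarrow> 0"
proof -
  define F where "F \<pi> = inverse_sizes \<pi> - (\<alpha> * fisher - 1 / \<alpha>) * real (card \<pi>)" for \<pi>
  define B where "B = c / \<alpha>\<^sup>2 + c / (1 - \<alpha>)"
  have point: "\<bar>score_variance n \<pi> - \<alpha> * fisher * real (card \<pi>) / real n\<bar> \<le> (\<bar>F \<pi>\<bar> + B) / real n"
    if n: "1 \<le> n" and pa: "partition_of n \<pi>" for n \<pi>
  proof -
    define k where "k = real (card \<pi>)"
    define x where "x = real n"
    have x: "1 \<le> x" "k \<le> x" using n card_partition_le[OF pa] by (auto simp: x_def k_def)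
    have "score_variance n \<pi> - \<alpha> * fisher * k / x
      = (p n \<pi> None - \<alpha> * k / x) / \<alpha>\<^sup>2 + ((w n \<pi> - 1 / x) * inverse_sizes \<pi> + F \<pi> / x)"
      using x alpha_pos unfolding score_variance_eq[OF n pa] F_def k_def[symmetric]
      by (simp add: power2_eq_square divide_simps) (simp add: algebra_simps)
    also have "\<bar>\<dots>\<bar> \<le> c / x / \<alpha>\<^sup>2 + (c / x\<^sup>2 * (x / (1 - \<alpha>)) + \<bar>F \<pi>\<bar> / x)"
    proof (intro order_trans[OF abs_triangle_ineq] add_mono)
      show "\<bar>(p n \<pi> None - \<alpha> * k / x) / \<alpha>\<^sup>2\<bar> \<le> c / x / \<alpha>\<^sup>2"
        using divide_right_mono[OF p_None_approx[OF n pa], of "\<alpha>\<^sup>2"] by (simp add: k_def x_def abs_divide)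
      have "k / (1 - \<alpha>) \<le> x / (1 - \<alpha>)" using x alpha_less_1 by (intro divide_right_mono) auto
      then show "\<bar>(w n \<pi> - 1 / x) * inverse_sizes \<pi>\<bar> \<le> c / x\<^sup>2 * (x / (1 - \<alpha>))"
        unfolding abs_mult using w_approx[OF n pa] inverse_sizes_bounds[OF pa]
        by (intro mult_mono) (auto simp: k_def x_def)
    qed (use x in auto)
    also have "\<dots> = (\<bar>F \<pi>\<bar> + B) / x"
      using x by (simp add: B_def power2_eq_square add_divide_distrib mult.commute)
    finally show ?thesis by (simp add: k_def x_def)
  qed
  have "(\<lambda>n. expectation (\<lambda>\<omega>. \<bar>F (\<rho> n \<omega>)\<bar>) / real n powr \<alpha>) \<longlonglongrightarrow> 0"
    using inverse_sizes_lln by (simp add: F_def)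
  moreover have "(\<lambda>n. B * real n powr (-\<alpha>)) \<longlonglongrightarrow> 0"
    using alpha_pos by (intro tendsto_mult_right_zero tendsto_neg_powr filterlim_real_sequentially) auto
  ultimately have lim: "(\<lambda>n. expectation (\<lambda>\<omega>. \<bar>F (\<rho> n \<omega>)\<bar>) / real n powr \<alpha> + B * real n powr (-\<alpha>)) \<longlonglongrightarrow> 0"
    using tendsto_add by fastforce
  show ?thesis
  proof (rule tendsto_sandwich[OF _ _ tendsto_const lim])
    show "\<forall>\<^sub>F n in sequentially. 0 \<le> expectation (\<lambda>\<omega>. \<bar>score_variance n (\<rho> n \<omega>) - \<alpha> * fisher * real (card (\<rho> n \<omega>)) / real n\<bar>) / real n powr (\<alpha> - 1)"
      by (intro always_eventually allI divide_nonneg_nonneg integral_nonneg) auto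
    show "\<forall>\<^sub>F n in sequentially. expectation (\<lambda>\<omega>. \<bar>score_variance n (\<rho> n \<omega>) - \<alpha> * fisher * real (card (\<rho> n \<omega>)) / real n\<bar>) / real n powr (\<alpha> - 1)
       \<le> expectation (\<lambda>\<omega>. \<bar>F (\<rho> n \<omega>)\<bar>) / real n powr \<alpha> + B * real n powr (-\<alpha>)"
      using eventually_ge_at_top[of 1]
    proof eventually_elim
      case (elim n)
      have "expectation (\<lambda>\<omega>. \<bar>score_variance n (\<rho> n \<omega>) - \<alpha> * fisher * real (card (\<rho> n \<omega>)) / real n\<bar>)
        \<le> expectation (\<lambda>\<omega>. (\<bar>F (\<rho> n \<omega>)\<bar> + B) / real n)"
        by (intro expectation_rho_mono[OF elim] point[OF elim])
      also have "\<dots> = (expectation (\<lambda>\<omega>. \<bar>F (\<rho> n \<omega>)\<bar>) + B) / real n"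
        using integrable_rho[OF elim, of "\<lambda>\<pi>. \<bar>F \<pi>\<bar>"] by (simp add: prob_space)
      finally have "expectation (\<lambda>\<omega>. \<bar>score_variance n (\<rho> n \<omega>) - \<alpha> * fisher * real (card (\<rho> n \<omega>)) / real n\<bar>) / real n powr (\<alpha> - 1)
         \<le> (expectation (\<lambda>\<omega>. \<bar>F (\<rho> n \<omega>)\<bar>) + B) / real n / real n powr (\<alpha> - 1)"
        by (intro divide_right_mono) auto
      also have "\<dots> = (expectation (\<lambda>\<omega>. \<bar>F (\<rho> n \<omega>)\<bar>) + B) / real n powr \<alpha>"
        using elim by (simp add: powr_diff)
      finally show ?case by (simp add: add_divide_distrib powr_minus_divide)
    qed
  qed
qed

end

section \<open>Sums of powers\<close>

lemma sum_powr_le: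
  assumes s: "0 < s" "s \<le> 1" and "1 \<le> n"
  shows "(\<Sum>j\<in>{1..<n}. real j powr (s - 1)) \<le> 2 / s * real n powr s"
  using \<open>1 \<le> n\<close>
proof (induction n rule: dec_induct)
  case base
  then show ?case using s by simp
next
  case (step n)
  have n: "1 \<le> real n" using step by simp
  have "real n powr (s - 1) \<le> 2 * (real n + 1) powr (s - 1)"
    using powr_succ_ge_half[of s "real n"] s n by simp
  also have "\<dots> \<le> 2 / s * ((real n + 1) powr s - real n powr s)"
    using mult_left_mono[OF powr_diff_bounds'(1)[of s "real n"], of "2 / s"] s n by simp
  finally have "real n powr (s - 1) \<le> 2 / s * ((real n + 1) powr s - real n powr s)" .
  then show ?case using step by (simp add: algebra_simps)
qed

text \<open>A Cesaro mean with weights \<open>j\<close> to the power \<open>s - 1\<close>, whose partial sums are of order \<open>n\<close> to the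
  power \<open>s\<close>.\<close>

lemma weighted_cesaro:
  fixes x :: "nat \<Rightarrow> real"
  assumes s: "0 < s" "s \<le> 1" and nonneg: "\<And>j. 0 \<le> x j"
    and lim: "(\<lambda>j. x j / real j powr (s - 1)) \<longlonglongrightarrow> 0"
  shows "(\<lambda>n. (\<Sum>j\<in>{1..<n}. x j) / real n powr s) \<longlonglongrightarrow> 0"
proof (rule LIMSEQ_I)
  fix e :: real assume e: "0 < e"
  define d where "d = e * s / 4"
  have d: "0 < d" using e s by (simp add: d_def)
  have "\<forall>\<^sub>F j in sequentially. x j / real j powr (s - 1) < d"
    using order_tendstoD(2)[OF lim d] .
  then obtain N where N: "\<And>j. N \<le> j \<Longrightarrow> x j / real j powr (s - 1) < d"
    by (auto simp: eventually_sequentially)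
  define S where "S = (\<Sum>j\<in>{1..<Suc N}. x j)"
  have "(\<lambda>n. S * real n powr (-s)) \<longlonglongrightarrow> 0"
    using s by (intro tendsto_mult_right_zero tendsto_neg_powr filterlim_real_sequentially) auto
  then have "\<forall>\<^sub>F n in sequentially. S * real n powr (-s) < e / 2"
    using e by (intro order_tendstoD) auto
  then obtain L where L: "\<And>n. L \<le> n \<Longrightarrow> S * real n powr (-s) < e / 2"
    by (auto simp: eventually_sequentially)
  show "\<exists>no. \<forall>n\<ge>no. norm ((\<Sum>j\<in>{1..<n}. x j) / real n powr s - 0) < e"
  proof (intro exI[of _ "max L 1"] allI impI)
    fix n assume n: "max L 1 \<le> n"
    have "x j \<le> (if j < Suc N then x j else 0) + d * real j powr (s - 1)" if "1 \<le> j" for j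
    proof (cases "j < Suc N")
      case True then show ?thesis using d by simp
    next
      case False
      then show ?thesis using N[of j] that by (simp add: field_simps)
    qed
    then have "(\<Sum>j\<in>{1..<n}. x j) \<le> (\<Sum>j\<in>{1..<n}. (if j < Suc N then x j else 0) + d * real j powr (s - 1))"
      by (intro sum_mono) auto
    also have "\<dots> = (\<Sum>j\<in>{1..<n}. if j < Suc N then x j else 0) + d * (\<Sum>j\<in>{1..<n}. real j powr (s - 1))"
      by (simp add: sum.distrib sum_distrib_left)
    also have "(\<Sum>j\<in>{1..<n}. if j < Suc N then x j else 0) \<le> S"
    proof -
      have "(\<Sum>j\<in>{1..<n}. if j < Suc N then x j else 0) = (\<Sum>j\<in>{1..<n} \<inter> {j. j < Suc N}. x j)"
        by (simp add: sum.inter_restrict)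
      also have "\<dots> \<le> S" unfolding S_def using nonneg by (intro sum_mono2) auto
      finally show ?thesis .
    qed
    also have "d * (\<Sum>j\<in>{1..<n}. real j powr (s - 1)) \<le> d * (2 / s * real n powr s)"
      using sum_powr_le[OF s] n d by (intro mult_left_mono) auto
    also have "d * (2 / s * real n powr s) = e / 2 * real n powr s" using s by (simp add: d_def)
    finally have "(\<Sum>j\<in>{1..<n}. x j) / real n powr s \<le> (S + e / 2 * real n powr s) / real n powr s"
      by (intro divide_right_mono) auto
    also have "\<dots> = S * real n powr (-s) + e / 2"
      using n by (simp add: add_divide_distrib powr_minus_divide)
    also have "\<dots> < e" using L[of n] n by simp
    finally show "norm ((\<Sum>j\<in>{1..<n}. x j) / real n powr s - 0) < e"
      using nonneg by (simp add: sum_nonneg)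
  qed
qed

section \<open>The characteristic function of the score\<close>

lemma iexp_quadratic: "cmod (iexp x - (1 + \<i> * complex_of_real x - complex_of_real (x\<^sup>2 / 2))) \<le> \<bar>x\<bar> ^ 3 / 6"
proof -
  have "(\<Sum>k\<le>2. (\<i> * complex_of_real x) ^ k / fact k) = 1 + \<i> * complex_of_real x - complex_of_real (x\<^sup>2 / 2)"
  proof -
    have "{..2::nat} = {0, 1, 2}" by auto
    then show ?thesis by (simp add: power_mult_distrib)
  qed
  then show ?thesis using iexp_approx1[of x 2] by (simp add: eval_nat_numeral)
qed

lemma cmod_iexp_diff_le: "cmod (iexp x - iexp y) \<le> \<bar>x - y\<bar>"
proof -
  have "iexp x - iexp y = iexp y * (iexp (x - y) - 1)"
    by (simp add: algebra_simps flip: exp_add)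
  then have "cmod (iexp x - iexp y) = cmod (iexp (x - y) - 1)" by (simp add: norm_mult)
  then show ?thesis using iexp_approx1[of "x - y" 0] by simp
qed

lemma exp_minus_quadratic:
  fixes y :: real
  assumes "0 \<le> y"
  shows "\<bar>exp (- y) - (1 - y)\<bar> \<le> y\<^sup>2 / 2"
proof -
  have "1 + - y \<le> exp (- y)" by (rule exp_ge_add_one_self)
  moreover have "exp (- y) \<le> 1 - y + y\<^sup>2 / 2"
  proof -
    have pos: "0 < 1 - y + y\<^sup>2 / 2" using zero_le_power2[of "y - 1"] by (simp add: power2_eq_square algebra_simps)
    have "1 \<le> (1 - y + y\<^sup>2 / 2) * (1 + y + y\<^sup>2 / 2)"
      using zero_le_power2[of "y\<^sup>2"] by (simp add: power2_eq_square algebra_simps)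
    also have "\<dots> \<le> (1 - y + y\<^sup>2 / 2) * exp y"
      using exp_lower_Taylor_quadratic[OF assms] pos by (intro mult_left_mono) auto
    finally have "1 * exp (- y) \<le> (1 - y + y\<^sup>2 / 2) * exp y * exp (- y)"
      by (intro mult_right_mono) auto
    then show ?thesis by (simp add: mult.assoc flip: exp_add)
  qed
  ultimately show ?thesis by (simp add: abs_le_iff)
qed

context partition_chain
begin

definition increment_bound :: real where
  "increment_bound = 1 / \<alpha> + 1 / (1 - \<alpha>)"

lemma increment_bound_nonneg: "0 \<le> increment_bound"
  using alpha_pos alpha_less_1 by (simp add: increment_bound_def)

text \<open>Bounds, in this order, the effect of the drift, of the difference between the conditional variance and
  the exponent \<open>y\<close> of the Gaussian factor, of the third moment, and of the expansion of \<open>exp (- y)\<close>.\<close>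

definition char_error :: "nat \<Rightarrow> real \<Rightarrow> real \<Rightarrow> nat set set \<Rightarrow> real" where
  "char_error n u y \<pi> = \<bar>u\<bar> * (c / \<alpha> / real n) + \<bar>u\<^sup>2 * score_variance n \<pi> / 2 - y\<bar>
      + \<bar>u\<bar> ^ 3 * (increment_bound * score_variance n \<pi>) / 6 + y\<^sup>2 / 2"

lemma char_step:
  assumes n: "1 \<le> n" and pa: "partition_of n \<pi>" and y: "0 \<le> y"
  shows "cmod ((\<Sum>s\<in>slots \<pi>. p n \<pi> s *\<^sub>R iexp (u * score_increment s)) - complex_of_real (exp (- y)))
     \<le> char_error n u y \<pi>"
proof -
  define \<mu> where "\<mu> = (\<Sum>s\<in>slots \<pi>. p n \<pi> s * score_increment s)"
  define V where "V = score_variance n \<pi>"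
  define Q where "Q s = 1 + \<i> * complex_of_real (u * score_increment s) - complex_of_real ((u * score_increment s)\<^sup>2 / 2)" for s
  have Q_eq: "(\<Sum>s\<in>slots \<pi>. p n \<pi> s *\<^sub>R Q s) = 1 + \<i> * complex_of_real (u * \<mu>) - complex_of_real (u\<^sup>2 * V / 2)"
  proof -
    have "(\<Sum>s\<in>slots \<pi>. p n \<pi> s *\<^sub>R Q s) = (\<Sum>s\<in>slots \<pi>. complex_of_real (p n \<pi> s)
         + \<i> * complex_of_real (u * (p n \<pi> s * score_increment s)) - complex_of_real (u\<^sup>2 / 2 * (p n \<pi> s * (score_increment s)\<^sup>2)))"
      by (intro sum.cong) (auto simp: Q_def scaleR_conv_of_real power_mult_distrib algebra_simps)
    also have "\<dots> = complex_of_real (\<Sum>s\<in>slots \<pi>. p n \<pi> s) + \<i> * complex_of_real (u * \<mu>) - complex_of_real (u\<^sup>2 / 2 * V)"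
      unfolding \<mu>_def V_def score_variance_def
      by (simp only: sum.distrib sum_subtractf of_real_sum sum_distrib_left)
    finally show ?thesis by (simp add: sum_p[OF n pa])
  qed
  have "cmod ((\<Sum>s\<in>slots \<pi>. p n \<pi> s *\<^sub>R iexp (u * score_increment s)) - (\<Sum>s\<in>slots \<pi>. p n \<pi> s *\<^sub>R Q s))
     \<le> (\<Sum>s\<in>slots \<pi>. p n \<pi> s * (\<bar>u\<bar> ^ 3 * (increment_bound * (score_increment s)\<^sup>2) / 6))"
  proof -
    have "cmod ((\<Sum>s\<in>slots \<pi>. p n \<pi> s *\<^sub>R iexp (u * score_increment s)) - (\<Sum>s\<in>slots \<pi>. p n \<pi> s *\<^sub>R Q s))
      = cmod (\<Sum>s\<in>slots \<pi>. p n \<pi> s *\<^sub>R (iexp (u * score_increment s) - Q s))"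
      by (simp only: scaleR_diff_right sum_subtractf)
    also have "\<dots> \<le> (\<Sum>s\<in>slots \<pi>. cmod (p n \<pi> s *\<^sub>R (iexp (u * score_increment s) - Q s)))"
      by (rule norm_sum)
    also have "\<dots> \<le> (\<Sum>s\<in>slots \<pi>. p n \<pi> s * (\<bar>u\<bar> ^ 3 * (increment_bound * (score_increment s)\<^sup>2) / 6))"
    proof (rule sum_mono)
      fix s assume s: "s \<in> slots \<pi>"
      have "cmod (iexp (u * score_increment s) - Q s) \<le> \<bar>u * score_increment s\<bar> ^ 3 / 6"
        unfolding Q_def by (rule iexp_quadratic)
      also have "\<dots> = \<bar>u\<bar> ^ 3 * (\<bar>score_increment s\<bar> * (score_increment s)\<^sup>2) / 6"
      proof -
        have "\<bar>a\<bar> ^ 3 = \<bar>a\<bar> * a\<^sup>2" for a :: real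
          by (simp add: power3_eq_cube power2_eq_square mult.commute)
        from this[of "score_increment s"] show ?thesis
          by (simp only: abs_mult power_mult_distrib)
      qed
      also have "\<dots> \<le> \<bar>u\<bar> ^ 3 * (increment_bound * (score_increment s)\<^sup>2) / 6"
        using abs_score_increment_le[OF pa s]
        by (intro divide_right_mono mult_left_mono mult_right_mono) (auto simp: increment_bound_def)
      finally show "cmod (p n \<pi> s *\<^sub>R (iexp (u * score_increment s) - Q s))
         \<le> p n \<pi> s * (\<bar>u\<bar> ^ 3 * (increment_bound * (score_increment s)\<^sup>2) / 6)"
        unfolding norm_scaleR abs_of_nonneg[OF p_nonneg[OF n pa s]]
        by (intro mult_left_mono p_nonneg[OF n pa s])
    qed
    finally show ?thesis .
  qed
  also have "\<dots> = \<bar>u\<bar> ^ 3 * (increment_bound * V) / 6"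
    unfolding V_def score_variance_def by (simp add: sum_distrib_left sum_divide_distrib mult_ac)
  finally have 1: "cmod ((\<Sum>s\<in>slots \<pi>. p n \<pi> s *\<^sub>R iexp (u * score_increment s)) - (1 + \<i> * complex_of_real (u * \<mu>) - complex_of_real (u\<^sup>2 * V / 2)))
     \<le> \<bar>u\<bar> ^ 3 * (increment_bound * V) / 6" unfolding Q_eq .
  have 2: "cmod (\<i> * complex_of_real (u * \<mu>)) \<le> \<bar>u\<bar> * (c / \<alpha> / real n)"
    unfolding norm_mult norm_ii norm_of_real abs_mult mult_1_left
    using score_drift[OF n pa] by (intro mult_left_mono) (simp_all add: \<mu>_def)
  have 3: "cmod (complex_of_real (u\<^sup>2 * V / 2 - y)) \<le> \<bar>u\<^sup>2 * V / 2 - y\<bar>"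
    by (simp only: norm_of_real)
  have 4: "cmod (complex_of_real (exp (- y) - (1 - y))) \<le> y\<^sup>2 / 2"
    using exp_minus_quadratic[OF y] by (simp only: norm_of_real)
  have "(\<Sum>s\<in>slots \<pi>. p n \<pi> s *\<^sub>R iexp (u * score_increment s)) - complex_of_real (exp (- y))
     = ((\<Sum>s\<in>slots \<pi>. p n \<pi> s *\<^sub>R iexp (u * score_increment s)) - (1 + \<i> * complex_of_real (u * \<mu>) - complex_of_real (u\<^sup>2 * V / 2)))
      + \<i> * complex_of_real (u * \<mu>) - complex_of_real (u\<^sup>2 * V / 2 - y) - complex_of_real (exp (- y) - (1 - y))"
    by (simp add: algebra_simps)
  also have "cmod \<dots> \<le> \<bar>u\<bar> ^ 3 * (increment_bound * V) / 6 + \<bar>u\<bar> * (c / \<alpha> / real n) + \<bar>u\<^sup>2 * V / 2 - y\<bar> + y\<^sup>2 / 2"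
    by (intro order_trans[OF norm_triangle_ineq4] order_trans[OF norm_triangle_ineq] add_mono 1 2 3 4)
  finally show ?thesis by (simp add: char_error_def V_def)
qed

text \<open>Lindeberg's argument: the increments are replaced one at a time by a factor \<open>exp (- y)\<close> with
  \<open>y \<ge> 0\<close>, and the errors add up because all other factors have modulus at most one. The frequency \<open>u\<close>
  and the weight \<open>\<eta>\<close> may depend on the partition at time \<open>m\<close>, whereas the schedule \<open>v\<close> is
  deterministic and can be taken out of the expectations.\<close>

lemma char_telescope:
  fixes \<eta> u :: "nat set set \<Rightarrow> real" and v :: "nat \<Rightarrow> real"
  assumes m: "1 \<le> m" "m \<le> n" and chi: "\<And>\<pi>. 0 \<le> \<eta> \<pi>"
    and v: "\<And>j. m \<le> j \<Longrightarrow> v j \<le> v (Suc j)"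
  shows "cmod (expectation (\<lambda>\<omega>. \<eta> (\<rho> m \<omega>) *\<^sub>R iexp (u (\<rho> m \<omega>) * score (\<rho> n \<omega>)))
     - complex_of_real (exp (- (v n - v m))) * expectation (\<lambda>\<omega>. \<eta> (\<rho> m \<omega>) *\<^sub>R iexp (u (\<rho> m \<omega>) * score (\<rho> m \<omega>))))
    \<le> (\<Sum>j\<in>{m..<n}. expectation (\<lambda>\<omega>. \<eta> (\<rho> m \<omega>) * char_error j (u (\<rho> m \<omega>)) (v (Suc j) - v j) (\<rho> j \<omega>)))"
  using m(2)
proof (induction n rule: dec_induct)
  case base
  show ?case by simp
next
  case (step n)
  have n: "1 \<le> n" using m step by simp
  define \<Phi> where "\<Phi> j = expectation (\<lambda>\<omega>. \<eta> (\<rho> m \<omega>) *\<^sub>R iexp (u (\<rho> m \<omega>) * score (\<rho> j \<omega>)))" for j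
  define E where "E j = expectation (\<lambda>\<omega>. \<eta> (\<rho> m \<omega>) * char_error j (u (\<rho> m \<omega>)) (v (Suc j) - v j) (\<rho> j \<omega>))" for j
  define y where "y = v (Suc n) - v n"
  have y: "0 \<le> y" using v step by (simp add: y_def)
  define e where "e = complex_of_real (exp (- y))"
  define Z where "Z \<pi>\<^sub>0 \<pi> = iexp (u \<pi>\<^sub>0 * score \<pi>)" for \<pi>\<^sub>0 \<pi>
  define S where "S \<pi>\<^sub>0 \<pi> = (\<Sum>s\<in>slots \<pi>. p n \<pi> s *\<^sub>R iexp (u \<pi>\<^sub>0 * score_increment s))" for \<pi>\<^sub>0 \<pi>
  have one: "cmod (\<Phi> (Suc n) - e * \<Phi> n) \<le> E n"
  proof -
    have \<Phi>_n: "\<Phi> n = expectation (\<lambda>\<omega>. \<eta> (\<rho> m \<omega>) *\<^sub>R Z (\<rho> m \<omega>) (\<rho> n \<omega>))"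
      by (simp only: \<Phi>_def Z_def)
    have i1: "integrable M (\<lambda>\<omega>. \<eta> (\<rho> m \<omega>) *\<^sub>R Z (\<rho> m \<omega>) (\<rho> n \<omega>))"
      and i2: "integrable M (\<lambda>\<omega>. \<eta> (\<rho> m \<omega>) *\<^sub>R (Z (\<rho> m \<omega>) (\<rho> n \<omega>) * S (\<rho> m \<omega>) (\<rho> n \<omega>)))"
      by (rule integrable_rho2[OF m(1) step(1)])+
    have "\<Phi> (Suc n) = expectation (\<lambda>\<omega>. \<Sum>s\<in>slots (\<rho> n \<omega>). p n (\<rho> n \<omega>) s *\<^sub>R
         (\<eta> (\<rho> m \<omega>) *\<^sub>R Z (\<rho> m \<omega>) (extend_partition n (\<rho> n \<omega>) s)))"
      unfolding \<Phi>_def Z_def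
      by (rule expectation_step[OF m(1) step(1), of "\<lambda>\<pi>\<^sub>0 _ \<pi>. \<eta> \<pi>\<^sub>0 *\<^sub>R iexp (u \<pi>\<^sub>0 * score \<pi>)"])
    also have "\<dots> = expectation (\<lambda>\<omega>. \<eta> (\<rho> m \<omega>) *\<^sub>R (Z (\<rho> m \<omega>) (\<rho> n \<omega>) * S (\<rho> m \<omega>) (\<rho> n \<omega>)))"
    proof (intro Bochner_Integration.integral_cong refl)
      fix \<omega> assume "\<omega> \<in> space M"
      then have pa: "partition_of n (\<rho> n \<omega>)" using rho_partition n by simp
      have Z: "Z \<pi>\<^sub>0 (extend_partition n (\<rho> n \<omega>) s) = Z \<pi>\<^sub>0 (\<rho> n \<omega>) * iexp (u \<pi>\<^sub>0 * score_increment s)"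
        if "s \<in> slots (\<rho> n \<omega>)" for \<pi>\<^sub>0 s
        unfolding Z_def score_extend[OF pa that] by (simp add: algebra_simps flip: exp_add)
      show "(\<Sum>s\<in>slots (\<rho> n \<omega>). p n (\<rho> n \<omega>) s *\<^sub>R
         (\<eta> (\<rho> m \<omega>) *\<^sub>R Z (\<rho> m \<omega>) (extend_partition n (\<rho> n \<omega>) s)))
        = \<eta> (\<rho> m \<omega>) *\<^sub>R (Z (\<rho> m \<omega>) (\<rho> n \<omega>) * S (\<rho> m \<omega>) (\<rho> n \<omega>))"
        unfolding S_def sum_distrib_left scaleR_sum_right
      proof (intro sum.cong refl)
        fix s assume "s \<in> slots (\<rho> n \<omega>)"
        then show "p n (\<rho> n \<omega>) s *\<^sub>R (\<eta> (\<rho> m \<omega>) *\<^sub>R Z (\<rho> m \<omega>) (extend_partition n (\<rho> n \<omega>) s))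
          = \<eta> (\<rho> m \<omega>) *\<^sub>R (Z (\<rho> m \<omega>) (\<rho> n \<omega>) * (p n (\<rho> n \<omega>) s *\<^sub>R iexp (u (\<rho> m \<omega>) * score_increment s)))"
          by (simp only: Z mult_scaleR_right) (simp only: scaleR_scaleR mult.commute)
      qed
    qed
    finally have "\<Phi> (Suc n) - e * \<Phi> n =
      expectation (\<lambda>\<omega>. \<eta> (\<rho> m \<omega>) *\<^sub>R (Z (\<rho> m \<omega>) (\<rho> n \<omega>) * S (\<rho> m \<omega>) (\<rho> n \<omega>))
         - e * (\<eta> (\<rho> m \<omega>) *\<^sub>R Z (\<rho> m \<omega>) (\<rho> n \<omega>)))"
      unfolding \<Phi>_n Bochner_Integration.integral_diff[OF i2 integrable_mult_right[OF i1]] integral_mult_right_zero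
      by simp
    also have "cmod \<dots> \<le> expectation (\<lambda>\<omega>. cmod (\<eta> (\<rho> m \<omega>) *\<^sub>R (Z (\<rho> m \<omega>) (\<rho> n \<omega>) * S (\<rho> m \<omega>) (\<rho> n \<omega>))
         - e * (\<eta> (\<rho> m \<omega>) *\<^sub>R Z (\<rho> m \<omega>) (\<rho> n \<omega>))))"
      by (rule integral_norm_bound)
    also have "\<dots> \<le> E n" unfolding E_def
    proof (rule expectation_rho2_mono[OF m(1) step(1), where
         \<phi> = "\<lambda>\<pi>\<^sub>0 \<pi>. cmod (\<eta> \<pi>\<^sub>0 *\<^sub>R (Z \<pi>\<^sub>0 \<pi> * S \<pi>\<^sub>0 \<pi>) - e * (\<eta> \<pi>\<^sub>0 *\<^sub>R Z \<pi>\<^sub>0 \<pi>))"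
         and \<psi> = "\<lambda>\<pi>\<^sub>0 \<pi>. \<eta> \<pi>\<^sub>0 * char_error n (u \<pi>\<^sub>0) (v (Suc n) - v n) \<pi>"])
      fix \<pi>\<^sub>0 \<pi> assume pa: "partition_of n \<pi>"
      have "\<eta> \<pi>\<^sub>0 *\<^sub>R (Z \<pi>\<^sub>0 \<pi> * S \<pi>\<^sub>0 \<pi>) - e * (\<eta> \<pi>\<^sub>0 *\<^sub>R Z \<pi>\<^sub>0 \<pi>) = \<eta> \<pi>\<^sub>0 *\<^sub>R (Z \<pi>\<^sub>0 \<pi> * (S \<pi>\<^sub>0 \<pi> - e))"
        by (simp add: algebra_simps)
      also have "cmod \<dots> = \<eta> \<pi>\<^sub>0 * cmod (S \<pi>\<^sub>0 \<pi> - e)"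
        using chi[of \<pi>\<^sub>0] by (simp add: norm_mult Z_def)
      also have "\<dots> \<le> \<eta> \<pi>\<^sub>0 * char_error n (u \<pi>\<^sub>0) y \<pi>"
        unfolding S_def e_def by (intro mult_left_mono char_step[OF n pa y] chi)
      finally show "cmod (\<eta> \<pi>\<^sub>0 *\<^sub>R (Z \<pi>\<^sub>0 \<pi> * S \<pi>\<^sub>0 \<pi>) - e * (\<eta> \<pi>\<^sub>0 *\<^sub>R Z \<pi>\<^sub>0 \<pi>))
          \<le> \<eta> \<pi>\<^sub>0 * char_error n (u \<pi>\<^sub>0) (v (Suc n) - v n) \<pi>"
        by (simp only: y_def)
    qed
    finally show ?thesis .
  qed
  have IH: "cmod (\<Phi> n - complex_of_real (exp (- (v n - v m))) * \<Phi> m) \<le> (\<Sum>j\<in>{m..<n}. E j)"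
    using step.IH by (simp only: \<Phi>_def E_def)
  have e_Suc: "complex_of_real (exp (- (v (Suc n) - v m))) = e * complex_of_real (exp (- (v n - v m)))"
    unfolding e_def y_def of_real_mult[symmetric] exp_add[symmetric] by simp
  have e_le: "cmod e \<le> 1" using y by (simp add: e_def)
  have "\<Phi> (Suc n) - complex_of_real (exp (- (v (Suc n) - v m))) * \<Phi> m
     = (\<Phi> (Suc n) - e * \<Phi> n) + e * (\<Phi> n - complex_of_real (exp (- (v n - v m))) * \<Phi> m)"
    unfolding e_Suc by (simp add: right_diff_distrib mult.assoc)
  also have "cmod \<dots> \<le> E n + 1 * (\<Sum>j\<in>{m..<n}. E j)"
    by (intro order_trans[OF norm_triangle_ineq] add_mono one order_trans[OF norm_mult_ineq] mult_mono IH e_le) auto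
  also have "\<dots> = (\<Sum>j\<in>{m..<Suc n}. E j)" using step(1) by simp
  finally show ?case by (simp only: \<Phi>_def E_def)
qed

lemma expectation_affine:
  fixes f g h :: "'a \<Rightarrow> real"
  assumes "integrable M f" "integrable M g" "integrable M h"
  shows "expectation (\<lambda>\<omega>. a + (b * f \<omega> + (d * g \<omega> + e * h \<omega>)))
     = a + (b * expectation f + (d * expectation g + e * expectation h))"
  using assms by (simp add: prob_space)

lemma R_times_powr: "1 \<le> j \<Longrightarrow> R j \<pi> * real j powr (\<alpha> - 1) = real (card \<pi>) / real j"
  unfolding R_def mult.assoc powr_add[symmetric] by (simp add: powr_minus_divide)

lemma abs_frequency_le:
  assumes r: "0 < \<delta>" "\<delta> \<le> r" and n: "1 \<le> n"
  shows "\<bar>t / sqrt (fisher * real n powr \<alpha> * r)\<bar> \<le> \<bar>t\<bar> / sqrt (fisher * \<delta>) * real n powr (-\<alpha> / 2)"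
proof -
  have I: "0 < fisher" by (rule fisher_pos)
  have "sqrt (fisher * real n powr \<alpha> * \<delta>) \<le> sqrt (fisher * real n powr \<alpha> * r)"
    using r I by (intro real_sqrt_le_mono mult_left_mono) auto
  moreover have "0 < sqrt (fisher * real n powr \<alpha> * \<delta>)" using r I n by simp
  ultimately have "\<bar>t\<bar> / sqrt (fisher * real n powr \<alpha> * r) \<le> \<bar>t\<bar> / sqrt (fisher * real n powr \<alpha> * \<delta>)"
    by (intro divide_left_mono) auto
  moreover have "sqrt (fisher * real n powr \<alpha> * \<delta>) = sqrt (fisher * \<delta>) * real n powr (\<alpha> / 2)"
    using n by (simp add: real_sqrt_mult powr_half_sqrt_powr)
  ultimately show ?thesis using r I n by (simp add: abs_divide powr_minus_divide)
qed

text \<open>The frequency is normalised by the value \<open>r\<close> of \<open>R\<close> at an earlier time. If \<open>R\<close> did not change after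
  that time, the conditional variance at time \<open>j\<close> would be about \<open>\<alpha> I r\<close> times \<open>j\<close> to the power
  \<open>\<alpha> - 1\<close>, and its contribution to the exponent would follow the schedule \<open>(t\<^sup>2 / 2) (j / n)\<^sup>\<alpha>\<close>. The
  bracket collects the deviations: law of large numbers, change of \<open>R\<close>, discretisation.\<close>

lemma char_error_le:
  fixes t :: real
  assumes j: "1 \<le> j" "partition_of j \<pi>" and r: "0 < \<delta>" "\<delta> \<le> r" and n: "1 \<le> n"
  defines "u \<equiv> t / sqrt (fisher * real n powr \<alpha> * r)"
    and "U \<equiv> \<bar>t\<bar> / sqrt (fisher * \<delta>) * real n powr (-\<alpha> / 2)"
    and "y \<equiv> t\<^sup>2 / 2 * (real n powr (-\<alpha>) * ((real j + 1) powr \<alpha> - real j powr \<alpha>))"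
  shows "char_error j u y \<pi> \<le> U * (c / \<alpha> / real j)
     + t\<^sup>2 / 2 * real n powr (-\<alpha>) * (1 / (fisher * \<delta>) * \<bar>score_variance j \<pi> - \<alpha> * fisher * real (card \<pi>) / real j\<bar>
         + \<alpha> / \<delta> * real j powr (\<alpha> - 1) * \<bar>R j \<pi> - r\<bar>
         + \<bar>\<alpha> * real j powr (\<alpha> - 1) - ((real j + 1) powr \<alpha> - real j powr \<alpha>)\<bar>)
     + U ^ 3 * increment_bound / 6 * score_variance j \<pi> + y\<^sup>2 / 2"
proof -
  define V where "V = score_variance j \<pi>"
  define D where "D = (real j + 1) powr \<alpha> - real j powr \<alpha>"
  define q where "q = real j powr (\<alpha> - 1)"
  define a where "a = real n powr (-\<alpha>)"
  have a: "0 < a" "real n powr \<alpha> = 1 / a" using n by (auto simp: a_def powr_minus_divide)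
  have I: "0 < fisher" by (rule fisher_pos)
  have V0: "0 \<le> V" unfolding V_def by (rule score_variance_bounds[OF j])
  have uU: "\<bar>u\<bar> \<le> U" unfolding u_def U_def by (rule abs_frequency_le[OF r n])
  have u2: "u\<^sup>2 = t\<^sup>2 * a / (fisher * r)"
    using r I a by (simp add: u_def power_divide)
  have "u\<^sup>2 * V / 2 - y = t\<^sup>2 / 2 * a * (1 / (fisher * r) * (V - \<alpha> * fisher * real (card \<pi>) / real j)
       + \<alpha> / r * q * (R j \<pi> - r) + (\<alpha> * q - D))"
  proof -
    have "real (card \<pi>) / real j = R j \<pi> * q" using R_times_powr[OF j(1)] by (simp add: q_def)
    then have "\<alpha> * fisher * real (card \<pi>) / real j = \<alpha> * fisher * (R j \<pi> * q)"
      unfolding times_divide_eq_right[symmetric] by (simp only:)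
    then have "1 / (fisher * r) * (V - \<alpha> * fisher * real (card \<pi>) / real j) + \<alpha> / r * q * (R j \<pi> - r) + (\<alpha> * q - D)
       = 1 / (fisher * r) * (V - \<alpha> * fisher * (R j \<pi> * q)) + \<alpha> / r * q * (R j \<pi> - r) + (\<alpha> * q - D)"
      by simp
    also have "\<dots> = V / (fisher * r) - D"
      using I r by (simp add: divide_simps) (simp add: algebra_simps)
    finally have fin: "t\<^sup>2 / 2 * a * (1 / (fisher * r) * (V - \<alpha> * fisher * real (card \<pi>) / real j)
       + \<alpha> / r * q * (R j \<pi> - r) + (\<alpha> * q - D)) = t\<^sup>2 / 2 * a * (V / (fisher * r) - D)" by simp
    have "u\<^sup>2 * V / 2 - y = t\<^sup>2 / 2 * a * (V / (fisher * r) - D)"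
      unfolding u2 y_def D_def[symmetric] a_def[symmetric] by (simp add: right_diff_distrib)
    then show ?thesis by (rule trans[OF _ fin[symmetric]])
  qed
  also have "\<bar>\<dots>\<bar> = t\<^sup>2 / 2 * a * \<bar>1 / (fisher * r) * (V - \<alpha> * fisher * real (card \<pi>) / real j)
       + \<alpha> / r * q * (R j \<pi> - r) + (\<alpha> * q - D)\<bar>"
    using a by (simp add: abs_mult)
  also have "\<dots> \<le> t\<^sup>2 / 2 * a * (1 / (fisher * \<delta>) * \<bar>V - \<alpha> * fisher * real (card \<pi>) / real j\<bar>
       + \<alpha> / \<delta> * q * \<bar>R j \<pi> - r\<bar> + \<bar>\<alpha> * q - D\<bar>)"
  proof (intro mult_left_mono order_trans[OF abs_triangle_ineq] add_mono order_refl)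
    have "1 / (fisher * r) \<le> 1 / (fisher * \<delta>)"
      using r I by (intro divide_left_mono mult_left_mono) auto
    then show "\<bar>1 / (fisher * r) * (V - \<alpha> * fisher * real (card \<pi>) / real j)\<bar>
        \<le> 1 / (fisher * \<delta>) * \<bar>V - \<alpha> * fisher * real (card \<pi>) / real j\<bar>"
      unfolding abs_mult using r I by (intro mult_mono) auto
    have "\<alpha> / r \<le> \<alpha> / \<delta>" using r alpha_pos by (intro divide_left_mono) auto
    then show "\<bar>\<alpha> / r * q * (R j \<pi> - r)\<bar> \<le> \<alpha> / \<delta> * q * \<bar>R j \<pi> - r\<bar>"
      unfolding abs_mult using r alpha_pos by (intro mult_mono mult_nonneg_nonneg) (auto simp: q_def)
  qed (use a in auto)
  finally have 2: "\<bar>u\<^sup>2 * V / 2 - y\<bar> \<le> \<dots>" .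
  have 1: "\<bar>u\<bar> * (c / \<alpha> / real j) \<le> U * (c / \<alpha> / real j)"
    using uU c_nonneg alpha_pos by (intro mult_right_mono) auto
  have "\<bar>u\<bar> ^ 3 * (increment_bound * V) \<le> U ^ 3 * (increment_bound * V)"
    using uU V0 increment_bound_nonneg by (intro mult_right_mono power_mono) auto
  then have 3: "\<bar>u\<bar> ^ 3 * (increment_bound * V) / 6 \<le> U ^ 3 * increment_bound / 6 * V" by simp
  show ?thesis
    unfolding char_error_def V_def[symmetric] D_def[symmetric] q_def[symmetric] a_def[symmetric]
    by (intro add_mono order_refl 1 2 3)
qed

lemma power_increment_error:
  "(\<lambda>j. \<bar>\<alpha> * real j powr (\<alpha> - 1) - ((real j + 1) powr \<alpha> - real j powr \<alpha>)\<bar> / real j powr (\<alpha> - 1)) \<longlonglongrightarrow> 0"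
proof -
  have lim: "(\<lambda>j. \<alpha> * (1 - (1 + 1 / real j) powr (\<alpha> - 1))) \<longlonglongrightarrow> \<alpha> * (1 - (1 + 0) powr (\<alpha> - 1))"
    by (intro tendsto_intros tendsto_divide_0[OF tendsto_const] filterlim_real_sequentially
          filterlim_at_top_imp_at_infinity) auto
  then have lim: "(\<lambda>j. \<alpha> * (1 - (1 + 1 / real j) powr (\<alpha> - 1))) \<longlonglongrightarrow> 0" by simp
  show ?thesis
  proof (rule tendsto_sandwich[OF _ _ tendsto_const lim])
    show "\<forall>\<^sub>F j in sequentially. \<bar>\<alpha> * real j powr (\<alpha> - 1) - ((real j + 1) powr \<alpha> - real j powr \<alpha>)\<bar> / real j powr (\<alpha> - 1)
        \<le> \<alpha> * (1 - (1 + 1 / real j) powr (\<alpha> - 1))"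
      using eventually_ge_at_top[of 1]
    proof eventually_elim
      case (elim j)
      define x where "x = real j"
      have x: "1 \<le> x" using elim by (simp add: x_def)
      have b: "\<alpha> * (x + 1) powr (\<alpha> - 1) \<le> (x + 1) powr \<alpha> - x powr \<alpha>" "(x + 1) powr \<alpha> - x powr \<alpha> \<le> \<alpha> * x powr (\<alpha> - 1)"
        using powr_diff_bounds'[of \<alpha> x] alpha_pos alpha_less_1 x by auto
      have "1 + 1 / x = (x + 1) / x" using x by (simp add: field_simps)
      then have "(1 + 1 / x) powr (\<alpha> - 1) = (x + 1) powr (\<alpha> - 1) / x powr (\<alpha> - 1)"
        using x by (simp add: powr_divide)
      then have "\<alpha> * (1 - (1 + 1 / x) powr (\<alpha> - 1)) = (\<alpha> * x powr (\<alpha> - 1) - \<alpha> * (x + 1) powr (\<alpha> - 1)) / x powr (\<alpha> - 1)"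
        using x by (simp add: diff_divide_distrib right_diff_distrib)
      then show ?case unfolding x_def[symmetric] using b by (simp add: divide_right_mono)
    qed
  qed (auto intro!: always_eventually)
qed

lemma expectation_R_diff_abs:
  "\<exists>C\<ge>0. \<forall>m n. 1 \<le> m \<longrightarrow> m \<le> n \<longrightarrow>
     expectation (\<lambda>\<omega>. \<bar>R n (\<rho> n \<omega>) - R m (\<rho> m \<omega>)\<bar>) \<le> C * real m powr (-\<alpha> / 2)"
proof -
  obtain C where C: "0 \<le> C" "\<And>m n. 1 \<le> m \<Longrightarrow> m \<le> n \<Longrightarrow>
     expectation (\<lambda>\<omega>. (R n (\<rho> n \<omega>) - R m (\<rho> m \<omega>))\<^sup>2) \<le> C * real m powr (-\<alpha>)"
    using expectation_R_diff_square by blast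
  have "expectation (\<lambda>\<omega>. \<bar>R n (\<rho> n \<omega>) - R m (\<rho> m \<omega>)\<bar>) \<le> (1 + C) * real m powr (-\<alpha> / 2)"
    if m: "1 \<le> m" "m \<le> n" for m n
  proof (rule expectation_abs_le[OF m, where F = "\<lambda>\<pi>\<^sub>0 \<pi>. R n \<pi> - R m \<pi>\<^sub>0"])
    show "expectation (\<lambda>\<omega>. (R n (\<rho> n \<omega>) - R m (\<rho> m \<omega>))\<^sup>2) \<le> C * (real m powr (-\<alpha> / 2))\<^sup>2"
      using C(2)[OF m] m by (simp add: power2_eq_square flip: powr_add)
  qed (use m in auto)
  then show ?thesis using C(1) by (intro exI[of _ "1 + C"]) auto
qed

text \<open>After summation over \<open>j\<close> all errors in \<open>char_error_le\<close> vanish as \<open>n\<close> tends to infinity, by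
  \<open>weighted_cesaro\<close>, except the one for the change of \<open>R\<close> after time \<open>m\<close>, which is small for large
  \<open>m\<close>. The weight \<open>\<eta>\<close> restricts to partitions whose \<open>R\<close> is not small, where dividing by it is
  harmless.\<close>

lemma char_given_past:
  assumes \<delta>: "0 < \<delta>"
  shows "\<exists>C\<ge>0. \<forall>m\<ge>1. \<forall>\<eta>. (\<forall>\<pi>. 0 \<le> \<eta> \<pi> \<and> \<eta> \<pi> \<le> 1 \<and> (\<eta> \<pi> \<noteq> 0 \<longrightarrow> \<delta> \<le> R m \<pi>)) \<longrightarrow>
     (\<forall>\<epsilon>>0. \<forall>\<^sub>F n in sequentially.
       cmod (expectation (\<lambda>\<omega>. \<eta> (\<rho> m \<omega>) *\<^sub>R iexp (t / sqrt (fisher * real n powr \<alpha> * R m (\<rho> m \<omega>)) * score (\<rho> n \<omega>)))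
          - complex_of_real (exp (- t\<^sup>2 / 2) * expectation (\<lambda>\<omega>. \<eta> (\<rho> m \<omega>)))) \<le> C * real m powr (-\<alpha> / 2) + \<epsilon>)"
proof -
  obtain K where K: "0 \<le> K" "\<And>m n. 1 \<le> m \<Longrightarrow> m \<le> n \<Longrightarrow>
     expectation (\<lambda>\<omega>. \<bar>R n (\<rho> n \<omega>) - R m (\<rho> m \<omega>)\<bar>) \<le> K * real m powr (-\<alpha> / 2)"
    using expectation_R_diff_abs by blast
  obtain W where W: "0 \<le> W"
    "\<And>n. 1 \<le> n \<Longrightarrow> expectation (\<lambda>\<omega>. score_variance n (\<rho> n \<omega>)) \<le> W * real n powr (\<alpha> - 1)"
    using expectation_score_variance_le by blast
  define x2 where "x2 j = expectation (\<lambda>\<omega>. \<bar>score_variance j (\<rho> j \<omega>) - \<alpha> * fisher * real (card (\<rho> j \<omega>)) / real j\<bar>)" for j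
  define x3 where "x3 j = \<bar>\<alpha> * real j powr (\<alpha> - 1) - ((real j + 1) powr \<alpha> - real j powr \<alpha>)\<bar>" for j :: nat
  define S where "S n = (\<Sum>j\<in>{1..<n}. real j powr (\<alpha> - 1))" for n :: nat
  define U where "U n = \<bar>t\<bar> / sqrt (fisher * \<delta>) * real n powr (-\<alpha> / 2)" for n :: nat
  define a where "a n = real n powr (-\<alpha>)" for n :: nat
  define C where "C = t\<^sup>2 / \<delta> * K"
  have I: "0 < fisher" by (rule fisher_pos)
  have C: "0 \<le> C" using \<delta> K by (simp add: C_def)
  have U0: "0 \<le> U n" for n using I \<delta> by (simp add: U_def)
  have a0: "0 \<le> a n" for n by (simp add: a_def)
  have x20: "0 \<le> x2 j" for j by (simp add: x2_def)
  have x30: "0 \<le> x3 j" for j by (simp add: x3_def)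
  (* the part of the accumulated error that vanishes for fixed m *)
  define err where "err n = U n * (c / \<alpha>) * (\<Sum>j\<in>{1..<n}. 1 / real j)
     + t\<^sup>2 / 2 / (fisher * \<delta>) * (a n * (\<Sum>j\<in>{1..<n}. x2 j)) + t\<^sup>2 / 2 * (a n * (\<Sum>j\<in>{1..<n}. x3 j))
     + U n ^ 3 * increment_bound / 6 * W * S n + t ^ 4 / 8 * (a n)\<^sup>2 * S n" for n
  have S_le: "a n * S n \<le> 2 / \<alpha>" if "1 \<le> n" for n
  proof -
    have "S n \<le> 2 / \<alpha> * real n powr \<alpha>"
      unfolding S_def using sum_powr_le[of \<alpha> n] alpha_pos alpha_less_1 that by simp
    then have "a n * S n \<le> a n * (2 / \<alpha> * real n powr \<alpha>)" using a0 by (intro mult_left_mono)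
    then show ?thesis using that by (simp add: a_def powr_minus_divide)
  qed
  have S0: "0 \<le> S n" for n by (simp add: S_def sum_nonneg)
  have lim_powr: "(\<lambda>n. real n powr (-\<alpha> / 2)) \<longlonglongrightarrow> 0"
    using alpha_pos by (intro tendsto_neg_powr filterlim_real_sequentially) auto
  have lim_a: "a \<longlonglongrightarrow> 0" unfolding a_def
    using alpha_pos by (intro tendsto_neg_powr filterlim_real_sequentially) auto
  have lim_U: "U \<longlonglongrightarrow> 0" unfolding U_def by (rule tendsto_mult_right_zero[OF lim_powr])
  have err_lim: "err \<longlonglongrightarrow> 0"
  proof -
    have 1: "(\<lambda>n. U n * (c / \<alpha>) * (\<Sum>j\<in>{1..<n}. 1 / real j)) \<longlonglongrightarrow> 0"
    proof -
      have "(\<lambda>j. (1 / real j) / real j powr (\<alpha> / 2 - 1)) \<longlonglongrightarrow> 0"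
      proof (rule Lim_transform_eventually[OF lim_powr])
        show "\<forall>\<^sub>F j in sequentially. real j powr (-\<alpha> / 2) = (1 / real j) / real j powr (\<alpha> / 2 - 1)"
          using eventually_ge_at_top[of 1]
          by eventually_elim (simp add: powr_diff powr_minus_divide)
      qed
      then have "(\<lambda>n. (\<Sum>j\<in>{1..<n}. 1 / real j) / real n powr (\<alpha> / 2)) \<longlonglongrightarrow> 0"
        using alpha_pos alpha_less_1 by (intro weighted_cesaro) auto
      then have "(\<lambda>n. \<bar>t\<bar> / sqrt (fisher * \<delta>) * (c / \<alpha>) * ((\<Sum>j\<in>{1..<n}. 1 / real j) / real n powr (\<alpha> / 2))) \<longlonglongrightarrow> 0"
        by (rule tendsto_mult_right_zero)
      then show ?thesis by (simp add: U_def powr_minus_divide mult_ac)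
    qed
    have 2: "(\<lambda>n. t\<^sup>2 / 2 / (fisher * \<delta>) * (a n * (\<Sum>j\<in>{1..<n}. x2 j))) \<longlonglongrightarrow> 0"
    proof (rule tendsto_mult_right_zero)
      have "(\<lambda>n. (\<Sum>j\<in>{1..<n}. x2 j) / real n powr \<alpha>) \<longlonglongrightarrow> 0"
        using alpha_pos alpha_less_1 x20 score_variance_lln by (intro weighted_cesaro) (auto simp: x2_def)
      then show "(\<lambda>n. a n * (\<Sum>j\<in>{1..<n}. x2 j)) \<longlonglongrightarrow> 0" by (simp add: a_def powr_minus_divide)
    qed
    have 3: "(\<lambda>n. t\<^sup>2 / 2 * (a n * (\<Sum>j\<in>{1..<n}. x3 j))) \<longlonglongrightarrow> 0"
    proof (rule tendsto_mult_right_zero)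
      have "(\<lambda>n. (\<Sum>j\<in>{1..<n}. x3 j) / real n powr \<alpha>) \<longlonglongrightarrow> 0"
        using alpha_pos alpha_less_1 x30 power_increment_error by (intro weighted_cesaro) (auto simp: x3_def)
      then show "(\<lambda>n. a n * (\<Sum>j\<in>{1..<n}. x3 j)) \<longlonglongrightarrow> 0" by (simp add: a_def powr_minus_divide)
    qed
    have U2: "(U n)\<^sup>2 = t\<^sup>2 / (fisher * \<delta>) * a n" for n
    proof -
      have "(real n powr (-\<alpha> / 2))\<^sup>2 = a n"
        by (simp add: a_def power2_eq_square flip: powr_add)
      then show ?thesis using I \<delta> by (simp add: U_def power_mult_distrib power_divide)
    qed
    have aS: "(\<lambda>n. z n * (a n * S n)) \<longlonglongrightarrow> 0" if "z \<longlonglongrightarrow> 0" "\<And>n. 0 \<le> z n" for z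
    proof (rule tendsto_sandwich[OF _ _ tendsto_const tendsto_mult_left_zero[OF that(1), of "2 / \<alpha>"]])
      show "\<forall>\<^sub>F n in sequentially. 0 \<le> z n * (a n * S n)"
        using that(2) a0 S0 by (intro always_eventually) auto
      show "\<forall>\<^sub>F n in sequentially. z n * (a n * S n) \<le> z n * (2 / \<alpha>)"
        using eventually_ge_at_top[of 1] by eventually_elim (intro mult_left_mono S_le that(2))
    qed
    have 4: "(\<lambda>n. U n ^ 3 * increment_bound / 6 * W * S n) \<longlonglongrightarrow> 0"
    proof -
      have "(\<lambda>n. (increment_bound / 6 * W * (t\<^sup>2 / (fisher * \<delta>))) * (U n * (a n * S n))) \<longlonglongrightarrow> 0"
        by (intro tendsto_mult_right_zero aS lim_U U0)
      moreover have "U n ^ 3 = U n * (t\<^sup>2 / (fisher * \<delta>) * a n)" for n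
        using U2[of n] by (simp add: power3_eq_cube power2_eq_square)
      ultimately show ?thesis by (simp add: mult_ac)
    qed
    have 5: "(\<lambda>n. t ^ 4 / 8 * (a n)\<^sup>2 * S n) \<longlonglongrightarrow> 0"
    proof -
      have "(\<lambda>n. t ^ 4 / 8 * (a n * (a n * S n))) \<longlonglongrightarrow> 0"
        by (intro tendsto_mult_right_zero aS lim_a a0)
      then show ?thesis by (simp add: power2_eq_square mult_ac)
    qed
    have "err \<longlonglongrightarrow> 0 + 0 + 0 + 0 + 0"
      unfolding err_def by (intro tendsto_add 1 2 3 4 5)
    then show ?thesis by simp
  qed
  have main: "\<forall>\<^sub>F n in sequentially.
       cmod (expectation (\<lambda>\<omega>. \<eta> (\<rho> m \<omega>) *\<^sub>R iexp (t / sqrt (fisher * real n powr \<alpha> * R m (\<rho> m \<omega>)) * score (\<rho> n \<omega>)))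
          - complex_of_real (exp (- t\<^sup>2 / 2) * expectation (\<lambda>\<omega>. \<eta> (\<rho> m \<omega>)))) \<le> C * real m powr (-\<alpha> / 2) + \<epsilon>"
    if m: "1 \<le> m" and eta: "\<And>\<pi>. 0 \<le> \<eta> \<pi>" "\<And>\<pi>. \<eta> \<pi> \<le> 1" "\<And>\<pi>. \<eta> \<pi> \<noteq> 0 \<Longrightarrow> \<delta> \<le> R m \<pi>" and \<epsilon>: "0 < \<epsilon>"
    for m \<eta> \<epsilon>
  proof -
    define u where "u n \<pi> = t / sqrt (fisher * real n powr \<alpha> * R m \<pi>)" for n \<pi>
    define v where "v n j = t\<^sup>2 / 2 * (a n * real j powr \<alpha>)" for n j :: nat
    define \<Phi> where "\<Phi> n j = expectation (\<lambda>\<omega>. \<eta> (\<rho> m \<omega>) *\<^sub>R iexp (u n (\<rho> m \<omega>) * score (\<rho> j \<omega>)))" for n j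
    define e where "e n = exp (- (v n n - v n m))" for n
    have tele: "cmod (\<Phi> n n - complex_of_real (e n) * \<Phi> n m) \<le> C * real m powr (-\<alpha> / 2) + err n" if n: "m \<le> n" for n
    proof -
      have n1: "1 \<le> n" using m n by simp
      have "cmod (\<Phi> n n - complex_of_real (e n) * \<Phi> n m)
        \<le> (\<Sum>j\<in>{m..<n}. expectation (\<lambda>\<omega>. \<eta> (\<rho> m \<omega>) * char_error j (u n (\<rho> m \<omega>)) (v n (Suc j) - v n j) (\<rho> j \<omega>)))"
        unfolding \<Phi>_def e_def
        using a0[of n] alpha_pos by (intro char_telescope[OF m n] eta)
          (auto simp: v_def intro!: mult_left_mono powr_mono2)
      also have "\<dots> \<le> (\<Sum>j\<in>{m..<n}. U n * (c / \<alpha>) * (1 / real j)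
           + t\<^sup>2 / 2 * a n * (1 / (fisher * \<delta>) * x2 j + \<alpha> / \<delta> * real j powr (\<alpha> - 1) * (K * real m powr (-\<alpha> / 2)) + x3 j)
           + U n ^ 3 * increment_bound / 6 * (W * real j powr (\<alpha> - 1)) + t ^ 4 / 8 * (a n)\<^sup>2 * real j powr (\<alpha> - 1))"
      proof (rule sum_mono)
        fix j assume "j \<in> {m..<n}"
        then have j: "m \<le> j" "1 \<le> j" using m by auto
        define D where "D = (real j + 1) powr \<alpha> - real j powr \<alpha>"
        define y where "y = t\<^sup>2 / 2 * (a n * D)"
        have y: "v n (Suc j) - v n j = y"
          by (simp add: v_def y_def D_def algebra_simps)
        have D: "0 \<le> D" "D \<le> real j powr (\<alpha> - 1)"
        proof -
          show "0 \<le> D" unfolding D_def using alpha_pos by (simp add: powr_mono2)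
          have "D \<le> \<alpha> * real j powr (\<alpha> - 1)" unfolding D_def
            using powr_diff_bounds'(2)[of \<alpha> "real j"] alpha_pos alpha_less_1 j by simp
          also have "\<dots> \<le> 1 * real j powr (\<alpha> - 1)" using alpha_less_1 by (intro mult_right_mono) auto
          finally show "D \<le> real j powr (\<alpha> - 1)" by simp
        qed
        have q1: "real j powr (\<alpha> - 1) \<le> 1"
          using j alpha_less_1 powr_mono2'[of "\<alpha> - 1" 1 "real j"] by simp
        have y2: "y\<^sup>2 / 2 \<le> t ^ 4 / 8 * (a n)\<^sup>2 * real j powr (\<alpha> - 1)"
        proof -
          have "D\<^sup>2 \<le> real j powr (\<alpha> - 1) * 1"
            unfolding power2_eq_square using D q1 by (intro mult_mono) auto
          then have "t ^ 4 / 8 * (a n)\<^sup>2 * D\<^sup>2 \<le> t ^ 4 / 8 * (a n)\<^sup>2 * real j powr (\<alpha> - 1)"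
            by (intro mult_left_mono) auto
          then show ?thesis by (simp add: y_def power_mult_distrib power_divide flip: power_mult)
        qed
        let ?B = "\<lambda>\<pi>\<^sub>0 \<pi>. (U n * (c / \<alpha> / real j) + y\<^sup>2 / 2 + t\<^sup>2 / 2 * a n * x3 j)
             + (t\<^sup>2 / 2 * a n * (1 / (fisher * \<delta>)) * \<bar>score_variance j \<pi> - \<alpha> * fisher * real (card \<pi>) / real j\<bar>
             + (t\<^sup>2 / 2 * a n * (\<alpha> / \<delta> * real j powr (\<alpha> - 1)) * \<bar>R j \<pi> - R m \<pi>\<^sub>0\<bar>
             + U n ^ 3 * increment_bound / 6 * score_variance j \<pi>))"
        have "expectation (\<lambda>\<omega>. \<eta> (\<rho> m \<omega>) * char_error j (u n (\<rho> m \<omega>)) y (\<rho> j \<omega>)) \<le> expectation (\<lambda>\<omega>. ?B (\<rho> m \<omega>) (\<rho> j \<omega>))"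
        proof (rule expectation_rho2_mono[OF m j(1), where \<phi> = "\<lambda>\<pi>\<^sub>0 \<pi>. \<eta> \<pi>\<^sub>0 * char_error j (u n \<pi>\<^sub>0) y \<pi>" and \<psi> = ?B])
          fix \<pi>\<^sub>0 \<pi> assume pa: "partition_of j \<pi>"
          have B0: "0 \<le> ?B \<pi>\<^sub>0 \<pi>"
            using U0[of n] c_nonneg alpha_pos a0[of n] x30[of j] I \<delta> increment_bound_nonneg score_variance_bounds(1)[OF j(2) pa]
            by (intro add_nonneg_nonneg mult_nonneg_nonneg) auto
          show "\<eta> \<pi>\<^sub>0 * char_error j (u n \<pi>\<^sub>0) y \<pi> \<le> ?B \<pi>\<^sub>0 \<pi>"
          proof (cases "\<eta> \<pi>\<^sub>0 = 0")
            case True then show ?thesis using B0 by simp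
          next
            case False
            have "char_error j (u n \<pi>\<^sub>0) y \<pi> \<le> ?B \<pi>\<^sub>0 \<pi>"
              using char_error_le[OF j(2) pa \<delta> eta(3)[OF False] n1, of t]
              unfolding u_def y_def D_def a_def U_def x3_def by (simp add: distrib_left mult_ac)
            then have "\<eta> \<pi>\<^sub>0 * char_error j (u n \<pi>\<^sub>0) y \<pi> \<le> \<eta> \<pi>\<^sub>0 * ?B \<pi>\<^sub>0 \<pi>"
              using eta(1) by (intro mult_left_mono)
            also have "\<dots> \<le> 1 * ?B \<pi>\<^sub>0 \<pi>" using eta(2) B0 by (intro mult_right_mono)
            finally show ?thesis by simp
          qed
        qed
        also have "\<dots> = (U n * (c / \<alpha> / real j) + y\<^sup>2 / 2 + t\<^sup>2 / 2 * a n * x3 j)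
             + (t\<^sup>2 / 2 * a n * (1 / (fisher * \<delta>)) * x2 j
             + (t\<^sup>2 / 2 * a n * (\<alpha> / \<delta> * real j powr (\<alpha> - 1)) * expectation (\<lambda>\<omega>. \<bar>R j (\<rho> j \<omega>) - R m (\<rho> m \<omega>)\<bar>)
             + U n ^ 3 * increment_bound / 6 * expectation (\<lambda>\<omega>. score_variance j (\<rho> j \<omega>))))"
        proof -
          have "integrable M (\<lambda>\<omega>. \<bar>score_variance j (\<rho> j \<omega>) - \<alpha> * fisher * real (card (\<rho> j \<omega>)) / real j\<bar>)"
            "integrable M (\<lambda>\<omega>. \<bar>R j (\<rho> j \<omega>) - R m (\<rho> m \<omega>)\<bar>)" "integrable M (\<lambda>\<omega>. score_variance j (\<rho> j \<omega>))"
            by (rule integrable_rho[OF j(2)] integrable_rho2[OF m j(1)])+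
          then show ?thesis unfolding x2_def by (rule expectation_affine)
        qed
        also have "\<dots> \<le> (U n * (c / \<alpha> / real j) + t ^ 4 / 8 * (a n)\<^sup>2 * real j powr (\<alpha> - 1) + t\<^sup>2 / 2 * a n * x3 j)
             + (t\<^sup>2 / 2 * a n * (1 / (fisher * \<delta>)) * x2 j
             + (t\<^sup>2 / 2 * a n * (\<alpha> / \<delta> * real j powr (\<alpha> - 1)) * (K * real m powr (-\<alpha> / 2))
             + U n ^ 3 * increment_bound / 6 * (W * real j powr (\<alpha> - 1))))"
          using y2 K(2)[OF m j(1)] W(2)[OF j(2)] U0[of n] a0[of n] \<delta> alpha_pos increment_bound_nonneg
          by (intro add_mono mult_left_mono order_refl) auto
        also have "\<dots> = U n * (c / \<alpha>) * (1 / real j)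
           + t\<^sup>2 / 2 * a n * (1 / (fisher * \<delta>) * x2 j + \<alpha> / \<delta> * real j powr (\<alpha> - 1) * (K * real m powr (-\<alpha> / 2)) + x3 j)
           + U n ^ 3 * increment_bound / 6 * (W * real j powr (\<alpha> - 1)) + t ^ 4 / 8 * (a n)\<^sup>2 * real j powr (\<alpha> - 1)"
          by (simp add: distrib_left)
        finally show "expectation (\<lambda>\<omega>. \<eta> (\<rho> m \<omega>) * char_error j (u n (\<rho> m \<omega>)) (v n (Suc j) - v n j) (\<rho> j \<omega>))
          \<le> U n * (c / \<alpha>) * (1 / real j)
           + t\<^sup>2 / 2 * a n * (1 / (fisher * \<delta>) * x2 j + \<alpha> / \<delta> * real j powr (\<alpha> - 1) * (K * real m powr (-\<alpha> / 2)) + x3 j)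
           + U n ^ 3 * increment_bound / 6 * (W * real j powr (\<alpha> - 1)) + t ^ 4 / 8 * (a n)\<^sup>2 * real j powr (\<alpha> - 1)"
          unfolding y .
      qed
      also have "\<dots> \<le> (\<Sum>j\<in>{1..<n}. U n * (c / \<alpha>) * (1 / real j)
           + t\<^sup>2 / 2 * a n * (1 / (fisher * \<delta>) * x2 j + \<alpha> / \<delta> * real j powr (\<alpha> - 1) * (K * real m powr (-\<alpha> / 2)) + x3 j)
           + U n ^ 3 * increment_bound / 6 * (W * real j powr (\<alpha> - 1)) + t ^ 4 / 8 * (a n)\<^sup>2 * real j powr (\<alpha> - 1))"
        using m U0[of n] c_nonneg alpha_pos a0[of n] x30 x20 I \<delta> increment_bound_nonneg K(1) W(1)
        by (intro sum_mono2 add_nonneg_nonneg mult_nonneg_nonneg) auto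
      also have "\<dots> = err n + (t\<^sup>2 / 2 * (\<alpha> / \<delta>) * K * real m powr (-\<alpha> / 2)) * (a n * S n)"
        unfolding err_def S_def
        by (simp add: sum.distrib distrib_left sum_distrib_left sum_divide_distrib mult_ac)
      also have "\<dots> \<le> err n + (t\<^sup>2 / 2 * (\<alpha> / \<delta>) * K * real m powr (-\<alpha> / 2)) * (2 / \<alpha>)"
        using S_le[OF n1] \<delta> alpha_pos K(1) by (intro add_left_mono mult_left_mono) auto
      also have "\<dots> = C * real m powr (-\<alpha> / 2) + err n"
        using alpha_pos by (simp add: C_def)
      finally show ?thesis .
    qed
    define Y where "Y = expectation (\<lambda>\<omega>. \<bar>score (\<rho> m \<omega>)\<bar>)"
    have start: "cmod (complex_of_real (e n) * \<Phi> n m - complex_of_real (exp (- t\<^sup>2 / 2) * expectation (\<lambda>\<omega>. \<eta> (\<rho> m \<omega>))))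
       \<le> U n * Y + \<bar>e n - exp (- t\<^sup>2 / 2)\<bar>" if n: "m \<le> n" for n
    proof -
      have n1: "1 \<le> n" using m n by simp
      have i: "integrable M (\<lambda>\<omega>. complex_of_real (\<eta> (\<rho> m \<omega>)))" "integrable M (\<lambda>\<omega>. \<eta> (\<rho> m \<omega>) *\<^sub>R iexp (u n (\<rho> m \<omega>) * score (\<rho> m \<omega>)))"
        by (rule integrable_rho[OF m])+
      have e01: "0 \<le> e n" "e n \<le> 1"
      proof -
        have "v n m \<le> v n n" unfolding v_def using n a0 alpha_pos by (intro mult_left_mono powr_mono2) auto
        then show "0 \<le> e n" "e n \<le> 1" by (auto simp: e_def)
      qed
      have E01: "0 \<le> expectation (\<lambda>\<omega>. \<eta> (\<rho> m \<omega>))" "expectation (\<lambda>\<omega>. \<eta> (\<rho> m \<omega>)) \<le> 1"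
      proof -
        show "0 \<le> expectation (\<lambda>\<omega>. \<eta> (\<rho> m \<omega>))" using eta by simp
        have "expectation (\<lambda>\<omega>. \<eta> (\<rho> m \<omega>)) \<le> expectation (\<lambda>\<omega>. 1)"
          by (rule expectation_rho_mono[OF m, of \<eta> "\<lambda>_. 1"]) (rule eta)
        then show "expectation (\<lambda>\<omega>. \<eta> (\<rho> m \<omega>)) \<le> 1" by (simp add: prob_space)
      qed
      have "\<Phi> n m - complex_of_real (expectation (\<lambda>\<omega>. \<eta> (\<rho> m \<omega>)))
        = expectation (\<lambda>\<omega>. \<eta> (\<rho> m \<omega>) *\<^sub>R iexp (u n (\<rho> m \<omega>) * score (\<rho> m \<omega>)) - complex_of_real (\<eta> (\<rho> m \<omega>)))"
        unfolding \<Phi>_def Bochner_Integration.integral_diff[OF i(2) i(1)] integral_complex_of_real ..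
      also have "cmod \<dots> \<le> expectation (\<lambda>\<omega>. cmod (\<eta> (\<rho> m \<omega>) *\<^sub>R iexp (u n (\<rho> m \<omega>) * score (\<rho> m \<omega>)) - complex_of_real (\<eta> (\<rho> m \<omega>))))"
        by (rule integral_norm_bound)
      also have "\<dots> \<le> expectation (\<lambda>\<omega>. U n * \<bar>score (\<rho> m \<omega>)\<bar>)"
      proof (rule expectation_rho_mono[OF m])
        fix \<pi> assume "partition_of m \<pi>"
        show "cmod (\<eta> \<pi> *\<^sub>R iexp (u n \<pi> * score \<pi>) - complex_of_real (\<eta> \<pi>)) \<le> U n * \<bar>score \<pi>\<bar>"
        proof (cases "\<eta> \<pi> = 0")
          case True then show ?thesis using U0 by simp
        next
          case False
          have uU: "\<bar>u n \<pi>\<bar> \<le> U n"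
            unfolding u_def U_def by (rule abs_frequency_le[OF \<delta> eta(3)[OF False] n1])
          have "\<eta> \<pi> *\<^sub>R iexp (u n \<pi> * score \<pi>) - complex_of_real (\<eta> \<pi>) = \<eta> \<pi> *\<^sub>R (iexp (u n \<pi> * score \<pi>) - 1)"
            by (simp add: scaleR_conv_of_real algebra_simps)
          also have "cmod \<dots> = \<eta> \<pi> * cmod (iexp (u n \<pi> * score \<pi>) - 1)" using eta(1)[of \<pi>] by simp
          also have "\<dots> \<le> 1 * \<bar>u n \<pi> * score \<pi>\<bar>"
            using iexp_approx1[of "u n \<pi> * score \<pi>" 0] eta(1,2)[of \<pi>] by (intro mult_mono) auto
          also have "\<dots> \<le> U n * \<bar>score \<pi>\<bar>" using uU by (simp add: abs_mult mult_right_mono)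
          finally show ?thesis .
        qed
      qed
      also have "\<dots> = U n * Y" unfolding Y_def by (rule integral_mult_right_zero)
      finally have 1: "cmod (\<Phi> n m - complex_of_real (expectation (\<lambda>\<omega>. \<eta> (\<rho> m \<omega>)))) \<le> U n * Y" .
      have "complex_of_real (e n) * \<Phi> n m - complex_of_real (exp (- t\<^sup>2 / 2) * expectation (\<lambda>\<omega>. \<eta> (\<rho> m \<omega>)))
         = complex_of_real (e n) * (\<Phi> n m - complex_of_real (expectation (\<lambda>\<omega>. \<eta> (\<rho> m \<omega>))))
          + complex_of_real ((e n - exp (- t\<^sup>2 / 2)) * expectation (\<lambda>\<omega>. \<eta> (\<rho> m \<omega>)))"
        by (simp add: algebra_simps)
      also have "cmod \<dots> \<le> 1 * (U n * Y) + \<bar>e n - exp (- t\<^sup>2 / 2)\<bar> * 1"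
      proof (intro order_trans[OF norm_triangle_ineq] add_mono)
        show "cmod (complex_of_real (e n) * (\<Phi> n m - complex_of_real (expectation (\<lambda>\<omega>. \<eta> (\<rho> m \<omega>))))) \<le> 1 * (U n * Y)"
          unfolding norm_mult using e01 1 by (intro mult_mono) auto
        show "cmod (complex_of_real ((e n - exp (- t\<^sup>2 / 2)) * expectation (\<lambda>\<omega>. \<eta> (\<rho> m \<omega>)))) \<le> \<bar>e n - exp (- t\<^sup>2 / 2)\<bar> * 1"
          unfolding norm_of_real abs_mult using E01 by (intro mult_left_mono) auto
      qed
      finally show ?thesis by simp
    qed
    have "(\<lambda>n. err n + (U n * Y + \<bar>e n - exp (- t\<^sup>2 / 2)\<bar>)) \<longlonglongrightarrow> 0 + (0 * Y + \<bar>exp (- (t\<^sup>2 / 2 - 0)) - exp (- t\<^sup>2 / 2)\<bar>)"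
    proof (intro tendsto_intros err_lim lim_U)
      have vm: "(\<lambda>n. v n m) \<longlonglongrightarrow> 0"
        unfolding v_def by (intro tendsto_mult_right_zero tendsto_mult_left_zero lim_a)
      have "\<forall>\<^sub>F n in sequentially. t\<^sup>2 / 2 = v n n"
        using eventually_ge_at_top[of 1] by eventually_elim (simp add: v_def a_def powr_minus_divide)
      then have vn: "(\<lambda>n. v n n) \<longlonglongrightarrow> t\<^sup>2 / 2"
        by (rule Lim_transform_eventually[OF tendsto_const])
      show "e \<longlonglongrightarrow> exp (- (t\<^sup>2 / 2 - 0))" unfolding e_def by (intro tendsto_intros vn vm)
    qed
    then have "\<forall>\<^sub>F n in sequentially. err n + (U n * Y + \<bar>e n - exp (- t\<^sup>2 / 2)\<bar>) < \<epsilon>"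
      using \<epsilon> by (intro order_tendstoD(2)) auto
    then show ?thesis using eventually_ge_at_top[of m]
    proof eventually_elim
      case (elim n)
      have "cmod (\<Phi> n n - complex_of_real (exp (- t\<^sup>2 / 2) * expectation (\<lambda>\<omega>. \<eta> (\<rho> m \<omega>))))
         \<le> (C * real m powr (-\<alpha> / 2) + err n) + (U n * Y + \<bar>e n - exp (- t\<^sup>2 / 2)\<bar>)"
        by (rule order_trans[OF norm_diff_triangle_ineq[of _ "complex_of_real (e n) * \<Phi> n m" "complex_of_real (e n) * \<Phi> n m", simplified] add_mono[OF tele start]])
           (use elim in auto)
      also have "\<dots> \<le> C * real m powr (-\<alpha> / 2) + \<epsilon>" using elim(1) by simp
      finally show ?case by (simp only: \<Phi>_def u_def)
    qed
  qed
  show ?thesis using C main by (intro exI[of _ C]) auto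
qed

lemma norm_expectation_le:
  fixes f :: "'a \<Rightarrow> 'c::{banach, second_countable_topology}"
  assumes "integrable M g" "integrable M f" "\<And>\<omega>. \<omega> \<in> space M \<Longrightarrow> norm (f \<omega>) \<le> g \<omega>"
  shows "norm (expectation f) \<le> expectation g"
  by (rule order_trans[OF integral_norm_bound integral_mono]) (use assms in auto)

definition std_score :: "nat set set \<Rightarrow> real" where
  "std_score \<pi> = score \<pi> / sqrt (fisher * real (card \<pi>))"

lemma card_eq_R: "1 \<le> n \<Longrightarrow> real (card \<pi>) = real n powr \<alpha> * R n \<pi>"
  by (simp add: R_def powr_minus_divide)

text \<open>The cost of replacing the normalisation by an earlier value of \<open>R\<close> with that by the current number of
  blocks, from \<open>1 / sqrt x - 1 / sqrt y = (y - x) / (sqrt x sqrt y (sqrt x + sqrt y))\<close>.\<close>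

lemma std_score_normalisation:
  assumes n: "1 \<le> n" and d: "0 < \<delta>" "\<delta> \<le> R n \<pi>" "\<delta> \<le> r"
  shows "\<bar>t * std_score \<pi> - t / sqrt (fisher * real n powr \<alpha> * r) * score \<pi>\<bar>
     \<le> \<bar>t\<bar> / (sqrt fisher * (\<delta> * sqrt \<delta>)) * (\<bar>score \<pi>\<bar> * real n powr (-\<alpha> / 2) * \<bar>R n \<pi> - r\<bar>)"
proof -
  define a where "a = sqrt (R n \<pi>)"
  define b where "b = sqrt r"
  define q where "q = sqrt fisher * real n powr (\<alpha> / 2)"
  have q: "0 < q" using fisher_pos n by (simp add: q_def)
  have s: "0 < sqrt \<delta>" "sqrt \<delta> \<le> a" "sqrt \<delta> \<le> b" using d by (auto simp: a_def b_def)
  have ab: "0 < a" "0 < b" using s less_le_trans[OF s(1)] by blast+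
  have sq: "sqrt (fisher * real n powr \<alpha> * x) = q * sqrt x" for x
    using n by (simp add: q_def real_sqrt_mult powr_half_sqrt_powr)
  have "t * std_score \<pi> - t / sqrt (fisher * real n powr \<alpha> * r) * score \<pi> = t * score \<pi> / q * (1 / a - 1 / b)"
    using sq[of "R n \<pi>"] sq[of r] card_eq_R[OF n, of \<pi>]
    by (simp add: std_score_def a_def b_def mult.assoc right_diff_distrib)
  also have "\<bar>\<dots>\<bar> = \<bar>t\<bar> * \<bar>score \<pi>\<bar> / q * \<bar>1 / a - 1 / b\<bar>" using q by (simp add: abs_mult)
  also have "\<dots> \<le> \<bar>t\<bar> * \<bar>score \<pi>\<bar> / q * (\<bar>R n \<pi> - r\<bar> / (\<delta> * sqrt \<delta>))"
  proof (rule mult_left_mono)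
    have "R n \<pi> - r = (a - b) * (a + b)"
      using d by (simp add: a_def b_def algebra_simps)
    then have eq: "\<bar>R n \<pi> - r\<bar> = \<bar>a - b\<bar> * (a + b)" using ab by (simp add: abs_mult)
    have "sqrt \<delta> * sqrt \<delta> * sqrt \<delta> \<le> a * b * (a + b)"
      using s ab by (intro mult_mono) auto
    then have "\<delta> * sqrt \<delta> \<le> a * b * (a + b)" using d by simp
    then have "\<bar>R n \<pi> - r\<bar> / (a * b * (a + b)) \<le> \<bar>R n \<pi> - r\<bar> / (\<delta> * sqrt \<delta>)"
      using s ab d by (intro divide_left_mono mult_pos_pos add_pos_pos) auto
    moreover have "\<bar>R n \<pi> - r\<bar> / (a * b * (a + b)) = \<bar>1 / a - 1 / b\<bar>"
    proof -
      have "1 / a - 1 / b = (b - a) / (a * b)" using ab by (simp add: field_simps)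
      then have "\<bar>1 / a - 1 / b\<bar> = \<bar>a - b\<bar> / (a * b)" using ab by (simp add: abs_mult abs_minus_commute)
      moreover have "a + b \<noteq> 0" using ab by simp
      ultimately show ?thesis unfolding eq by simp
    qed
    ultimately show "\<bar>1 / a - 1 / b\<bar> \<le> \<bar>R n \<pi> - r\<bar> / (\<delta> * sqrt \<delta>)" by simp
  qed (use q in auto)
  also have "\<dots> = \<bar>t\<bar> / (sqrt fisher * (\<delta> * sqrt \<delta>)) * (\<bar>score \<pi>\<bar> * real n powr (-\<alpha> / 2) * \<bar>R n \<pi> - r\<bar>)"
    by (simp add: q_def powr_minus_divide mult_ac)
  finally show ?thesis .
qed

text \<open>Choose a late time \<open>m\<close> and freeze the normalisation there, at a cost controlled by
  \<open>expectation_R_diff_square\<close>; then apply \<open>char_given_past\<close>. Events of time \<open>l \<le> m\<close> are functions of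
  the partition at time \<open>m\<close> and enter through the weight \<open>\<eta>\<close>. This is what makes the central limit
  theorem mixing.\<close>

lemma std_score_char:
  assumes l: "1 \<le> l"
  shows "(\<lambda>n. expectation (\<lambda>\<omega>. indicat_real A (\<rho> l \<omega>) *\<^sub>R iexp (t * std_score (\<rho> n \<omega>))))
     \<longlonglongrightarrow> complex_of_real (exp (- t\<^sup>2 / 2) * expectation (\<lambda>\<omega>. indicat_real A (\<rho> l \<omega>)))"
proof (rule LIMSEQ_I)
  fix \<epsilon> :: real assume \<epsilon>: "0 < \<epsilon>"
  (* five errors e from small R and from the limit in n, and one from the choice of m *)
  define e where "e = \<epsilon> / 10"
  have e: "0 < e" using \<epsilon> by (simp add: e_def)
  obtain \<delta> where \<delta>: "0 < \<delta>" "\<And>n. 1 \<le> n \<Longrightarrow> prob {\<omega>\<in>space M. R n (\<rho> n \<omega>) < \<delta>} \<le> e"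
    using R_not_small[OF e] by blast
  obtain C where C: "0 \<le> C" "\<And>m \<eta> \<epsilon>'. 1 \<le> m \<Longrightarrow> (\<forall>\<pi>. 0 \<le> \<eta> \<pi> \<and> \<eta> \<pi> \<le> 1 \<and> (\<eta> \<pi> \<noteq> 0 \<longrightarrow> \<delta> \<le> R m \<pi>)) \<Longrightarrow> 0 < \<epsilon>' \<Longrightarrow>
     (\<forall>\<^sub>F n in sequentially.
       cmod (expectation (\<lambda>\<omega>. \<eta> (\<rho> m \<omega>) *\<^sub>R iexp (t / sqrt (fisher * real n powr \<alpha> * R m (\<rho> m \<omega>)) * score (\<rho> n \<omega>)))
          - complex_of_real (exp (- t\<^sup>2 / 2) * expectation (\<lambda>\<omega>. \<eta> (\<rho> m \<omega>)))) \<le> C * real m powr (-\<alpha> / 2) + \<epsilon>')"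
    using char_given_past[OF \<delta>(1), of t] by blast
  obtain K where K: "0 \<le> K" "\<And>m n. 1 \<le> m \<Longrightarrow> m \<le> n \<Longrightarrow>
     expectation (\<lambda>\<omega>. (R n (\<rho> n \<omega>) - R m (\<rho> m \<omega>))\<^sup>2) \<le> K * real m powr (-\<alpha>)"
    using expectation_R_diff_square by blast
  obtain Q where Q: "0 \<le> Q" "\<And>n. 1 \<le> n \<Longrightarrow> expectation (\<lambda>\<omega>. (score (\<rho> n \<omega>))\<^sup>2) \<le> Q * real n powr \<alpha>"
    using expectation_score_square by blast
  define D where "D = \<bar>t\<bar> / (sqrt fisher * (\<delta> * sqrt \<delta>))"
  have D: "0 \<le> D" using \<delta> fisher_pos by (simp add: D_def)
  have "(\<lambda>m. (C + D * (Q + K)) * real m powr (-\<alpha> / 2)) \<longlonglongrightarrow> 0"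
    using alpha_pos by (intro tendsto_mult_right_zero tendsto_neg_powr filterlim_real_sequentially) auto
  then have "\<forall>\<^sub>F m in sequentially. (C + D * (Q + K)) * real m powr (-\<alpha> / 2) < e"
    using e by (intro order_tendstoD) auto
  then have "\<forall>\<^sub>F m in sequentially. (C + D * (Q + K)) * real m powr (-\<alpha> / 2) < e \<and> l \<le> m"
    using eventually_ge_at_top[of l] by eventually_elim simp
  then obtain m where m_small: "(C + D * (Q + K)) * real m powr (-\<alpha> / 2) < e" and lm: "l \<le> m"
    by (auto simp: eventually_sequentially)
  have m: "1 \<le> m" using l lm by simp
  define \<eta> where "\<eta> \<pi> = indicat_real A (restrict_partition l \<pi>) * (if \<delta> \<le> R m \<pi> then 1 else 0)" for \<pi>
  define u where "u n \<pi> = t / sqrt (fisher * real n powr \<alpha> * R m \<pi>)" for n \<pi>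
  define bad where "bad n \<pi> = (if R n \<pi> < \<delta> then 1 else 0 :: real)" for n \<pi>
  have eta: "\<forall>\<pi>. 0 \<le> \<eta> \<pi> \<and> \<eta> \<pi> \<le> 1 \<and> (\<eta> \<pi> \<noteq> 0 \<longrightarrow> \<delta> \<le> R m \<pi>)"
    by (auto simp: \<eta>_def indicator_def)
  have bad: "expectation (\<lambda>\<omega>. bad n (\<rho> n \<omega>)) \<le> e" if n: "1 \<le> n" for n
  proof -
    have "expectation (\<lambda>\<omega>. bad n (\<rho> n \<omega>)) = expectation (indicat_real {\<omega>\<in>space M. R n (\<rho> n \<omega>) < \<delta>})"
      by (intro Bochner_Integration.integral_cong) (auto simp: indicator_def bad_def)
    also have "\<dots> = prob {\<omega>\<in>space M. R n (\<rho> n \<omega>) < \<delta>}" using sets_rho[OF n] by (simp add: Int_absorb1 subset_eq)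
    finally show ?thesis using \<delta>(2)[OF n] by simp
  qed
  have restrict: "indicat_real A (\<rho> l \<omega>) = indicat_real A (restrict_partition l (\<rho> m \<omega>))" if "\<omega> \<in> space M" for \<omega>
    using rho_restrict[OF l lm that] by simp
  define e2 where "e2 = complex_of_real (exp (- t\<^sup>2 / 2))"
  have e2: "cmod e2 \<le> 1" by (simp add: e2_def)
  define E where "E n = expectation (\<lambda>\<omega>. indicat_real A (\<rho> l \<omega>) *\<^sub>R iexp (t * std_score (\<rho> n \<omega>)))" for n
  define P where "P = expectation (\<lambda>\<omega>. indicat_real A (\<rho> l \<omega>))"
  define E2 where "E2 n = expectation (\<lambda>\<omega>. \<eta> (\<rho> m \<omega>) *\<^sub>R iexp (t * std_score (\<rho> n \<omega>)))" for n
  define E3 where "E3 n = expectation (\<lambda>\<omega>. \<eta> (\<rho> m \<omega>) *\<^sub>R iexp (u n (\<rho> m \<omega>) * score (\<rho> n \<omega>)))" for n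
  define P2 where "P2 = expectation (\<lambda>\<omega>. \<eta> (\<rho> m \<omega>))"
  have near: "\<bar>indicat_real A (\<rho> l \<omega>) - \<eta> (\<rho> m \<omega>)\<bar> \<le> bad m (\<rho> m \<omega>)" if "\<omega> \<in> space M" for \<omega>
    using restrict[OF that] by (auto simp: \<eta>_def bad_def indicator_def)
  have d1: "cmod (E n - E2 n) \<le> e" if n: "m \<le> n" for n
  proof -
    have i: "integrable M (\<lambda>\<omega>. indicat_real A (\<rho> l \<omega>) *\<^sub>R iexp (t * std_score (\<rho> n \<omega>)))"
      "integrable M (\<lambda>\<omega>. \<eta> (\<rho> m \<omega>) *\<^sub>R iexp (t * std_score (\<rho> n \<omega>)))"
      using l lm m n by (auto intro!: integrable_rho2)
    have "cmod (E n - E2 n) = cmod (expectation (\<lambda>\<omega>. indicat_real A (\<rho> l \<omega>) *\<^sub>R iexp (t * std_score (\<rho> n \<omega>)) - \<eta> (\<rho> m \<omega>) *\<^sub>R iexp (t * std_score (\<rho> n \<omega>))))"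
      unfolding E_def E2_def Bochner_Integration.integral_diff[OF i] ..
    also have "\<dots> \<le> expectation (\<lambda>\<omega>. bad m (\<rho> m \<omega>))"
    proof (rule norm_expectation_le)
      show "integrable M (\<lambda>\<omega>. bad m (\<rho> m \<omega>))" by (rule integrable_rho[OF m])
      fix \<omega> assume w: "\<omega> \<in> space M"
      have "norm (indicat_real A (\<rho> l \<omega>) *\<^sub>R iexp (t * std_score (\<rho> n \<omega>)) - \<eta> (\<rho> m \<omega>) *\<^sub>R iexp (t * std_score (\<rho> n \<omega>)))
        = \<bar>indicat_real A (\<rho> l \<omega>) - \<eta> (\<rho> m \<omega>)\<bar>"
        by (simp flip: scaleR_diff_left)
      then show "norm (indicat_real A (\<rho> l \<omega>) *\<^sub>R iexp (t * std_score (\<rho> n \<omega>)) - \<eta> (\<rho> m \<omega>) *\<^sub>R iexp (t * std_score (\<rho> n \<omega>)))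
         \<le> bad m (\<rho> m \<omega>)" using near[OF w] by simp
    qed (rule Bochner_Integration.integrable_diff[OF i])
    finally show ?thesis using bad[OF m] by simp
  qed
  have d5: "cmod (e2 * complex_of_real P2 - e2 * complex_of_real P) \<le> e"
  proof -
    have i: "integrable M (\<lambda>\<omega>. \<eta> (\<rho> m \<omega>))" "integrable M (\<lambda>\<omega>. indicat_real A (\<rho> l \<omega>))"
      using l m by (auto intro: integrable_rho)
    have "\<bar>P2 - P\<bar> = norm (expectation (\<lambda>\<omega>. \<eta> (\<rho> m \<omega>) - indicat_real A (\<rho> l \<omega>)))"
      unfolding P2_def P_def Bochner_Integration.integral_diff[OF i] by simp
    also have "\<dots> \<le> expectation (\<lambda>\<omega>. bad m (\<rho> m \<omega>))"
      using near by (intro norm_expectation_le Bochner_Integration.integrable_diff i integrable_rho[OF m])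
        (simp add: abs_minus_commute)
    finally have "\<bar>P2 - P\<bar> \<le> e" using bad[OF m] by simp
    then have "cmod e2 * cmod (complex_of_real (P2 - P)) \<le> 1 * e"
      unfolding norm_of_real by (intro mult_mono e2) auto
    then show ?thesis by (simp add: right_diff_distrib flip: norm_mult)
  qed
  have d2: "cmod (E2 n - E3 n) \<le> 2 * e + D * (Q + K) * real m powr (-\<alpha> / 2)" if n: "m \<le> n" for n
  proof -
    have n1: "1 \<le> n" using m n by simp
    define s where "s = real m powr (-\<alpha> / 2)"
    have s: "0 < s" "s\<^sup>2 = real m powr (-\<alpha>)" using m by (auto simp: s_def power2_eq_square simp flip: powr_add)
    have i: "integrable M (\<lambda>\<omega>. \<eta> (\<rho> m \<omega>) *\<^sub>R iexp (t * std_score (\<rho> n \<omega>)))"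
      "integrable M (\<lambda>\<omega>. \<eta> (\<rho> m \<omega>) *\<^sub>R iexp (u n (\<rho> m \<omega>) * score (\<rho> n \<omega>)))"
      by (rule integrable_rho2[OF m n])+
    let ?B = "\<lambda>\<pi>\<^sub>0 \<pi>. 0 + (2 * bad n \<pi> + (D * s * real n powr (-\<alpha>) * (score \<pi>)\<^sup>2 + D / s * (R n \<pi> - R m \<pi>\<^sub>0)\<^sup>2))"
    have "cmod (E2 n - E3 n) = cmod (expectation (\<lambda>\<omega>. \<eta> (\<rho> m \<omega>) *\<^sub>R iexp (t * std_score (\<rho> n \<omega>)) - \<eta> (\<rho> m \<omega>) *\<^sub>R iexp (u n (\<rho> m \<omega>) * score (\<rho> n \<omega>))))"
      unfolding E2_def E3_def Bochner_Integration.integral_diff[OF i] ..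
    also have "\<dots> \<le> expectation (\<lambda>\<omega>. ?B (\<rho> m \<omega>) (\<rho> n \<omega>))"
    proof (rule norm_expectation_le)
      show "integrable M (\<lambda>\<omega>. ?B (\<rho> m \<omega>) (\<rho> n \<omega>))" by (rule integrable_rho2[OF m n])
      fix \<omega> assume "\<omega> \<in> space M"
      define \<pi>\<^sub>0 where "\<pi>\<^sub>0 = \<rho> m \<omega>"
      define \<pi> where "\<pi> = \<rho> n \<omega>"
      have "norm (\<eta> \<pi>\<^sub>0 *\<^sub>R iexp (t * std_score \<pi>) - \<eta> \<pi>\<^sub>0 *\<^sub>R iexp (u n \<pi>\<^sub>0 * score \<pi>)) =
          \<eta> \<pi>\<^sub>0 * cmod (iexp (t * std_score \<pi>) - iexp (u n \<pi>\<^sub>0 * score \<pi>))"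
        using eta by (simp flip: scaleR_diff_right)
      also have "\<dots> \<le> ?B \<pi>\<^sub>0 \<pi>"
      proof (cases "\<eta> \<pi>\<^sub>0 = 0 \<or> R n \<pi> < \<delta>")
        case True
        have "cmod (iexp (t * std_score \<pi>) - iexp (u n \<pi>\<^sub>0 * score \<pi>)) \<le> 2"
          by (rule order_trans[OF norm_triangle_ineq4]) simp
        then have "\<eta> \<pi>\<^sub>0 * cmod (iexp (t * std_score \<pi>) - iexp (u n \<pi>\<^sub>0 * score \<pi>)) \<le> 2 * bad n \<pi>"
          using True eta mult_mono[of "\<eta> \<pi>\<^sub>0" 1 "cmod (iexp (t * std_score \<pi>) - iexp (u n \<pi>\<^sub>0 * score \<pi>))" 2]
          by (auto simp: bad_def)
        moreover have "0 \<le> D * s * real n powr (-\<alpha>) * (score \<pi>)\<^sup>2 + D / s * (R n \<pi> - R m \<pi>\<^sub>0)\<^sup>2"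
          using D s by simp
        ultimately show ?thesis by linarith
      next
        case False
        define z where "z = \<bar>score \<pi>\<bar> * real n powr (-\<alpha> / 2)"
        have z: "0 \<le> z" "z\<^sup>2 = real n powr (-\<alpha>) * (score \<pi>)\<^sup>2"
          using n1 by (auto simp: z_def power_mult_distrib) (simp add: power2_eq_square flip: powr_add)
        have "cmod (iexp (t * std_score \<pi>) - iexp (u n \<pi>\<^sub>0 * score \<pi>)) \<le> \<bar>t * std_score \<pi> - u n \<pi>\<^sub>0 * score \<pi>\<bar>"
          by (rule cmod_iexp_diff_le)
        also have "\<dots> \<le> D * (z * \<bar>R n \<pi> - R m \<pi>\<^sub>0\<bar>)"
          unfolding u_def D_def z_def using False eta
          by (intro std_score_normalisation[OF n1 \<delta>(1)]) auto
        also have "\<dots> \<le> D * (s * z\<^sup>2 + (R n \<pi> - R m \<pi>\<^sub>0)\<^sup>2 / s)"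
        proof (intro mult_left_mono D)
          define y where "y = \<bar>R n \<pi> - R m \<pi>\<^sub>0\<bar>"
          have "0 \<le> (s * z - y)\<^sup>2 / s" using s by simp
          also have "\<dots> = s * z\<^sup>2 - 2 * (z * y) + y\<^sup>2 / s" using s by (simp add: power2_eq_square field_simps)
          finally have "2 * (z * y) \<le> s * z\<^sup>2 + y\<^sup>2 / s" by simp
          moreover have "0 \<le> z * y" using z by (simp add: y_def)
          ultimately show "z * \<bar>R n \<pi> - R m \<pi>\<^sub>0\<bar> \<le> s * z\<^sup>2 + (R n \<pi> - R m \<pi>\<^sub>0)\<^sup>2 / s" by (simp add: y_def)
        qed
        also have "\<dots> = D * s * real n powr (-\<alpha>) * (score \<pi>)\<^sup>2 + D / s * (R n \<pi> - R m \<pi>\<^sub>0)\<^sup>2"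
          by (simp add: z distrib_left mult_ac)
        finally have 1: "cmod (iexp (t * std_score \<pi>) - iexp (u n \<pi>\<^sub>0 * score \<pi>)) \<le> \<dots>" .
        have "\<eta> \<pi>\<^sub>0 * cmod (iexp (t * std_score \<pi>) - iexp (u n \<pi>\<^sub>0 * score \<pi>)) \<le> 1 * cmod (iexp (t * std_score \<pi>) - iexp (u n \<pi>\<^sub>0 * score \<pi>))"
          using eta by (intro mult_right_mono) auto
        then show ?thesis using 1 by (simp add: bad_def)
      qed
      finally show "norm (\<eta> (\<rho> m \<omega>) *\<^sub>R iexp (t * std_score (\<rho> n \<omega>)) - \<eta> (\<rho> m \<omega>) *\<^sub>R iexp (u n (\<rho> m \<omega>) * score (\<rho> n \<omega>))) \<le> ?B (\<rho> m \<omega>) (\<rho> n \<omega>)"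
        by (simp only: \<pi>\<^sub>0_def \<pi>_def)
    qed (rule Bochner_Integration.integrable_diff[OF i])
    also have "\<dots> = 0 + (2 * expectation (\<lambda>\<omega>. bad n (\<rho> n \<omega>)) + (D * s * real n powr (-\<alpha>) * expectation (\<lambda>\<omega>. (score (\<rho> n \<omega>))\<^sup>2)
         + D / s * expectation (\<lambda>\<omega>. (R n (\<rho> n \<omega>) - R m (\<rho> m \<omega>))\<^sup>2)))"
      by (intro expectation_affine integrable_rho[OF n1] integrable_rho2[OF m n])
    also have "\<dots> \<le> 0 + (2 * e + (D * s * real n powr (-\<alpha>) * (Q * real n powr \<alpha>) + D / s * (K * s\<^sup>2)))"
      using bad[OF n1] Q(2)[OF n1] K(2)[OF m n] D s by (intro add_mono mult_left_mono order_refl) auto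
    also have "\<dots> = 2 * e + D * (Q + K) * s"
      using n1 s(1) by (simp add: powr_minus_divide power2_eq_square algebra_simps)
    finally show ?thesis by (simp add: s_def)
  qed
  have d3: "\<forall>\<^sub>F n in sequentially. cmod (E3 n - e2 * complex_of_real P2) \<le> C * real m powr (-\<alpha> / 2) + e"
    using C(2)[OF m eta e] by (simp only: E3_def u_def e2_def P2_def of_real_mult)
  obtain N where N: "\<And>n. N \<le> n \<Longrightarrow> cmod (E3 n - e2 * complex_of_real P2) \<le> C * real m powr (-\<alpha> / 2) + e"
    using d3 by (auto simp: eventually_sequentially)
  have "cmod (E n - e2 * complex_of_real P) < \<epsilon>" if n: "max N m \<le> n" for n
  proof -
    have "E n - e2 * complex_of_real P = (E n - E2 n) + (E2 n - E3 n) + (E3 n - e2 * complex_of_real P2) + (e2 * complex_of_real P2 - e2 * complex_of_real P)"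
      by simp
    also have "cmod \<dots> \<le> e + (2 * e + D * (Q + K) * real m powr (-\<alpha> / 2)) + (C * real m powr (-\<alpha> / 2) + e) + e"
      using n by (intro order_trans[OF norm_triangle_ineq] add_mono d1 d2 N d5) auto
    also have "\<dots> = 5 * e + (C + D * (Q + K)) * real m powr (-\<alpha> / 2)" by (simp add: algebra_simps)
    also have "\<dots> < \<epsilon>" using m_small e by (simp add: e_def)
    finally show ?thesis .
  qed
  then show "\<exists>no. \<forall>n\<ge>no. norm (expectation (\<lambda>\<omega>. indicat_real A (\<rho> l \<omega>) *\<^sub>R iexp (t * std_score (\<rho> n \<omega>))) -
      complex_of_real (exp (- t\<^sup>2 / 2) * expectation (\<lambda>\<omega>. indicat_real A (\<rho> l \<omega>)))) < \<epsilon>"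
    unfolding E_def e2_def P_def of_real_mult by blast
qed

end

section \<open>The quasi maximum likelihood estimator\<close>

definition score_at :: "real \<Rightarrow> nat set set \<Rightarrow> real" where
  "score_at x \<pi> = - block_sum (\<lambda>j. \<Sum>i<j. 1 / (real i - x)) \<pi> - 1 / x"

text \<open>The slope, up to sign, of the secant of the score between \<open>x\<close> and \<open>y\<close>; for \<open>x = y = \<alpha>\<close> it is the
  information.\<close>

definition secant_information :: "real \<Rightarrow> real \<Rightarrow> nat set set \<Rightarrow> real" where
  "secant_information x y \<pi> = block_sum (\<lambda>j. \<Sum>i<j. 1 / ((real i - x) * (real i - y))) \<pi> - 1 / (x * y)"

text \<open>An exact identity, obtained from \<open>1 / (i - x) - 1 / (i - y)\<close>, instead of a Taylor expansion: it
  relates the score to the error of the estimator before anything is known about that error.\<close>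

lemma score_at_diff:
  assumes x: "0 < x" "x < 1" and y: "0 < y" "y < 1"
  shows "score_at x \<pi> - score_at y \<pi> = - (x - y) * secant_information x y \<pi>"
proof -
  have ne: "real i - z \<noteq> 0" if "0 < z" "z < 1" for i z
    using that by (cases i) auto
  have "1 / (real i - x) = 1 / (real i - y) + (x - y) * (1 / ((real i - x) * (real i - y)))" for i
    using ne[OF x, of i] ne[OF y, of i] by (simp add: divide_simps)
  then have "block_sum (\<lambda>j. \<Sum>i<j. 1 / (real i - x)) \<pi> = block_sum (\<lambda>j. \<Sum>i<j. 1 / (real i - y)) \<pi>
      + (x - y) * block_sum (\<lambda>j. \<Sum>i<j. 1 / ((real i - x) * (real i - y))) \<pi>"
    unfolding block_sum_def by (simp only: sum.distrib sum_distrib_left)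
  moreover have "1 / x = 1 / y - (x - y) * (1 / (x * y))" using x y by (simp add: field_simps)
  moreover have "- (Q + d * S) - (z - d * T) - (- Q - z) = - d * (S - T)" for Q d S z T :: real
    by (simp add: algebra_simps)
  ultimately show ?thesis unfolding score_at_def secant_information_def by (simp only:)
qed

text \<open>The terms with \<open>i > 0\<close> are nonnegative because \<open>x\<close> and \<open>y\<close> lie below all positive integers, and
  those with \<open>i = 0\<close> sum to \<open>(k - 1) / (x y)\<close>. Positivity gives uniqueness of the estimator, and growth
  with \<open>k\<close> gives its consistency.\<close>

lemma secant_information_ge:
  assumes pa: "partition_of n \<pi>" and x: "0 < x" "x < 1" and y: "0 < y" "y < 1" and k: "1 \<le> card \<pi>"
  shows "real (card \<pi>) - 1 \<le> secant_information x y \<pi>"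
proof -
  have pos: "0 \<le> 1 / ((real i - x) * (real i - y))" for i
    using x y by (cases i) (auto intro!: divide_nonneg_nonneg mult_nonneg_nonneg mult_nonpos_nonpos)
  have "block_sum (\<lambda>_. 1 / (x * y)) \<pi> \<le> block_sum (\<lambda>j. \<Sum>i<j. 1 / ((real i - x) * (real i - y))) \<pi>"
  proof (rule block_sum_mono[OF pa])
    fix j :: nat assume "1 \<le> j"
    then have "(\<Sum>i\<in>{0}. 1 / ((real i - x) * (real i - y))) \<le> (\<Sum>i<j. 1 / ((real i - x) * (real i - y)))"
      using pos by (intro sum_mono2) auto
    then show "1 / (x * y) \<le> (\<Sum>i<j. 1 / ((real i - x) * (real i - y)))" by simp
  qed
  then have "(real (card \<pi>) - 1) * (1 / (x * y)) \<le> secant_information x y \<pi>"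
    unfolding secant_information_def by (simp add: block_sum_def diff_divide_distrib)
  moreover have "x * y \<le> 1" using x y by (simp add: mult_le_one)
  then have "1 \<le> 1 / (x * y)" using x y by simp
  then have "(real (card \<pi>) - 1) * 1 \<le> (real (card \<pi>) - 1) * (1 / (x * y))"
    using k by (intro mult_left_mono) auto
  ultimately show ?thesis by simp
qed

lemma sum_blocks_of_size:
  assumes pa: "partition_of n \<pi>"
  shows "(\<Sum>j=2..n. real (blocks_of_size \<pi> j) * (\<Sum>i=1..j-1. g i)) = block_sum (\<lambda>j. \<Sum>i=1..j-1. g i) \<pi>"
proof -
  have sub: "card ` \<pi> \<subseteq> {1..n}"
  proof
    fix j assume "j \<in> card ` \<pi>"
    then obtain U where U: "U \<in> \<pi>" "j = card U" by auto
    have "card U \<le> card {1..n}" using block_subset[OF pa U(1)] by (intro card_mono) auto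
    then show "j \<in> {1..n}" using card_block_pos[OF pa U(1)] U by simp
  qed
  have "block_sum (\<lambda>j. \<Sum>i=1..j-1. g i) \<pi> = (\<Sum>j\<in>{1..n}. \<Sum>U\<in>{U\<in>\<pi>. card U = j}. \<Sum>i=1..card U-1. g i)"
    unfolding block_sum_def using finite_partition_of[OF pa] sub by (simp only: sum.group finite_atLeastAtMost)
  also have "\<dots> = (\<Sum>j\<in>{1..n}. real (blocks_of_size \<pi> j) * (\<Sum>i=1..j-1. g i))"
    by (intro sum.cong) (auto simp: blocks_of_size_def)
  also have "\<dots> = (\<Sum>j\<in>{2..n}. real (blocks_of_size \<pi> j) * (\<Sum>i=1..j-1. g i))"
  proof (rule sum.mono_neutral_right)
    show "\<forall>i\<in>{1..n} - {2..n}. real (blocks_of_size \<pi> i) * sum g {1..i - 1} = 0"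
    proof
      fix i assume "i \<in> {1..n} - {2..n}"
      then have "i = 1" by auto
      then show "real (blocks_of_size \<pi> i) * sum g {1..i - 1} = 0" by simp
    qed
  qed auto
  finally show ?thesis by simp
qed

lemma score_at_eq:
  assumes pa: "partition_of n \<pi>"
  shows "score_at x \<pi> = (real (card \<pi>) - 1) / x - block_sum (\<lambda>j. \<Sum>i=1..j-1. 1 / (real i - x)) \<pi>"
proof -
  have "(\<Sum>i<card U. 1 / (real i - x)) = - 1 / x + (\<Sum>i=1..card U-1. 1 / (real i - x))" if U: "U \<in> \<pi>" for U
  proof -
    have "{..<card U} = insert 0 {1..card U - 1}" using card_block_pos[OF pa U] by auto
    then show ?thesis by simp
  qed
  then have "block_sum (\<lambda>j. \<Sum>i<j. 1 / (real i - x)) \<pi> = real (card \<pi>) * (- 1 / x) + block_sum (\<lambda>j. \<Sum>i=1..j-1. 1 / (real i - x)) \<pi>"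
    unfolding block_sum_def by (simp add: sum.distrib sum_subtractf)
  then show ?thesis by (simp add: score_at_def diff_divide_distrib)
qed

lemma score_at_root:
  assumes pa: "partition_of n \<pi>" and k: "1 < card \<pi>" "card \<pi> < n"
  shows "\<exists>x. 0 < x \<and> x < 1 \<and> score_at x \<pi> = 0"
proof -
  (* so close to the endpoints of the unit interval the pole there, of size at least 1 / b, exceeds
     all other terms, which are at most 2 n in total *)
  define b where "b = 1 / (2 * real n + 1)"
  have n: "2 \<le> real n" using k by simp
  have b: "0 < b" "b \<le> 1 / 5" using n by (auto simp: b_def field_simps)
  have kk: "1 \<le> real (card \<pi>) - 1" "real (card \<pi>) - 1 \<le> real n" using k by auto
  have "score_at (1 - b) \<pi> \<le> 0"
  proof -
    have "\<exists>U\<in>\<pi>. 2 \<le> card U"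
    proof (rule ccontr)
      assume "\<not> (\<exists>U\<in>\<pi>. 2 \<le> card U)"
      then have "(\<Sum>U\<in>\<pi>. real (card U)) \<le> (\<Sum>U\<in>\<pi>. 1)" by (intro sum_mono) force
      then show False using block_sum_size[OF pa] k by (simp add: block_sum_def)
    qed
    then obtain U where U: "U \<in> \<pi>" "2 \<le> card U" by blast
    have pos: "0 \<le> (\<Sum>i=1..card V-1. 1 / (real i - (1 - b)))" for V :: "nat set"
      using b by (intro sum_nonneg) auto
    have "1 / b \<le> (\<Sum>i=1..card U-1. 1 / (real i - (1 - b)))"
    proof -
      have "(\<Sum>i\<in>{1}. 1 / (real i - (1 - b))) \<le> (\<Sum>i=1..card U-1. 1 / (real i - (1 - b)))"
        using U b by (intro sum_mono2) auto
      then show ?thesis by simp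
    qed
    also have "\<dots> \<le> block_sum (\<lambda>j. \<Sum>i=1..j-1. 1 / (real i - (1 - b))) \<pi>"
      unfolding block_sum_def using U finite_partition_of[OF pa] pos
      by (intro member_le_sum) auto
    finally have "2 * real n + 1 \<le> block_sum (\<lambda>j. \<Sum>i=1..j-1. 1 / (real i - (1 - b))) \<pi>" by (simp add: b_def)
    moreover have "(real (card \<pi>) - 1) / (1 - b) \<le> 2 * real n"
    proof -
      have "(real (card \<pi>) - 1) \<le> 2 * real n * (1 - b)"
      proof -
        have "real (card \<pi>) - 1 \<le> 2 * real n * (1 / 2)" using kk by simp
        also have "\<dots> \<le> 2 * real n * (1 - b)" using b by (intro mult_left_mono) auto
        finally show ?thesis .
      qed
      then show ?thesis using b by (simp add: field_simps)
    qed
    ultimately show ?thesis unfolding score_at_eq[OF pa] by linarith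
  qed
  moreover have "0 \<le> score_at b \<pi>"
  proof -
    have "block_sum (\<lambda>j. \<Sum>i=1..j-1. 1 / (real i - b)) \<pi> \<le> block_sum (\<lambda>j. 2 * real j) \<pi>"
    proof (rule block_sum_mono[OF pa])
      fix j :: nat assume "1 \<le> j"
      have "(\<Sum>i=1..j-1. 1 / (real i - b)) \<le> (\<Sum>i=1..j-1. 2)"
      proof (rule sum_mono)
        fix i assume "i \<in> {1..j - 1}"
        then have "1 / 2 \<le> real i - b" using b by auto
        then show "1 / (real i - b) \<le> 2" by (simp add: field_simps)
      qed
      also have "\<dots> \<le> 2 * real j" by simp
      finally show "(\<Sum>i=1..j-1. 1 / (real i - b)) \<le> 2 * real j" .
    qed
    also have "\<dots> = 2 * real n" using block_sum_size[OF pa] by (simp add: block_sum_def flip: sum_distrib_left)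
    finally have upper: "block_sum (\<lambda>j. \<Sum>i=1..j-1. 1 / (real i - b)) \<pi> \<le> 2 * real n" .
    have "2 * real n \<le> 1 * (2 * real n + 1)" by simp
    also have "1 * (2 * real n + 1) \<le> (real (card \<pi>) - 1) * (2 * real n + 1)"
      using kk by (intro mult_right_mono) auto
    also have "(real (card \<pi>) - 1) * (2 * real n + 1) = (real (card \<pi>) - 1) / b"
      by (simp add: b_def)
    finally have "2 * real n \<le> (real (card \<pi>) - 1) / b" .
    then show ?thesis unfolding score_at_eq[OF pa] using upper by simp
  qed
  moreover have "continuous_on {b..1 - b} (\<lambda>x. score_at x \<pi>)"
    unfolding score_at_def block_sum_def
  proof (intro continuous_intros ballI)
    fix i :: nat and x assume "x \<in> {b..1 - b}"
    then have "0 < x" "x < 1" using b by auto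
    then show "real i - x \<noteq> 0" by (cases i) auto
  qed (use b in auto)
  ultimately obtain x where "b \<le> x" "x \<le> 1 - b" "score_at x \<pi> = 0"
    using IVT2'[of "\<lambda>x. score_at x \<pi>" "1 - b" 0 b] b by auto
  then show ?thesis using b by (intro exI[of _ x]) auto
qed

lemma qmle_root:
  assumes pa: "partition_of n \<pi>" and k: "1 < card \<pi>" "card \<pi> < n"
  shows "0 < qmle n \<pi>" "qmle n \<pi> < 1" "score_at (qmle n \<pi>) \<pi> = 0"
proof -
  obtain x where x: "0 < x" "x < 1" "score_at x \<pi> = 0" using score_at_root[OF assms] by blast
  have uniq: "y = x" if y: "0 < y" "y < 1" "score_at y \<pi> = 0" for y
  proof -
    have "(x - y) * secant_information x y \<pi> = 0"
      using score_at_diff[OF x(1,2) y(1,2), of \<pi>] x(3) y(3) by auto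
    moreover have "0 < secant_information x y \<pi>"
      using secant_information_ge[OF pa x(1,2) y(1,2)] k by simp
    ultimately show ?thesis by auto
  qed
  have "qmle n \<pi> = (THE x. 0 < x \<and> x < 1 \<and> score_at x \<pi> = 0)"
    unfolding qmle_def score_at_eq[OF pa] sum_blocks_of_size[OF pa] using k by simp
  also have "\<dots> = x" by (rule the_equality) (use x in simp, use uniq in blast)
  finally show "0 < qmle n \<pi>" "qmle n \<pi> < 1" "score_at (qmle n \<pi>) \<pi> = 0" using x by auto
qed

section \<open>A second order expansion\<close>

text \<open>Taylor's formula with Peano remainder, by the mean value inequality applied to the remainder; its
  derivative is controlled by differentiability of \<open>deriv f\<close> at \<open>1\<close>.\<close>

lemma second_order_expansion:
  fixes f :: "real \<Rightarrow> real"
  assumes d: "0 < \<delta>" and f: "\<forall>x\<in>{1 - \<delta><..<1 + \<delta>}. f differentiable (at x) \<and> deriv f differentiable (at x)"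
    and e: "0 < \<epsilon>"
  shows "\<exists>r>0. \<forall>h. \<bar>h\<bar> < r \<longrightarrow> \<bar>f (1 + h) - f 1 - deriv f 1 * h - deriv (deriv f) 1 / 2 * h\<^sup>2\<bar> \<le> \<epsilon> * h\<^sup>2"
proof -
  have "(deriv f has_real_derivative deriv (deriv f) 1) (at 1)"
    using f d by (intro DERIV_deriv_iff_real_differentiable[THEN iffD2]) auto
  then have "((\<lambda>h. (deriv f (1 + h) - deriv f 1) / h) \<longlongrightarrow> deriv (deriv f) 1) (at 0)"
    by (simp add: DERIV_def)
  then obtain r0 where r0: "0 < r0"
    "\<And>h. h \<noteq> 0 \<Longrightarrow> \<bar>h\<bar> < r0 \<Longrightarrow> \<bar>(deriv f (1 + h) - deriv f 1) / h - deriv (deriv f) 1\<bar> < \<epsilon>"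
    using e unfolding LIM_eq by (metis diff_zero real_norm_def)
  have slope: "\<bar>deriv f (1 + h) - deriv f 1 - deriv (deriv f) 1 * h\<bar> \<le> \<epsilon> * \<bar>h\<bar>" if "\<bar>h\<bar> < r0" for h
  proof (cases "h = 0")
    case False
    have "deriv f (1 + h) - deriv f 1 - deriv (deriv f) 1 * h = ((deriv f (1 + h) - deriv f 1) / h - deriv (deriv f) 1) * h"
      using False by (simp add: field_simps)
    then show ?thesis using r0(2)[OF False that] by (simp add: abs_mult mult_right_mono)
  qed simp
  define r where "r = min r0 \<delta>"
  have "\<bar>f (1 + h) - f 1 - deriv f 1 * h - deriv (deriv f) 1 / 2 * h\<^sup>2\<bar> \<le> \<epsilon> * h\<^sup>2" if h: "\<bar>h\<bar> < r" for h
  proof -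
    define g where "g y = f (1 + y) - deriv f 1 * y - deriv (deriv f) 1 / 2 * y\<^sup>2" for y
    have "norm (g h - g 0) \<le> \<epsilon> * \<bar>h\<bar> * norm (h - 0)"
    proof (rule field_differentiable_bound[where S = "cball 0 \<bar>h\<bar>" and f' = "\<lambda>y. deriv f (1 + y) - deriv f 1 - deriv (deriv f) 1 * y"])
      fix y :: real assume y: "y \<in> cball 0 \<bar>h\<bar>"
      then have yr: "\<bar>y\<bar> < r" "\<bar>y\<bar> \<le> \<bar>h\<bar>" using h by auto
      have "(f has_real_derivative deriv f (1 + y)) (at (1 + y))"
      proof -
        have "1 + y \<in> {1 - \<delta><..<1 + \<delta>}" using yr by (auto simp: r_def abs_less_iff)
        then show ?thesis using f by (intro DERIV_deriv_iff_real_differentiable[THEN iffD2]) blast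
      qed
      then have "((\<lambda>y. f (1 + y)) has_real_derivative deriv f (1 + y)) (at y)"
        using DERIV_shift[of f "deriv f (1 + y)" y 1] by (simp add: add.commute)
      then have "(g has_real_derivative deriv f (1 + y) - deriv f 1 - deriv (deriv f) 1 * y) (at y)"
        unfolding g_def by (auto intro!: derivative_eq_intros)
      then show "(g has_real_derivative deriv f (1 + y) - deriv f 1 - deriv (deriv f) 1 * y) (at y within cball 0 \<bar>h\<bar>)"
        by (rule has_field_derivative_at_within)
      show "norm (deriv f (1 + y) - deriv f 1 - deriv (deriv f) 1 * y) \<le> \<epsilon> * \<bar>h\<bar>"
        using slope[of y] yr e by (simp add: r_def) (smt (verit) mult_left_mono)
    qed auto
    then show ?thesis by (simp add: g_def power2_eq_square algebra_simps)
  qed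
  moreover have "0 < r" using r0 d by (simp add: r_def)
  ultimately show ?thesis by blast
qed

context partition_chain
begin

section \<open>Convergence in probability as a filter\<close>

text \<open>The sets of pairs whose probability under the chain tends to one. Convergence along this filter is
  convergence in probability of statistics of the chain, so the calculus of limits along filters
  applies to them; elementary operations on random variables need no separate treatment.\<close>

definition in_prob :: "(nat \<times> nat set set) filter" where
  "in_prob = Abs_filter (\<lambda>Q. (\<lambda>n. prob {\<omega>\<in>space M. \<not> Q (n, \<rho> n \<omega>)}) \<longlonglongrightarrow> 0)"

lemma eventually_in_prob:
  "eventually Q in_prob \<longleftrightarrow> (\<lambda>n. prob {\<omega>\<in>space M. \<not> Q (n, \<rho> n \<omega>)}) \<longlonglongrightarrow> 0"
  unfolding in_prob_def
proof (rule eventually_Abs_filter, rule is_filter.intro)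
  have mono: "(\<lambda>n. prob {\<omega>\<in>space M. \<not> Q (n, \<rho> n \<omega>)}) \<longlonglongrightarrow> 0"
    if "x \<longlonglongrightarrow> 0" "\<And>n. 1 \<le> n \<Longrightarrow> prob {\<omega>\<in>space M. \<not> Q (n, \<rho> n \<omega>)} \<le> x n" for Q x
    by (rule tendsto_sandwich[OF _ _ tendsto_const that(1)])
      (auto intro!: always_eventually eventually_mono[OF eventually_ge_at_top[of 1] that(2)])
  show "(\<lambda>n. prob {\<omega> \<in> space M. \<not> True}) \<longlonglongrightarrow> 0" by simp
  fix P Q :: "nat \<times> nat set set \<Rightarrow> bool"
  {
    assume "(\<lambda>n. prob {\<omega> \<in> space M. \<not> P (n, \<rho> n \<omega>)}) \<longlonglongrightarrow> 0" "(\<lambda>n. prob {\<omega> \<in> space M. \<not> Q (n, \<rho> n \<omega>)}) \<longlonglongrightarrow> 0"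
    then have "(\<lambda>n. prob {\<omega> \<in> space M. \<not> P (n, \<rho> n \<omega>)} + prob {\<omega> \<in> space M. \<not> Q (n, \<rho> n \<omega>)}) \<longlonglongrightarrow> 0"
      using tendsto_add by fastforce
    then show "(\<lambda>n. prob {\<omega> \<in> space M. \<not> (P (n, \<rho> n \<omega>) \<and> Q (n, \<rho> n \<omega>))}) \<longlonglongrightarrow> 0"
    proof (rule mono[of _ "\<lambda>x. P x \<and> Q x"])
      fix n :: nat assume n: "1 \<le> n"
      have "{\<omega> \<in> space M. \<not> (P (n, \<rho> n \<omega>) \<and> Q (n, \<rho> n \<omega>))} = {\<omega> \<in> space M. \<not> P (n, \<rho> n \<omega>)} \<union> {\<omega> \<in> space M. \<not> Q (n, \<rho> n \<omega>)}"
        by auto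
      then show "prob {\<omega> \<in> space M. \<not> (P (n, \<rho> n \<omega>) \<and> Q (n, \<rho> n \<omega>))} \<le> prob {\<omega> \<in> space M. \<not> P (n, \<rho> n \<omega>)} + prob {\<omega> \<in> space M. \<not> Q (n, \<rho> n \<omega>)}"
        using measure_Un_le[OF sets_rho[OF n, of "\<lambda>\<pi>. \<not> P (n, \<pi>)"] sets_rho[OF n, of "\<lambda>\<pi>. \<not> Q (n, \<pi>)"]] by simp
    qed
  next
    assume PQ: "\<forall>x. P x \<longrightarrow> Q x" and P: "(\<lambda>n. prob {\<omega> \<in> space M. \<not> P (n, \<rho> n \<omega>)}) \<longlonglongrightarrow> 0"
    show "(\<lambda>n. prob {\<omega> \<in> space M. \<not> Q (n, \<rho> n \<omega>)}) \<longlonglongrightarrow> 0"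
    proof (rule mono[OF P])
      fix n :: nat assume n: "1 \<le> n"
      show "prob {\<omega> \<in> space M. \<not> Q (n, \<rho> n \<omega>)} \<le> prob {\<omega> \<in> space M. \<not> P (n, \<rho> n \<omega>)}"
        using PQ sets_rho[OF n, of "\<lambda>\<pi>. \<not> P (n, \<pi>)"] by (intro finite_measure_mono) auto
    qed
  }
qed

lemma prob_rho:
  assumes "1 \<le> n"
  shows "prob {\<omega>\<in>space M. Q (\<rho> n \<omega>)} = expectation (\<lambda>\<omega>. if Q (\<rho> n \<omega>) then 1 else 0)"
proof -
  have "expectation (\<lambda>\<omega>. if Q (\<rho> n \<omega>) then 1 else 0) = expectation (indicat_real {\<omega>\<in>space M. Q (\<rho> n \<omega>)})"
    by (intro Bochner_Integration.integral_cong) (auto simp: indicator_def)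
  then show ?thesis using sets_rho[OF assms] by (simp add: Int_absorb1 subset_eq)
qed

lemma markov_rho:
  assumes n: "1 \<le> n" and b: "0 < b" and "\<And>\<pi>. partition_of n \<pi> \<Longrightarrow> 0 \<le> F \<pi>"
    and "\<And>\<pi>. partition_of n \<pi> \<Longrightarrow> Q \<pi> \<Longrightarrow> b \<le> F \<pi>"
  shows "prob {\<omega>\<in>space M. Q (\<rho> n \<omega>)} \<le> expectation (\<lambda>\<omega>. F (\<rho> n \<omega>)) / b"
proof -
  have "expectation (\<lambda>\<omega>. if Q (\<rho> n \<omega>) then 1 else 0) \<le> expectation (\<lambda>\<omega>. F (\<rho> n \<omega>) / b)"
    using assms by (intro expectation_rho_mono[OF n]) auto
  then show ?thesis unfolding prob_rho[OF n] by simp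
qed

lemma in_prob_sequentially: "eventually P sequentially \<Longrightarrow> eventually (\<lambda>x. P (fst x)) in_prob"
proof -
  assume "eventually P sequentially"
  then have "eventually (\<lambda>n. 0 = prob {\<omega>\<in>space M. \<not> P (fst (n, \<rho> n \<omega>))}) sequentially"
    by eventually_elim simp
  then show ?thesis unfolding eventually_in_prob by (rule Lim_transform_eventually[OF tendsto_const])
qed

lemma in_prob_partition: "eventually (\<lambda>x. 1 \<le> fst x \<and> partition_of (fst x) (snd x)) in_prob"
proof -
  have "eventually (\<lambda>n. 0 = prob {\<omega>\<in>space M. \<not> (1 \<le> fst (n, \<rho> n \<omega>) \<and> partition_of (fst (n, \<rho> n \<omega>)) (snd (n, \<rho> n \<omega>)))}) sequentially"
    using eventually_ge_at_top[of 1]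
  proof eventually_elim
    case (elim n)
    then have "{\<omega>\<in>space M. \<not> (1 \<le> fst (n, \<rho> n \<omega>) \<and> partition_of (fst (n, \<rho> n \<omega>)) (snd (n, \<rho> n \<omega>)))} = {}"
      using rho_partition by auto
    then show ?case by (simp only: measure_empty)
  qed
  then show ?thesis unfolding eventually_in_prob by (rule Lim_transform_eventually[OF tendsto_const])
qed

lemma in_prob_size: "filterlim (\<lambda>x. real (fst x)) at_top in_prob"
  unfolding filterlim_at_top
proof
  fix Z :: real
  have "eventually (\<lambda>n. Z \<le> real n) sequentially"
    using filterlim_real_sequentially unfolding filterlim_at_top by blast
  then show "\<forall>\<^sub>F x in in_prob. Z \<le> real (fst x)" by (rule in_prob_sequentially)
qed

lemma in_prob_L1:
  fixes F :: "nat \<Rightarrow> nat set set \<Rightarrow> real"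
  assumes "(\<lambda>n. expectation (\<lambda>\<omega>. \<bar>F n (\<rho> n \<omega>)\<bar>)) \<longlonglongrightarrow> 0"
  shows "((\<lambda>x. F (fst x) (snd x)) \<longlongrightarrow> 0) in_prob"
proof (rule tendstoI)
  fix e :: real assume e: "0 < e"
  have lim: "(\<lambda>n. expectation (\<lambda>\<omega>. \<bar>F n (\<rho> n \<omega>)\<bar>) / e) \<longlonglongrightarrow> 0"
    using tendsto_divide[OF assms tendsto_const[of e]] e by simp
  show "\<forall>\<^sub>F x in in_prob. dist (F (fst x) (snd x)) 0 < e"
    unfolding eventually_in_prob
  proof (rule tendsto_sandwich[OF _ _ tendsto_const lim])
    show "\<forall>\<^sub>F n in sequentially. prob {\<omega> \<in> space M. \<not> dist (F (fst (n, \<rho> n \<omega>)) (snd (n, \<rho> n \<omega>))) 0 < e}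
        \<le> expectation (\<lambda>\<omega>. \<bar>F n (\<rho> n \<omega>)\<bar>) / e"
      using eventually_ge_at_top[of 1]
    proof eventually_elim
      case (elim n)
      show ?case using markov_rho[OF elim e, of "\<lambda>\<pi>. \<bar>F n \<pi>\<bar>" "\<lambda>\<pi>. \<not> \<bar>F n \<pi>\<bar> < e"] by simp
    qed
  qed auto
qed

text \<open>Partitions on which the number of blocks and the score are of their usual order.\<close>

definition typical :: "real \<Rightarrow> (nat \<times> nat set set) set" where
  "typical K = {(n, \<pi>). 1 / K \<le> R n \<pi> \<and> R n \<pi> \<le> K \<and> \<bar>score \<pi>\<bar> \<le> K * real n powr (\<alpha> / 2)}"

lemma typical_likely:
  assumes \<epsilon>: "0 < \<epsilon>"
  shows "\<exists>K>0. \<forall>n\<ge>1. prob {\<omega>\<in>space M. (n, \<rho> n \<omega>) \<notin> typical K} \<le> \<epsilon>"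
proof -
  define e where "e = \<epsilon> / 3"
  have e: "0 < e" using \<epsilon> by (simp add: e_def)
  obtain \<delta> where \<delta>: "0 < \<delta>" "\<And>n. 1 \<le> n \<Longrightarrow> prob {\<omega>\<in>space M. R n (\<rho> n \<omega>) < \<delta>} \<le> e"
    using R_not_small[OF e] by blast
  obtain C where C: "0 \<le> C" "\<And>n. 1 \<le> n \<Longrightarrow> expectation (\<lambda>\<omega>. R n (\<rho> n \<omega>)) \<le> C"
    using expectation_R_bounded by blast
  obtain Q where Q: "0 \<le> Q" "\<And>n. 1 \<le> n \<Longrightarrow> expectation (\<lambda>\<omega>. (score (\<rho> n \<omega>))\<^sup>2) \<le> Q * real n powr \<alpha>"
    using expectation_score_square by blast
  define K where "K = max 1 (max (1 / \<delta>) (max (C / e) (Q / e)))"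
  have K: "1 \<le> K" "1 / \<delta> \<le> K" "C / e \<le> K" "Q / e \<le> K" by (auto simp: K_def)
  have "prob {\<omega>\<in>space M. (n, \<rho> n \<omega>) \<notin> typical K} \<le> \<epsilon>" if n: "1 \<le> n" for n
  proof -
    let ?A = "{\<omega>\<in>space M. R n (\<rho> n \<omega>) < \<delta>}"
    let ?B = "{\<omega>\<in>space M. K < R n (\<rho> n \<omega>)}"
    let ?C = "{\<omega>\<in>space M. K * real n powr (\<alpha> / 2) < \<bar>score (\<rho> n \<omega>)\<bar>}"
    have "1 / K \<le> \<delta>" using K \<delta> by (simp add: field_simps)
    then have "{\<omega>\<in>space M. (n, \<rho> n \<omega>) \<notin> typical K} \<subseteq> ?A \<union> (?B \<union> ?C)"
      by (auto simp: typical_def)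
    then have "prob {\<omega>\<in>space M. (n, \<rho> n \<omega>) \<notin> typical K} \<le> prob (?A \<union> (?B \<union> ?C))"
      using sets_rho[OF n] by (intro finite_measure_mono) auto
    also have "\<dots> \<le> prob ?A + (prob ?B + prob ?C)"
      by (intro order_trans[OF measure_Un_le] add_left_mono measure_Un_le sets.Un sets_rho[OF n])
    also have "\<dots> \<le> e + (e + e)"
    proof (intro add_mono \<delta>(2)[OF n])
      have "prob ?B \<le> expectation (\<lambda>\<omega>. R n (\<rho> n \<omega>)) / K"
        using K by (intro markov_rho[OF n]) (auto simp: R_nonneg)
      also have "\<dots> \<le> C / K" using C(2)[OF n] K by (intro divide_right_mono) auto
      also have "\<dots> \<le> e" using K(1,3) e by (simp add: field_simps)
      finally show "prob ?B \<le> e" .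
      have "prob ?C \<le> expectation (\<lambda>\<omega>. (score (\<rho> n \<omega>))\<^sup>2) / (K * real n powr \<alpha>)"
      proof (rule markov_rho[OF n])
        fix \<pi> assume "K * real n powr (\<alpha> / 2) < \<bar>score \<pi>\<bar>"
        then have "(K * real n powr (\<alpha> / 2))\<^sup>2 \<le> \<bar>score \<pi>\<bar>\<^sup>2"
          using K by (intro power_mono) auto
        moreover have "(real n powr (\<alpha> / 2))\<^sup>2 = real n powr \<alpha>"
          by (simp add: power2_eq_square flip: powr_add)
        moreover have "K * 1 \<le> K * K" using K by (intro mult_left_mono) auto
        then have "K * real n powr \<alpha> \<le> K\<^sup>2 * real n powr \<alpha>" by (simp add: power2_eq_square mult_right_mono)
        ultimately show "K * real n powr \<alpha> \<le> (score \<pi>)\<^sup>2" by (simp add: power_mult_distrib)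
      qed (use K n in auto)
      also have "\<dots> \<le> Q * real n powr \<alpha> / (K * real n powr \<alpha>)"
        using Q(2)[OF n] K by (intro divide_right_mono) auto
      also have "\<dots> = Q / K" using n by simp
      also have "\<dots> \<le> e" using K(1,4) e by (simp add: field_simps)
      finally show "prob ?C \<le> e" .
    qed
    also have "\<dots> = \<epsilon>" by (simp add: e_def)
    finally show ?thesis .
  qed
  then show ?thesis using K(1) by (intro exI[of _ K]) auto
qed

text \<open>Typical sets have probability arbitrarily close to one, uniformly in \<open>n\<close>. Convergence in probability
  may therefore be proved with deterministic bounds for the stochastically bounded quantities.\<close>

lemma in_prob_localize:
  fixes g :: "nat \<times> nat set set \<Rightarrow> real"
  assumes "\<And>K. 0 < K \<Longrightarrow> (g \<longlongrightarrow> 0) (inf in_prob (principal (typical K)))"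
  shows "(g \<longlongrightarrow> 0) in_prob"
proof (rule tendstoI)
  fix e :: real assume e: "0 < e"
  show "\<forall>\<^sub>F x in in_prob. dist (g x) 0 < e"
    unfolding eventually_in_prob
  proof (rule LIMSEQ_I)
    fix r :: real assume r: "0 < r"
    obtain K where K: "0 < K" "\<And>n. 1 \<le> n \<Longrightarrow> prob {\<omega>\<in>space M. (n, \<rho> n \<omega>) \<notin> typical K} \<le> r / 2"
      using typical_likely[of "r / 2"] r by auto
    have "\<forall>\<^sub>F x in inf in_prob (principal (typical K)). dist (g x) 0 < e"
      using assms[OF K(1)] e by (rule tendstoD)
    then have "\<forall>\<^sub>F x in in_prob. x \<in> typical K \<longrightarrow> dist (g x) 0 < e"
      by (simp add: eventually_inf_principal)
    then have "\<forall>\<^sub>F n in sequentially. prob {\<omega>\<in>space M. \<not> ((n, \<rho> n \<omega>) \<in> typical K \<longrightarrow> dist (g (n, \<rho> n \<omega>)) 0 < e)} < r / 2"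
      unfolding eventually_in_prob using r by (intro order_tendstoD) auto
    then have "\<forall>\<^sub>F n in sequentially. prob {\<omega>\<in>space M. \<not> dist (g (n, \<rho> n \<omega>)) 0 < e} < r"
      using eventually_ge_at_top[of 1]
    proof eventually_elim
      case (elim n)
      let ?A = "{\<omega>\<in>space M. \<not> ((n, \<rho> n \<omega>) \<in> typical K \<longrightarrow> dist (g (n, \<rho> n \<omega>)) 0 < e)}"
      let ?B = "{\<omega>\<in>space M. (n, \<rho> n \<omega>) \<notin> typical K}"
      have A: "?A \<in> sets M" and B: "?B \<in> sets M"
        using sets_rho[OF elim(2), of "\<lambda>\<pi>. \<not> ((n, \<pi>) \<in> typical K \<longrightarrow> dist (g (n, \<pi>)) 0 < e)"]
          sets_rho[OF elim(2), of "\<lambda>\<pi>. (n, \<pi>) \<notin> typical K"] by auto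
      have "prob {\<omega>\<in>space M. \<not> dist (g (n, \<rho> n \<omega>)) 0 < e} \<le> prob (?A \<union> ?B)"
        using A B by (intro finite_measure_mono) auto
      also have "\<dots> \<le> prob ?A + prob ?B" by (intro measure_Un_le A B)
      also have "\<dots> < r" using elim(1) K(2)[OF elim(2)] by simp
      finally show ?case .
    qed
    then show "\<exists>no. \<forall>n\<ge>no. norm (prob {\<omega> \<in> space M. \<not> dist (g (n, \<rho> n \<omega>)) 0 < e} - 0) < r"
      by (simp add: eventually_sequentially)
  qed
qed

section \<open>The chi-square distance\<close>

definition chi_square :: "nat \<Rightarrow> nat set set \<Rightarrow> real" where
  "chi_square n \<pi> = (\<Sum>s\<in>slots \<pi>. (predictive_estimate n \<pi> s - p n \<pi> s)\<^sup>2 / p n \<pi> s)"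

lemma p_pos:
  assumes "1 \<le> n" "partition_of n \<pi>" "s \<in> slots \<pi>"
  shows "0 < p n \<pi> s"
  using assms(3)
proof (cases rule: slots_cases)
  case 1
  have "0 < \<kappa> * real (card \<pi>) / real n" using kappa_pos card_partition_pos[OF assms(2,1)] assms(1) by simp
  then show ?thesis using p_None_ge[OF assms(1,2)] 1 by simp
next
  case (2 U)
  have "1 \<le> real (card U)" using card_block_pos[OF assms(2) 2(2)] by simp
  then show ?thesis using 2 p_Some[OF assms(1,2)] w_pos[OF assms(1,2)] alpha_less_1 by simp
qed

lemma sum_predictive_estimate:
  assumes "1 \<le> n" "partition_of n \<pi>"
  shows "(\<Sum>s\<in>slots \<pi>. predictive_estimate n \<pi> s) = 1"
proof -
  have "(\<Sum>U\<in>\<pi>. (real (card U) - qmle n \<pi>) / real n) = (real n - real (card \<pi>) * qmle n \<pi>) / real n"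
    using block_sum_size[OF assms(2)] by (simp add: block_sum_def sum_subtractf flip: sum_divide_distrib)
  then show ?thesis using assms(1)
    by (simp add: sum_slots[OF assms(2)] predictive_estimate_def diff_divide_distrib)
qed

text \<open>For a block \<open>U\<close> the difference between estimate and probability is \<open>z (|U| - \<alpha>) - a / n\<close>, and the
  probability is \<open>w (|U| - \<alpha>)\<close>. Expanding the square, the sum over the blocks involves only
  \<open>inverse_sizes\<close>, the number of blocks and \<open>n\<close>.\<close>

lemma chi_square_eq:
  assumes n: "1 \<le> n" and pa: "partition_of n \<pi>"
  defines "a \<equiv> qmle n \<pi> - \<alpha>" and "z \<equiv> 1 / real n - w n \<pi>"
  shows "chi_square n \<pi> = (real (card \<pi>) / real n * (\<alpha> + a) - p n \<pi> None)\<^sup>2 / p n \<pi> None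
     + (a\<^sup>2 / ((real n)\<^sup>2 * w n \<pi>) * inverse_sizes \<pi> - 2 * a * z * real (card \<pi>) / (real n * w n \<pi>)
        + z\<^sup>2 * (real n - \<alpha> * real (card \<pi>)) / w n \<pi>)"
proof -
  have x: "0 < real n" using n by simp
  have w: "0 < w n \<pi>" by (rule w_pos[OF n pa])
  have "(predictive_estimate n \<pi> (Some U) - p n \<pi> (Some U))\<^sup>2 / p n \<pi> (Some U)
     = a\<^sup>2 / ((real n)\<^sup>2 * w n \<pi>) * (1 / (real (card U) - \<alpha>)) - 2 * a * z / (real n * w n \<pi>) + z\<^sup>2 / w n \<pi> * (real (card U) - \<alpha>)"
    if U: "U \<in> \<pi>" for U
  proof -
    define y where "y = real (card U) - \<alpha>"
    have y: "0 < y" using card_block_pos[OF pa U] alpha_less_1 by (simp add: y_def)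
    have "predictive_estimate n \<pi> (Some U) - p n \<pi> (Some U) = z * y - a / real n"
      using p_Some[OF n pa U] by (simp add: predictive_estimate_def a_def z_def y_def diff_divide_distrib left_diff_distrib)
    moreover have "(z * y - a / real n)\<^sup>2 / (w n \<pi> * y)
       = a\<^sup>2 / ((real n)\<^sup>2 * w n \<pi>) * (1 / y) - 2 * a * z / (real n * w n \<pi>) + z\<^sup>2 / w n \<pi> * y"
      using x w y by (simp add: power2_eq_square divide_simps) (simp add: algebra_simps)
    ultimately show ?thesis using p_Some[OF n pa U] by (simp add: y_def)
  qed
  then have "(\<Sum>U\<in>\<pi>. (predictive_estimate n \<pi> (Some U) - p n \<pi> (Some U))\<^sup>2 / p n \<pi> (Some U))
    = (\<Sum>U\<in>\<pi>. a\<^sup>2 / ((real n)\<^sup>2 * w n \<pi>) * (1 / (real (card U) - \<alpha>)) - 2 * a * z / (real n * w n \<pi>) + z\<^sup>2 / w n \<pi> * (real (card U) - \<alpha>))"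
    by (rule sum.cong[OF refl])
  also have "\<dots> = a\<^sup>2 / ((real n)\<^sup>2 * w n \<pi>) * inverse_sizes \<pi> - real (card \<pi>) * (2 * a * z / (real n * w n \<pi>))
       + z\<^sup>2 / w n \<pi> * (\<Sum>U\<in>\<pi>. real (card U) - \<alpha>)"
    unfolding inverse_sizes_def block_sum_def
    by (simp only: sum.distrib[of _ "\<lambda>U. z\<^sup>2 / w n \<pi> * (real (card U) - \<alpha>)"] sum_subtractf[of _ "\<lambda>_. 2 * a * z / (real n * w n \<pi>)"] sum_distrib_left sum_constant)
  also have "(\<Sum>U\<in>\<pi>. real (card U) - \<alpha>) = real n - \<alpha> * real (card \<pi>)"
    using block_sum_size[OF pa] by (simp add: block_sum_def sum_subtractf)
  finally show ?thesis
    unfolding chi_square_def sum_slots[OF pa]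
    by (simp add: predictive_estimate_def a_def mult_ac)
qed

text \<open>Both vectors sum to one, so the linear term of the expansion of \<open>f\<close> at \<open>1\<close> drops out.\<close>

lemma f_divergence_chi_square:
  assumes n: "1 \<le> n" and pa: "partition_of n \<pi>"
    and ratio: "\<And>s. s \<in> slots \<pi> \<Longrightarrow> \<bar>predictive_estimate n \<pi> s / p n \<pi> s - 1\<bar> < r"
    and f: "\<And>h. \<bar>h\<bar> < r \<Longrightarrow> \<bar>f (1 + h) - A * h - B * h\<^sup>2\<bar> \<le> \<epsilon> * h\<^sup>2"
  shows "\<bar>f_divergence f (slots \<pi>) (predictive_estimate n \<pi>) (p n \<pi>) - B * chi_square n \<pi>\<bar> \<le> \<epsilon> * chi_square n \<pi>"
proof -
  define q where "q = predictive_estimate n \<pi>"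
  define h where "h s = q s / p n \<pi> s - 1" for s
  have pos: "0 < p n \<pi> s" if "s \<in> slots \<pi>" for s by (rule p_pos[OF n pa that])
  have ph: "p n \<pi> s * h s = q s - p n \<pi> s" "p n \<pi> s * (h s)\<^sup>2 = (q s - p n \<pi> s)\<^sup>2 / p n \<pi> s" if "s \<in> slots \<pi>" for s
    using pos[OF that] by (auto simp: h_def power2_eq_square field_simps)
  have sum0: "(\<Sum>s\<in>slots \<pi>. p n \<pi> s * h s) = 0"
    using sum_predictive_estimate[OF n pa] sum_p[OF n pa] by (simp add: ph(1) sum_subtractf q_def)
  have chi: "(\<Sum>s\<in>slots \<pi>. p n \<pi> s * (h s)\<^sup>2) = chi_square n \<pi>"
    by (simp add: ph(2) chi_square_def q_def)
  have "f_divergence f (slots \<pi>) q (p n \<pi>) = (\<Sum>s\<in>slots \<pi>. p n \<pi> s * f (1 + h s))"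
    unfolding f_divergence_def by (simp add: h_def)
  also have "\<dots> - B * chi_square n \<pi> = (\<Sum>s\<in>slots \<pi>. p n \<pi> s * (f (1 + h s) - A * h s - B * (h s)\<^sup>2))"
    using sum0 unfolding chi[symmetric]
    by (simp add: right_diff_distrib sum_subtractf mult.left_commute[of _ A] mult.left_commute[of _ B] flip: sum_distrib_left)
  also have "\<bar>\<dots>\<bar> \<le> (\<Sum>s\<in>slots \<pi>. \<bar>p n \<pi> s * (f (1 + h s) - A * h s - B * (h s)\<^sup>2)\<bar>)" by (rule sum_abs)
  also have "\<dots> \<le> (\<Sum>s\<in>slots \<pi>. \<epsilon> * (p n \<pi> s * (h s)\<^sup>2))"
  proof (rule sum_mono)
    fix s assume s: "s \<in> slots \<pi>"
    have "\<bar>f (1 + h s) - A * h s - B * (h s)\<^sup>2\<bar> \<le> \<epsilon> * (h s)\<^sup>2"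
      using ratio[OF s] by (intro f) (simp add: h_def q_def)
    then have "p n \<pi> s * \<bar>f (1 + h s) - A * h s - B * (h s)\<^sup>2\<bar> \<le> p n \<pi> s * (\<epsilon> * (h s)\<^sup>2)"
      using pos[OF s] by (intro mult_left_mono) auto
    then show "\<bar>p n \<pi> s * (f (1 + h s) - A * h s - B * (h s)\<^sup>2)\<bar> \<le> \<epsilon> * (p n \<pi> s * (h s)\<^sup>2)"
      using pos[OF s] by (simp add: abs_mult mult_ac)
  qed
  also have "\<dots> = \<epsilon> * chi_square n \<pi>" unfolding chi[symmetric] by (simp add: sum_distrib_left)
  finally show ?thesis by (simp only: q_def)
qed

text \<open>A bound that is uniform over the slots. It brings all ratios into the range where the second order
  expansion of \<open>f\<close> is valid.\<close>

lemma ratio_le: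
  assumes n: "1 \<le> n" and pa: "partition_of n \<pi>" and s: "s \<in> slots \<pi>"
  defines "a \<equiv> qmle n \<pi> - \<alpha>"
  shows "\<bar>predictive_estimate n \<pi> s / p n \<pi> s - 1\<bar> \<le>
     \<bar>a\<bar> / (real n * w n \<pi> * (1 - \<alpha>)) + (c / real n) / (real n * w n \<pi>)
      + (\<bar>a\<bar> + c / real (card \<pi>)) / (real n * p n \<pi> None / real (card \<pi>))"
proof -
  define x where "x = real n"
  define k where "k = real (card \<pi>)"
  have x: "0 < x" and k: "0 < k" using n card_partition_pos[OF pa n] by (auto simp: x_def k_def)
  have w: "0 < w n \<pi>" by (rule w_pos[OF n pa])
  have p0: "0 < p n \<pi> None" using p_pos[OF n pa] by (simp add: slots_def)
  have t: "0 \<le> \<bar>a\<bar> / (x * w n \<pi> * (1 - \<alpha>))" "0 \<le> (c / x) / (x * w n \<pi>)" "0 \<le> (\<bar>a\<bar> + c / k) / (x * p n \<pi> None / k)"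
    using x w k p0 c_nonneg alpha_less_1 by auto
  from s show ?thesis
  proof (cases rule: slots_cases)
    case 1
    have "predictive_estimate n \<pi> s / p n \<pi> s - 1 = (k * qmle n \<pi> / x - p n \<pi> None) / p n \<pi> None"
      using 1 p0 by (simp add: predictive_estimate_def x_def k_def diff_divide_distrib)
    also have "k * qmle n \<pi> / x - p n \<pi> None = k * a / x - (p n \<pi> None - \<alpha> * k / x)"
      by (simp add: a_def algebra_simps diff_divide_distrib)
    also have "\<bar>(k * a / x - (p n \<pi> None - \<alpha> * k / x)) / p n \<pi> None\<bar> \<le> (k * \<bar>a\<bar> / x + c / x) / p n \<pi> None"
    proof -
      have "\<bar>k * a / x - (p n \<pi> None - \<alpha> * k / x)\<bar> \<le> \<bar>k * a / x\<bar> + \<bar>p n \<pi> None - \<alpha> * k / x\<bar>"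
        by (rule abs_triangle_ineq4)
      also have "\<dots> \<le> k * \<bar>a\<bar> / x + c / x"
        using p_None_approx[OF n pa] k x by (intro add_mono) (auto simp: abs_mult k_def x_def)
      finally show ?thesis using p0 by (simp add: abs_divide divide_right_mono)
    qed
    also have "\<dots> = (\<bar>a\<bar> + c / k) / (x * p n \<pi> None / k)" using x k p0 by (simp add: field_simps)
    finally show ?thesis using t unfolding x_def[symmetric] k_def[symmetric] by linarith
  next
    case (2 U)
    define y where "y = real (card U) - \<alpha>"
    have y: "1 - \<alpha> \<le> y" "0 < y" using card_block_pos[OF pa 2(2)] alpha_less_1 by (auto simp: y_def)
    have "predictive_estimate n \<pi> s / p n \<pi> s - 1 = (1 / x - w n \<pi>) / w n \<pi> - a / (x * w n \<pi> * y)"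
      using 2 p_Some[OF n pa 2(2)] w y x unfolding y_def[symmetric]
      by (simp add: predictive_estimate_def a_def y_def x_def divide_simps) (simp add: algebra_simps)
    also have "\<bar>\<dots>\<bar> \<le> \<bar>(1 / x - w n \<pi>) / w n \<pi>\<bar> + \<bar>a / (x * w n \<pi> * y)\<bar>" by (rule abs_triangle_ineq4)
    also have "\<dots> \<le> (c / x) / (x * w n \<pi>) + \<bar>a\<bar> / (x * w n \<pi> * (1 - \<alpha>))"
    proof (rule add_mono)
      have "\<bar>1 / x - w n \<pi>\<bar> / w n \<pi> \<le> (c / x\<^sup>2) / w n \<pi>"
        using w_approx[OF n pa] w by (intro divide_right_mono) (auto simp: x_def abs_minus_commute)
      then show "\<bar>(1 / x - w n \<pi>) / w n \<pi>\<bar> \<le> (c / x) / (x * w n \<pi>)" using w by (simp add: power2_eq_square)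
      have "\<bar>a\<bar> / (x * w n \<pi> * y) \<le> \<bar>a\<bar> / (x * w n \<pi> * (1 - \<alpha>))"
        using x w y alpha_less_1 by (intro divide_left_mono mult_left_mono mult_pos_pos) auto
      then show "\<bar>a / (x * w n \<pi> * y)\<bar> \<le> \<bar>a\<bar> / (x * w n \<pi> * (1 - \<alpha>))" using x w y by simp
    qed
    finally show ?thesis using t unfolding x_def[symmetric] k_def[symmetric] by linarith
  qed
qed

end

lemma bounded_times_null:
  fixes b h :: "'b \<Rightarrow> real"
  assumes "eventually (\<lambda>x. \<bar>b x\<bar> \<le> C) F" "(h \<longlongrightarrow> 0) F"
  shows "((\<lambda>x. b x * h x) \<longlongrightarrow> 0) F"
proof (rule Lim_null_comparison)
  show "\<forall>\<^sub>F x in F. norm (b x * h x) \<le> C * \<bar>h x\<bar>"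
    using assms(1) by eventually_elim (simp add: abs_mult mult_right_mono)
  show "((\<lambda>x. C * \<bar>h x\<bar>) \<longlongrightarrow> 0) F"
    using tendsto_mult_right_zero[OF tendsto_rabs_zero[OF assms(2)]] .
qed

context partition_chain
begin

lemma score_at_alpha: "score_at \<alpha> = score"
  by (simp add: fun_eq_iff score_at_def score_def)

text \<open>The bound \<open>\<bar>i - x\<bar> \<ge> c0\<close> allows each term to be compared with its value at \<open>x = \<alpha>\<close>.\<close>

lemma secant_information_close:
  assumes c0: "0 < c0" "2 * c0 \<le> \<alpha>" "2 * c0 \<le> 1 - \<alpha>" and x: "\<bar>x - \<alpha>\<bar> \<le> c0"
  shows "\<bar>secant_information x \<alpha> \<pi> - information \<pi>\<bar> \<le> \<bar>x - \<alpha>\<bar> / c0 * (information \<pi> + 2 / \<alpha>\<^sup>2)"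
proof -
  define a where "a = x - \<alpha>"
  define S where "S = block_sum (\<lambda>j. \<Sum>i<j. 1 / (real i - \<alpha>)\<^sup>2) \<pi>"
  have xb: "c0 \<le> x" "x \<le> 1 - c0" using c0 x by (auto simp: abs_le_iff)
  have far: "c0 \<le> \<bar>real i - x\<bar>" for i using xb by (cases i) auto
  have ne: "real i - \<alpha> \<noteq> 0" for i using alpha_pos alpha_less_1 by (cases i) auto
  have term_le: "\<bar>1 / ((real i - x) * (real i - \<alpha>)) - 1 / (real i - \<alpha>)\<^sup>2\<bar> \<le> \<bar>a\<bar> / c0 * (1 / (real i - \<alpha>)\<^sup>2)" for i
  proof -
    have "real i - x \<noteq> 0" using far[of i] c0 by auto
    then have "1 / ((real i - x) * (real i - \<alpha>)) - 1 / (real i - \<alpha>)\<^sup>2 = a / (real i - x) * (1 / (real i - \<alpha>)\<^sup>2)"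
      using ne[of i] by (simp add: a_def power2_eq_square divide_simps)
    also have "\<bar>\<dots>\<bar> = \<bar>a\<bar> / \<bar>real i - x\<bar> * (1 / (real i - \<alpha>)\<^sup>2)" by (simp add: abs_mult)
    also have "\<dots> \<le> \<bar>a\<bar> / c0 * (1 / (real i - \<alpha>)\<^sup>2)"
      using far[of i] c0 \<open>real i - x \<noteq> 0\<close> by (intro mult_right_mono divide_left_mono mult_pos_pos) auto
    finally show ?thesis .
  qed
  have "\<bar>block_sum (\<lambda>j. \<Sum>i<j. 1 / ((real i - x) * (real i - \<alpha>))) \<pi> - S\<bar>
     = \<bar>\<Sum>U\<in>\<pi>. \<Sum>i<card U. 1 / ((real i - x) * (real i - \<alpha>)) - 1 / (real i - \<alpha>)\<^sup>2\<bar>"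
    by (simp add: S_def block_sum_def sum_subtractf)
  also have "\<dots> \<le> (\<Sum>U\<in>\<pi>. \<Sum>i<card U. \<bar>a\<bar> / c0 * (1 / (real i - \<alpha>)\<^sup>2))"
    by (intro order_trans[OF sum_abs] sum_mono term_le)
  also have "\<dots> = \<bar>a\<bar> / c0 * S" by (simp only: S_def block_sum_def sum_distrib_left)
  finally have 1: "\<bar>block_sum (\<lambda>j. \<Sum>i<j. 1 / ((real i - x) * (real i - \<alpha>))) \<pi> - S\<bar> \<le> \<bar>a\<bar> / c0 * S" .
  have "1 / \<alpha>\<^sup>2 - 1 / (x * \<alpha>) = a / x * (1 / \<alpha>\<^sup>2)"
    using xb c0 alpha_pos by (simp add: a_def power2_eq_square divide_simps)
  also have "\<bar>\<dots>\<bar> = \<bar>a\<bar> / x * (1 / \<alpha>\<^sup>2)" using xb c0 by (simp add: abs_mult)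
  also have "\<dots> \<le> \<bar>a\<bar> / c0 * (1 / \<alpha>\<^sup>2)"
    using xb c0 by (intro mult_right_mono divide_left_mono) auto
  finally have 2: "\<bar>1 / \<alpha>\<^sup>2 - 1 / (x * \<alpha>)\<bar> \<le> \<bar>a\<bar> / c0 * (1 / \<alpha>\<^sup>2)" .
  have "secant_information x \<alpha> \<pi> - information \<pi>
     = (block_sum (\<lambda>j. \<Sum>i<j. 1 / ((real i - x) * (real i - \<alpha>))) \<pi> - S) + (1 / \<alpha>\<^sup>2 - 1 / (x * \<alpha>))"
    by (simp add: secant_information_def information_def S_def)
  also have "\<bar>\<dots>\<bar> \<le> \<bar>a\<bar> / c0 * S + \<bar>a\<bar> / c0 * (1 / \<alpha>\<^sup>2)"
    by (rule order_trans[OF abs_triangle_ineq add_mono[OF 1 2]])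
  also have "\<dots> = \<bar>a\<bar> / c0 * (information \<pi> + 2 / \<alpha>\<^sup>2)"
    by (simp add: information_def S_def distrib_left right_diff_distrib)
  finally show ?thesis by (simp only: a_def)
qed

text \<open>With \<open>Z = Y\<^sup>2 / k\<close> and \<open>W = k a\<^sup>2\<close>, where \<open>a\<close> is the error of the estimator, the steps are:
  \<open>a\<close> tends to \<open>0\<close> by the secant identity; then \<open>B / k\<close> tends to \<open>I\<close>, so that \<open>W \<approx> Z / I\<^sup>2\<close>; the
  formula for the chi-square distance gives \<open>n \<chi>\<^sup>2 \<approx> W / \<alpha> + W (\<alpha> I - 1 / \<alpha>) = \<alpha> I W\<close>; and finally
  \<open>n D \<approx> (f''(1) / 2) n \<chi>\<^sup>2\<close>.\<close>

lemma divergence_on_typical: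
  fixes f :: "real \<Rightarrow> real"
  assumes K: "0 < K" and f1: "f 1 = 0" and \<delta>: "0 < \<delta>"
    and f: "\<forall>x\<in>{1 - \<delta><..<1 + \<delta>}. f differentiable (at x) \<and> deriv f differentiable (at x)"
  shows "((\<lambda>x. real (fst x) * f_divergence f (slots (snd x)) (predictive_estimate (fst x) (snd x)) (p (fst x) (snd x))
       - \<alpha> * deriv (deriv f) 1 / 2 * (std_score (snd x))\<^sup>2) \<longlongrightarrow> 0) (inf in_prob (principal (typical K)))"
proof -
  define F where "F = inf in_prob (principal (typical K))"
  define N where "N x = real (fst x)" for x :: "nat \<times> nat set set"
  define k where "k x = real (card (snd x))" for x :: "nat \<times> nat set set"
  define r where "r x = R (fst x) (snd x)" for x
  define Y where "Y x = score (snd x)" for x :: "nat \<times> nat set set"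
  define q where "q x = qmle (fst x) (snd x)" for x
  define a where "a x = q x - \<alpha>" for x
  define B where "B x = secant_information (q x) \<alpha> (snd x)" for x
  define p0 where "p0 x = p (fst x) (snd x) None" for x
  define v where "v x = w (fst x) (snd x)" for x
  define H where "H x = information (snd x)" for x :: "nat \<times> nat set set"
  define G where "G x = inverse_sizes (snd x)" for x :: "nat \<times> nat set set"
  define I where "I = fisher"
  define g where "g = \<alpha> * I - 1 / \<alpha>"
  have I: "0 < I" by (simp add: I_def fisher_pos)
  have F_le: "F \<le> in_prob" by (simp add: F_def)
  have good: "\<forall>\<^sub>F x in F. 1 \<le> fst x \<and> partition_of (fst x) (snd x) \<and> x \<in> typical K"
    using in_prob_partition unfolding F_def eventually_inf_principal by eventually_elim simp
  have N_top: "filterlim N at_top F"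
    using filterlim_mono[OF in_prob_size order_refl F_le] by (simp add: N_def[abs_def])
  have N_null: "((\<lambda>x. C * N x powr (-s)) \<longlongrightarrow> 0) F" if "0 < s" for s C
    by (intro tendsto_mult_right_zero tendsto_neg_powr N_top) (use that in simp)
  have basic: "\<forall>\<^sub>F x in F. 1 \<le> N x \<and> 1 \<le> k x \<and> k x \<le> N x \<and> 1 / K \<le> r x \<and> r x \<le> K
      \<and> \<bar>Y x\<bar> \<le> K * N x powr (\<alpha> / 2) \<and> 0 < p0 x \<and> 0 < v x
      \<and> \<bar>N x * p0 x - \<alpha> * k x\<bar> \<le> c \<and> \<bar>(N x)\<^sup>2 * (1 / N x - v x)\<bar> \<le> c"
    using good
  proof eventually_elim
    case (elim x)
    then have n: "1 \<le> fst x" and pa: "partition_of (fst x) (snd x)" and t: "x \<in> typical K" by auto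
    have N1: "1 \<le> N x" using n by (simp add: N_def)
    have "\<bar>p0 x - \<alpha> * k x / N x\<bar> \<le> c / N x" using p_None_approx[OF n pa] by (simp add: p0_def k_def N_def)
    then have "N x * \<bar>p0 x - \<alpha> * k x / N x\<bar> \<le> N x * (c / N x)" using N1 by (intro mult_left_mono) auto
    moreover have "N x * \<bar>p0 x - \<alpha> * k x / N x\<bar> = \<bar>N x * (p0 x - \<alpha> * k x / N x)\<bar>" using N1 by (simp add: abs_mult)
    moreover have "N x * (p0 x - \<alpha> * k x / N x) = N x * p0 x - \<alpha> * k x" using N1 by (simp add: right_diff_distrib)
    ultimately have 1: "\<bar>N x * p0 x - \<alpha> * k x\<bar> \<le> c" using N1 by simp
    have "\<bar>v x - 1 / N x\<bar> \<le> c / (N x)\<^sup>2" using w_approx[OF n pa] by (simp add: v_def N_def)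
    then have "(N x)\<^sup>2 * \<bar>v x - 1 / N x\<bar> \<le> (N x)\<^sup>2 * (c / (N x)\<^sup>2)" by (intro mult_left_mono) auto
    then have 2: "\<bar>(N x)\<^sup>2 * (1 / N x - v x)\<bar> \<le> c" using N1 by (simp add: abs_mult abs_minus_commute)
    show ?case
      using t n 1 2 card_partition_pos[OF pa n] card_partition_le[OF pa]
        p_pos[OF n pa, of None] w_pos[OF n pa]
      by (auto simp: typical_def N_def k_def r_def Y_def p0_def v_def slots_def split_beta)
  qed
  have k_r: "\<forall>\<^sub>F x in F. k x = N x powr \<alpha> * r x"
    using good by eventually_elim (simp add: card_eq_R k_def N_def r_def)
  have r_inv: "\<forall>\<^sub>F x in F. 1 / r x \<le> K \<and> 0 < r x"
    using basic
  proof eventually_elim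
    case (elim x)
    then have "1 / K \<le> r x" "0 < 1 / K" using K by auto
    then have "0 < r x" "1 / K \<le> r x" by linarith+
    then show ?case using K by (simp add: field_simps)
  qed
  have k_inv_le: "\<forall>\<^sub>F x in F. 1 / k x \<le> K * N x powr (-\<alpha>)"
    using k_r r_inv
  proof eventually_elim
    case (elim x)
    then have "1 / k x = 1 / r x * N x powr (-\<alpha>)" by (simp add: powr_minus_divide)
    also have "\<dots> \<le> K * N x powr (-\<alpha>)" using elim by (intro mult_right_mono) auto
    finally show ?case .
  qed
  have k_inv: "((\<lambda>x. 1 / k x) \<longlongrightarrow> 0) F"
  proof (rule Lim_null_comparison[OF _ N_null[OF alpha_pos]])
    show "\<forall>\<^sub>F x in F. norm (1 / k x) \<le> K * N x powr (-\<alpha>)"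
      using k_inv_le basic by eventually_elim simp
  qed
  have N_inv: "((\<lambda>x. 1 / N x) \<longlongrightarrow> 0) F"
  proof (rule Lim_null_comparison[OF _ k_inv])
    show "\<forall>\<^sub>F x in F. norm (1 / N x) \<le> 1 / k x"
      using basic by eventually_elim (simp add: frac_le)
  qed
  have kN: "((\<lambda>x. k x / N x) \<longlongrightarrow> 0) F"
  proof (rule Lim_null_comparison[OF _ N_null[of "1 - \<alpha>" K]])
    show "\<forall>\<^sub>F x in F. norm (k x / N x) \<le> K * N x powr (- (1 - \<alpha>))"
      using basic k_r
    proof eventually_elim
      case (elim x)
      then have "k x / N x = r x * N x powr (- (1 - \<alpha>))" by (simp add: powr_diff)
      also have "\<dots> \<le> K * N x powr (- (1 - \<alpha>))" using elim by (intro mult_right_mono) auto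
      finally show ?case using elim by simp
    qed
  qed (use alpha_less_1 in auto)
  have k_big: "\<forall>\<^sub>F x in F. 2 < k x"
  proof -
    have "\<forall>\<^sub>F x in F. 1 / k x < 1 / 2" by (rule order_tendstoD(2)[OF k_inv]) simp
    then show ?thesis using basic by eventually_elim (simp add: field_simps)
  qed
  have k_small: "\<forall>\<^sub>F x in F. k x < N x"
  proof -
    have "\<forall>\<^sub>F x in F. k x / N x < 1" by (rule order_tendstoD(2)[OF kN]) simp
    then show ?thesis using basic by eventually_elim (simp add: field_simps)
  qed
  have root: "\<forall>\<^sub>F x in F. Y x = a x * B x \<and> k x / 2 \<le> B x"
    using good k_big k_small
  proof eventually_elim
    case (elim x)
    then have pa: "partition_of (fst x) (snd x)" by simp
    have k: "1 < card (snd x)" "card (snd x) < fst x" using elim by (auto simp: k_def N_def)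
    note root = qmle_root[OF pa k]
    have "score_at (q x) (snd x) - score_at \<alpha> (snd x) = - (q x - \<alpha>) * B x"
      unfolding q_def B_def by (rule score_at_diff[OF root(1,2) alpha_pos alpha_less_1])
    then have "0 - Y x = - a x * B x" using root(3) by (simp only: score_at_alpha Y_def a_def q_def)
    then have "Y x = a x * B x" by simp
    moreover have "k x - 1 \<le> B x"
      unfolding B_def k_def q_def using k by (intro secant_information_ge[OF pa root(1,2) alpha_pos alpha_less_1]) auto
    ultimately show ?case using elim by simp
  qed
  have Yk: "((\<lambda>x. \<bar>Y x\<bar> / k x) \<longlongrightarrow> 0) F"
  proof (rule Lim_null_comparison[OF _ N_null[of "\<alpha> / 2" "K * K"]])
    show "\<forall>\<^sub>F x in F. norm (\<bar>Y x\<bar> / k x) \<le> K * K * N x powr (- (\<alpha> / 2))"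
      using basic k_inv_le
    proof eventually_elim
      case (elim x)
      have "\<bar>Y x\<bar> * (1 / k x) \<le> (K * N x powr (\<alpha> / 2)) * (K * N x powr (-\<alpha>))"
        using elim by (intro mult_mono) auto
      also have "\<dots> = K * K * (N x powr (\<alpha> / 2) * N x powr (-\<alpha>))" by (simp only: mult_ac)
      also have "N x powr (\<alpha> / 2) * N x powr (-\<alpha>) = N x powr (- (\<alpha> / 2))" by (simp flip: powr_add)
      finally show ?case using elim by simp
    qed
  qed (use alpha_pos in auto)
  have a_null: "(a \<longlongrightarrow> 0) F"
  proof (rule Lim_null_comparison[OF _ tendsto_mult_right_zero[OF Yk, of 2]])
    show "\<forall>\<^sub>F x in F. norm (a x) \<le> 2 * (\<bar>Y x\<bar> / k x)"
      using root basic
    proof eventually_elim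
      case (elim x)
      have "\<bar>a x\<bar> * (k x / 2) \<le> \<bar>a x\<bar> * B x" using elim by (intro mult_left_mono) auto
      also have "\<dots> = \<bar>Y x\<bar>" using elim by (simp add: abs_mult)
      finally show ?case using elim by (simp add: field_simps)
    qed
  qed
  have ratio_lim: "((\<lambda>x. T (snd x) / k x) \<longlongrightarrow> l) F"
    if "(\<lambda>n. expectation (\<lambda>\<omega>. \<bar>T (\<rho> n \<omega>) - l * real (card (\<rho> n \<omega>))\<bar>) / real n powr \<alpha>) \<longlonglongrightarrow> 0" for T l
  proof -
    have "((\<lambda>x. (T (snd x) - l * real (card (snd x))) / real (fst x) powr \<alpha>) \<longlongrightarrow> 0) in_prob"
      using that by (intro in_prob_L1[where F = "\<lambda>n \<pi>. (T \<pi> - l * real (card \<pi>)) / real n powr \<alpha>"]) (simp add: abs_divide)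
    then have null: "((\<lambda>x. (T (snd x) - l * k x) / N x powr \<alpha>) \<longlongrightarrow> 0) F"
      using tendsto_mono[OF F_le] by (simp add: k_def N_def)
    have "((\<lambda>x. T (snd x) / k x - l) \<longlongrightarrow> 0) F"
    proof (rule Lim_transform_eventually)
      show "((\<lambda>x. 1 / r x * ((T (snd x) - l * k x) / N x powr \<alpha>)) \<longlongrightarrow> 0) F"
        by (rule bounded_times_null[OF _ null, of _ K]) (use r_inv in eventually_elim, simp)
      show "\<forall>\<^sub>F x in F. 1 / r x * ((T (snd x) - l * k x) / N x powr \<alpha>) = T (snd x) / k x - l"
        using basic r_inv k_r
      proof eventually_elim
        case (elim x)
        then have "1 / r x * ((T (snd x) - l * k x) / N x powr \<alpha>) = (T (snd x) - l * k x) / k x"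
          by simp
        also have "\<dots> = T (snd x) / k x - l" using elim by (simp add: diff_divide_distrib)
        finally show ?case .
      qed
    qed
    then show ?thesis by (rule LIM_zero_cancel)
  qed
  have Hk: "((\<lambda>x. H x / k x) \<longlongrightarrow> I) F"
    unfolding H_def I_def by (rule ratio_lim[OF information_lln])
  have Gk: "((\<lambda>x. G x / k x) \<longlongrightarrow> g) F"
    unfolding G_def g_def I_def by (rule ratio_lim[OF inverse_sizes_lln])
  define c0 where "c0 = min \<alpha> (1 - \<alpha>) / 2"
  have c0: "0 < c0" "2 * c0 \<le> \<alpha>" "2 * c0 \<le> 1 - \<alpha>" using alpha_pos alpha_less_1 by (auto simp: c0_def)
  have Bk: "((\<lambda>x. B x / k x) \<longlongrightarrow> I) F"
  proof -
    have "((\<lambda>x. \<bar>a x\<bar> / c0 * (H x / k x + 2 / \<alpha>\<^sup>2 * (1 / k x))) \<longlongrightarrow> \<bar>0\<bar> / c0 * (I + 2 / \<alpha>\<^sup>2 * 0)) F"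
      using c0 by (intro tendsto_intros a_null Hk k_inv) auto
    then have null: "((\<lambda>x. \<bar>a x\<bar> / c0 * (H x / k x + 2 / \<alpha>\<^sup>2 * (1 / k x))) \<longlongrightarrow> 0) F" by simp
    have "\<forall>\<^sub>F x in F. \<bar>a x\<bar> < c0" using order_tendstoD(2)[OF tendsto_rabs_zero[OF a_null] c0(1)] .
    then have "\<forall>\<^sub>F x in F. norm (B x / k x - H x / k x) \<le> \<bar>a x\<bar> / c0 * (H x / k x + 2 / \<alpha>\<^sup>2 * (1 / k x))"
      using basic
    proof eventually_elim
      case (elim x)
      have "\<bar>B x - H x\<bar> \<le> \<bar>a x\<bar> / c0 * (H x + 2 / \<alpha>\<^sup>2)"
        unfolding B_def H_def a_def using elim by (intro secant_information_close[OF c0]) (simp add: a_def)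
      then have "\<bar>B x - H x\<bar> / k x \<le> \<bar>a x\<bar> / c0 * (H x + 2 / \<alpha>\<^sup>2) / k x"
        using elim by (intro divide_right_mono) auto
      moreover have "norm (B x / k x - H x / k x) = \<bar>B x - H x\<bar> / k x"
        using elim by (simp add: abs_divide flip: diff_divide_distrib)
      moreover have "\<bar>a x\<bar> / c0 * (H x + 2 / \<alpha>\<^sup>2) / k x = \<bar>a x\<bar> / c0 * (H x / k x + 2 / \<alpha>\<^sup>2 * (1 / k x))"
        by (simp add: add_divide_distrib distrib_left)
      ultimately show ?case by linarith
    qed
    then have "((\<lambda>x. B x / k x - H x / k x) \<longlongrightarrow> 0) F" by (rule Lim_null_comparison[OF _ null])
    then have "((\<lambda>x. (B x / k x - H x / k x) + H x / k x) \<longlongrightarrow> 0 + I) F" by (intro tendsto_add Hk)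
    then show ?thesis by simp
  qed
  define Z where "Z x = (Y x)\<^sup>2 / k x" for x
  define W where "W x = k x * (a x)\<^sup>2" for x
  have Z_le: "\<forall>\<^sub>F x in F. \<bar>Z x\<bar> \<le> K ^ 3"
    using basic k_inv_le
  proof eventually_elim
    case (elim x)
    have "(Y x)\<^sup>2 \<le> (K * N x powr (\<alpha> / 2))\<^sup>2"
      using elim by (intro iffD1[OF abs_le_square_iff]) auto
    also have "\<dots> = K\<^sup>2 * N x powr \<alpha>"
      by (simp add: power_mult_distrib) (simp add: power2_eq_square flip: powr_add)
    finally have "(Y x)\<^sup>2 * (1 / k x) \<le> (K\<^sup>2 * N x powr \<alpha>) * (K * N x powr (-\<alpha>))"
      using elim by (intro mult_mono) auto
    also have "\<dots> = K ^ 3" using elim by (simp add: powr_minus_divide power2_eq_square power3_eq_cube)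
    finally show ?case using elim by (simp add: Z_def)
  qed
  have W_eq: "\<forall>\<^sub>F x in F. W x = Z x * (1 / (B x / k x)\<^sup>2)"
    using root basic
  proof eventually_elim
    case (elim x)
    then have "0 < B x" "0 < k x" by linarith+
    then show ?case using elim by (simp add: W_def Z_def power_mult_distrib power_divide) (simp add: power2_eq_square)
  qed
  have Bk_inv: "((\<lambda>x. 1 / (B x / k x)\<^sup>2) \<longlongrightarrow> 1 / I\<^sup>2) F"
    using I by (intro tendsto_intros Bk) auto
  have WZ: "((\<lambda>x. W x - Z x / I\<^sup>2) \<longlongrightarrow> 0) F"
  proof (rule Lim_transform_eventually)
    show "((\<lambda>x. Z x * (1 / (B x / k x)\<^sup>2 - 1 / I\<^sup>2)) \<longlongrightarrow> 0) F"
      by (rule bounded_times_null[OF Z_le LIM_zero[OF Bk_inv]])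
    show "\<forall>\<^sub>F x in F. Z x * (1 / (B x / k x)\<^sup>2 - 1 / I\<^sup>2) = W x - Z x / I\<^sup>2"
      using W_eq by eventually_elim (simp only: right_diff_distrib times_divide_eq_right mult_1_right)
  qed
  have W_le: "\<forall>\<^sub>F x in F. \<bar>W x\<bar> \<le> K ^ 3 / I\<^sup>2 + 1"
  proof -
    have "\<forall>\<^sub>F x in F. \<bar>W x - Z x / I\<^sup>2\<bar> < 1" using order_tendstoD(2)[OF tendsto_rabs_zero[OF WZ]] by simp
    then show ?thesis using Z_le
    proof eventually_elim
      case (elim x)
      have "\<bar>Z x / I\<^sup>2\<bar> \<le> K ^ 3 / I\<^sup>2" using elim by (simp add: abs_divide divide_right_mono)
      then show ?case using elim by linarith
    qed
  qed
  (* d and e are the errors of the two parts of the predictive simplex, scaled to be bounded;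
     r0 and nw are the factors by which the probabilities differ from their leading terms *)
  define r0 where "r0 x = N x * p0 x / k x" for x
  define d where "d x = \<alpha> * k x - N x * p0 x" for x
  define nw where "nw x = N x * v x" for x
  define e where "e x = (N x)\<^sup>2 * (1 / N x - v x)" for x
  have d_le: "\<forall>\<^sub>F x in F. \<bar>d x\<bar> \<le> c" using basic by eventually_elim (simp add: d_def abs_minus_commute)
  have e_le: "\<forall>\<^sub>F x in F. \<bar>e x\<bar> \<le> c" using basic by eventually_elim (simp add: e_def)
  have r0_lim: "(r0 \<longlongrightarrow> \<alpha>) F"
  proof -
    have "((\<lambda>x. d x * (1 / k x)) \<longlongrightarrow> 0) F" by (rule bounded_times_null[OF d_le k_inv])
    then have "((\<lambda>x. \<alpha> - d x * (1 / k x)) \<longlongrightarrow> \<alpha> - 0) F" by (intro tendsto_intros)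
    moreover have "\<forall>\<^sub>F x in F. \<alpha> - d x * (1 / k x) = r0 x"
      using basic by eventually_elim (simp add: d_def r0_def field_simps)
    ultimately show ?thesis using Lim_transform_eventually by fastforce
  qed
  have nw_lim: "(nw \<longlongrightarrow> 1) F"
  proof -
    have "((\<lambda>x. e x * (1 / N x)) \<longlongrightarrow> 0) F" by (rule bounded_times_null[OF e_le N_inv])
    then have "((\<lambda>x. 1 - e x * (1 / N x)) \<longlongrightarrow> 1 - 0) F" by (intro tendsto_intros)
    moreover have "\<forall>\<^sub>F x in F. 1 - e x * (1 / N x) = nw x"
      using basic by eventually_elim (simp add: e_def nw_def power2_eq_square field_simps)
    ultimately show ?thesis using Lim_transform_eventually by fastforce
  qed
  define \<chi>\<^sub>2 where "\<chi>\<^sub>2 x = N x * chi_square (fst x) (snd x)" for x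
  have chi_eq: "\<forall>\<^sub>F x in F. \<chi>\<^sub>2 x = W x * (1 / r0 x) + (2 * (d x * a x) + d x * (d x * (1 / k x))) * (1 / r0 x)
      + (W x * (G x / k x * (1 / nw x)) - 2 * (e x * (a x * (k x / N x) * (1 / nw x)))
         + e x * (e x * ((1 - \<alpha> * (k x / N x)) * (1 / N x) * (1 / nw x))))"
    using good basic
  proof eventually_elim
    case (elim x)
    then have n: "1 \<le> fst x" and pa: "partition_of (fst x) (snd x)" by auto
    have pos: "0 < N x" "0 < k x" "0 < p0 x" "0 < v x" using elim by auto
    have E: "chi_square (fst x) (snd x) = (k x / N x * (\<alpha> + a x) - p0 x)\<^sup>2 / p0 x
      + ((a x)\<^sup>2 / ((N x)\<^sup>2 * v x) * G x - 2 * a x * (1 / N x - v x) * k x / (N x * v x)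
         + (1 / N x - v x)\<^sup>2 * (N x - \<alpha> * k x) / v x)"
      using chi_square_eq[OF n pa] unfolding N_def k_def a_def q_def p0_def v_def G_def .
    have z: "1 / N x - v x = e x / (N x)\<^sup>2" using pos by (simp add: e_def)
    have t1: "N x * ((k x / N x * (\<alpha> + a x) - p0 x)\<^sup>2 / p0 x)
       = W x * (1 / r0 x) + (2 * (d x * a x) + d x * (d x * (1 / k x))) * (1 / r0 x)"
    proof -
      have "k x / N x * (\<alpha> + a x) - p0 x = (k x * a x + d x) / N x"
        using pos by (simp add: d_def field_simps)
      then have "N x * ((k x / N x * (\<alpha> + a x) - p0 x)\<^sup>2 / p0 x) = (k x * a x + d x)\<^sup>2 / (N x * p0 x)"
        using pos by (simp add: power_divide power2_eq_square)
      also have "\<dots> = (k x * (a x)\<^sup>2 + 2 * (d x * a x) + d x * (d x * (1 / k x))) / r0 x"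
        using pos by (simp add: r0_def power2_eq_square divide_simps) (simp add: algebra_simps)
      finally show ?thesis by (simp add: W_def distrib_right add_divide_distrib)
    qed
    have t2: "N x * ((a x)\<^sup>2 / ((N x)\<^sup>2 * v x) * G x) = W x * (G x / k x * (1 / nw x))"
      using pos by (simp add: W_def nw_def power2_eq_square)
    have t3: "N x * (2 * a x * (e x / (N x)\<^sup>2) * k x / (N x * v x)) = 2 * (e x * (a x * (k x / N x) * (1 / nw x)))"
      using pos by (simp add: nw_def power2_eq_square)
    have t4: "N x * ((e x / (N x)\<^sup>2)\<^sup>2 * (N x - \<alpha> * k x) / v x) = e x * (e x * ((1 - \<alpha> * (k x / N x)) * (1 / N x) * (1 / nw x)))"
      using pos by (simp add: nw_def power2_eq_square divide_simps)
    have split: "N x * (b1 + (b2 - b3 + b4)) = N x * b1 + (N x * b2 - N x * b3 + N x * b4)" for b1 b2 b3 b4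
      by (simp only: distrib_left right_diff_distrib)
    show ?case unfolding \<chi>\<^sub>2_def E z split t1 t2 t3 t4 by (rule refl)
  qed
  have chi_lim: "((\<lambda>x. \<chi>\<^sub>2 x - \<alpha> * I * W x) \<longlongrightarrow> 0) F"
  proof (rule Lim_transform_eventually)
    have nw_inv: "((\<lambda>x. 1 / nw x) \<longlongrightarrow> 1 / 1) F" by (intro tendsto_intros nw_lim) simp
    have r0_inv: "((\<lambda>x. 1 / r0 x) \<longlongrightarrow> 1 / \<alpha>) F" using alpha_pos by (intro tendsto_intros r0_lim) auto
    have "((\<lambda>x. G x / k x * (1 / nw x)) \<longlongrightarrow> g * (1 / 1)) F" by (intro tendsto_mult Gk nw_inv)
    then have "((\<lambda>x. G x / k x * (1 / nw x) - g) \<longlongrightarrow> 0) F" by (intro LIM_zero) simp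
    then have 3: "((\<lambda>x. W x * (G x / k x * (1 / nw x) - g)) \<longlongrightarrow> 0) F" by (rule bounded_times_null[OF W_le])
    have 1: "((\<lambda>x. W x * (1 / r0 x - 1 / \<alpha>)) \<longlongrightarrow> 0) F" by (rule bounded_times_null[OF W_le LIM_zero[OF r0_inv]])
    have "((\<lambda>x. (2 * (d x * a x) + d x * (d x * (1 / k x))) * (1 / r0 x)) \<longlongrightarrow> (2 * 0 + 0) * (1 / \<alpha>)) F"
      by (intro tendsto_mult tendsto_add tendsto_const r0_inv bounded_times_null[OF d_le] a_null bounded_times_null[OF d_le k_inv])
    then have 2: "((\<lambda>x. (2 * (d x * a x) + d x * (d x * (1 / k x))) * (1 / r0 x)) \<longlongrightarrow> 0) F" by simp
    have "((\<lambda>x. a x * (k x / N x) * (1 / nw x)) \<longlongrightarrow> 0 * 0 * (1 / 1)) F" by (intro tendsto_mult a_null kN nw_inv)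
    then have "((\<lambda>x. 2 * (e x * (a x * (k x / N x) * (1 / nw x)))) \<longlongrightarrow> 0) F"
      by (intro tendsto_mult_right_zero bounded_times_null[OF e_le]) simp
    note 4 = this
    have "((\<lambda>x. (1 - \<alpha> * (k x / N x)) * (1 / N x) * (1 / nw x)) \<longlongrightarrow> (1 - \<alpha> * 0) * 0 * (1 / 1)) F"
      by (intro tendsto_mult tendsto_diff tendsto_const kN N_inv nw_inv)
    then have 5: "((\<lambda>x. e x * (e x * ((1 - \<alpha> * (k x / N x)) * (1 / N x) * (1 / nw x)))) \<longlongrightarrow> 0) F"
      by (intro bounded_times_null[OF e_le]) simp
    have "((\<lambda>x. W x * (1 / r0 x - 1 / \<alpha>) + (2 * (d x * a x) + d x * (d x * (1 / k x))) * (1 / r0 x)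
        + (W x * (G x / k x * (1 / nw x) - g) - 2 * (e x * (a x * (k x / N x) * (1 / nw x)))
           + e x * (e x * ((1 - \<alpha> * (k x / N x)) * (1 / N x) * (1 / nw x))))) \<longlongrightarrow> 0 + 0 + (0 - 0 + 0)) F"
      by (intro tendsto_add tendsto_diff 1 2 3 4 5)
    then show "((\<lambda>x. W x * (1 / r0 x - 1 / \<alpha>) + (2 * (d x * a x) + d x * (d x * (1 / k x))) * (1 / r0 x)
        + (W x * (G x / k x * (1 / nw x) - g) - 2 * (e x * (a x * (k x / N x) * (1 / nw x)))
           + e x * (e x * ((1 - \<alpha> * (k x / N x)) * (1 / N x) * (1 / nw x))))) \<longlongrightarrow> 0) F" by simp
    show "\<forall>\<^sub>F x in F. W x * (1 / r0 x - 1 / \<alpha>) + (2 * (d x * a x) + d x * (d x * (1 / k x))) * (1 / r0 x)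
        + (W x * (G x / k x * (1 / nw x) - g) - 2 * (e x * (a x * (k x / N x) * (1 / nw x)))
           + e x * (e x * ((1 - \<alpha> * (k x / N x)) * (1 / N x) * (1 / nw x)))) = \<chi>\<^sub>2 x - \<alpha> * I * W x"
      using chi_eq
    proof eventually_elim
      case (elim x)
      have "\<alpha> * I * W x = W x * (1 / \<alpha>) + W x * g" by (simp add: g_def algebra_simps)
      then show ?case unfolding elim by (simp only: right_diff_distrib[of "W x"])
    qed
  qed
  have chi_Z: "((\<lambda>x. \<chi>\<^sub>2 x - \<alpha> * (Z x / I)) \<longlongrightarrow> 0) F"
  proof (rule Lim_transform_eventually)
    show "((\<lambda>x. (\<chi>\<^sub>2 x - \<alpha> * I * W x) + \<alpha> * I * (W x - Z x / I\<^sup>2)) \<longlongrightarrow> 0) F"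
      using tendsto_add[OF chi_lim tendsto_mult_right_zero[OF WZ, of "\<alpha> * I"]] by simp
    show "\<forall>\<^sub>F x in F. (\<chi>\<^sub>2 x - \<alpha> * I * W x) + \<alpha> * I * (W x - Z x / I\<^sup>2) = \<chi>\<^sub>2 x - \<alpha> * (Z x / I)"
      using I by (intro always_eventually allI) (simp add: right_diff_distrib power2_eq_square)
  qed
  have chi_le: "\<forall>\<^sub>F x in F. \<bar>\<chi>\<^sub>2 x\<bar> \<le> \<alpha> * I * (K ^ 3 / I\<^sup>2 + 1) + 1"
  proof -
    have "\<forall>\<^sub>F x in F. \<bar>\<chi>\<^sub>2 x - \<alpha> * I * W x\<bar> < 1" using order_tendstoD(2)[OF tendsto_rabs_zero[OF chi_lim]] by simp
    then show ?thesis using W_le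
    proof eventually_elim
      case (elim x)
      have "\<bar>\<alpha> * I * W x\<bar> \<le> \<alpha> * I * (K ^ 3 / I\<^sup>2 + 1)"
        using elim alpha_pos I by (simp only: abs_mult abs_of_pos) (intro mult_left_mono, auto)
      then show ?case using elim by linarith
    qed
  qed
  define Q where "Q x = \<bar>a x\<bar> / (nw x * (1 - \<alpha>)) + (c * (1 / N x)) / nw x + (\<bar>a x\<bar> + c * (1 / k x)) / r0 x" for x
  have Q_null: "(Q \<longlongrightarrow> 0) F"
  proof -
    have "(Q \<longlongrightarrow> \<bar>0\<bar> / (1 * (1 - \<alpha>)) + (c * 0) / 1 + (\<bar>0\<bar> + c * 0) / \<alpha>) F"
      unfolding Q_def using alpha_pos alpha_less_1 by (intro tendsto_intros a_null nw_lim N_inv k_inv r0_lim) auto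
    then show ?thesis by simp
  qed
  define D where "D x = N x * f_divergence f (slots (snd x)) (predictive_estimate (fst x) (snd x)) (p (fst x) (snd x))" for x
  define f2 where "f2 = deriv (deriv f) 1 / 2"
  have D_chi: "((\<lambda>x. D x - f2 * \<chi>\<^sub>2 x) \<longlongrightarrow> 0) F"
  proof (rule tendstoI)
    fix \<epsilon> :: real assume \<epsilon>: "0 < \<epsilon>"
    (* the bound for n times the chi-square distance on the typical set *)
    define Cx where "Cx = \<alpha> * I * (K ^ 3 / I\<^sup>2 + 1) + 1"
    have Cx: "0 < Cx" using alpha_pos I K by (simp add: Cx_def add_nonneg_pos)
    define \<eta> where "\<eta> = \<epsilon> / (2 * Cx)"
    have \<eta>: "0 < \<eta>" using \<epsilon> Cx by (simp add: \<eta>_def)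
    obtain s where s: "0 < s" "\<And>h. \<bar>h\<bar> < s \<Longrightarrow> \<bar>f (1 + h) - deriv f 1 * h - f2 * h\<^sup>2\<bar> \<le> \<eta> * h\<^sup>2"
      using second_order_expansion[OF \<delta> f \<eta>] f1 by (auto simp: f2_def)
    have "\<forall>\<^sub>F x in F. Q x < s" using order_tendstoD(2)[OF Q_null s(1)] .
    then show "\<forall>\<^sub>F x in F. dist (D x - f2 * \<chi>\<^sub>2 x) 0 < \<epsilon>"
      using good basic chi_le
    proof eventually_elim
      case (elim x)
      then have n: "1 \<le> fst x" and pa: "partition_of (fst x) (snd x)" by auto
      have ratio: "\<bar>predictive_estimate (fst x) (snd x) t / p (fst x) (snd x) t - 1\<bar> < s" if "t \<in> slots (snd x)" for t
        using ratio_le[OF n pa that] elim(1)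
        by (simp add: Q_def a_def q_def nw_def N_def v_def r0_def p0_def k_def)
      have "\<bar>f_divergence f (slots (snd x)) (predictive_estimate (fst x) (snd x)) (p (fst x) (snd x)) - f2 * chi_square (fst x) (snd x)\<bar>
          \<le> \<eta> * chi_square (fst x) (snd x)"
        by (rule f_divergence_chi_square[OF n pa ratio s(2)])
      then have "N x * \<bar>f_divergence f (slots (snd x)) (predictive_estimate (fst x) (snd x)) (p (fst x) (snd x)) - f2 * chi_square (fst x) (snd x)\<bar>
          \<le> N x * (\<eta> * chi_square (fst x) (snd x))" using elim by (intro mult_left_mono) auto
      moreover have "N x * \<bar>f_divergence f (slots (snd x)) (predictive_estimate (fst x) (snd x)) (p (fst x) (snd x)) - f2 * chi_square (fst x) (snd x)\<bar>
         = \<bar>D x - f2 * \<chi>\<^sub>2 x\<bar>"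
      proof -
        have scale: "N x * \<bar>y\<bar> = \<bar>N x * y\<bar>" for y using elim by (simp add: abs_mult)
        show ?thesis unfolding scale D_def \<chi>\<^sub>2_def by (simp only: right_diff_distrib mult.left_commute)
      qed
      moreover have "N x * (\<eta> * chi_square (fst x) (snd x)) = \<eta> * \<chi>\<^sub>2 x" by (simp add: \<chi>\<^sub>2_def)
      ultimately have "\<bar>D x - f2 * \<chi>\<^sub>2 x\<bar> \<le> \<eta> * \<chi>\<^sub>2 x" by simp
      also have "\<dots> \<le> \<eta> * Cx" using elim \<eta> by (intro mult_left_mono) (auto simp: Cx_def)
      also have "\<dots> < \<epsilon>" using \<epsilon> Cx by (simp add: \<eta>_def)
      finally show ?case by simp
    qed
  qed
  have "((\<lambda>x. D x - \<alpha> * deriv (deriv f) 1 / 2 * (std_score (snd x))\<^sup>2) \<longlongrightarrow> 0) F"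
  proof (rule Lim_transform_eventually)
    show "((\<lambda>x. (D x - f2 * \<chi>\<^sub>2 x) + f2 * (\<chi>\<^sub>2 x - \<alpha> * (Z x / I))) \<longlongrightarrow> 0) F"
      using tendsto_add[OF D_chi tendsto_mult_right_zero[OF chi_Z, of f2]] by simp
    show "\<forall>\<^sub>F x in F. (D x - f2 * \<chi>\<^sub>2 x) + f2 * (\<chi>\<^sub>2 x - \<alpha> * (Z x / I)) = D x - \<alpha> * deriv (deriv f) 1 / 2 * (std_score (snd x))\<^sup>2"
      using basic
    proof eventually_elim
      case (elim x)
      have "(std_score (snd x))\<^sup>2 = Z x / I"
        using I elim by (simp add: std_score_def power_divide Z_def Y_def k_def I_def)
      then show ?case by (simp add: f2_def right_diff_distrib)
    qed
  qed
  then show ?thesis by (simp add: D_def N_def F_def)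
qed

lemma divergence_asymptotics:
  fixes f :: "real \<Rightarrow> real"
  assumes "f 1 = 0" "0 < \<delta>"
    and "\<forall>x\<in>{1 - \<delta><..<1 + \<delta>}. f differentiable (at x) \<and> deriv f differentiable (at x)"
  shows "((\<lambda>x. real (fst x) * f_divergence f (slots (snd x)) (predictive_estimate (fst x) (snd x)) (p (fst x) (snd x))
       - \<alpha> * deriv (deriv f) 1 / 2 * (std_score (snd x))\<^sup>2) \<longlongrightarrow> 0) in_prob"
  by (intro in_prob_localize divergence_on_typical[OF _ assms])

end

section \<open>From characteristic functions to stable convergence\<close>

text \<open>Levy's continuity theorem is used twice: for \<open>T\<close>, and for \<open>X\<close>, whose characteristic function
  differs from that of \<open>b T\<^sup>2\<close> by a quantity that vanishes by closeness in probability.\<close>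

lemma (in prob_space) square_limit_from_char:
  fixes T X :: "nat \<Rightarrow> 'a \<Rightarrow> real" and h :: "real \<Rightarrow> real"
  assumes T [measurable]: "\<And>n. T n \<in> borel_measurable M" and X [measurable]: "\<And>n. X n \<in> borel_measurable M"
    and char_lim: "\<And>t. (\<lambda>n. expectation (\<lambda>\<omega>. iexp (t * T n \<omega>))) \<longlonglongrightarrow> complex_of_real (exp (- t\<^sup>2 / 2))"
    and close: "\<And>e. 0 < e \<Longrightarrow> (\<lambda>n. prob {\<omega>\<in>space M. e \<le> \<bar>X n \<omega> - b * (T n \<omega>)\<^sup>2\<bar>}) \<longlonglongrightarrow> 0"
    and h: "\<And>x. isCont h x" "\<And>x. \<bar>h x\<bar> \<le> C"
  shows "(\<lambda>n. expectation (\<lambda>\<omega>. h (X n \<omega>))) \<longlonglongrightarrow> (LINT x|std_normal_distribution. h (b * x\<^sup>2))"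
proof -
  define \<nu> where "\<nu> = distr std_normal_distribution borel (\<lambda>x. b * x\<^sup>2)"
  interpret std: real_distribution std_normal_distribution by (rule real_dist_normal_dist)
  have nu: "real_distribution \<nu>" unfolding \<nu>_def by (rule std.real_distribution_distr) measurable
  have weak1: "weak_conv_m (\<lambda>n. distr M borel (T n)) std_normal_distribution"
  proof (rule levy_continuity)
    show "(\<lambda>n. char (distr M borel (T n)) t) \<longlonglongrightarrow> char std_normal_distribution t" for t
      unfolding char_std_normal_distribution using char_lim[of t] by (simp add: char_def integral_distr)
  qed (auto intro: real_dist_normal_dist)
  have "(\<lambda>n. expectation (\<lambda>\<omega>. iexp (s * X n \<omega>))) \<longlonglongrightarrow> char \<nu> s" for s
  proof -
    have "(\<lambda>n. LINT x|distr M borel (T n). iexp (s * (b * x\<^sup>2))) \<longlonglongrightarrow> (LINT x|std_normal_distribution. iexp (s * (b * x\<^sup>2)))"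
      by (rule weak_conv_imp_integral_bdd_continuous_conv[OF _ real_dist_normal_dist weak1, where B = 1])
        (auto intro!: continuous_intros)
    then have lim1: "(\<lambda>n. expectation (\<lambda>\<omega>. iexp (s * (b * (T n \<omega>)\<^sup>2)))) \<longlonglongrightarrow> char \<nu> s"
      by (simp add: integral_distr char_def \<nu>_def)
    have lim2: "(\<lambda>n. expectation (\<lambda>\<omega>. iexp (s * X n \<omega>)) - expectation (\<lambda>\<omega>. iexp (s * (b * (T n \<omega>)\<^sup>2)))) \<longlonglongrightarrow> 0"
    proof (rule LIMSEQ_I)
      fix r :: real assume r: "0 < r"
      define e where "e = r / (2 * (\<bar>s\<bar> + 1))"
      have e: "0 < e" using r by (simp add: e_def add_nonneg_pos)
      have se: "\<bar>s\<bar> * e \<le> r / 2"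
        using r mult_right_mono[of "\<bar>s\<bar>" "\<bar>s\<bar> + 1" r] by (simp add: e_def field_simps)
      let ?A = "\<lambda>n. {\<omega>\<in>space M. e \<le> \<bar>X n \<omega> - b * (T n \<omega>)\<^sup>2\<bar>}"
      have "\<forall>\<^sub>F n in sequentially. prob (?A n) < r / 4"
        using close[OF e] r by (intro order_tendstoD) auto
      then obtain n0 where n0: "\<And>n. n0 \<le> n \<Longrightarrow> prob (?A n) < r / 4" by (auto simp: eventually_sequentially)
      have "norm (expectation (\<lambda>\<omega>. iexp (s * X n \<omega>)) - expectation (\<lambda>\<omega>. iexp (s * (b * (T n \<omega>)\<^sup>2)))) < r" if n: "n0 \<le> n" for n
      proof -
        have i: "integrable M (\<lambda>\<omega>. iexp (s * X n \<omega>))" "integrable M (\<lambda>\<omega>. iexp (s * (b * (T n \<omega>)\<^sup>2)))"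
          by (auto intro!: integrable_const_bound[where B = 1])
        have "norm (expectation (\<lambda>\<omega>. iexp (s * X n \<omega>)) - expectation (\<lambda>\<omega>. iexp (s * (b * (T n \<omega>)\<^sup>2))))
          = norm (expectation (\<lambda>\<omega>. iexp (s * X n \<omega>) - iexp (s * (b * (T n \<omega>)\<^sup>2))))"
          unfolding Bochner_Integration.integral_diff[OF i] ..
        also have "\<dots> \<le> expectation (\<lambda>\<omega>. norm (iexp (s * X n \<omega>) - iexp (s * (b * (T n \<omega>)\<^sup>2))))"
          by (rule integral_norm_bound)
        also have "\<dots> \<le> expectation (\<lambda>\<omega>. 2 * indicator (?A n) \<omega> + \<bar>s\<bar> * e)"
        proof (rule integral_mono)
          show "integrable M (\<lambda>\<omega>. norm (iexp (s * X n \<omega>) - iexp (s * (b * (T n \<omega>)\<^sup>2))))"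
            using i by (intro integrable_norm Bochner_Integration.integrable_diff)
          show "integrable M (\<lambda>\<omega>. 2 * indicator (?A n) \<omega> + \<bar>s\<bar> * e)"
            by (intro Bochner_Integration.integrable_add integrable_mult_right integrable_real_indicator integrable_const) (auto simp: emeasure_eq_measure)
          fix \<omega> assume w: "\<omega> \<in> space M"
          show "norm (iexp (s * X n \<omega>) - iexp (s * (b * (T n \<omega>)\<^sup>2))) \<le> 2 * indicator (?A n) \<omega> + \<bar>s\<bar> * e"
          proof (cases "\<omega> \<in> ?A n")
            case True
            have "norm (iexp (s * X n \<omega>) - iexp (s * (b * (T n \<omega>)\<^sup>2))) \<le> 2"
              by (rule order_trans[OF norm_triangle_ineq4]) simp
            then show ?thesis using True e by (simp add: add_increasing2)
          next
            case False
            have "norm (iexp (s * X n \<omega>) - iexp (s * (b * (T n \<omega>)\<^sup>2))) \<le> \<bar>s * X n \<omega> - s * (b * (T n \<omega>)\<^sup>2)\<bar>"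
              by (rule cmod_iexp_diff_le)
            also have "\<dots> = \<bar>s\<bar> * \<bar>X n \<omega> - b * (T n \<omega>)\<^sup>2\<bar>" by (simp add: abs_mult flip: right_diff_distrib)
            also have "\<dots> \<le> \<bar>s\<bar> * e" using False w by (intro mult_left_mono) auto
            finally show ?thesis using False by simp
          qed
        qed
        also have "\<dots> = 2 * prob (?A n) + \<bar>s\<bar> * e"
          by (subst Bochner_Integration.integral_add) (auto simp: emeasure_eq_measure prob_space Int_absorb1 subset_eq)
        also have "\<dots> < r" using n0[OF n] se by simp
        finally show ?thesis .
      qed
      then show "\<exists>no. \<forall>n\<ge>no. norm (expectation (\<lambda>\<omega>. iexp (s * X n \<omega>)) - expectation (\<lambda>\<omega>. iexp (s * (b * (T n \<omega>)\<^sup>2))) - 0) < r"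
        by auto
    qed
    show ?thesis using tendsto_add[OF lim2 lim1] by simp
  qed
  then have weak2: "weak_conv_m (\<lambda>n. distr M borel (X n)) \<nu>"
    by (intro levy_continuity nu) (auto simp: char_def integral_distr)
  have "(\<lambda>n. LINT x|distr M borel (X n). h x) \<longlonglongrightarrow> (LINT x|\<nu>. h x)"
    by (rule weak_conv_imp_integral_bdd_continuous_conv[OF _ nu weak2, where B = C]) (use h in auto)
  moreover have [measurable]: "h \<in> borel_measurable borel"
    by (intro borel_measurable_continuous_onI continuous_at_imp_continuous_on) (use h in auto)
  ultimately show ?thesis by (simp add: integral_distr \<nu>_def)
qed

context partition_chain
begin

text \<open>If the event has positive probability, apply \<open>square_limit_from_char\<close> under the conditional
  measure, where convergence in probability persists.\<close>

lemma mixing_limit: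
  fixes h :: "real \<Rightarrow> real"
  assumes G: "((\<lambda>x. G (fst x) (snd x) - b * (std_score (snd x))\<^sup>2) \<longlongrightarrow> 0) in_prob"
    and h: "\<And>x. isCont h x" "\<And>x. \<bar>h x\<bar> \<le> C" and l: "1 \<le> l"
  shows "(\<lambda>n. expectation (\<lambda>\<omega>. indicat_real A (\<rho> l \<omega>) * h (G n (\<rho> n \<omega>))))
     \<longlonglongrightarrow> expectation (\<lambda>\<omega>. indicat_real A (\<rho> l \<omega>)) * (LINT x|std_normal_distribution. h (b * x\<^sup>2))"
proof (rule LIMSEQ_imp_Suc)
  (* the index is shifted because the value of the chain at time 0 is arbitrary *)
  define I where "I = (\<lambda>\<omega>. indicat_real A (\<rho> l \<omega>))"
  define P where "P = expectation I"
  have I_meas [measurable]: "I \<in> borel_measurable M" unfolding I_def by (rule borel_measurable_rho[OF l])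
  have I_int: "integrable M I" unfolding I_def by (rule integrable_rho[OF l])
  have I01: "0 \<le> I \<omega>" "I \<omega> \<le> 1" for \<omega> by (auto simp: I_def indicator_def)
  have P0: "0 \<le> P" unfolding P_def using I01 by simp
  show "(\<lambda>n. expectation (\<lambda>\<omega>. indicat_real A (\<rho> l \<omega>) * h (G (Suc n) (\<rho> (Suc n) \<omega>))))
     \<longlonglongrightarrow> expectation (\<lambda>\<omega>. indicat_real A (\<rho> l \<omega>)) * (LINT x|std_normal_distribution. h (b * x\<^sup>2))"
  proof (cases "P = 0")
    case True
    have "expectation (\<lambda>\<omega>. I \<omega> * h (G (Suc n) (\<rho> (Suc n) \<omega>))) = 0" for n
    proof -
      have "AE \<omega> in M. I \<omega> = 0"
        using True I01 I_int unfolding P_def by (subst (asm) integral_nonneg_eq_0_iff_AE) auto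
      then have "expectation (\<lambda>\<omega>. I \<omega> * h (G (Suc n) (\<rho> (Suc n) \<omega>))) = expectation (\<lambda>\<omega>. 0)"
        by (intro integral_cong_AE) (auto intro!: borel_measurable_times borel_measurable_rho)
      then show ?thesis by simp
    qed
    then show ?thesis using True unfolding P_def I_def by simp
  next
    case False
    then have P: "0 < P" using P0 by simp
    (* the conditional measure given the event *)
    define \<nu> where "\<nu> = density M (\<lambda>\<omega>. ennreal (I \<omega> / P))"
    have d0: "AE \<omega> in M. 0 \<le> I \<omega> / P" using I01 P by auto
    have int_nu: "integral\<^sup>L \<nu> f = expectation (\<lambda>\<omega>. I \<omega> *\<^sub>R f \<omega>) /\<^sub>R P"
      if [measurable]: "f \<in> borel_measurable M" for f :: "'a \<Rightarrow> 'c::{banach, second_countable_topology}"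
    proof -
      have "integral\<^sup>L \<nu> f = expectation (\<lambda>\<omega>. (I \<omega> / P) *\<^sub>R f \<omega>)"
        unfolding \<nu>_def using d0 by (intro integral_density) auto
      also have "\<dots> = expectation (\<lambda>\<omega>. inverse P *\<^sub>R (I \<omega> *\<^sub>R f \<omega>))"
        by (simp add: divide_inverse mult.commute)
      finally show ?thesis by (simp only: integral_scaleR_right)
    qed
    have "emeasure \<nu> (space \<nu>) = 1"
    proof -
      have "emeasure \<nu> (space \<nu>) = (\<integral>\<^sup>+\<omega>. ennreal (I \<omega> / P) \<partial>M)"
        unfolding \<nu>_def by (simp add: emeasure_density cong: nn_integral_cong)
      also have "\<dots> = ennreal (expectation (\<lambda>\<omega>. I \<omega> / P))"
        using I01 P I_int by (intro nn_integral_eq_integral) auto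
      also have "expectation (\<lambda>\<omega>. I \<omega> / P) = 1" using P by (simp add: P_def)
      finally show ?thesis by simp
    qed
    then interpret nu: prob_space \<nu> by (rule prob_spaceI)
    have sets_nu [simp, measurable_cong]: "sets \<nu> = sets M" and space_nu [simp]: "space \<nu> = space M" by (auto simp: \<nu>_def)
    have T: "(\<lambda>\<omega>. std_score (\<rho> (Suc n) \<omega>)) \<in> borel_measurable M" for n by (rule borel_measurable_rho) simp
    have X: "(\<lambda>\<omega>. G (Suc n) (\<rho> (Suc n) \<omega>)) \<in> borel_measurable M" for n by (rule borel_measurable_rho) simp
    have "(\<lambda>n. nu.expectation (\<lambda>\<omega>. h (G (Suc n) (\<rho> (Suc n) \<omega>)))) \<longlonglongrightarrow> (LINT x|std_normal_distribution. h (b * x\<^sup>2))"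
    proof (rule nu.square_limit_from_char[where T = "\<lambda>n \<omega>. std_score (\<rho> (Suc n) \<omega>)" and X = "\<lambda>n \<omega>. G (Suc n) (\<rho> (Suc n) \<omega>)", OF _ _ _ _ h])
      show "(\<lambda>\<omega>. std_score (\<rho> (Suc n) \<omega>)) \<in> borel_measurable \<nu>" for n using T by simp
      show "(\<lambda>\<omega>. G (Suc n) (\<rho> (Suc n) \<omega>)) \<in> borel_measurable \<nu>" for n using X by simp
      show "(\<lambda>n. nu.expectation (\<lambda>\<omega>. iexp (t * std_score (\<rho> (Suc n) \<omega>)))) \<longlonglongrightarrow> complex_of_real (exp (- t\<^sup>2 / 2))" for t
      proof -
        have "(\<lambda>n. expectation (\<lambda>\<omega>. I \<omega> *\<^sub>R iexp (t * std_score (\<rho> (Suc n) \<omega>))) /\<^sub>R P) \<longlonglongrightarrow> complex_of_real (exp (- t\<^sup>2 / 2) * P) /\<^sub>R P"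
          using LIMSEQ_Suc[OF std_score_char[OF l, of A t]] unfolding I_def P_def by (intro tendsto_intros)
        moreover have "complex_of_real (exp (- t\<^sup>2 / 2) * P) /\<^sub>R P = complex_of_real (exp (- t\<^sup>2 / 2))"
          using P by (simp add: scaleR_conv_of_real)
        moreover have "nu.expectation (\<lambda>\<omega>. iexp (t * std_score (\<rho> (Suc n) \<omega>))) = expectation (\<lambda>\<omega>. I \<omega> *\<^sub>R iexp (t * std_score (\<rho> (Suc n) \<omega>))) /\<^sub>R P" for n
          by (rule int_nu) (rule borel_measurable_rho, simp)
        ultimately show ?thesis by simp
      qed
      fix e :: real assume e: "0 < e"
      let ?B = "\<lambda>n. {\<omega>\<in>space M. e \<le> \<bar>G n (\<rho> n \<omega>) - b * (std_score (\<rho> n \<omega>))\<^sup>2\<bar>}"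
      have "\<forall>\<^sub>F x in in_prob. dist (G (fst x) (snd x) - b * (std_score (snd x))\<^sup>2) 0 < e" using G e by (rule tendstoD)
      then have "(\<lambda>n. prob (?B n)) \<longlonglongrightarrow> 0" unfolding eventually_in_prob by (simp add: not_less)
      then have "(\<lambda>n. prob (?B (Suc n)) / P) \<longlonglongrightarrow> 0 / P" by (intro tendsto_intros LIMSEQ_Suc) (use P in auto)
      then have lim: "(\<lambda>n. prob (?B (Suc n)) / P) \<longlonglongrightarrow> 0" by simp
      show "(\<lambda>n. nu.prob {\<omega>\<in>space \<nu>. e \<le> \<bar>G (Suc n) (\<rho> (Suc n) \<omega>) - b * (std_score (\<rho> (Suc n) \<omega>))\<^sup>2\<bar>}) \<longlonglongrightarrow> 0"
      proof (rule tendsto_sandwich[OF _ _ tendsto_const lim])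
        have "nu.prob (?B (Suc n)) \<le> prob (?B (Suc n)) / P" for n
        proof -
          have B: "?B (Suc n) \<in> sets M"
            using sets_rho[of "Suc n" "\<lambda>\<pi>. e \<le> \<bar>G (Suc n) \<pi> - b * (std_score \<pi>)\<^sup>2\<bar>"] by simp
          have iB: "integrable M (indicat_real (?B (Suc n)))"
            using B by (intro integrable_real_indicator) (auto simp: emeasure_eq_measure)
          have "nu.prob (?B (Suc n)) = nu.expectation (indicat_real (?B (Suc n)))"
            using B by (simp add: Int_absorb1 subset_eq)
          also have "\<dots> = expectation (\<lambda>\<omega>. I \<omega> * indicat_real (?B (Suc n)) \<omega>) / P"
            using int_nu[of "indicat_real (?B (Suc n))"] B by (simp add: divide_inverse mult.commute)
          also have "\<dots> \<le> expectation (indicat_real (?B (Suc n))) / P"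
          proof (intro divide_right_mono integral_mono iB)
            show "integrable M (\<lambda>\<omega>. I \<omega> * indicat_real (?B (Suc n)) \<omega>)"
              using I01 B by (intro Bochner_Integration.integrable_bound[OF iB]) (auto simp: abs_mult intro!: mult_left_le_one_le)
            show "I \<omega> * indicat_real (?B (Suc n)) \<omega> \<le> indicat_real (?B (Suc n)) \<omega>" for \<omega>
              using I01[of \<omega>] by (intro mult_left_le_one_le) auto
          qed (use P in simp)
          also have "expectation (indicat_real (?B (Suc n))) = prob (?B (Suc n))"
            using B by (simp add: Int_absorb1 subset_eq)
          finally show ?thesis .
        qed
        then show "\<forall>\<^sub>F n in sequentially. nu.prob {\<omega>\<in>space \<nu>. e \<le> \<bar>G (Suc n) (\<rho> (Suc n) \<omega>) - b * (std_score (\<rho> (Suc n) \<omega>))\<^sup>2\<bar>} \<le> prob (?B (Suc n)) / P"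
          by (intro always_eventually) simp
      qed auto
    qed
    then have "(\<lambda>n. P * nu.expectation (\<lambda>\<omega>. h (G (Suc n) (\<rho> (Suc n) \<omega>)))) \<longlonglongrightarrow> P * (LINT x|std_normal_distribution. h (b * x\<^sup>2))"
      by (intro tendsto_intros)
    moreover have "P * nu.expectation (\<lambda>\<omega>. h (G (Suc n) (\<rho> (Suc n) \<omega>))) = expectation (\<lambda>\<omega>. I \<omega> * h (G (Suc n) (\<rho> (Suc n) \<omega>)))" for n
    proof -
      have "(\<lambda>\<omega>. h (G (Suc n) (\<rho> (Suc n) \<omega>))) \<in> borel_measurable M" by (rule borel_measurable_rho) simp
      from int_nu[OF this] show ?thesis using P by simp
    qed
    ultimately show ?thesis by (simp add: I_def P_def)
  qed
qed

section \<open>The limit sigma algebra\<close>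

lemma sets_vimage_rho:
  "sets (vimage_algebra (space M) (\<rho> n) (count_space UNIV)) = {{\<omega>\<in>space M. \<rho> n \<omega> \<in> A} | A. True}"
  by (subst sets_vimage_algebra2) (auto simp: vimage_def Int_def conj_commute)

lemma sets_F_infinity:
  "sets (F_infinity M \<rho>) = sigma_sets (space M) {{\<omega>\<in>space M. \<rho> n \<omega> \<in> A} | n A. 1 \<le> n}"
proof -
  have "(\<Union>n\<in>{1..}. sets (vimage_algebra (space M) (\<rho> n) (count_space UNIV))) = {{\<omega>\<in>space M. \<rho> n \<omega> \<in> A} | n A. 1 \<le> n}"
    unfolding sets_vimage_rho by auto
  moreover have "{{\<omega>\<in>space M. \<rho> n \<omega> \<in> A} | n A. 1 \<le> n} \<subseteq> Pow (space M)" by auto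
  ultimately show ?thesis unfolding F_infinity_def by (simp add: sets_measure_of)
qed

lemma space_F_infinity [simp]: "space (F_infinity M \<rho>) = space M"
  unfolding F_infinity_def by (rule space_measure_of_conv)

lemma subalgebra_F_infinity: "subalgebra M (F_infinity M \<rho>)"
  unfolding subalgebra_def sets_F_infinity
proof (intro conjI sets.sigma_sets_subset)
  show "{{\<omega>\<in>space M. \<rho> n \<omega> \<in> A} | n A. 1 \<le> n} \<subseteq> sets M" using sets_rho[of _ "\<lambda>\<pi>. \<pi> \<in> _"] by auto
qed simp

lemma measurable_F_infinity:
  fixes \<phi> :: "nat set set \<Rightarrow> real"
  assumes "1 \<le> n"
  shows "(\<lambda>\<omega>. \<phi> (\<rho> n \<omega>)) \<in> borel_measurable (F_infinity M \<rho>)"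
proof (rule measurableI)
  fix S :: "real set" assume "S \<in> sets borel"
  have "(\<lambda>\<omega>. \<phi> (\<rho> n \<omega>)) -` S \<inter> space (F_infinity M \<rho>) = {\<omega>\<in>space M. \<rho> n \<omega> \<in> \<phi> -` S}" by auto
  also have "\<dots> \<in> sets (F_infinity M \<rho>)" unfolding sets_F_infinity by (intro sigma_sets.Basic) (use assms in blast)
  finally show "(\<lambda>\<omega>. \<phi> (\<rho> n \<omega>)) -` S \<inter> space (F_infinity M \<rho>) \<in> sets (F_infinity M \<rho>)" .
qed simp

lemma Int_stable_generator: "Int_stable {{\<omega>\<in>space M. \<rho> n \<omega> \<in> A} | n A. 1 \<le> n}"
proof (rule Int_stableI)
  fix a b assume "a \<in> {{\<omega>\<in>space M. \<rho> n \<omega> \<in> A} | n A. 1 \<le> n}" "b \<in> {{\<omega>\<in>space M. \<rho> n \<omega> \<in> A} | n A. 1 \<le> n}"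
  then obtain m A n B where m: "1 \<le> m" "a = {\<omega>\<in>space M. \<rho> m \<omega> \<in> A}" and n: "1 \<le> n" "b = {\<omega>\<in>space M. \<rho> n \<omega> \<in> B}" by auto
  define r where "r = max m n"
  have "a \<inter> b = {\<omega>\<in>space M. \<rho> r \<omega> \<in> {\<pi>. restrict_partition m \<pi> \<in> A \<and> restrict_partition n \<pi> \<in> B}}"
    unfolding m(2) n(2) using rho_restrict[OF m(1), of r] rho_restrict[OF n(1), of r] by (auto simp: r_def)
  moreover have "1 \<le> r" using m by (simp add: r_def)
  ultimately show "a \<inter> b \<in> {{\<omega>\<in>space M. \<rho> n \<omega> \<in> A} | n A. 1 \<le> n}" by blast
qed

lemma integrable_times_bounded:
  fixes f Z :: "'a \<Rightarrow> real"
  assumes "integrable M f" "Z \<in> borel_measurable M" "\<And>\<omega>. \<bar>Z \<omega>\<bar> \<le> C"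
  shows "integrable M (\<lambda>\<omega>. f \<omega> * Z \<omega>)"
proof (rule Bochner_Integration.integrable_bound[OF integrable_mult_right[OF assms(1), of C]])
  show "(\<lambda>\<omega>. f \<omega> * Z \<omega>) \<in> borel_measurable M" using assms by (intro borel_measurable_times) auto
  have "0 \<le> C" using assms(3)[of undefined] by linarith
  then have "\<bar>Z \<omega>\<bar> * \<bar>f \<omega>\<bar> \<le> C * \<bar>f \<omega>\<bar>" for \<omega> by (intro mult_right_mono assms(3)) auto
  then show "AE \<omega> in M. norm (f \<omega> * Z \<omega>) \<le> norm (C * f \<omega>)"
    using \<open>0 \<le> C\<close> by (intro AE_I2) (simp add: abs_mult mult.commute)
qed

text \<open>The functionals \<open>g \<mapsto> E (g Z\<^sub>n) - L E g\<close> are bounded on \<open>L\<^sup>1\<close>, uniformly in \<open>n\<close>, so the set of \<open>g\<close>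
  on which they tend to zero is closed.\<close>

lemma L1_limit_of_limits:
  fixes g :: "'a \<Rightarrow> real" and Z :: "nat \<Rightarrow> 'a \<Rightarrow> real"
  assumes Z: "\<And>n. 1 \<le> n \<Longrightarrow> Z n \<in> borel_measurable M" "\<And>n \<omega>. \<bar>Z n \<omega>\<bar> \<le> C"
    and gi: "\<And>i. integrable M (s i)" "integrable M g"
    and lim: "\<And>i. (\<lambda>n. expectation (\<lambda>\<omega>. s i \<omega> * Z n \<omega>)) \<longlonglongrightarrow> expectation (s i) * L"
    and approx: "(\<lambda>i. expectation (\<lambda>\<omega>. \<bar>s i \<omega> - g \<omega>\<bar>)) \<longlonglongrightarrow> 0"
  shows "(\<lambda>n. expectation (\<lambda>\<omega>. g \<omega> * Z n \<omega>)) \<longlonglongrightarrow> expectation g * L"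
proof (rule LIMSEQ_I)
  fix r :: real assume r: "0 < r"
  have "(\<lambda>i. (C + \<bar>L\<bar>) * expectation (\<lambda>\<omega>. \<bar>s i \<omega> - g \<omega>\<bar>)) \<longlonglongrightarrow> 0"
    by (rule tendsto_mult_right_zero[OF approx])
  then have "\<forall>\<^sub>F i in sequentially. (C + \<bar>L\<bar>) * expectation (\<lambda>\<omega>. \<bar>s i \<omega> - g \<omega>\<bar>) < r / 2"
    using r by (intro order_tendstoD) auto
  then obtain i where i: "(C + \<bar>L\<bar>) * expectation (\<lambda>\<omega>. \<bar>s i \<omega> - g \<omega>\<bar>) < r / 2"
    by (auto simp: eventually_sequentially)
  define D where "D = expectation (\<lambda>\<omega>. \<bar>s i \<omega> - g \<omega>\<bar>)"
  obtain n0 where n0: "\<And>n. n0 \<le> n \<Longrightarrow> \<bar>expectation (\<lambda>\<omega>. s i \<omega> * Z n \<omega>) - expectation (s i) * L\<bar> < r / 2"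
    using LIMSEQ_D[OF lim[of i], of "r / 2"] r by auto
  have d: "integrable M (\<lambda>\<omega>. \<bar>s i \<omega> - g \<omega>\<bar>)" using gi by auto
  have "\<bar>expectation (\<lambda>\<omega>. g \<omega> * Z n \<omega>) - expectation g * L\<bar> < r" if n: "max n0 1 \<le> n" for n
  proof -
    have Zm: "Z n \<in> borel_measurable M" using Z(1) n by simp
    have prod_int: "integrable M (\<lambda>\<omega>. f \<omega> * Z n \<omega>)" if f: "integrable M f" for f :: "'a \<Rightarrow> real"
      by (rule integrable_times_bounded[OF f Zm Z(2)])
    have "\<bar>expectation (\<lambda>\<omega>. s i \<omega> * Z n \<omega>) - expectation (\<lambda>\<omega>. g \<omega> * Z n \<omega>)\<bar> \<le> C * D"
    proof -
      have "norm (expectation (\<lambda>\<omega>. s i \<omega> * Z n \<omega> - g \<omega> * Z n \<omega>)) \<le> expectation (\<lambda>\<omega>. C * \<bar>s i \<omega> - g \<omega>\<bar>)"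
      proof (rule norm_expectation_le)
        show "integrable M (\<lambda>\<omega>. C * \<bar>s i \<omega> - g \<omega>\<bar>)" using d by simp
        show "integrable M (\<lambda>\<omega>. s i \<omega> * Z n \<omega> - g \<omega> * Z n \<omega>)" using gi by (intro Bochner_Integration.integrable_diff prod_int)
        fix \<omega>
        have eq: "s i \<omega> * Z n \<omega> - g \<omega> * Z n \<omega> = Z n \<omega> * (s i \<omega> - g \<omega>)" by (simp add: algebra_simps)
        show "norm (s i \<omega> * Z n \<omega> - g \<omega> * Z n \<omega>) \<le> C * \<bar>s i \<omega> - g \<omega>\<bar>"
          unfolding eq real_norm_def abs_mult by (intro mult_right_mono Z(2)) auto
      qed
      then show ?thesis using prod_int gi by (simp add: D_def)
    qed
    moreover have "\<bar>expectation (s i) * L - expectation g * L\<bar> \<le> \<bar>L\<bar> * D"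
    proof -
      have "norm (expectation (\<lambda>\<omega>. s i \<omega> - g \<omega>)) \<le> D" unfolding D_def
        using gi d by (intro norm_expectation_le) auto
      then have "\<bar>expectation (s i) - expectation g\<bar> \<le> D" using gi by simp
      moreover have "expectation (s i) * L - expectation g * L = L * (expectation (s i) - expectation g)" by (simp add: algebra_simps)
      ultimately show ?thesis by (simp only: abs_mult mult_left_mono abs_ge_zero)
    qed
    moreover have "\<bar>b' - d'\<bar> \<le> \<bar>a' - b'\<bar> + \<bar>a' - c'\<bar> + \<bar>c' - d'\<bar>" for a' b' c' d' :: real by linarith
    note this[of "expectation (\<lambda>\<omega>. g \<omega> * Z n \<omega>)" "expectation g * L" "expectation (\<lambda>\<omega>. s i \<omega> * Z n \<omega>)" "expectation (s i) * L"]
    moreover have "C * D + \<bar>L\<bar> * D < r / 2" using i by (simp only: distrib_right D_def)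
    moreover have "\<bar>expectation (\<lambda>\<omega>. s i \<omega> * Z n \<omega>) - expectation (s i) * L\<bar> < r / 2" using n0[of n] n by simp
    ultimately show ?thesis by linarith
  qed
  then show "\<exists>no. \<forall>n\<ge>no. norm (expectation (\<lambda>\<omega>. g \<omega> * Z n \<omega>) - expectation g * L) < r" by (auto intro!: exI[of _ "max n0 1"])
qed

text \<open>The events of the partitions at finite times are closed under intersections; Dynkin's argument extends
  the limit to the generated sigma algebra. Disjoint unions are \<open>L\<^sup>1\<close> limits of finite ones.\<close>

lemma mixing_limit_events:
  fixes Z :: "nat \<Rightarrow> 'a \<Rightarrow> real"
  assumes Z: "\<And>n. 1 \<le> n \<Longrightarrow> Z n \<in> borel_measurable M" "\<And>n \<omega>. \<bar>Z n \<omega>\<bar> \<le> C"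
    and base: "\<And>l A. 1 \<le> l \<Longrightarrow> (\<lambda>n. expectation (\<lambda>\<omega>. indicat_real A (\<rho> l \<omega>) * Z n \<omega>)) \<longlonglongrightarrow> expectation (\<lambda>\<omega>. indicat_real A (\<rho> l \<omega>)) * L"
    and E: "E \<in> sets (F_infinity M \<rho>)"
  shows "(\<lambda>n. expectation (\<lambda>\<omega>. indicat_real E \<omega> * Z n \<omega>)) \<longlonglongrightarrow> expectation (indicat_real E) * L"
proof -
  let ?U = "{{\<omega>\<in>space M. \<rho> n \<omega> \<in> A} | n A. 1 \<le> n}"
  have prod_int: "integrable M (\<lambda>\<omega>. f \<omega> * Z n \<omega>)" if f: "integrable M f" and n: "1 \<le> n" for f :: "'a \<Rightarrow> real" and n
    by (rule integrable_times_bounded[OF f Z(1)[OF n] Z(2)])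
  have sub: "sigma_sets (space M) ?U \<subseteq> sets M" using subalgebra_F_infinity unfolding subalgebra_def sets_F_infinity by simp
  have ind_int: "integrable M (indicat_real S)" if "S \<in> sigma_sets (space M) ?U" for S
    using sub that by (intro integrable_real_indicator) (auto simp: emeasure_eq_measure)
  have base_event: "(\<lambda>n. expectation (\<lambda>\<omega>. indicat_real S \<omega> * Z n \<omega>)) \<longlonglongrightarrow> expectation (indicat_real S) * L"
    if S: "S \<in> ?U" for S
  proof -
    from S obtain l A where l: "1 \<le> l" "S = {\<omega>\<in>space M. \<rho> l \<omega> \<in> A}" by auto
    have "expectation (\<lambda>\<omega>. indicat_real S \<omega> * f \<omega>) = expectation (\<lambda>\<omega>. indicat_real A (\<rho> l \<omega>) * f \<omega>)" for f
      using l by (intro Bochner_Integration.integral_cong) (auto simp: indicator_def)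
    from this this[of "\<lambda>_. 1"] show ?thesis using base[OF l(1), of A] by simp
  qed
  have "E \<in> sigma_sets (space M) ?U" using E by (simp add: sets_F_infinity)
  moreover have "?U \<subseteq> Pow (space M)" by auto
  ultimately have prem: "Int_stable ?U" "?U \<subseteq> Pow (space M)" "E \<in> sigma_sets (space M) ?U"
    using Int_stable_generator by auto
  show ?thesis using prem
  proof (induction rule: sigma_sets_induct_disjoint)
    case (basic S)
    then show ?case by (rule base_event)
  next
    case empty
    show ?case by simp
  next
    case (compl S)
    have "{\<omega>\<in>space M. \<rho> 1 \<omega> \<in> UNIV} \<in> ?U" by blast
    then have "space M \<in> ?U" by simp
    from base_event[OF this] have sp: "(\<lambda>n. expectation (\<lambda>\<omega>. indicat_real (space M) \<omega> * Z n \<omega>)) \<longlonglongrightarrow> expectation (indicat_real (space M)) * L" .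
    have sM: "space M \<in> sigma_sets (space M) ?U" by (rule sigma_sets_top)
    have diff: "indicat_real (space M - S) \<omega> = indicat_real (space M) \<omega> - indicat_real S \<omega>" for \<omega>
      using sub compl.hyps sets.sets_into_space[of S M] by (auto simp: indicator_def)
    have "\<forall>\<^sub>F n in sequentially. expectation (\<lambda>\<omega>. indicat_real (space M) \<omega> * Z n \<omega>) - expectation (\<lambda>\<omega>. indicat_real S \<omega> * Z n \<omega>)
         = expectation (\<lambda>\<omega>. indicat_real (space M - S) \<omega> * Z n \<omega>)"
      using eventually_ge_at_top[of 1]
    proof eventually_elim
      case (elim n)
      show ?case unfolding diff left_diff_distrib
        by (rule Bochner_Integration.integral_diff[symmetric]) (intro prod_int ind_int elim sM compl.hyps)+
    qed
    moreover have "expectation (indicat_real (space M - S)) = expectation (indicat_real (space M)) - expectation (indicat_real S)"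
      unfolding diff[abs_def] by (rule Bochner_Integration.integral_diff) (intro ind_int sM compl.hyps)+
    ultimately show ?case
      using Lim_transform_eventually[OF tendsto_diff[OF sp compl.IH]] by (simp add: left_diff_distrib)
  next
    case (union S)
    define T where "T i \<omega> = (\<Sum>j<i. indicat_real (S j) \<omega>)" for i \<omega>
    have Si: "S j \<in> sigma_sets (space M) ?U" for j using union.hyps(2) by auto
    have ST: "(\<Union>j. S j) \<in> sigma_sets (space M) ?U" by (rule sigma_sets.Union) (rule Si)
    have T_eq: "T i \<omega> = indicat_real (\<Union>j<i. S j) \<omega>" for i \<omega>
      unfolding T_def using union.hyps(1) by (subst indicator_UN_disjoint) (auto simp: disjoint_family_on_def)
    have lim_T: "(\<lambda>i. T i \<omega>) \<longlonglongrightarrow> indicat_real (\<Union>j. S j) \<omega>" for \<omega>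
      unfolding T_eq by (rule LIMSEQ_indicator_UN)
    show ?case
    proof (rule L1_limit_of_limits[OF Z, where s = T])
      show iT: "integrable M (T i)" for i unfolding T_def using Si by (intro Bochner_Integration.integrable_sum ind_int)
      show "integrable M (indicat_real (\<Union>j. S j))" by (rule ind_int[OF ST])
      show "(\<lambda>n. expectation (\<lambda>\<omega>. T i \<omega> * Z n \<omega>)) \<longlonglongrightarrow> expectation (T i) * L" for i
      proof (rule Lim_transform_eventually)
        show "(\<lambda>n. \<Sum>j<i. expectation (\<lambda>\<omega>. indicat_real (S j) \<omega> * Z n \<omega>)) \<longlonglongrightarrow> expectation (T i) * L"
        proof -
          have "expectation (T i) * L = (\<Sum>j<i. expectation (indicat_real (S j)) * L)"
            unfolding T_def using Si by (subst Bochner_Integration.integral_sum) (auto intro: ind_int simp: sum_distrib_right)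
          then show ?thesis using union.IH by (simp only:) (intro tendsto_sum)
        qed
        show "\<forall>\<^sub>F n in sequentially. (\<Sum>j<i. expectation (\<lambda>\<omega>. indicat_real (S j) \<omega> * Z n \<omega>)) = expectation (\<lambda>\<omega>. T i \<omega> * Z n \<omega>)"
          using eventually_ge_at_top[of 1]
        proof eventually_elim
          case (elim n)
          show ?case unfolding T_def sum_distrib_right
            by (rule Bochner_Integration.integral_sum[symmetric]) (intro prod_int ind_int Si elim)
        qed
      qed
      have "(\<lambda>i. expectation (\<lambda>\<omega>. \<bar>T i \<omega> - indicat_real (\<Union>j. S j) \<omega>\<bar>)) \<longlonglongrightarrow> expectation (\<lambda>\<omega>. 0)"
      proof (rule integral_dominated_convergence[where w = "\<lambda>_. 1"])
        show "AE \<omega> in M. (\<lambda>i. \<bar>T i \<omega> - indicat_real (\<Union>j. S j) \<omega>\<bar>) \<longlonglongrightarrow> 0"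
          by (intro AE_I2 tendsto_rabs_zero LIM_zero lim_T)
        show "(\<lambda>\<omega>. \<bar>T i \<omega> - indicat_real (\<Union>j. S j) \<omega>\<bar>) \<in> borel_measurable M" for i
          using iT[of i] ind_int[OF ST] by (intro borel_measurable_abs borel_measurable_diff) auto
        show "AE \<omega> in M. norm \<bar>T i \<omega> - indicat_real (\<Union>j. S j) \<omega>\<bar> \<le> 1" for i
          unfolding T_eq by (intro AE_I2) (auto simp: indicator_def)
      qed auto
      then show "(\<lambda>i. expectation (\<lambda>\<omega>. \<bar>T i \<omega> - indicat_real (\<Union>j. S j) \<omega>\<bar>)) \<longlonglongrightarrow> 0" by simp
    qed
  qed
qed

text \<open>Simple functions are dense in \<open>L\<^sup>1\<close>.\<close>

lemma mixing_limit_integrable: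
  fixes Z :: "nat \<Rightarrow> 'a \<Rightarrow> real" and g :: "'a \<Rightarrow> real"
  assumes Z: "\<And>n. 1 \<le> n \<Longrightarrow> Z n \<in> borel_measurable M" "\<And>n \<omega>. \<bar>Z n \<omega>\<bar> \<le> C"
    and base: "\<And>l A. 1 \<le> l \<Longrightarrow> (\<lambda>n. expectation (\<lambda>\<omega>. indicat_real A (\<rho> l \<omega>) * Z n \<omega>)) \<longlonglongrightarrow> expectation (\<lambda>\<omega>. indicat_real A (\<rho> l \<omega>)) * L"
    and g: "integrable M g" "g \<in> borel_measurable (F_infinity M \<rho>)"
  shows "(\<lambda>n. expectation (\<lambda>\<omega>. g \<omega> * Z n \<omega>)) \<longlonglongrightarrow> expectation g * L"
proof -
  let ?F = "restr_to_subalg M (F_infinity M \<rho>)"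
  note sub = subalgebra_F_infinity
  have "integrable ?F g" by (rule integrable_in_subalg[OF sub g(2,1)])
  then show ?thesis
  proof (induction rule: integrable_induct)
    case (base A c)
    then have A: "A \<in> sets (F_infinity M \<rho>)" by (simp add: sets_restr_to_subalg[OF sub])
    have "(\<lambda>n. c * expectation (\<lambda>\<omega>. indicat_real A \<omega> * Z n \<omega>)) \<longlonglongrightarrow> c * (expectation (indicat_real A) * L)"
      by (intro tendsto_mult_left mixing_limit_events[OF Z assms(3) A])
    moreover have "expectation (\<lambda>\<omega>. indicat_real A \<omega> *\<^sub>R c * Z n \<omega>) = c * expectation (\<lambda>\<omega>. indicat_real A \<omega> * Z n \<omega>)" for n
      by (subst integral_mult_right_zero[symmetric]) (simp add: mult_ac)
    moreover have "expectation (\<lambda>\<omega>. indicat_real A \<omega> *\<^sub>R c) = c * expectation (indicat_real A)"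
      by (subst integral_mult_right_zero[symmetric]) (simp add: mult_ac)
    ultimately show ?case by (simp only: mult.assoc)
  next
    case (add f1 f2)
    have i: "integrable M f1" "integrable M f2" using add.hyps(1,2) integrable_from_subalg[OF sub] by auto
    have prod_int: "integrable M (\<lambda>\<omega>. f \<omega> * Z n \<omega>)" if f: "integrable M f" and n: "1 \<le> n" for f :: "'a \<Rightarrow> real" and n
      by (rule integrable_times_bounded[OF f Z(1)[OF n] Z(2)])
    have "\<forall>\<^sub>F n in sequentially. expectation (\<lambda>\<omega>. f1 \<omega> * Z n \<omega>) + expectation (\<lambda>\<omega>. f2 \<omega> * Z n \<omega>) = expectation (\<lambda>\<omega>. (f1 \<omega> + f2 \<omega>) * Z n \<omega>)"
      using eventually_ge_at_top[of 1]
    proof eventually_elim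
      case (elim n)
      show ?case unfolding distrib_right
        by (rule Bochner_Integration.integral_add[symmetric]) (intro prod_int i elim)+
    qed
    then show ?case
      using Lim_transform_eventually[OF tendsto_add[OF add.IH(1) add.IH(2)]] i by (simp add: distrib_right)
  next
    case (lim f s)
    have i: "integrable M f" "\<And>j. integrable M (s j)" using lim.hyps(1,4) integrable_from_subalg[OF sub] by auto
    show ?case
    proof (rule L1_limit_of_limits[OF Z i(2) i(1) lim.IH])
      have "(\<lambda>j. expectation (\<lambda>\<omega>. \<bar>s j \<omega> - f \<omega>\<bar>)) \<longlonglongrightarrow> expectation (\<lambda>\<omega>. 0)"
      proof (rule integral_dominated_convergence[where w = "\<lambda>\<omega>. 3 * \<bar>f \<omega>\<bar>"])
        show "AE \<omega> in M. (\<lambda>j. \<bar>s j \<omega> - f \<omega>\<bar>) \<longlonglongrightarrow> 0"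
          using lim.hyps(2) by (intro AE_I2 tendsto_rabs_zero LIM_zero) (simp add: space_restr_to_subalg)
        show "AE \<omega> in M. norm \<bar>s j \<omega> - f \<omega>\<bar> \<le> 3 * \<bar>f \<omega>\<bar>" for j
        proof (rule AE_I2)
          fix \<omega> assume "\<omega> \<in> space M"
          then have "\<bar>s j \<omega>\<bar> \<le> 2 * \<bar>f \<omega>\<bar>" using lim.hyps(3)[of \<omega> j] by (simp add: space_restr_to_subalg)
          then show "norm \<bar>s j \<omega> - f \<omega>\<bar> \<le> 3 * \<bar>f \<omega>\<bar>" by simp
        qed
        show "(\<lambda>\<omega>. \<bar>s j \<omega> - f \<omega>\<bar>) \<in> borel_measurable M" for j
          using i by (intro borel_measurable_abs borel_measurable_diff) auto
      qed (use i in auto)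
      then show "(\<lambda>j. expectation (\<lambda>\<omega>. \<bar>s j \<omega> - f \<omega>\<bar>)) \<longlonglongrightarrow> 0" by simp
    qed
  qed
qed

text \<open>The left-hand integrals change neither when the conditional expectation of \<open>h (X\<^sub>n)\<close> is replaced by
  \<open>h (X\<^sub>n)\<close>, which is measurable with respect to the sigma algebra, nor when \<open>g\<close> is then replaced by its
  conditional expectation. On the right, independence makes the conditional expectation constant.
  The value of the chain at time \<open>0\<close> is arbitrary, whence the separate assumption on \<open>X 0\<close>.\<close>

lemma stable_limit:
  fixes G :: "nat \<Rightarrow> nat set set \<Rightarrow> real" and N :: "'a \<Rightarrow> real" and b :: real
  defines "F \<equiv> F_infinity M \<rho>" and "X \<equiv> \<lambda>n \<omega>. G n (\<rho> n \<omega>)"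
  assumes X0: "X 0 \<in> borel_measurable M"
    and G: "((\<lambda>x. G (fst x) (snd x) - b * (std_score (snd x))\<^sup>2) \<longlongrightarrow> 0) in_prob"
    and N: "N \<in> borel_measurable M" "distr M borel N = std_normal_distribution"
    and ind: "indep_set (sets F) (sets (vimage_algebra (space M) N borel))"
  shows "stably_converges M F X (\<lambda>\<omega>. b * \<bar>N \<omega>\<bar>\<^sup>2)"
proof -
  have sub: "subalgebra M F" unfolding F_def by (rule subalgebra_F_infinity)
  interpret F: finite_measure_subalgebra M F by unfold_locales (rule sub)
  have X_F: "X n \<in> borel_measurable F" if "1 \<le> n" for n
    unfolding F_def X_def by (rule measurable_F_infinity[OF that])
  have X_M: "X n \<in> borel_measurable M" for n
    using X0 X_F[of n] measurable_from_subalg[OF sub] by (cases n) auto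
  have Y_M: "(\<lambda>\<omega>. b * \<bar>N \<omega>\<bar>\<^sup>2) \<in> borel_measurable M"
    using N(1) by simp
  have main: "(\<lambda>n. LINT \<omega>|M. g \<omega> * real_cond_exp M F (\<lambda>\<omega>. h (X n \<omega>)) \<omega>)
      \<longlonglongrightarrow> (LINT \<omega>|M. g \<omega> * real_cond_exp M F (\<lambda>\<omega>. h (b * \<bar>N \<omega>\<bar>\<^sup>2)) \<omega>)"
    if g: "integrable M g" and h: "continuous_on UNIV h" "bounded (range h)" for g h :: "_ \<Rightarrow> real"
  proof -
    obtain C where C: "\<And>x. \<bar>h x\<bar> \<le> C" using h(2) by (auto simp: bounded_iff)
    have cont: "isCont h x" for x using h(1) by (simp add: continuous_on_eq_continuous_at)
    have h_borel: "h \<in> borel_measurable borel" by (rule borel_measurable_continuous_onI[OF h(1)])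
    define L where "L = (LINT x|std_normal_distribution. h (b * x\<^sup>2))"
    define c' where "c' = real_cond_exp M F g"
    have hX_M: "(\<lambda>\<omega>. h (X n \<omega>)) \<in> borel_measurable M" for n
      by (rule measurable_compose[OF X_M h_borel])
    have hX_int: "integrable M (\<lambda>\<omega>. h (X n \<omega>))" for n
      by (rule integrable_const_bound[where B = C]) (use C hX_M in auto)
    have c'_int: "integrable M c'" and c'_F: "c' \<in> borel_measurable F" and c'_E: "expectation c' = expectation g"
      unfolding c'_def using F.real_cond_exp_int[OF g] by auto
    have left: "(LINT \<omega>|M. g \<omega> * real_cond_exp M F (\<lambda>\<omega>. h (X n \<omega>)) \<omega>) = expectation (\<lambda>\<omega>. c' \<omega> * h (X n \<omega>))"
      if n: "1 \<le> n" for n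
    proof -
      have hX_F: "(\<lambda>\<omega>. h (X n \<omega>)) \<in> borel_measurable F"
        by (rule measurable_compose[OF X_F[OF n] h_borel])
      have "AE \<omega> in M. real_cond_exp M F (\<lambda>\<omega>. h (X n \<omega>)) \<omega> = h (X n \<omega>)"
        by (rule F.real_cond_exp_F_meas[OF hX_int hX_F])
      then have "(LINT \<omega>|M. g \<omega> * real_cond_exp M F (\<lambda>\<omega>. h (X n \<omega>)) \<omega>) = expectation (\<lambda>\<omega>. g \<omega> * h (X n \<omega>))"
        using g hX_M by (intro integral_cong_AE) auto
      also have "\<dots> = expectation (\<lambda>\<omega>. h (X n \<omega>) * g \<omega>)" by (simp add: mult.commute)
      also have "\<dots> = expectation (\<lambda>\<omega>. h (X n \<omega>) * c' \<omega>)"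
        unfolding c'_def
      proof (rule F.real_cond_exp_intg(2)[symmetric])
        show "integrable M (\<lambda>\<omega>. h (X n \<omega>) * g \<omega>)"
          using integrable_times_bounded[OF g hX_M C, of n] by (simp add: mult.commute)
      qed (use hX_F g in auto)
      finally show ?thesis by (simp add: mult.commute)
    qed
    have "(\<lambda>n. expectation (\<lambda>\<omega>. c' \<omega> * h (X n \<omega>))) \<longlonglongrightarrow> expectation c' * L"
    proof (rule mixing_limit_integrable[where C = C])
      show "(\<lambda>n. expectation (\<lambda>\<omega>. indicat_real A (\<rho> l \<omega>) * h (X n \<omega>))) \<longlonglongrightarrow> expectation (\<lambda>\<omega>. indicat_real A (\<rho> l \<omega>)) * L"
        if "1 \<le> l" for l A
        unfolding L_def X_def by (rule mixing_limit[OF G cont C that])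
    qed (use hX_M C c'_int c'_F in \<open>auto simp: F_def\<close>)
    moreover have "\<forall>\<^sub>F n in sequentially. expectation (\<lambda>\<omega>. c' \<omega> * h (X n \<omega>)) = (LINT \<omega>|M. g \<omega> * real_cond_exp M F (\<lambda>\<omega>. h (X n \<omega>)) \<omega>)"
      using eventually_ge_at_top[of 1] by eventually_elim (simp add: left)
    ultimately have lim: "(\<lambda>n. LINT \<omega>|M. g \<omega> * real_cond_exp M F (\<lambda>\<omega>. h (X n \<omega>)) \<omega>) \<longlonglongrightarrow> expectation g * L"
      unfolding c'_E by (rule Lim_transform_eventually)
    have hY_M: "(\<lambda>\<omega>. h (b * \<bar>N \<omega>\<bar>\<^sup>2)) \<in> borel_measurable M"
      by (rule measurable_compose[OF Y_M h_borel])
    have hY_int: "integrable M (\<lambda>\<omega>. h (b * \<bar>N \<omega>\<bar>\<^sup>2))"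
      by (rule integrable_const_bound[where B = C]) (use C hY_M in auto)
    have hY_E: "expectation (\<lambda>\<omega>. h (b * \<bar>N \<omega>\<bar>\<^sup>2)) = L"
    proof -
      have "(\<lambda>x. h (b * \<bar>x\<bar>\<^sup>2)) \<in> borel_measurable borel"
        by (rule measurable_compose[OF _ h_borel]) simp
      from integral_distr[OF N(1) this] show ?thesis by (simp add: N(2) L_def)
    qed
    have "AE \<omega> in M. real_cond_exp M F (\<lambda>\<omega>. h (b * \<bar>N \<omega>\<bar>\<^sup>2)) \<omega> = L"
    proof (rule F.real_cond_exp_charact)
      fix A assume A: "A \<in> sets F"
      have A_M: "A \<in> sets M" using A sub by (auto simp: subalgebra_def)
      have sp: "space F = space M" using sub by (simp add: subalgebra_def)
      have iv: "indep_var borel (indicat_real A) borel (\<lambda>\<omega>. h (b * \<bar>N \<omega>\<bar>\<^sup>2))"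
        unfolding indep_var_eq
      proof (intro conjI)
        show "random_variable borel (indicat_real A)" using A_M by simp
        show "random_variable borel (\<lambda>\<omega>. h (b * \<bar>N \<omega>\<bar>\<^sup>2))" by (rule hY_M)
        have 1: "sigma_sets (space M) {indicat_real A -` S \<inter> space M |S. S \<in> sets borel} \<subseteq> sets F"
        proof -
          have "(indicat_real A :: _ \<Rightarrow> real) \<in> borel_measurable F" using A by simp
          then have "{indicat_real A -` S \<inter> space M |S. S \<in> sets borel} \<subseteq> sets F"
            using measurable_sets[of "indicat_real A" F borel] by (auto simp: sp)
          then show ?thesis using sets.sigma_sets_subset[of _ F] by (simp add: sp)
        qed
        have 2: "sigma_sets (space M) {(\<lambda>\<omega>. h (b * \<bar>N \<omega>\<bar>\<^sup>2)) -` S \<inter> space M |S. S \<in> sets borel} \<subseteq> sets (vimage_algebra (space M) N borel)"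
        proof -
          have NV: "N \<in> borel_measurable (vimage_algebra (space M) N borel)" by (rule measurable_vimage_algebra1) simp
          have "(\<lambda>\<omega>. h (b * \<bar>N \<omega>\<bar>\<^sup>2)) \<in> borel_measurable (vimage_algebra (space M) N borel)"
            by (rule measurable_compose[OF _ h_borel]) (use NV in simp)
          then have "{(\<lambda>\<omega>. h (b * \<bar>N \<omega>\<bar>\<^sup>2)) -` S \<inter> space M |S. S \<in> sets borel} \<subseteq> sets (vimage_algebra (space M) N borel)"
            using measurable_sets[of "\<lambda>\<omega>. h (b * \<bar>N \<omega>\<bar>\<^sup>2)" "vimage_algebra (space M) N borel" borel] by auto
          then show ?thesis using sets.sigma_sets_subset[of _ "vimage_algebra (space M) N borel"] by simp
        qed
        show "indep_set (sigma_sets (space M) {indicat_real A -` S \<inter> space M |S. S \<in> sets borel})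
           (sigma_sets (space M) {(\<lambda>\<omega>. h (b * \<bar>N \<omega>\<bar>\<^sup>2)) -` S \<inter> space M |S. S \<in> sets borel})"
        proof (rule indep_setI)
          show "prob (u \<inter> v) = prob u * prob v"
            if "u \<in> sigma_sets (space M) {indicat_real A -` S \<inter> space M |S. S \<in> sets borel}"
              "v \<in> sigma_sets (space M) {(\<lambda>\<omega>. h (b * \<bar>N \<omega>\<bar>\<^sup>2)) -` S \<inter> space M |S. S \<in> sets borel}" for u v
            by (rule indep_setD[OF ind subsetD[OF 1 that(1)] subsetD[OF 2 that(2)]])
        qed (use 1 2 indep_setD_ev1[OF ind] indep_setD_ev2[OF ind] in auto)
      qed
      have iA: "integrable M (indicat_real A)" using A_M by (intro integrable_real_indicator) (auto simp: emeasure_eq_measure)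
      have "set_lebesgue_integral M A (\<lambda>\<omega>. h (b * \<bar>N \<omega>\<bar>\<^sup>2)) = expectation (indicat_real A) * L"
        unfolding set_lebesgue_integral_def real_scaleR_def hY_E[symmetric]
        by (rule indep_var_lebesgue_integral[OF iv iA hY_int])
      also have "\<dots> = set_lebesgue_integral M A (\<lambda>_. L)"
        by (simp add: set_lebesgue_integral_def)
      finally show "set_lebesgue_integral M A (\<lambda>\<omega>. h (b * \<bar>N \<omega>\<bar>\<^sup>2)) = set_lebesgue_integral M A (\<lambda>_. L)" .
    qed (use hY_int in auto)
    then have "(LINT \<omega>|M. g \<omega> * real_cond_exp M F (\<lambda>\<omega>. h (b * \<bar>N \<omega>\<bar>\<^sup>2)) \<omega>) = (LINT \<omega>|M. g \<omega> * L)"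
      using g by (intro integral_cong_AE) auto
    then show ?thesis using lim by simp
  qed
  show ?thesis unfolding stably_converges_def using sub X_M Y_M main by blast
qed

end

section \<open>Mixtures of Pitman--Yor weights\<close>

text \<open>The complement of the support is a union of open null sets; by Lindelof's theorem countably many of them
  suffice.\<close>

lemma AE_msupport:
  fixes \<mu> :: "real measure"
  assumes sets: "sets \<mu> = sets borel" and supp: "msupport \<mu> \<subseteq> S"
  shows "AE \<theta> in \<mu>. \<theta> \<in> S"
proof -
  define \<U> where "\<U> = {U. open U \<and> emeasure \<mu> U = 0}"
  obtain \<U>' where U': "\<U>' \<subseteq> \<U>" "countable \<U>'" "\<Union>\<U>' = \<Union>\<U>"
    using Lindelof[of \<U>] by (auto simp: \<U>_def)
  have null: "\<Union>\<U>' \<in> null_sets \<mu>"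
  proof -
    have "(\<Union>U\<in>\<U>'. U) \<in> null_sets \<mu>"
      using U' sets by (intro null_sets_UN') (auto simp: \<U>_def null_sets_def)
    then show ?thesis by simp
  qed
  show ?thesis
  proof (rule AE_I'[OF null])
    show "{\<theta>\<in>space \<mu>. \<theta> \<notin> S} \<subseteq> \<Union>\<U>'"
    proof
      fix \<theta> assume "\<theta> \<in> {\<theta>\<in>space \<mu>. \<theta> \<notin> S}"
      then have "\<theta> \<notin> msupport \<mu>" using supp by auto
      then obtain U where "open U" "\<theta> \<in> U" "\<not> 0 < emeasure \<mu> U" by (auto simp: msupport_def)
      then show "\<theta> \<in> \<Union>\<U>'" unfolding U'(3) by (auto simp: \<U>_def)
    qed
  qed
qed

lemma py_weight_Suc_left: "1 \<le> n \<Longrightarrow> py_weight \<alpha> \<theta> (Suc n) k = py_weight \<alpha> \<theta> n k / (\<theta> + real n)"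
  by (simp add: py_weight_def prod.atLeastLessThan_Suc)

lemma py_weight_Suc_Suc: "1 \<le> n \<Longrightarrow> 1 \<le> k \<Longrightarrow>
   py_weight \<alpha> \<theta> (Suc n) (Suc k) = py_weight \<alpha> \<theta> n k * (\<theta> + real k * \<alpha>) / (\<theta> + real n)"
  by (simp add: py_weight_def prod.atLeastLessThan_Suc)

locale gibbs_weights = prob_space \<mu>
  for \<mu> :: "real measure" and \<alpha> l u :: real +
  assumes sets_mu [measurable_cong]: "sets \<mu> = sets borel"
    and AE_range: "AE \<theta> in \<mu>. \<theta> \<in> {l..u}"
    and alpha: "0 < \<alpha>" "\<alpha> < 1" and l: "- \<alpha> < l" "l \<le> 0" and u: "0 \<le> u"
begin

lemma range_pos: "1 \<le> i \<Longrightarrow> \<theta> \<in> {l..u} \<Longrightarrow> 0 < \<theta> + real i" "1 \<le> i \<Longrightarrow> \<theta> \<in> {l..u} \<Longrightarrow> 0 < \<theta> + real i * \<alpha>"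
proof -
  assume i: "1 \<le> i" and t: "\<theta> \<in> {l..u}"
  have "1 \<le> real i" using i by simp
  then show "0 < \<theta> + real i" using t l alpha by auto
  have "1 * \<alpha> \<le> real i * \<alpha>" using i alpha by (intro mult_right_mono) auto
  moreover have "l \<le> \<theta>" using t by simp
  ultimately show "0 < \<theta> + real i * \<alpha>" using l by linarith
qed

lemma py_weight_bounds:
  assumes "\<theta> \<in> {l..u}"
  shows "(\<Prod>i\<in>{1..<k}. l + real i * \<alpha>) / (\<Prod>i\<in>{1..<n}. u + real i) \<le> py_weight \<alpha> \<theta> n k"
    and "py_weight \<alpha> \<theta> n k \<le> (\<Prod>i\<in>{1..<k}. u + real i * \<alpha>) / (\<Prod>i\<in>{1..<n}. l + real i)"
proof -
  have lm: "l \<in> {l..u}" and um: "u \<in> {l..u}" using l u by auto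
  show "(\<Prod>i\<in>{1..<k}. l + real i * \<alpha>) / (\<Prod>i\<in>{1..<n}. u + real i) \<le> py_weight \<alpha> \<theta> n k"
    unfolding py_weight_def
    using assms range_pos[OF _ lm] range_pos[OF _ assms]
    by (intro frac_le prod_nonneg prod_mono prod_pos) (auto intro: less_imp_le)
  show "py_weight \<alpha> \<theta> n k \<le> (\<Prod>i\<in>{1..<k}. u + real i * \<alpha>) / (\<Prod>i\<in>{1..<n}. l + real i)"
    unfolding py_weight_def
    using assms range_pos[OF _ lm] range_pos[OF _ assms] range_pos[OF _ um]
    by (intro frac_le prod_nonneg prod_mono prod_pos) (auto intro: less_imp_le)
qed

lemma lower_bound_pos: "0 < (\<Prod>i\<in>{1..<k}. l + real i * \<alpha>) / (\<Prod>i\<in>{1..<n}. u + real i)"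
proof -
  have "l \<in> {l..u}" "u \<in> {l..u}" using l u by auto
  then show ?thesis using range_pos by (intro divide_pos_pos prod_pos) auto
qed

lemma py_weight_pos: "\<theta> \<in> {l..u} \<Longrightarrow> 0 < py_weight \<alpha> \<theta> n k"
  using py_weight_bounds(1)[of \<theta> k n] lower_bound_pos[of k n] by linarith

lemma measurable_py_weight [measurable]: "(\<lambda>\<theta>. py_weight \<alpha> \<theta> n k) \<in> borel_measurable \<mu>"
  unfolding py_weight_def by measurable

lemma integrable_py_weight: "integrable \<mu> (\<lambda>\<theta>. py_weight \<alpha> \<theta> n k)"
proof (rule integrable_const_bound[where B = "(\<Prod>i\<in>{1..<k}. u + real i * \<alpha>) / (\<Prod>i\<in>{1..<n}. l + real i)"])
  show "AE \<theta> in \<mu>. norm (py_weight \<alpha> \<theta> n k) \<le> (\<Prod>i\<in>{1..<k}. u + real i * \<alpha>) / (\<Prod>i\<in>{1..<n}. l + real i)"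
    using AE_range
  proof eventually_elim
    case (elim \<theta>)
    show ?case using py_weight_pos[OF elim, of n k] py_weight_bounds(2)[OF elim, of n k] by simp
  qed
qed simp

lemma gibbs_weight_mono:
  assumes "integrable \<mu> f" "integrable \<mu> g" "\<And>\<theta>. \<theta> \<in> {l..u} \<Longrightarrow> f \<theta> \<le> (g \<theta> :: real)"
  shows "expectation f \<le> expectation g"
  using AE_range assms by (intro integral_mono_AE) (auto elim: eventually_mono)

lemma gibbs_weight_pos: "0 < gibbs_weight \<alpha> \<mu> n k"
proof -
  have "expectation (\<lambda>_. (\<Prod>i\<in>{1..<k}. l + real i * \<alpha>) / (\<Prod>i\<in>{1..<n}. u + real i)) \<le> gibbs_weight \<alpha> \<mu> n k"
    unfolding gibbs_weight_def
    by (intro gibbs_weight_mono integrable_py_weight py_weight_bounds integrable_const)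
  then show ?thesis using lower_bound_pos[of k n] by (simp add: prob_space)
qed

text \<open>Expresses that the predictive probabilities sum to one.\<close>

lemma gibbs_weight_recursion:
  assumes n: "1 \<le> n" and k: "1 \<le> k"
  shows "gibbs_weight \<alpha> \<mu> (Suc n) (Suc k) = gibbs_weight \<alpha> \<mu> n k - (real n - real k * \<alpha>) * gibbs_weight \<alpha> \<mu> (Suc n) k"
proof -
  have "gibbs_weight \<alpha> \<mu> (Suc n) (Suc k) = expectation (\<lambda>\<theta>. py_weight \<alpha> \<theta> n k - (real n - real k * \<alpha>) * py_weight \<alpha> \<theta> (Suc n) k)"
    unfolding gibbs_weight_def
  proof (rule integral_cong_AE)
    show "AE \<theta> in \<mu>. py_weight \<alpha> \<theta> (Suc n) (Suc k) = py_weight \<alpha> \<theta> n k - (real n - real k * \<alpha>) * py_weight \<alpha> \<theta> (Suc n) k"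
      using AE_range
    proof eventually_elim
      case (elim \<theta>)
      have "0 < \<theta> + real n" by (rule range_pos(1)[OF n elim])
      then show ?case
        unfolding py_weight_Suc_Suc[OF n k] py_weight_Suc_left[OF n, of _ _ k] by (simp add: field_simps)
    qed
  qed measurable
  then show ?thesis using integrable_py_weight by (simp add: gibbs_weight_def)
qed

text \<open>The ratio is an average of \<open>1 / (\<theta> + n)\<close> over the mixing measure, weighted by \<open>py_weight\<close>.\<close>

lemma gibbs_weight_ratio_bounds:
  assumes n: "1 \<le> n"
  shows "1 / (real n + u) \<le> gibbs_weight \<alpha> \<mu> (Suc n) k / gibbs_weight \<alpha> \<mu> n k"
    and "gibbs_weight \<alpha> \<mu> (Suc n) k / gibbs_weight \<alpha> \<mu> n k \<le> 1 / (real n + l)"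
proof -
  have lm: "l \<in> {l..u}" using l u by auto
  have pos: "0 < l + real n" by (rule range_pos(1)[OF n lm])
  have "expectation (\<lambda>\<theta>. py_weight \<alpha> \<theta> n k * (1 / (real n + u))) \<le> gibbs_weight \<alpha> \<mu> (Suc n) k"
    unfolding gibbs_weight_def
  proof (rule gibbs_weight_mono)
    fix \<theta> assume t: "\<theta> \<in> {l..u}"
    have "1 / (real n + u) \<le> 1 / (\<theta> + real n)"
      using t range_pos(1)[OF n t] by (intro divide_left_mono mult_pos_pos) auto
    then have "py_weight \<alpha> \<theta> n k * (1 / (real n + u)) \<le> py_weight \<alpha> \<theta> n k * (1 / (\<theta> + real n))"
      using py_weight_pos[OF t, of n k] by (intro mult_left_mono) auto
    then show "py_weight \<alpha> \<theta> n k * (1 / (real n + u)) \<le> py_weight \<alpha> \<theta> (Suc n) k"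
      using n by (simp add: py_weight_Suc_left)
  qed (intro integrable_py_weight integrable_mult_left)+
  then have "gibbs_weight \<alpha> \<mu> n k * (1 / (real n + u)) \<le> gibbs_weight \<alpha> \<mu> (Suc n) k"
    by (simp only: gibbs_weight_def integral_mult_left_zero)
  then show "1 / (real n + u) \<le> gibbs_weight \<alpha> \<mu> (Suc n) k / gibbs_weight \<alpha> \<mu> n k"
    using gibbs_weight_pos[of n k] by (simp add: pos_le_divide_eq mult.commute)
  have "gibbs_weight \<alpha> \<mu> (Suc n) k \<le> expectation (\<lambda>\<theta>. py_weight \<alpha> \<theta> n k * (1 / (real n + l)))"
    unfolding gibbs_weight_def
  proof (rule gibbs_weight_mono)
    fix \<theta> assume t: "\<theta> \<in> {l..u}"
    have "1 / (\<theta> + real n) \<le> 1 / (real n + l)"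
      using t pos by (intro divide_left_mono mult_pos_pos) auto
    then have "py_weight \<alpha> \<theta> n k * (1 / (\<theta> + real n)) \<le> py_weight \<alpha> \<theta> n k * (1 / (real n + l))"
      using py_weight_pos[OF t, of n k] by (intro mult_left_mono) auto
    then show "py_weight \<alpha> \<theta> (Suc n) k \<le> py_weight \<alpha> \<theta> n k * (1 / (real n + l))"
      using n by (simp add: py_weight_Suc_left)
  qed (intro integrable_py_weight integrable_mult_left)+
  then have "gibbs_weight \<alpha> \<mu> (Suc n) k \<le> gibbs_weight \<alpha> \<mu> n k * (1 / (real n + l))"
    by (simp only: gibbs_weight_def integral_mult_left_zero)
  then show "gibbs_weight \<alpha> \<mu> (Suc n) k / gibbs_weight \<alpha> \<mu> n k \<le> 1 / (real n + l)"
    using gibbs_weight_pos[of n k] by (simp add: pos_divide_le_eq mult.commute)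
qed

lemma gibbs_weight_ratio_approx:
  assumes n: "1 \<le> n"
  shows "\<bar>gibbs_weight \<alpha> \<mu> (Suc n) k / gibbs_weight \<alpha> \<mu> n k - 1 / real n\<bar> \<le> (u - l / (1 + l)) / (real n)\<^sup>2"
proof -
  have x: "1 \<le> real n" using n by simp
  have l1: "0 < 1 + l" using l alpha by simp
  have "1 / real n - 1 / (real n + u) = u / (real n * (real n + u))" using x u by (simp add: field_simps)
  also have "\<dots> \<le> u / (real n * real n)" using x u by (intro divide_left_mono mult_left_mono mult_pos_pos) auto
  also have "\<dots> \<le> (u - l / (1 + l)) / (real n)\<^sup>2"
    using l l1 by (simp add: power2_eq_square divide_right_mono divide_nonpos_pos)
  finally have 1: "1 / real n - 1 / (real n + u) \<le> (u - l / (1 + l)) / (real n)\<^sup>2" .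
  have ln: "real n * (1 + l) \<le> real n + l"
    using x l mult_right_mono_neg[of 1 "real n" l] by (simp add: algebra_simps)
  have pos: "0 < real n + l" using x l alpha by simp
  have "1 / (real n + l) - 1 / real n = - l / (real n * (real n + l))" using x pos by (simp add: field_simps)
  also have "\<dots> \<le> - l / (real n * (real n * (1 + l)))"
    using x l l1 ln pos by (intro divide_left_mono mult_left_mono mult_pos_pos) auto
  also have "\<dots> = (- l / (1 + l)) / (real n)\<^sup>2" using x l1 by (simp add: power2_eq_square)
  also have "\<dots> \<le> (u - l / (1 + l)) / (real n)\<^sup>2" using u by (intro divide_right_mono) auto
  finally have 2: "1 / (real n + l) - 1 / real n \<le> (u - l / (1 + l)) / (real n)\<^sup>2" .
  show ?thesis using 1 2 gibbs_weight_ratio_bounds[OF n, of k] by (simp add: abs_le_iff)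
qed

text \<open>Here the ratio is a weighted average of \<open>(\<theta> + k \<alpha>) / (\<theta> + n)\<close>, which for \<open>k \<le> n\<close> is at least
  \<open>(l + \<alpha>) k / n\<close>.\<close>

lemma gibbs_weight_new_block:
  assumes n: "1 \<le> n" and k: "1 \<le> k" "k \<le> n"
  shows "(\<alpha> + l) * real k / real n \<le> gibbs_weight \<alpha> \<mu> (Suc n) (Suc k) / gibbs_weight \<alpha> \<mu> n k"
proof -
  define q where "q = (\<alpha> + l) * real k / real n"
  have "expectation (\<lambda>\<theta>. py_weight \<alpha> \<theta> n k * q) \<le> gibbs_weight \<alpha> \<mu> (Suc n) (Suc k)"
    unfolding gibbs_weight_def
  proof (rule gibbs_weight_mono)
    fix \<theta> assume t: "\<theta> \<in> {l..u}"
    have pos: "0 < \<theta> + real n" by (rule range_pos(1)[OF n t])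
    have ka: "(\<alpha> + l) * real k \<le> real n"
      using k l alpha mult_mono[of "\<alpha> + l" 1 "real k" "real n"] by simp
    have "0 \<le> (\<theta> - l) * (real n - (\<alpha> + l) * real k) + - l * (real n * (real k - 1) + (\<alpha> + l) * real k)"
    proof (rule add_nonneg_nonneg[OF mult_nonneg_nonneg mult_nonneg_nonneg])
      have "0 \<le> real n * (real k - 1)" and "0 \<le> (\<alpha> + l) * real k" using k l by simp_all
      then show "0 \<le> real n * (real k - 1) + (\<alpha> + l) * real k" by linarith
    qed (use t ka l in auto)
    also have "\<dots> = (\<theta> + real k * \<alpha>) * real n - (\<alpha> + l) * real k * (\<theta> + real n)" by (simp add: algebra_simps)
    finally have "(\<alpha> + l) * real k * (\<theta> + real n) \<le> (\<theta> + real k * \<alpha>) * real n" by simp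
    then have "q \<le> (\<theta> + real k * \<alpha>) / (\<theta> + real n)" using pos n by (simp add: q_def frac_le_eq divide_simps)
    then have "py_weight \<alpha> \<theta> n k * q \<le> py_weight \<alpha> \<theta> n k * ((\<theta> + real k * \<alpha>) / (\<theta> + real n))"
      using py_weight_pos[OF t, of n k] by (intro mult_left_mono) auto
    then show "py_weight \<alpha> \<theta> n k * q \<le> py_weight \<alpha> \<theta> (Suc n) (Suc k)"
      using n k by (simp add: py_weight_Suc_Suc)
  qed (intro integrable_py_weight integrable_mult_left)+
  then have "gibbs_weight \<alpha> \<mu> n k * q \<le> gibbs_weight \<alpha> \<mu> (Suc n) (Suc k)"
    by (simp only: gibbs_weight_def integral_mult_left_zero)
  then have "q \<le> gibbs_weight \<alpha> \<mu> (Suc n) (Suc k) / gibbs_weight \<alpha> \<mu> n k"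
    using gibbs_weight_pos[of n k] by (simp add: pos_le_divide_eq mult.commute)
  then show ?thesis by (simp only: q_def)
qed

end

lemma partition_chain_gibbs:
  fixes M :: "'a measure"
  assumes "prob_space M" and gw: "gibbs_weights \<mu> \<alpha> l u" and part: "gibbs_partition M \<alpha> \<mu> \<rho>"
  shows "partition_chain M \<rho> \<alpha> (predictive \<alpha> \<mu>)
     (\<lambda>n \<pi>. gibbs_weight \<alpha> \<mu> (Suc n) (card \<pi>) / gibbs_weight \<alpha> \<mu> n (card \<pi>)) (u - l / (1 + l)) (\<alpha> + l)"
proof -
  interpret M: prob_space M by fact
  interpret gibbs_weights \<mu> \<alpha> l u by (rule gw)
  have meas: "\<rho> n \<in> measurable M (count_space UNIV)" if "1 \<le> n" for n
    using part that by (simp add: gibbs_partition_def)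
  have ev: "{\<omega> \<in> space M. \<rho> n \<omega> = \<pi>} \<in> sets M" if "1 \<le> n" for n \<pi>
    using measurable_sets[OF meas[OF that], of "{\<pi>}"] by (simp add: vimage_def Int_def conj_commute)
  show ?thesis
  proof (unfold_locales, goal_cases)
    case 1 then show ?case by (rule alpha)
  next
    case 2 then show ?case by (rule alpha)
  next
    case (3 n) then show ?case by (rule meas)
  next
    case (4 \<omega>) then show ?case using part by (simp add: gibbs_partition_def)
  next
    case (5 n \<omega>) then show ?case using part by (simp add: gibbs_partition_def)
  next
    case (6 n \<pi> s)
    let ?A = "{\<omega> \<in> space M. \<rho> n \<omega> = \<pi>}"
    let ?B = "{\<omega> \<in> space M. \<rho> n \<omega> = \<pi> \<and> \<rho> (Suc n) \<omega> = extend_partition n \<pi> s}"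
    have BA: "M.prob ?B \<le> M.prob ?A" using ev[OF 6(1)] by (intro M.finite_measure_mono) auto
    show ?case
    proof (cases "M.prob ?A > 0")
      case True
      then have "\<P>(\<omega> in M. \<rho> (Suc n) \<omega> = extend_partition n \<pi> s \<bar> \<rho> n \<omega> = \<pi>) = predictive \<alpha> \<mu> n \<pi> s"
        using part 6 by (simp add: gibbs_partition_def)
      moreover have "{\<omega> \<in> space M. \<rho> (Suc n) \<omega> = extend_partition n \<pi> s \<and> \<rho> n \<omega> = \<pi>} = ?B" by auto
      ultimately show ?thesis using True by (simp add: cond_prob_def field_simps)
    next
      case False
      then have "M.prob ?A = 0" using measure_nonneg[of M ?A] by linarith
      then show ?thesis using BA measure_nonneg[of M ?B] by simp
    qed
  next
    case (7 n \<pi>)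
    then have k: "1 \<le> card \<pi>" by (intro card_partition_pos) auto
    have "gibbs_weight \<alpha> \<mu> n (card \<pi>) > 0" by (rule gibbs_weight_pos)
    then show ?case unfolding predictive_def using gibbs_weight_recursion[OF 7(1) k] by (simp add: field_simps)
  next
    case (8 n \<pi> U) then show ?case by (simp add: predictive_def)
  next
    case (9 n \<pi>) then show ?case by (intro gibbs_weight_ratio_approx)
  next
    case (10 n \<pi>) then show ?case by (intro divide_pos_pos gibbs_weight_pos)
  next
    case 11 then show ?case using l by simp
  next
    case (12 n \<pi>)
    then show ?case unfolding predictive_def using card_partition_pos[of n \<pi>] card_partition_le[of n \<pi>]
      by (simp add: gibbs_weight_new_block)
  qed
qed

theorem theorem4p2:
  fixes M :: "'a measure"
    and \<rho> :: "nat \<Rightarrow> 'a \<Rightarrow> nat set set"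
    and \<mu> :: "real measure"
    and \<alpha> \<theta>l \<theta>u \<delta> C \<beta> :: real
    and f :: "real \<Rightarrow> real"
    and N :: "'a \<Rightarrow> real"
  assumes "prob_space M"
    and "0 < \<alpha>" and "\<alpha> < 1"
    and "prob_space \<mu>" and "sets \<mu> = sets borel"
    and "msupport \<mu> \<subseteq> {\<theta>l..\<theta>u}"
    and "- \<alpha> < \<theta>l" and "\<theta>l \<le> 0" and "0 \<le> \<theta>u"
    and "gibbs_partition M \<alpha> \<mu> \<rho>"
    and "convex_on {0..} f" and "f 1 = 0"
    and "\<delta> > 0" and "C > 0" and "\<beta> > 0"
    and "\<forall>x\<in>{1 - \<delta><..<1 + \<delta>}. f differentiable (at x) \<and> deriv f differentiable (at x)"
    and "\<forall>x. \<bar>x\<bar> < \<delta> \<longrightarrow>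
           \<bar>deriv (deriv f) (1 + x) - deriv (deriv f) 1\<bar> \<le> C * \<bar>x\<bar> powr \<beta>"
    and "N \<in> borel_measurable M"
    and "distr M borel N = std_normal_distribution"
    and "prob_space.indep_set M (sets (F_infinity M \<rho>))
           (sets (vimage_algebra (space M) N borel))"
  shows "stably_converges M (F_infinity M \<rho>)
           (\<lambda>n \<omega>. real n * f_divergence f (slots (\<rho> n \<omega>))
              (predictive_estimate n (\<rho> n \<omega>)) (predictive \<alpha> \<mu> n (\<rho> n \<omega>)))
           (\<lambda>\<omega>. \<alpha> * deriv (deriv f) 1 / 2 * \<bar>N \<omega>\<bar>\<^sup>2)"
proof -
  have "gibbs_weights \<mu> \<alpha> \<theta>l \<theta>u"
    using assms(2-9) AE_msupport[OF assms(5,6)]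
    by (intro gibbs_weights.intro gibbs_weights_axioms.intro) auto
  then interpret partition_chain M \<rho> \<alpha> "predictive \<alpha> \<mu>"
    "\<lambda>n \<pi>. gibbs_weight \<alpha> \<mu> (Suc n) (card \<pi>) / gibbs_weight \<alpha> \<mu> n (card \<pi>)" "\<theta>u - \<theta>l / (1 + \<theta>l)" "\<alpha> + \<theta>l"
    using assms(1,10) by (intro partition_chain_gibbs)
  show ?thesis
    by (rule stable_limit[where G = "\<lambda>n \<pi>. real n * f_divergence f (slots \<pi>) (predictive_estimate n \<pi>) (predictive \<alpha> \<mu> n \<pi>)"])
       (use divergence_asymptotics[OF assms(12,13,16)] assms(18-20) in auto)
qed

end
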